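(* Let $(M,g)$ be a generalized gravitational wave spacetime with $C^r$ coefficients, $r\ge2$ (see context). (1) For every $p\in M$ there are $C^{r-1}$ Rosen coordinates $(t,q',y')$ in a neighborhood of $p$, i.e. coordinates in which $$g=a'_t-dt\otimes dy'-dy'\otimes dt,\qquad \partial_{y'}=n,$$ with $C^{r-2}$ space metric $a'_t$. (2) $(M,g)$ admits global Rosen coordinates (respectively, Rosen coordinates time-local at $t=t_0$) if and only if there is a global (respectively, time-local at $t=t_0$) solution $u$ of the Hamilton-Jacobi equation $\partial_tu+H(t,q,\partial_qu)=0$ whose base characteristics are complete (respectively, defined on a common time interval neighborhood of $t_0$). The differentiability in (2) is as follows: if there are such $C^1$ Rosen coordinates (with continuous metric coefficients) then there is such a $C^1$ solution $u$; conversely, if there is such a $C^k$ solution $u$, $2\le k\le r+1$, then there are such $C^{k-1}$ Rosen coordinates.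
   Context: Setting. $r\ge 2$; $Q$ is a connected $d$-dimensional ($C^{r+1}$, Hausdorff, paracompact, boundaryless) manifold; $T\subset\mathbb{R}$ is a connected interval, open because spacetimes are without boundary; $E=T\times Q$ with points $e=(t,q)$. On $Q$ there are given a time-dependent Riemannian metric $a_t$, a time-dependent 1-form $b_t$ and a function $V(t,q)$, all $C^r$ in $(t,q)\in E$. The Hamiltonian is $H(t,q,p)=\frac12 a_t^{-1}(p-b_t,p-b_t)+V(t,q)$, $p\in T_q^*Q$. The generalized gravitational wave spacetime is $M=T\times Q\times\mathbb{R}$ with points $(t,q,y)$ and metric $g=a_t-dt\otimes(dy-b_t)-(dy-b_t)\otimes dt-2V\,dt^2$; $n=\partial_y$ (at constant $t,q$). Rosen coordinates: new variables $(t,q',y')$, with the same $t$ (which is forced, up to an additive constant, by $dt=-g(\cdot,n)$), with $q'$ ranging in a $d$-dimensional manifold $Q'$, such that $\partial_{y'}$ (at constant $t,q'$) equals $n$ and $g=a'_t-dt\otimes dy'-dy'\otimes dt$ for a time-dependent Riemannian metric $a'_t$ on $Q'$. A single chart is not required to cover $Q'$. They are global if they identify $M$ with $T\times Q'\times\mathbb{R}$, and time-local at $t_0$ if they identify $I\times Q\times\mathbb{R}$ with $I\times Q'\times\mathbb{R}$ for some open interval $I\ni t_0$. A solution $u$ of the Hamilton-Jacobi equation is global if defined on all of $E$, time-local at $t_0$ if defined on $I\times Q$ for some open interval $I\ni t_0$. Its base characteristics are the curves $t\mapsto(t,q(t))$ with $\dot q=a_t^{-1}(\cdot,\partial_qu-b_t)$;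 they are complete if each extends to the whole time axis $T$. *)

theory Defs
  imports "HOL-Analysis.Analysis"
begin

section \<open>Manifolds of finite differentiability\<close>

text \<open>
  \<open>Ck_on k S f\<close> is meant for open \<open>S\<close> in a finite-dimensional space: there, continuity of all
  iterated directional derivatives up to order \<open>k\<close> is the same as \<open>f\<close> being of class \<open>C^k\<close>.
\<close>

primrec Ck_on ::
  "nat \<Rightarrow> 'a::real_normed_vector set \<Rightarrow> ('a \<Rightarrow> 'b::real_normed_vector) \<Rightarrow> bool" where
  "Ck_on 0 S f \<longleftrightarrow> continuous_on S f"
| "Ck_on (Suc k) S f \<longleftrightarrow>
     (\<forall>x\<in>S. f differentiable (at x)) \<and> (\<forall>v. Ck_on k S (\<lambda>x. frechet_derivative f (at x) v))"

text \<open>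
  A chart is a pair of its domain and its coordinate map; the values of the coordinate map
  outside the domain are irrelevant. The dimension of the manifold is \<open>DIM('e)\<close>, where \<open>'e\<close> is
  the model space, and its points form the set \<open>topspace X\<close>.
\<close>

type_synonym ('q, 'e) chart = "'q set \<times> ('q \<Rightarrow> 'e)"

definition chart_inv :: "('q, 'e) chart \<Rightarrow> 'e \<Rightarrow> 'q" where
  "chart_inv c = inv_into (fst c) (snd c)"

definition is_chart :: "'q topology \<Rightarrow> ('q, 'e::euclidean_space) chart \<Rightarrow> bool" where
  "is_chart X c \<longleftrightarrow> openin X (fst c) \<and> open (snd c ` fst c) \<and>
     homeomorphic_map (subtopology X (fst c)) (top_of_set (snd c ` fst c)) (snd c)"

definition Ck_atlas :: "nat \<Rightarrow> 'q topology \<Rightarrow> ('q, 'e::euclidean_space) chart set \<Rightarrow> bool" where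
  "Ck_atlas k X A \<longleftrightarrow> (\<forall>c\<in>A. is_chart X c) \<and> (\<Union>c\<in>A. fst c) = topspace X \<and>
     (\<forall>c\<in>A. \<forall>c'\<in>A. Ck_on k (snd c ` (fst c \<inter> fst c')) (snd c' \<circ> chart_inv c))"

definition paracompact_space :: "'q topology \<Rightarrow> bool" where
  "paracompact_space X \<longleftrightarrow>
     (\<forall>\<U>. (\<forall>U\<in>\<U>. openin X U) \<and> \<Union>\<U> = topspace X \<longrightarrow>
       (\<exists>\<V>. (\<forall>V\<in>\<V>. openin X V \<and> (\<exists>U\<in>\<U>. V \<subseteq> U)) \<and> \<Union>\<V> = topspace X \<and>
          locally_finite_in X \<V>))"

definition Ck_manifold :: "nat \<Rightarrow> 'q topology \<Rightarrow> ('q, 'e::euclidean_space) chart set \<Rightarrow> bool" where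
  "Ck_manifold k X A \<longleftrightarrow> Hausdorff_space X \<and> paracompact_space X \<and> Ck_atlas k X A"

definition std_atlas :: "('e, 'e) chart set" where
  "std_atlas = {(UNIV, \<lambda>x. x)}"

text \<open>In the following two definitions \<open>S\<close> is an open subset of the manifold.\<close>

definition Ck_fun ::
  "nat \<Rightarrow> ('x, 'e::euclidean_space) chart set \<Rightarrow> 'x set \<Rightarrow> ('x \<Rightarrow> real) \<Rightarrow> bool" where
  "Ck_fun k A S f \<longleftrightarrow> (\<forall>c\<in>A. Ck_on k (snd c ` (fst c \<inter> S)) (f \<circ> chart_inv c))"

definition Ck_map ::
  "nat \<Rightarrow> 'x topology \<Rightarrow> ('x, 'e::euclidean_space) chart set \<Rightarrow> 'x set \<Rightarrow>
   'y topology \<Rightarrow> ('y, 'f::euclidean_space) chart set \<Rightarrow> ('x \<Rightarrow> 'y) \<Rightarrow> bool" where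
  "Ck_map k X A S Y B f \<longleftrightarrow> continuous_map (subtopology X S) Y f \<and>
     (\<forall>c\<in>A. \<forall>c'\<in>B. Ck_on k (snd c ` {p \<in> fst c \<inter> S. f p \<in> fst c'}) (snd c' \<circ> f \<circ> chart_inv c))"

definition Ck_diffeo ::
  "nat \<Rightarrow> 'x topology \<Rightarrow> ('x, 'e::euclidean_space) chart set \<Rightarrow> 'x set \<Rightarrow>
   'y topology \<Rightarrow> ('y, 'f::euclidean_space) chart set \<Rightarrow> 'y set \<Rightarrow> ('x \<Rightarrow> 'y) \<Rightarrow> bool" where
  "Ck_diffeo k X A U Y B W f \<longleftrightarrow> openin X U \<and> openin Y W \<and> bij_betw f U W \<and>
     Ck_map k X A U Y B f \<and> Ck_map k Y B W X A (inv_into U f)"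

text \<open>The differential of \<open>f\<close> at \<open>p\<close>, expressed in the chart \<open>c\<close> at \<open>p\<close> and \<open>c'\<close> at \<open>f p\<close>.\<close>

definition coord_deriv ::
  "('x, 'e::euclidean_space) chart \<Rightarrow> ('y, 'f::euclidean_space) chart \<Rightarrow> ('x \<Rightarrow> 'y) \<Rightarrow> 'x \<Rightarrow> 'e \<Rightarrow> 'f"
  where
  "coord_deriv c c' f p = frechet_derivative (snd c' \<circ> f \<circ> chart_inv c) (at (snd c p))"


section \<open>Events and spacetime\<close>

text \<open>Product structures on \<open>\<real> \<times> Q\<close> (points \<open>(t, q)\<close>) and \<open>\<real> \<times> Q \<times> \<real>\<close> (points \<open>(t, q, y)\<close>).\<close>

definition event_chart :: "('q, 'e) chart \<Rightarrow> (real \<times> 'q, real \<times> 'e) chart" where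
  "event_chart c = (UNIV \<times> fst c, \<lambda>(t, q). (t, snd c q))"

definition event_atlas :: "('q, 'e) chart set \<Rightarrow> (real \<times> 'q, real \<times> 'e) chart set" where
  "event_atlas A = event_chart ` A"

definition spacetime_top :: "'q topology \<Rightarrow> (real \<times> 'q \<times> real) topology" where
  "spacetime_top X = prod_topology euclidean (prod_topology X euclidean)"

definition spacetime_chart ::
  "('q, 'e) chart \<Rightarrow> (real \<times> 'q \<times> real, real \<times> 'e \<times> real) chart" where
  "spacetime_chart c = (UNIV \<times> fst c \<times> UNIV, \<lambda>(t, q, y). (t, snd c q, y))"

definition spacetime_atlas ::
  "('q, 'e) chart set \<Rightarrow> (real \<times> 'q \<times> real, real \<times> 'e \<times> real) chart set" where
  "spacetime_atlas A = spacetime_chart ` A"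

text \<open>
  A time-dependent tensor field on \<open>Q\<close> is given by its components \<open>a c (t, q)\<close> in every chart \<open>c\<close>
  of the atlas around \<open>q\<close>, subject to the transformation law under change of charts; the
  components are evaluated on vectors of the model space. The set \<open>D\<close> is the open subset of
  \<open>\<real> \<times> Q\<close> on which the field is defined.
\<close>

type_synonym ('q, 'e) tmetric = "('q, 'e) chart \<Rightarrow> real \<times> 'q \<Rightarrow> 'e \<Rightarrow> 'e \<Rightarrow> real"
type_synonym ('q, 'e) tform = "('q, 'e) chart \<Rightarrow> real \<times> 'q \<Rightarrow> 'e \<Rightarrow> real"

definition riemannian_metric_on ::
  "nat \<Rightarrow> ('q, 'e::euclidean_space) chart set \<Rightarrow> (real \<times> 'q) set \<Rightarrow> ('q, 'e) tmetric \<Rightarrow> bool" where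
  "riemannian_metric_on k A D a \<longleftrightarrow>
     (\<forall>c\<in>A. \<forall>v w. Ck_on k (snd (event_chart c) ` (fst (event_chart c) \<inter> D))
        (\<lambda>z. a c (chart_inv (event_chart c) z) v w)) \<and>
     (\<forall>c\<in>A. \<forall>(t, q)\<in>D. q \<in> fst c \<longrightarrow>
        bilinear (a c (t, q)) \<and> (\<forall>v w. a c (t, q) v w = a c (t, q) w v) \<and>
        (\<forall>v. v \<noteq> 0 \<longrightarrow> a c (t, q) v v > 0)) \<and>
     (\<forall>c\<in>A. \<forall>c'\<in>A. \<forall>(t, q)\<in>D. q \<in> fst c \<inter> fst c' \<longrightarrow>
        (\<forall>v w. a c (t, q) v w =
           a c' (t, q) (coord_deriv c c' (\<lambda>x. x) q v) (coord_deriv c c' (\<lambda>x. x) q w)))"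

definition one_form_on ::
  "nat \<Rightarrow> ('q, 'e::euclidean_space) chart set \<Rightarrow> (real \<times> 'q) set \<Rightarrow> ('q, 'e) tform \<Rightarrow> bool" where
  "one_form_on k A D b \<longleftrightarrow>
     (\<forall>c\<in>A. \<forall>v. Ck_on k (snd (event_chart c) ` (fst (event_chart c) \<inter> D))
        (\<lambda>z. b c (chart_inv (event_chart c) z) v)) \<and>
     (\<forall>c\<in>A. \<forall>(t, q)\<in>D. q \<in> fst c \<longrightarrow> linear (b c (t, q))) \<and>
     (\<forall>c\<in>A. \<forall>c'\<in>A. \<forall>(t, q)\<in>D. q \<in> fst c \<inter> fst c' \<longrightarrow>
        (\<forall>v. b c (t, q) v = b c' (t, q) (coord_deriv c c' (\<lambda>x. x) q v)))"

text \<open>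
  The data \<open>Q = (X, A)\<close>, \<open>T\<close>, \<open>a\<close>, \<open>b\<close>, \<open>V\<close> of a generalized gravitational wave spacetime
  \<open>M = T \<times> Q \<times> \<real>\<close> with \<open>C^r\<close> coefficients, and the components of its metric
  \<open>g = a - dt \<otimes> (dy - b) - (dy - b) \<otimes> dt - 2 V dt\<^sup>2\<close> in the chart \<open>spacetime_chart c\<close>.
\<close>

definition gw_spacetime ::
  "nat \<Rightarrow> 'q topology \<Rightarrow> ('q, 'e::euclidean_space) chart set \<Rightarrow> real set \<Rightarrow>
   ('q, 'e) tmetric \<Rightarrow> ('q, 'e) tform \<Rightarrow> (real \<times> 'q \<Rightarrow> real) \<Rightarrow> bool" where
  "gw_spacetime r X A T a b V \<longleftrightarrow>
     Ck_manifold (r + 1) X A \<and> connected_space X \<and> open T \<and> is_interval T \<and>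
     riemannian_metric_on r A (T \<times> topspace X) a \<and>
     one_form_on r A (T \<times> topspace X) b \<and>
     Ck_fun r (event_atlas A) (T \<times> topspace X) V"

definition gw_metric ::
  "('q, 'e) tmetric \<Rightarrow> ('q, 'e) tform \<Rightarrow> (real \<times> 'q \<Rightarrow> real) \<Rightarrow> ('q, 'e) chart \<Rightarrow>
   real \<times> 'q \<times> real \<Rightarrow> real \<times> 'e \<times> real \<Rightarrow> real \<times> 'e \<times> real \<Rightarrow> real" where
  "gw_metric a b V c = (\<lambda>(t, q, y) (\<tau>, v, \<eta>) (\<sigma>, w, \<zeta>).
     a c (t, q) v w - \<tau> * (\<zeta> - b c (t, q) w) - (\<eta> - b c (t, q) v) * \<sigma> - 2 * V (t, q) * \<tau> * \<sigma>)"


section \<open>Rosen coordinates\<close>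

text \<open>The metric \<open>a' - dt \<otimes> dy' - dy' \<otimes> dt\<close>.\<close>

definition rosen_metric ::
  "('w, 'e) tmetric \<Rightarrow> ('w, 'e) chart \<Rightarrow>
   real \<times> 'w \<times> real \<Rightarrow> real \<times> 'e \<times> real \<Rightarrow> real \<times> 'e \<times> real \<Rightarrow> real" where
  "rosen_metric a' c = (\<lambda>(t, q, y) (\<tau>, v, \<eta>) (\<sigma>, w, \<zeta>). a' c (t, q) v w - \<tau> * \<zeta> - \<eta> * \<sigma>)"

text \<open>
  The new variables \<open>(t, q', y')\<close> are the components of a \<open>C^k\<close> diffeomorphism \<open>\<Phi>\<close> from an open
  set \<open>U\<close> of spacetime onto an open set \<open>W\<close> of \<open>\<real> \<times> Q' \<times> \<real>\<close>, where \<open>Q' = (X', A')\<close>.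
  In product charts both \<open>n = \<partial>\<^sub>y\<close> and \<open>\<partial>\<^sub>y\<^sub>'\<close> have the components \<open>(0, 0, 1)\<close>.
  The metric \<open>a'\<close> is needed only at those \<open>(t, q')\<close> over which \<open>W\<close> is nonempty.
\<close>

definition rosen_coordinates ::
  "nat \<Rightarrow> 'q topology \<Rightarrow> ('q, 'e::euclidean_space) chart set \<Rightarrow>
   ('q, 'e) tmetric \<Rightarrow> ('q, 'e) tform \<Rightarrow> (real \<times> 'q \<Rightarrow> real) \<Rightarrow> (real \<times> 'q \<times> real) set \<Rightarrow>
   'w topology \<Rightarrow> ('w, 'e) chart set \<Rightarrow> (real \<times> 'w \<times> real) set \<Rightarrow>
   (real \<times> 'q \<times> real \<Rightarrow> real \<times> 'w \<times> real) \<Rightarrow> ('w, 'e) tmetric \<Rightarrow> bool" where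
  "rosen_coordinates k X A a b V U X' A' W \<Phi> a' \<longleftrightarrow>
     1 \<le> k \<and> Ck_manifold k X' A' \<and>
     Ck_diffeo k (spacetime_top X) (spacetime_atlas A) U
       (spacetime_top X') (spacetime_atlas A') W \<Phi> \<and>
     riemannian_metric_on (k - 1) A' {(t, q'). \<exists>y'. (t, q', y') \<in> W} a' \<and>
     (\<forall>p\<in>U. fst (\<Phi> p) = fst p) \<and>
     (\<forall>c\<in>A. \<forall>c'\<in>A'. \<forall>p\<in>U.
        p \<in> fst (spacetime_chart c) \<and> \<Phi> p \<in> fst (spacetime_chart c') \<longrightarrow>
        (let L = coord_deriv (spacetime_chart c) (spacetime_chart c') \<Phi> p
         in L (0, 0, 1) = (0, 0, 1) \<and>
            (\<forall>\<xi> \<zeta>. gw_metric a b V c p \<xi> \<zeta> = rosen_metric a' c' (\<Phi> p) (L \<xi>) (L \<zeta>))))"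

text \<open>
  Genuine coordinates around a point: \<open>q'\<close> takes values in the model space with its standard
  manifold structure.
\<close>

definition rosen_near ::
  "nat \<Rightarrow> 'q topology \<Rightarrow> ('q, 'e::euclidean_space) chart set \<Rightarrow> real set \<Rightarrow>
   ('q, 'e) tmetric \<Rightarrow> ('q, 'e) tform \<Rightarrow> (real \<times> 'q \<Rightarrow> real) \<Rightarrow> real \<times> 'q \<times> real \<Rightarrow> bool" where
  "rosen_near k X A T a b V p \<longleftrightarrow>
     (\<exists>U W \<Phi> a'. p \<in> U \<and> U \<subseteq> T \<times> topspace X \<times> UNIV \<and>
        rosen_coordinates k X A a b V U (euclidean :: 'e topology) std_atlas W \<Phi> a')"

text \<open>
  Rosen coordinates identifying \<open>I \<times> Q \<times> \<real>\<close> with \<open>I \<times> Q' \<times> \<real>\<close>. The first argument is the type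
  on which \<open>Q'\<close> lives, since HOL has no quantifier over types inside formulas.
\<close>

definition admits_rosen_over ::
  "'w itself \<Rightarrow> nat \<Rightarrow> 'q topology \<Rightarrow> ('q, 'e::euclidean_space) chart set \<Rightarrow>
   ('q, 'e) tmetric \<Rightarrow> ('q, 'e) tform \<Rightarrow> (real \<times> 'q \<Rightarrow> real) \<Rightarrow> real set \<Rightarrow> bool" where
  "admits_rosen_over _ k X A a b V I \<longleftrightarrow>
     (\<exists>(X' :: 'w topology) (A' :: ('w, 'e) chart set) \<Phi> a'.
        rosen_coordinates k X A a b V (I \<times> topspace X \<times> UNIV) X' A' (I \<times> topspace X' \<times> UNIV) \<Phi> a')"

definition admits_global_rosen ::
  "'w itself \<Rightarrow> nat \<Rightarrow> 'q topology \<Rightarrow> ('q, 'e::euclidean_space) chart set \<Rightarrow> real set \<Rightarrow>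
   ('q, 'e) tmetric \<Rightarrow> ('q, 'e) tform \<Rightarrow> (real \<times> 'q \<Rightarrow> real) \<Rightarrow> bool" where
  "admits_global_rosen ty k X A T a b V \<longleftrightarrow> admits_rosen_over ty k X A a b V T"

definition admits_time_local_rosen ::
  "'w itself \<Rightarrow> nat \<Rightarrow> 'q topology \<Rightarrow> ('q, 'e::euclidean_space) chart set \<Rightarrow> real set \<Rightarrow>
   ('q, 'e) tmetric \<Rightarrow> ('q, 'e) tform \<Rightarrow> (real \<times> 'q \<Rightarrow> real) \<Rightarrow> real \<Rightarrow> bool" where
  "admits_time_local_rosen ty k X A T a b V t0 \<longleftrightarrow>
     (\<exists>I. open I \<and> is_interval I \<and> t0 \<in> I \<and> I \<subseteq> T \<and> admits_rosen_over ty k X A a b V I)"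


section \<open>The Hamilton-Jacobi equation\<close>

text \<open>
  For an inner product \<open>G\<close>, \<open>sharp G \<alpha>\<close> is the vector \<open>G\<^sup>-\<^sup>1(\<cdot>, \<alpha>)\<close> dual to the covector \<open>\<alpha>\<close>.
\<close>

definition sharp :: "('e \<Rightarrow> 'e \<Rightarrow> real) \<Rightarrow> ('e \<Rightarrow> real) \<Rightarrow> 'e" where
  "sharp G \<alpha> = (THE w. \<forall>v. G w v = \<alpha> v)"

definition inverse_metric :: "('e \<Rightarrow> 'e \<Rightarrow> real) \<Rightarrow> ('e \<Rightarrow> real) \<Rightarrow> ('e \<Rightarrow> real) \<Rightarrow> real" where
  "inverse_metric G \<alpha> \<beta> = \<alpha> (sharp G \<beta>)"

definition hamiltonian ::
  "('q, 'e) tmetric \<Rightarrow> ('q, 'e) tform \<Rightarrow> (real \<times> 'q \<Rightarrow> real) \<Rightarrow> ('q, 'e) chart \<Rightarrow>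
   real \<times> 'q \<Rightarrow> ('e \<Rightarrow> real) \<Rightarrow> real" where
  "hamiltonian a b V c e p =
     (1 / 2) * inverse_metric (a c e) (\<lambda>v. p v - b c e v) (\<lambda>v. p v - b c e v) + V e"

definition time_deriv :: "(real \<times> 'q \<Rightarrow> real) \<Rightarrow> real \<times> 'q \<Rightarrow> real" where
  "time_deriv u = (\<lambda>(t, q). deriv (\<lambda>s. u (s, q)) t)"

definition space_deriv ::
  "('q, 'e::euclidean_space) chart \<Rightarrow> (real \<times> 'q \<Rightarrow> real) \<Rightarrow> real \<times> 'q \<Rightarrow> 'e \<Rightarrow> real" where
  "space_deriv c u = (\<lambda>(t, q). frechet_derivative (\<lambda>x. u (t, chart_inv c x)) (at (snd c q)))"

definition hj_solution ::
  "nat \<Rightarrow> 'q topology \<Rightarrow> ('q, 'e::euclidean_space) chart set \<Rightarrow>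
   ('q, 'e) tmetric \<Rightarrow> ('q, 'e) tform \<Rightarrow> (real \<times> 'q \<Rightarrow> real) \<Rightarrow> real set \<Rightarrow>
   (real \<times> 'q \<Rightarrow> real) \<Rightarrow> bool" where
  "hj_solution k X A a b V I u \<longleftrightarrow>
     1 \<le> k \<and> Ck_fun k (event_atlas A) (I \<times> topspace X) u \<and>
     (\<forall>c\<in>A. \<forall>t\<in>I. \<forall>q\<in>fst c.
        time_deriv u (t, q) + hamiltonian a b V c (t, q) (space_deriv c u (t, q)) = 0)"

text \<open>Base characteristics, defined on an open interval \<open>K\<close>, of a solution on \<open>I \<times> Q\<close>.\<close>

definition base_characteristic ::
  "'q topology \<Rightarrow> ('q, 'e::euclidean_space) chart set \<Rightarrow> ('q, 'e) tmetric \<Rightarrow> ('q, 'e) tform \<Rightarrow>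
   real set \<Rightarrow> (real \<times> 'q \<Rightarrow> real) \<Rightarrow> real set \<Rightarrow> (real \<Rightarrow> 'q) \<Rightarrow> bool" where
  "base_characteristic X A a b I u K \<gamma> \<longleftrightarrow>
     open K \<and> is_interval K \<and> K \<noteq> {} \<and> K \<subseteq> I \<and> continuous_map (top_of_set K) X \<gamma> \<and>
     (\<forall>c\<in>A. \<forall>t\<in>K. \<gamma> t \<in> fst c \<longrightarrow>
        ((\<lambda>s. snd c (\<gamma> s)) has_vector_derivative
           sharp (a c (t, \<gamma> t)) (\<lambda>v. space_deriv c u (t, \<gamma> t) v - b c (t, \<gamma> t) v)) (at t))"

definition characteristics_extend_to ::
  "'q topology \<Rightarrow> ('q, 'e::euclidean_space) chart set \<Rightarrow> ('q, 'e) tmetric \<Rightarrow> ('q, 'e) tform \<Rightarrow>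
   real set \<Rightarrow> (real \<times> 'q \<Rightarrow> real) \<Rightarrow> real set \<Rightarrow> bool" where
  "characteristics_extend_to X A a b I u J \<longleftrightarrow>
     (\<forall>K \<gamma>. base_characteristic X A a b I u K \<gamma> \<longrightarrow>
        (\<exists>K' \<gamma>'. base_characteristic X A a b I u K' \<gamma>' \<and> K \<subseteq> K' \<and> J \<subseteq> K' \<and>
           (\<forall>t\<in>K. \<gamma>' t = \<gamma> t)))"

definition has_global_solution ::
  "nat \<Rightarrow> 'q topology \<Rightarrow> ('q, 'e::euclidean_space) chart set \<Rightarrow> real set \<Rightarrow>
   ('q, 'e) tmetric \<Rightarrow> ('q, 'e) tform \<Rightarrow> (real \<times> 'q \<Rightarrow> real) \<Rightarrow> bool" where
  "has_global_solution k X A T a b V \<longleftrightarrow>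
     (\<exists>u. hj_solution k X A a b V T u \<and> characteristics_extend_to X A a b T u T)"

definition has_time_local_solution ::
  "nat \<Rightarrow> 'q topology \<Rightarrow> ('q, 'e::euclidean_space) chart set \<Rightarrow> real set \<Rightarrow>
   ('q, 'e) tmetric \<Rightarrow> ('q, 'e) tform \<Rightarrow> (real \<times> 'q \<Rightarrow> real) \<Rightarrow> real \<Rightarrow> bool" where
  "has_time_local_solution k X A T a b V t0 \<longleftrightarrow>
     (\<exists>I J u. open I \<and> is_interval I \<and> I \<subseteq> T \<and> hj_solution k X A a b V I u \<and>
        open J \<and> is_interval J \<and> t0 \<in> J \<and> J \<subseteq> I \<and> characteristics_extend_to X A a b I u J)"

end

theory Submission
  imports Defs
begin

text \<open>
  Rosen coordinates and solutions of the Hamilton-Jacobi equation correspond by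
  \<open>y' = y - u(t, q)\<close>, with \<open>q'\<close> a label that is constant along the base characteristics of \<open>u\<close>.
  Completing the square in the metric shows this: the terms mixing \<open>dt\<close> with \<open>dq'\<close> vanish exactly
  when the curves of constant \<open>q'\<close> have velocity \<open>a\<^sup>-\<^sup>1(\<partial>\<^sub>q u - b)\<close>, and then the term in \<open>dt\<^sup>2\<close>
  vanishes exactly when \<open>u\<close> solves the equation.

  Given a solution of class \<open>C^k\<close> with complete characteristics, \<open>q'\<close> is the position at a fixed time
  of the characteristic through the event; its velocity field is only \<open>C^(k-1)\<close>, which is the loss of
  one derivative. Conversely, since \<open>\<partial>\<^sub>y\<^sub>' = \<partial>\<^sub>y\<close>, a Rosen diffeomorphism has \<open>q'\<close> independent of
  \<open>y\<close> and \<open>y - y'\<close> equal to a function \<open>u(t, q)\<close>. There \<open>u\<close> is only \<open>C\<^sup>1\<close>, so its characteristics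
  need not be unique for general reasons; but \<open>q'\<close> is constant along each of them because the kernel of
  the differential of \<open>q'\<close> on events is spanned by the velocity, so each is a curve of constant \<open>q'\<close>.
  Local solutions come from the Hamiltonian flow: the action along characteristics that start with
  zero momentum, pulled back by the inverse of the flow of positions.
\<close>

section \<open>Calculus of finitely often differentiable functions\<close>

text \<open>Counting derivatives shapes the proof. A solution of class \<open>C^k\<close> has a
  velocity field of class \<open>C^(k-1)\<close>, and the flow must be of exactly that class, so the
  dependence of a differential equation on its parameters may lose nothing. A fixed point argument
  gives only continuity; each derivative is then found as the solution of the equation of first
  variation, and an induction applies this to that equation again. That the space derivative of the
  action is the momentum is also read off from the first variation, so no second space derivatives
  of the flow enter; for \<open>r = 2\<close> the flow is only \<open>C\<^sup>1\<close>. Since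
  \<partial>_y is preserved, the work takes place on events \<open>(t, q)\<close>, where a pair
  \<open>\<phi>\<close>, \<open>\<psi>\<close> of maps inverse to each other at each time describes
  the change of \<open>q\<close>, in both directions of the equivalence. Solutions live on
  \<open>I\<close> and characteristics are followed on some \<open>J\<close> inside
  \<open>I\<close>: the global case is \<open>I = J = T\<close>. Differentiability is established in
  one convenient pair of charts and moved to all charts afterwards.\<close>

lemma Ck_on_subset: "Ck_on k S f \<Longrightarrow> T \<subseteq> S \<Longrightarrow> Ck_on k T f"
proof (induction k arbitrary: f)
  case 0
  then show ?case by (auto intro: continuous_on_subset)
next
  case (Suc k)
  then show ?case by (simp, blast)
qed

lemma Ck_on_SucD_derivative:
  "Ck_on (Suc k) S f \<Longrightarrow> x \<in> S \<Longrightarrow> (f has_derivative frechet_derivative f (at x)) (at x)"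
  by (simp add: frechet_derivative_works)

lemma Ck_on_Suc_imp: "Ck_on (Suc k) S f \<Longrightarrow> Ck_on k S f"
proof (induction k arbitrary: f)
  case 0
  then show ?case
    by (auto intro!: continuous_at_imp_continuous_on differentiable_imp_continuous_within)
next
  case (Suc k)
  have "\<forall>x\<in>S. f differentiable at x" using Suc.prems by simp
  moreover have "\<forall>v. Ck_on (Suc k) S (\<lambda>x. frechet_derivative f (at x) v)"
    using Suc.prems unfolding Ck_on.simps(2)[of "Suc k" S f] by blast
  ultimately show ?case using Suc.IH by simp
qed

lemma Ck_on_mono:
  assumes "Ck_on l S f" "k \<le> l"
  shows "Ck_on k S f"
  using assms(2,1)
proof (induction rule: dec_induct)
  case (step n)
  then show ?case using Ck_on_Suc_imp by blast
qed

lemma Ck_on_imp_continuous_on: "Ck_on k S f \<Longrightarrow> continuous_on S f"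
  using Ck_on_mono[of k S f 0] by simp

text \<open>Derivatives are taken in the full sense \<open>at x\<close>, so agreement on
  \<open>S\<close> carries over to them only because \<open>S\<close> is a neighbourhood of each of
  its points.\<close>

lemma Ck_on_cong:
  assumes "open S" "Ck_on k S f" "\<And>x. x \<in> S \<Longrightarrow> f x = g x"
  shows "Ck_on k S g"
  using assms(2,3)
proof (induction k arbitrary: f g)
  case 0
  then show ?case by (simp cong: continuous_on_cong)
next
  case (Suc k)
  have D: "(g has_derivative frechet_derivative f (at x)) (at x)" if "x \<in> S" for x
    using has_derivative_transform_within_open[OF Ck_on_SucD_derivative[OF Suc.prems(1) that] \<open>open S\<close> that]
      Suc.prems(2) by blast
  have "frechet_derivative g (at x) = frechet_derivative f (at x)" if "x \<in> S" for x
    using D[OF that] frechet_derivative_at by fastforce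
  then have "Ck_on k S (\<lambda>x. frechet_derivative g (at x) v)" for v
    using Suc.IH[of "\<lambda>x. frechet_derivative f (at x) v"] Suc.prems by simp
  then show ?case using D by (auto simp: differentiable_def)
qed

text \<open>The function is the same on all the sets \<open>U\<close>, and so are its derivatives;
  only differentiability and continuity have to be checked, and these are local. Statements about
  charts are glued this way.\<close>

lemma Ck_on_local:
  assumes "\<And>x. x \<in> S \<Longrightarrow> \<exists>U. open U \<and> x \<in> U \<and> Ck_on k U f"
  shows "Ck_on k S f"
  using assms
proof (induction k arbitrary: f)
  case 0
  have "isCont f x" if "x \<in> S" for x
    using 0[OF that] by (auto simp: continuous_on_eq_continuous_at)
  then show ?case by (simp add: continuous_at_imp_continuous_on)
next
  case (Suc k)
  have "f differentiable (at x)" if "x \<in> S" for x using Suc.prems[OF that] by auto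
  moreover have "Ck_on k S (\<lambda>x. frechet_derivative f (at x) v)" for v
    by (rule Suc.IH) (use Suc.prems in fastforce)
  ultimately show ?case by simp
qed

text \<open>\<open>frechet_derivative\<close> is a choice operator; this replaces it by any formula
  for the derivative, which an induction over \<open>k\<close> can then treat as an ordinary
  function.\<close>

lemma Ck_on_SucI:
  assumes "open S" "\<And>x. x \<in> S \<Longrightarrow> (f has_derivative f' x) (at x)"
    and "\<And>v. Ck_on k S (\<lambda>x. f' x v)"
  shows "Ck_on (Suc k) S f"
proof -
  have "frechet_derivative f (at x) = f' x" if "x \<in> S" for x
    using assms(2)[OF that] frechet_derivative_at by fastforce
  then have "Ck_on k S (\<lambda>x. frechet_derivative f (at x) v)" for v
    by (intro Ck_on_cong[OF assms(1) assms(3)[of v]]) simp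
  then show ?thesis using assms(2) by (auto simp: differentiable_def)
qed

lemma Ck_on_const: "Ck_on k S (\<lambda>x. c)"
  by (induction k arbitrary: c) (auto simp: frechet_derivative_const)

lemma Ck_on_linear:
  assumes "bounded_linear f" shows "Ck_on k S f"
proof (cases k)
  case 0
  then show ?thesis using assms linear_continuous_on by auto
next
  case (Suc m)
  have D: "(f has_derivative f) (at x)" for x
    using assms bounded_linear_imp_has_derivative by blast
  then have "frechet_derivative f (at x) = f" for x
    by (rule frechet_derivative_at[symmetric])
  then show ?thesis using D by (auto simp: differentiable_def Suc Ck_on_const)
qed

lemma Ck_on_id: "Ck_on k S (\<lambda>x. x)"
  by (rule Ck_on_linear) (rule bounded_linear_ident)

lemma Ck_on_add:
  assumes "open S" "Ck_on k S f" "Ck_on k S g"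
  shows "Ck_on k S (\<lambda>x. f x + g x)"
  using assms(2,3)
proof (induction k arbitrary: f g)
  case 0
  then show ?case by (simp add: continuous_on_add)
next
  case (Suc k)
  show ?case
    by (rule Ck_on_SucI[OF \<open>open S\<close> has_derivative_add[OF
          Ck_on_SucD_derivative[OF Suc.prems(1)] Ck_on_SucD_derivative[OF Suc.prems(2)]]])
      (use Suc in auto)
qed

lemma Ck_on_linear_compose:
  assumes "open S" "Ck_on k S f" "bounded_linear h"
  shows "Ck_on k S (\<lambda>x. h (f x))"
  using assms(2)
proof (induction k arbitrary: f)
  case 0
  then show ?case using assms(3)
    by (simp add: bounded_linear.continuous_on)
next
  case (Suc k)
  show ?case
    by (rule Ck_on_SucI[OF \<open>open S\<close> bounded_linear.has_derivative[OF assms(3)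
          Ck_on_SucD_derivative[OF Suc.prems]]]) (use Suc in auto)
qed

text \<open>The product rule gives two terms of the same bilinear kind, each containing
  \<open>f\<close> or \<open>g\<close> itself as a factor, which is why these are also lowered to
  class \<open>k\<close>.\<close>

lemma Ck_on_bilinear:
  assumes "open S" "Ck_on k S f" "Ck_on k S g" "bounded_bilinear B"
  shows "Ck_on k S (\<lambda>x. B (f x) (g x))"
  using assms(2,3)
proof (induction k arbitrary: f g)
  case 0
  then show ?case using assms(4) by (simp add: bounded_bilinear.continuous_on)
next
  case (Suc k)
  show ?case
    by (rule Ck_on_SucI[OF \<open>open S\<close> bounded_bilinear.FDERIV[OF assms(4)
          Ck_on_SucD_derivative[OF Suc.prems(1)] Ck_on_SucD_derivative[OF Suc.prems(2)]]])
      (use Suc.prems Ck_on_Suc_imp[OF Suc.prems(1)] Ck_on_Suc_imp[OF Suc.prems(2)]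
       in \<open>auto intro!: Ck_on_add[OF \<open>open S\<close>] Suc.IH\<close>)
qed

lemmas Ck_on_scaleR = Ck_on_bilinear[OF _ _ _ bounded_bilinear_scaleR]
lemmas Ck_on_mult = Ck_on_bilinear[OF _ _ _ bounded_bilinear_mult]
lemmas Ck_on_inner = Ck_on_bilinear[OF _ _ _ bounded_bilinear_inner]
lemmas Ck_on_minus = Ck_on_linear_compose[OF _ _ bounded_linear_minus[OF bounded_linear_ident]]

lemma Ck_on_diff:
  assumes "open S" "Ck_on k S f" "Ck_on k S g"
  shows "Ck_on k S (\<lambda>x. f x - g x)"
  using Ck_on_add[OF assms(1,2) Ck_on_minus[OF assms(1,3)]] by simp

lemma Ck_on_sum:
  assumes "open S" "\<And>i. i \<in> I \<Longrightarrow> Ck_on k S (f i)"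
  shows "Ck_on k S (\<lambda>x. \<Sum>i\<in>I. f i x)"
  using assms(2)
  by (induction I rule: infinite_finite_induct)
    (auto intro: Ck_on_const Ck_on_add[OF \<open>open S\<close>])

lemma Ck_on_Pair:
  assumes "open S" "Ck_on k S f" "Ck_on k S g"
  shows "Ck_on k S (\<lambda>x. (f x, g x))"
proof -
  have "bounded_linear (\<lambda>y. (y, 0))" "bounded_linear (\<lambda>y. (0, y))"
    by (auto intro!: bounded_linear_Pair bounded_linear_ident bounded_linear_zero)
  then have "Ck_on k S (\<lambda>x. (f x, 0) + (0, g x))"
    using assms by (intro Ck_on_add Ck_on_linear_compose[where h = "\<lambda>y. (y, 0)"]
        Ck_on_linear_compose[where h = "\<lambda>y. (0, y)"])
  then show ?thesis by simp
qed

lemmas Ck_on_fst = Ck_on_linear_compose[OF _ _ bounded_linear_fst]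
lemmas Ck_on_snd = Ck_on_linear_compose[OF _ _ bounded_linear_snd]

text \<open>\<open>Ck_on\<close> controls derivatives in fixed directions only. A derivative applied
  to a direction that varies with the point is brought to that form by this expansion, the
  coordinates becoming scalar factors.\<close>

lemma linear_componentwise_sum:
  fixes f :: "'a::euclidean_space \<Rightarrow> 'b::real_vector"
  assumes "linear f"
  shows "f x = (\<Sum>b\<in>Basis. (x \<bullet> b) *\<^sub>R f b)"
proof -
  have "f x = f (\<Sum>b\<in>Basis. (x \<bullet> b) *\<^sub>R b)" by (simp add: euclidean_representation)
  then show ?thesis by (simp add: linear_sum[OF assms] linear_scale[OF assms])
qed

text \<open>The chain rule feeds the varying direction \<open>Df(x) v\<close> into
  \<open>Dg\<close>; expanded in a basis, it leaves partial derivatives of \<open>g\<close> composed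
  with \<open>f\<close>, to which the induction applies.\<close>

lemma Ck_on_compose:
  fixes f :: "'a::real_normed_vector \<Rightarrow> 'b::euclidean_space" and g :: "'b \<Rightarrow> 'c::real_normed_vector"
  assumes "open S" "open T" "Ck_on k S f" "Ck_on k T g" "\<And>x. x \<in> S \<Longrightarrow> f x \<in> T"
  shows "Ck_on k S (\<lambda>x. g (f x))"
  using assms(3,4)
proof (induction k arbitrary: g)
  case 0
  then show ?case using assms(5)
    by (auto intro: continuous_on_compose2)
next
  case (Suc k)
  have D: "((\<lambda>x. g (f x)) has_derivative
      (\<lambda>v. frechet_derivative g (at (f x)) (frechet_derivative f (at x) v))) (at x)"
    if "x \<in> S" for x
    using diff_chain_at[OF Ck_on_SucD_derivative[OF Suc.prems(1) that]
        Ck_on_SucD_derivative[OF Suc.prems(2) assms(5)[OF that]]] by (simp add: o_def)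
  have "linear (frechet_derivative g (at (f x)))" if "x \<in> S" for x
    using Suc.prems(2) assms(5)[OF that] linear_frechet_derivative by fastforce
  note [simp] = linear_componentwise_sum[OF this, symmetric]
  have "Ck_on k S (\<lambda>x. \<Sum>b\<in>Basis. (frechet_derivative f (at x) v \<bullet> b) *\<^sub>R
      frechet_derivative g (at (f x)) b)" for v
    using Suc.prems Ck_on_Suc_imp[OF Suc.prems(1)]
    by (intro Ck_on_sum Ck_on_scaleR Ck_on_inner Ck_on_const \<open>open S\<close> Suc.IH) simp_all
  then have C: "Ck_on k S (\<lambda>x. frechet_derivative g (at (f x)) (frechet_derivative f (at x) v))" for v
    by (rule Ck_on_cong[OF \<open>open S\<close>]) simp
  show ?case
    by (rule Ck_on_SucI[OF \<open>open S\<close> D C])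
qed

lemma Ck_on_open_preimage:
  assumes "open S" "Ck_on k S f" "open T"
  shows "open {x \<in> S. f x \<in> T}"
proof -
  have "{x \<in> S. f x \<in> T} = S \<inter> f -` T" by auto
  then show ?thesis
    using continuous_open_preimage[OF Ck_on_imp_continuous_on[OF assms(2)] assms(1,3)] by simp
qed

subsection \<open>Partial derivatives\<close>

text \<open>The mean value inequality for \<open>f (z + s b) - s c\<close> as a function of
  \<open>s\<close>, whose derivative is \<open>g - c\<close>.\<close>

lemma partial_increment_bound:
  fixes f :: "'a::real_normed_vector \<Rightarrow> 'b::real_normed_vector"
  assumes "\<And>s. s \<in> closed_segment 0 r \<Longrightarrow>
      ((\<lambda>h. f (z + s *\<^sub>R b + h *\<^sub>R b)) has_vector_derivative g (z + s *\<^sub>R b)) (at 0)"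
    and "\<And>s. s \<in> closed_segment 0 r \<Longrightarrow> norm (g (z + s *\<^sub>R b) - c) \<le> e"
  shows "norm (f (z + r *\<^sub>R b) - f z - r *\<^sub>R c) \<le> e * \<bar>r\<bar>"
proof -
  let ?F = "\<lambda>s. f (z + s *\<^sub>R b) - s *\<^sub>R c"
  have D: "(?F has_vector_derivative g (z + s *\<^sub>R b) - c) (at s)" if "s \<in> closed_segment 0 r" for s
  proof -
    have "((\<lambda>h. f (z + (s + h) *\<^sub>R b)) has_vector_derivative g (z + s *\<^sub>R b)) (at 0)"
      using assms(1)[OF that] by (simp add: algebra_simps)
    then have "((\<lambda>h. f (z + h *\<^sub>R b)) has_vector_derivative g (z + s *\<^sub>R b)) (at s)"
      unfolding has_vector_derivative_def
      using has_derivative_compose[of "\<lambda>h. h - s" "\<lambda>h. h" s UNIV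
          "\<lambda>h. f (z + (s + h) *\<^sub>R b)" "\<lambda>x. x *\<^sub>R g (z + s *\<^sub>R b)"]
      by (simp add: has_derivative_diff[OF has_derivative_ident has_derivative_const, simplified])
    then show ?thesis by (auto intro!: derivative_eq_intros)
  qed
  have "norm (?F r - ?F 0) \<le> e * norm (r - 0)"
  proof (rule differentiable_bound[OF convex_closed_segment[of 0 r],
        where f' = "\<lambda>s h. h *\<^sub>R (g (z + s *\<^sub>R b) - c)"])
    show "(?F has_derivative (\<lambda>h. h *\<^sub>R (g (z + s *\<^sub>R b) - c))) (at s within closed_segment 0 r)"
      if "s \<in> closed_segment 0 r" for s
      using D[OF that] has_derivative_at_withinI unfolding has_vector_derivative_def by blast
    show "onorm (\<lambda>h. h *\<^sub>R (g (z + s *\<^sub>R b) - c)) \<le> e" if "s \<in> closed_segment 0 r" for s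
    proof (rule onorm_le)
      fix h :: real
      show "norm (h *\<^sub>R (g (z + s *\<^sub>R b) - c)) \<le> e * norm h"
        using mult_right_mono[OF assms(2)[OF that], of "\<bar>h\<bar>"] by (simp add: mult.commute)
    qed
  qed auto
  then show ?thesis by (simp add: algebra_simps)
qed

text \<open>Coordinates are changed one after the other, which is the induction over \<open>B\<close>.\<close>

lemma partials_increment:
  fixes f :: "'a::euclidean_space \<Rightarrow> 'b::real_normed_vector"
  assumes "finite B" "B \<subseteq> Basis" "open S" "x \<in> S" "e > 0"
    and D: "\<And>b z. b \<in> Basis \<Longrightarrow> z \<in> S \<Longrightarrow>
      ((\<lambda>h. f (z + h *\<^sub>R b)) has_vector_derivative f' b z) (at 0)"
    and C: "\<And>b. b \<in> Basis \<Longrightarrow> isCont (f' b) x"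
  shows "\<exists>d>0. \<forall>k. (\<forall>b. \<bar>k b\<bar> < d) \<longrightarrow> (\<forall>z. norm (z - x) < d \<longrightarrow>
      norm (f (z + (\<Sum>b\<in>B. k b *\<^sub>R b)) - f z - (\<Sum>b\<in>B. k b *\<^sub>R f' b x)) \<le> e * (\<Sum>b\<in>B. \<bar>k b\<bar>))"
  using assms(1,2)
proof (induction B rule: finite_induct)
  case empty
  then show ?case by (auto intro: exI[of _ 1])
next
  case (insert b B)
  then obtain d1 where d1: "d1 > 0" "\<And>k z. (\<And>b. \<bar>k b\<bar> < d1) \<Longrightarrow> norm (z - x) < d1 \<Longrightarrow>
      norm (f (z + (\<Sum>b\<in>B. k b *\<^sub>R b)) - f z - (\<Sum>b\<in>B. k b *\<^sub>R f' b x)) \<le> e * (\<Sum>b\<in>B. \<bar>k b\<bar>)"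
    by auto
  have b: "b \<in> Basis" using insert by auto
  obtain d2 where d2: "d2 > 0" "\<And>z. norm (z - x) < d2 \<Longrightarrow> norm (f' b z - f' b x) < e"
    using C[OF b] \<open>e > 0\<close> unfolding continuous_at_eps_delta dist_norm by metis
  obtain d3 where d3: "d3 > 0" "ball x d3 \<subseteq> S" using \<open>open S\<close> \<open>x \<in> S\<close> open_contains_ball by metis
  \<comment> \<open>Halved because two displacements add up: \<open>z\<close> is within
    \<open>d\<close> of \<open>x\<close>, and the coordinate \<open>b\<close> moves by less than
    \<open>d\<close> more.\<close>
  define d where "d = min d1 (min d2 d3) / 2"
  have dpos: "d > 0" using d1 d2 d3 by (simp add: d_def)
  show ?case
  proof (intro exI[of _ d] conjI dpos allI impI)
    fix k :: "'a \<Rightarrow> real" and z assume k: "\<forall>b. \<bar>k b\<bar> < d" and z: "norm (z - x) < d"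
    have near: "norm (z + s *\<^sub>R b - x) < min d1 (min d2 d3)" if "s \<in> closed_segment 0 (k b)" for s
    proof -
      have "\<bar>s\<bar> \<le> \<bar>k b\<bar>" using that by (auto simp: closed_segment_eq_real_ivl split: if_splits)
      then have "norm (s *\<^sub>R b) < d" using k b by (simp add: le_less_trans)
      then have "norm ((z - x) + s *\<^sub>R b) < d + d" using z norm_triangle_lt[of "z - x" "s *\<^sub>R b"] by simp
      then show ?thesis by (simp add: d_def algebra_simps)
    qed
    have 1: "norm (f (z + k b *\<^sub>R b) - f z - k b *\<^sub>R f' b x) \<le> e * \<bar>k b\<bar>"
    proof (rule partial_increment_bound[where g = "f' b"])
      fix s assume s: "s \<in> closed_segment 0 (k b)"
      have "z + s *\<^sub>R b \<in> ball x d3" using near[OF s] by (simp add: dist_norm norm_minus_commute)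
      then show "((\<lambda>h. f (z + s *\<^sub>R b + h *\<^sub>R b)) has_vector_derivative f' b (z + s *\<^sub>R b)) (at 0)"
        using D[OF b] d3 by blast
      show "norm (f' b (z + s *\<^sub>R b) - f' b x) \<le> e" using d2(2)[of "z + s *\<^sub>R b"] near[OF s] by simp
    qed
    have 2: "norm (f (z + k b *\<^sub>R b + (\<Sum>b\<in>B. k b *\<^sub>R b)) - f (z + k b *\<^sub>R b) - (\<Sum>b\<in>B. k b *\<^sub>R f' b x))
        \<le> e * (\<Sum>b\<in>B. \<bar>k b\<bar>)"
    proof (rule d1(2))
      have "d \<le> d1" using d1(1) d2(1) d3(1) unfolding d_def by linarith
      then show "\<bar>k b\<bar> < d1" for b using k less_le_trans by blast
      show "norm (z + k b *\<^sub>R b - x) < d1" using near[of "k b"] by auto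
    qed
    have "f (z + (\<Sum>b\<in>insert b B. k b *\<^sub>R b)) - f z - (\<Sum>b\<in>insert b B. k b *\<^sub>R f' b x) =
      (f (z + k b *\<^sub>R b) - f z - k b *\<^sub>R f' b x) +
      (f (z + k b *\<^sub>R b + (\<Sum>b\<in>B. k b *\<^sub>R b)) - f (z + k b *\<^sub>R b) - (\<Sum>b\<in>B. k b *\<^sub>R f' b x))"
      using insert by (simp add: algebra_simps)
    then have "norm (f (z + (\<Sum>b\<in>insert b B. k b *\<^sub>R b)) - f z - (\<Sum>b\<in>insert b B. k b *\<^sub>R f' b x))
      \<le> e * \<bar>k b\<bar> + e * (\<Sum>b\<in>B. \<bar>k b\<bar>)"
      using norm_triangle_mono[OF 1 2] by presburger
    then show "norm (f (z + (\<Sum>b\<in>insert b B. k b *\<^sub>R b)) - f z - (\<Sum>b\<in>insert b B. k b *\<^sub>R f' b x))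
      \<le> e * (\<Sum>b\<in>insert b B. \<bar>k b\<bar>)"
      using insert by (simp add: algebra_simps)
  qed
qed

text \<open>Solutions of differential equations are built one partial derivative at a time, time and
  parameters separately; this turns them into differentiable functions. The increment is split into
  moves along the coordinate axes.\<close>

lemma has_derivative_partials:
  fixes f :: "'a::euclidean_space \<Rightarrow> 'b::real_normed_vector"
  assumes "open S" "x \<in> S"
    and D: "\<And>b z. b \<in> Basis \<Longrightarrow> z \<in> S \<Longrightarrow>
      ((\<lambda>h. f (z + h *\<^sub>R b)) has_vector_derivative f' b z) (at 0)"
    and C: "\<And>b. b \<in> Basis \<Longrightarrow> isCont (f' b) x"
  shows "(f has_derivative (\<lambda>v. \<Sum>b\<in>Basis. (v \<bullet> b) *\<^sub>R f' b x)) (at x)"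
  unfolding has_derivative_at_alt
proof (intro conjI allI impI)
  show "bounded_linear (\<lambda>v. \<Sum>b\<in>Basis. (v \<bullet> b) *\<^sub>R f' b x)"
    by (intro bounded_linear_sum bounded_linear_compose[OF bounded_linear_scaleR_left]
        bounded_linear_inner_left)
  fix e :: real assume "e > 0"
  \<comment> \<open>The increment bound involves the sum of the absolute coordinates, which is at
    most \<open>DIM('a)\<close> times the norm.\<close>
  define e' where "e' = e / real DIM('a)"
  have "e' > 0" using \<open>e > 0\<close> by (simp add: e'_def)
  from partials_increment[OF finite_Basis subset_refl assms(1,2) this D C]
  obtain d where d: "d > 0" "\<And>k z. (\<And>b. \<bar>k b\<bar> < d) \<Longrightarrow> norm (z - x) < d \<Longrightarrow>
      norm (f (z + (\<Sum>b\<in>Basis. k b *\<^sub>R b)) - f z - (\<Sum>b\<in>Basis. k b *\<^sub>R f' b x)) \<le> e' * (\<Sum>b\<in>Basis. \<bar>k b\<bar>)"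
    by auto
  show "\<exists>d>0. \<forall>y. norm (y - x) < d \<longrightarrow>
     norm (f y - f x - (\<Sum>b\<in>Basis. ((y - x) \<bullet> b) *\<^sub>R f' b x)) \<le> e * norm (y - x)"
  proof (intro exI[of _ d] conjI d allI impI)
    fix y assume y: "norm (y - x) < d"
    \<comment> \<open>Zero off \<open>Basis\<close>, because the bound on the coefficients is
      demanded for every \<open>b\<close>.\<close>
    let ?k = "\<lambda>b. if b \<in> Basis then (y - x) \<bullet> b else 0"
    have k: "\<bar>?k b\<bar> \<le> norm (y - x)" for b using Basis_le_norm by auto
    then have "\<And>b. \<bar>?k b\<bar> < d" using y le_less_trans by blast
    from d(2)[of ?k x, OF this] have
      "norm (f (x + (\<Sum>b\<in>Basis. ((y - x) \<bullet> b) *\<^sub>R b)) - f x - (\<Sum>b\<in>Basis. ((y - x) \<bullet> b) *\<^sub>R f' b x))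
        \<le> e' * (\<Sum>b\<in>Basis. \<bar>(y - x) \<bullet> b\<bar>)"
      using d(1) by simp
    also have "\<dots> \<le> e' * (\<Sum>b\<in>(Basis::'a set). norm (y - x))"
      using \<open>e' > 0\<close> by (intro mult_left_mono sum_mono Basis_le_norm) auto
    also have "\<dots> = e * norm (y - x)" by (simp add: e'_def)
    finally show "norm (f y - f x - (\<Sum>b\<in>Basis. ((y - x) \<bullet> b) *\<^sub>R f' b x)) \<le> e * norm (y - x)"
      by (simp only: euclidean_representation) simp
  qed
qed

lemma Ck_on_SucI_partials:
  fixes f :: "'a::euclidean_space \<Rightarrow> 'b::real_normed_vector"
  assumes "open S"
    and D: "\<And>b z. b \<in> Basis \<Longrightarrow> z \<in> S \<Longrightarrow>
      ((\<lambda>h. f (z + h *\<^sub>R b)) has_vector_derivative f' b z) (at 0)"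
    and C: "\<And>b. b \<in> Basis \<Longrightarrow> Ck_on k S (f' b)"
  shows "Ck_on (Suc k) S f"
proof (rule Ck_on_SucI[OF assms(1)])
  show "(f has_derivative (\<lambda>v. \<Sum>b\<in>Basis. (v \<bullet> b) *\<^sub>R f' b x)) (at x)" if "x \<in> S" for x
    using has_derivative_partials[OF assms(1) that D] Ck_on_imp_continuous_on[OF C]
      continuous_on_eq_continuous_at[OF assms(1)] that by blast
  show "Ck_on k S (\<lambda>x. \<Sum>b\<in>Basis. (v \<bullet> b) *\<^sub>R f' b x)" for v
    by (intro Ck_on_sum Ck_on_scaleR Ck_on_const C assms)
qed

lemma has_vector_derivative_at_0_iff:
  "(f has_vector_derivative f') (at 0) \<longleftrightarrow> ((\<lambda>h. (f h - f 0) /\<^sub>R h) \<longlongrightarrow> f') (at (0::real))"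
proof -
  have "((\<lambda>h. (f h - f 0) /\<^sub>R h) \<longlongrightarrow> f') (at 0) \<longleftrightarrow>
      ((\<lambda>h. norm ((f h - f 0) /\<^sub>R h - f')) \<longlongrightarrow> 0) (at 0)"
    by (simp add: LIM_zero_iff tendsto_norm_zero_iff)
  also have "\<dots> \<longleftrightarrow> ((\<lambda>h. norm (f h - f 0 - h *\<^sub>R f') / norm h) \<longlongrightarrow> 0) (at 0)"
  proof (rule filterlim_cong[OF refl refl])
    show "\<forall>\<^sub>F h in at (0::real). norm ((f h - f 0) /\<^sub>R h - f') = norm (f h - f 0 - h *\<^sub>R f') / norm h"
    proof (rule eventually_at_filter[THEN iffD2], rule always_eventually, intro allI impI)
      fix h :: real assume "h \<noteq> 0"
      then have "(f h - f 0) /\<^sub>R h - f' = (f h - f 0 - h *\<^sub>R f') /\<^sub>R h"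
        by (simp add: scaleR_diff_right)
      then show "norm ((f h - f 0) /\<^sub>R h - f') = norm (f h - f 0 - h *\<^sub>R f') / norm h"
        by (simp add: divide_inverse mult.commute)
    qed
  qed
  finally show ?thesis
    by (simp add: has_vector_derivative_def has_derivative_iff_norm bounded_linear_scaleR_left)
qed

lemma has_derivative_imp_directional:
  assumes "(f has_derivative f') (at x)"
  shows "((\<lambda>h. f (x + h *\<^sub>R v)) has_vector_derivative f' v) (at 0)"
proof -
  have "((\<lambda>h::real. x + h *\<^sub>R v) has_derivative (\<lambda>h. h *\<^sub>R v)) (at 0)"
    by (auto intro!: derivative_eq_intros)
  from diff_chain_at[OF this, of f f'] assms show ?thesis
    using linear_scale[OF has_derivative_linear[OF assms]]
    by (simp add: has_vector_derivative_def o_def)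
qed

subsection \<open>Linear equations and inverse functions\<close>

text \<open>Being injective, \<open>A0\<close> is bounded below by some \<open>c > 0\<close>. Once
  \<open>A h\<close> is within \<open>c / 2\<close> of \<open>A0\<close>, the error term is absorbed
  into the left side, so that no bound on \<open>w\<close> enters.\<close>

lemma tendsto_solve:
  fixes A :: "'z \<Rightarrow> 'e::euclidean_space \<Rightarrow> 'e"
  assumes "linear A0" "inj A0" "\<And>h. linear (A h)"
    and "\<And>v. ((\<lambda>h. A h v) \<longlongrightarrow> A0 v) F" "((\<lambda>h. A h (w h)) \<longlongrightarrow> A0 w0) F"
  shows "(w \<longlongrightarrow> w0) F"
proof -
  obtain c where c: "c > 0" "\<And>v. c * norm v \<le> norm (A0 v)"
    using linear_inj_bounded_below_pos[OF assms(1,2)] by metis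
  define \<delta> where "\<delta> = (\<lambda>h. \<Sum>b\<in>Basis. norm (A h b - A0 b))"
  have "(\<delta> \<longlongrightarrow> (\<Sum>b\<in>Basis. norm (A0 b - A0 b))) F"
    unfolding \<delta>_def by (intro tendsto_intros assms)
  then have "(\<delta> \<longlongrightarrow> 0) F" by simp
  then have ev: "\<forall>\<^sub>F h in F. \<delta> h < c / 2" using c(1) order_tendstoD(2)[of \<delta> 0 F "c / 2"] by simp
  have bd: "norm (A h v - A0 v) \<le> \<delta> h * norm v" for h v
  proof -
    have "A h v - A0 v = (\<Sum>b\<in>Basis. (v \<bullet> b) *\<^sub>R (A h b - A0 b))"
      by (simp add: linear_componentwise_sum[OF assms(1), of v]
          linear_componentwise_sum[OF assms(3), of h v] scaleR_diff_right sum_subtractf)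
    also have "norm \<dots> \<le> (\<Sum>b\<in>Basis. norm v * norm (A h b - A0 b))"
      by (intro order_trans[OF norm_sum] sum_mono) (simp add: Basis_le_norm mult_right_mono)
    finally show ?thesis by (simp add: \<delta>_def sum_distrib_left mult.commute)
  qed
  have "((\<lambda>h. norm (A h (w h) - A h w0) * (2 / c)) \<longlongrightarrow> norm (A0 w0 - A0 w0) * (2 / c)) F"
    by (intro tendsto_intros assms)
  then have lim: "((\<lambda>h. norm (A h (w h) - A h w0) * (2 / c)) \<longlongrightarrow> 0) F" by simp
  have "\<forall>\<^sub>F h in F. norm (w h - w0) \<le> norm (A h (w h) - A h w0) * (2 / c)"
    using ev
  proof eventually_elim
    case (elim h)
    have "c * norm (w h - w0) \<le> norm (A0 (w h - w0))" by (rule c)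
    also have "\<dots> \<le> norm (A h (w h - w0)) + \<delta> h * norm (w h - w0)"
      using bd[of h "w h - w0"] norm_triangle_sub[of "A0 (w h - w0)" "A h (w h - w0)"]
      by (simp add: norm_minus_commute)
    also have "\<dots> \<le> norm (A h (w h) - A h w0) + c / 2 * norm (w h - w0)"
      using mult_right_mono[of "\<delta> h" "c / 2" "norm (w h - w0)"] elim
      by (simp add: linear_diff[OF assms(3)])
    finally show ?case using c(1) by (simp add: field_simps)
  qed
  then have "((\<lambda>h. w h - w0) \<longlongrightarrow> 0) F" by (rule Lim_null_comparison[OF _ lim])
  then show ?thesis by (simp add: LIM_zero_iff)
qed

text \<open>Implicit differentiation of \<open>A w = \<beta>\<close>: the derivative solves a system
  with the same \<open>A\<close> and right side \<open>d\<beta> - dA w\<close>, so the induction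
  applies to it. That it exists follows from the difference quotients, which solve such a system
  with \<open>A\<close> taken at the displaced point. Inverse maps and \<open>sharp\<close> get
  their regularity from here.\<close>

lemma Ck_on_solve:
  fixes A :: "'z::euclidean_space \<Rightarrow> 'e::euclidean_space \<Rightarrow> 'e"
  assumes "open S" "\<And>z. z \<in> S \<Longrightarrow> linear (A z)" "\<And>z. z \<in> S \<Longrightarrow> inj (A z)"
    and "\<And>v. Ck_on k S (\<lambda>z. A z v)" "Ck_on k S (\<lambda>z. A z (w z))"
  shows "Ck_on k S w"
  using assms(4,5)
proof (induction k arbitrary: w)
  case 0
  have "isCont w z" if "z \<in> S" for z
  proof -
    have "\<forall>\<^sub>F h in at z. h \<in> S" using that \<open>open S\<close> eventually_at_topological by blast
    \<comment> \<open>\<open>tendsto_solve\<close> wants linear maps for all \<open>h\<close>, so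
      outside of \<open>S\<close> the map is replaced by \<open>A z\<close>.\<close>
    define A' where "A' h = (if h \<in> S then A h else A z)" for h
    have ev: "\<forall>\<^sub>F h in at z. A h v = A' h v" for v
      using \<open>\<forall>\<^sub>F h in at z. h \<in> S\<close> by eventually_elim (simp add: A'_def)
    have lim: "((\<lambda>h. A h v) \<longlongrightarrow> A z v) (at z)" "((\<lambda>h. A h (w h)) \<longlongrightarrow> A z (w z)) (at z)" for v
      using 0 that \<open>open S\<close> by (auto simp: continuous_on_eq_continuous_at isCont_def)
    have "(w \<longlongrightarrow> w z) (at z)"
    proof (rule tendsto_solve[of "A z" A'])
      show "((\<lambda>h. A' h v) \<longlongrightarrow> A z v) (at z)" for v
        using lim(1)[of v] ev by (rule Lim_transform_eventually)
      show "((\<lambda>h. A' h (w h)) \<longlongrightarrow> A z (w z)) (at z)"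
        by (rule Lim_transform_eventually[OF lim(2)])
          (use \<open>\<forall>\<^sub>F h in at z. h \<in> S\<close> in \<open>eventually_elim, simp add: A'_def\<close>)
    qed (use assms that in \<open>auto simp: A'_def\<close>)
    then show ?thesis by (simp add: isCont_def)
  qed
  then show ?case by (simp add: continuous_at_imp_continuous_on)
next
  case (Suc k)
  let ?\<beta> = "\<lambda>z. A z (w z)"
  have wk: "Ck_on k S w"
    by (rule Suc.IH) (use Suc.prems Ck_on_Suc_imp in blast)+
  define dA where "dA = (\<lambda>z v e. frechet_derivative (\<lambda>z. A z v) (at z) e)"
  define d\<beta> where "d\<beta> = (\<lambda>z e. frechet_derivative ?\<beta> (at z) e)"
  define w' where "w' = (\<lambda>e z. inv (A z) (d\<beta> z e - (\<Sum>b\<in>Basis. (w z \<bullet> b) *\<^sub>R dA z b e)))"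
  have surj: "surj (A z)" if "z \<in> S" for z
    using assms(2,3)[OF that] linear_inj_imp_surj by blast
  have Aw': "A z (w' e z) = d\<beta> z e - (\<Sum>b\<in>Basis. (w z \<bullet> b) *\<^sub>R dA z b e)" if "z \<in> S" for z e
    unfolding w'_def using surj_f_inv_f[OF surj[OF that]] by blast
  have w'k: "Ck_on k S (w' e)" for e
  proof (rule Suc.IH)
    show "Ck_on k S (\<lambda>z. A z v)" for v using Suc.prems Ck_on_Suc_imp by blast
    have "Ck_on k S (\<lambda>z. d\<beta> z e - (\<Sum>b\<in>Basis. (w z \<bullet> b) *\<^sub>R dA z b e))"
      unfolding d\<beta>_def dA_def using Suc.prems
      by (intro Ck_on_diff Ck_on_sum Ck_on_scaleR Ck_on_inner wk Ck_on_const \<open>open S\<close>) simp_all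
    then show "Ck_on k S (\<lambda>z. A z (w' e z))"
      by (rule Ck_on_cong[OF \<open>open S\<close>]) (simp add: Aw')
  qed
  show ?case
  proof (rule Ck_on_SucI_partials[OF \<open>open S\<close> _ w'k])
    fix e z assume "z \<in> S"
    have lin: "((\<lambda>h. z + h *\<^sub>R e) \<longlongrightarrow> z) (at 0)" by (auto intro!: tendsto_eq_intros)
    then have evS: "\<forall>\<^sub>F h in at 0. z + h *\<^sub>R e \<in> S"
      using \<open>open S\<close> \<open>z \<in> S\<close> topological_tendstoD by blast
    define A' where "A' h = (if z + h *\<^sub>R e \<in> S then A (z + h *\<^sub>R e) else A z)" for h
    define q where "q h = (w (z + h *\<^sub>R e) - w z) /\<^sub>R h" for h
    have DA: "((\<lambda>h. (A (z + h *\<^sub>R e) v - A z v) /\<^sub>R h) \<longlongrightarrow> dA z v e) (at 0)" for v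
      using has_derivative_imp_directional[OF Ck_on_SucD_derivative[OF Suc.prems(1)[of v] \<open>z \<in> S\<close>], of e]
      by (simp add: has_vector_derivative_at_0_iff dA_def)
    have DB: "((\<lambda>h. (?\<beta> (z + h *\<^sub>R e) - ?\<beta> z) /\<^sub>R h) \<longlongrightarrow> d\<beta> z e) (at 0)"
      using has_derivative_imp_directional[OF Ck_on_SucD_derivative[OF Suc.prems(2) \<open>z \<in> S\<close>], of e]
      by (simp add: has_vector_derivative_at_0_iff d\<beta>_def)
    have linA: "linear (A' h)" for h using assms(2) \<open>z \<in> S\<close> by (simp add: A'_def)
    have "(q \<longlongrightarrow> w' e z) (at 0)"
    proof (rule tendsto_solve[OF assms(2,3)[OF \<open>z \<in> S\<close>] linA])
      show "((\<lambda>h. A' h v) \<longlongrightarrow> A z v) (at 0)" for v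
      proof (rule Lim_transform_eventually)
        show "((\<lambda>h. A (z + h *\<^sub>R e) v) \<longlongrightarrow> A z v) (at 0)"
          using Ck_on_imp_continuous_on[OF Suc.prems(1)[of v]] \<open>z \<in> S\<close> \<open>open S\<close> lin
          by (auto simp: continuous_on_eq_continuous_at intro: isCont_tendsto_compose)
        show "\<forall>\<^sub>F h in at 0. A (z + h *\<^sub>R e) v = A' h v"
          using evS by eventually_elim (simp add: A'_def)
      qed
      \<comment> \<open>Subtracting the equations at \<open>z + h e\<close> and at \<open>z\<close>
        and dividing by \<open>h\<close> gives the system for \<open>q h\<close>, whose right side
        converges.\<close>
      have "((\<lambda>h. (?\<beta> (z + h *\<^sub>R e) - ?\<beta> z) /\<^sub>R h
          - (\<Sum>b\<in>Basis. (w z \<bullet> b) *\<^sub>R ((A (z + h *\<^sub>R e) b - A z b) /\<^sub>R h))) \<longlongrightarrow> A z (w' e z)) (at 0)"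
        unfolding Aw'[OF \<open>z \<in> S\<close>] by (intro tendsto_intros DA DB)
      moreover have "\<forall>\<^sub>F h in at 0. (?\<beta> (z + h *\<^sub>R e) - ?\<beta> z) /\<^sub>R h
          - (\<Sum>b\<in>Basis. (w z \<bullet> b) *\<^sub>R ((A (z + h *\<^sub>R e) b - A z b) /\<^sub>R h)) = A' h (q h)"
        using evS
      proof eventually_elim
        case (elim h)
        note l = assms(2)[OF elim] and l0 = assms(2)[OF \<open>z \<in> S\<close>]
        have "(\<Sum>b\<in>Basis. (w z \<bullet> b) *\<^sub>R ((A (z + h *\<^sub>R e) b - A z b) /\<^sub>R h)) =
            ((\<Sum>b\<in>Basis. (w z \<bullet> b) *\<^sub>R A (z + h *\<^sub>R e) b) - (\<Sum>b\<in>Basis. (w z \<bullet> b) *\<^sub>R A z b)) /\<^sub>R h"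
          by (simp add: scaleR_sum_right sum_subtractf scaleR_diff_right mult.commute)
        also have "\<dots> = (A (z + h *\<^sub>R e) (w z) - A z (w z)) /\<^sub>R h"
          by (simp add: linear_componentwise_sum[OF l, of "w z"] linear_componentwise_sum[OF l0, of "w z"])
        finally show ?case
          using elim by (simp add: A'_def q_def linear_scale[OF l] linear_diff[OF l] scaleR_diff_right)
      qed
      ultimately show "((\<lambda>h. A' h (q h)) \<longlongrightarrow> A z (w' e z)) (at 0)"
        by (rule Lim_transform_eventually)
    qed
    show "((\<lambda>h. w (z + h *\<^sub>R e)) has_vector_derivative w' e z) (at 0)"
      using \<open>(q \<longlongrightarrow> w' e z) (at 0)\<close> unfolding q_def by (simp add: has_vector_derivative_at_0_iff)
  qed
qed

text \<open>The derivative of \<open>g\<close> at \<open>y\<close> is the inverse of that of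
  \<open>f\<close> at \<open>g y\<close>, hence solves a linear system whose coefficients are as
  smooth as \<open>g\<close>, up to the order of \<open>Df\<close>. So \<open>g\<close> gains one
  order at a time until it reaches that of \<open>f\<close>.\<close>

lemma Ck_on_inverse:
  fixes f :: "'e::euclidean_space \<Rightarrow> 'e"
  assumes "open S" "open T" "Ck_on (Suc k) S f" "continuous_on T g"
    and gS: "\<And>y. y \<in> T \<Longrightarrow> g y \<in> S" and fg: "\<And>y. y \<in> T \<Longrightarrow> f (g y) = y"
    and inj: "\<And>x. x \<in> S \<Longrightarrow> inj (frechet_derivative f (at x))"
  shows "Ck_on (Suc k) T g"
proof -
  define A where "A = (\<lambda>y. frechet_derivative f (at (g y)))"
  have Df: "(f has_derivative A y) (at (g y))" if "y \<in> T" for y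
    using Ck_on_SucD_derivative[OF assms(3) gS[OF that]] by (simp add: A_def)
  have lin: "linear (A y)" if "y \<in> T" for y using Df[OF that] has_derivative_linear by blast
  have injA: "inj (A y)" if "y \<in> T" for y using inj gS[OF that] by (simp add: A_def)
  have Dg: "(g has_derivative inv (A y)) (at y)" if "y \<in> T" for y
  proof (rule has_derivative_inverse_basic[OF Df[OF that] _ _ _ \<open>open T\<close> that fg])
    have "linear (inv (A y))"
      using lin[OF that] injA[OF that]
      by (metis inj_linear_imp_inv_linear)
    then show "bounded_linear (inv (A y))" by (simp add: linear_conv_bounded_linear)
    show "inv (A y) \<circ> A y = id" using injA[OF that] by simp
    show "continuous (at y) g" using assms(2,4) that continuous_on_eq_continuous_at by blast
  qed
  have "Ck_on j T g" if "j \<le> Suc k" for j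
    using that
  proof (induction j)
    case 0
    then show ?case using assms by simp
  next
    case (Suc j)
    then have gj: "Ck_on j T g" by simp
    show ?case
    proof (rule Ck_on_SucI[OF \<open>open T\<close> Dg])
      fix v
      show "Ck_on j T (\<lambda>y. inv (A y) v)"
      proof (rule Ck_on_solve[OF \<open>open T\<close> lin injA])
        show "Ck_on j T (\<lambda>y. A y v)" for v
          unfolding A_def
        proof (rule Ck_on_compose[OF \<open>open T\<close> \<open>open S\<close> gj _ gS])
          show "Ck_on j S (\<lambda>x. frechet_derivative f (at x) v)"
            using assms(3) Suc.prems by (intro Ck_on_mono[of k _ _ j]) auto
        qed
        have "A y (inv (A y) v) = v" if "y \<in> T" for y
          using linear_inj_imp_surj[OF lin[OF that] injA[OF that]] by (simp add: surj_f_inv_f)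
        then show "Ck_on j T (\<lambda>y. A y (inv (A y) v))"
          by (intro Ck_on_cong[OF \<open>open T\<close> Ck_on_const[of _ _ v]]) simp
      qed
    qed
  qed
  then show ?thesis by blast
qed

section \<open>Ordinary differential equations depending on parameters\<close>

text \<open>The integral over \<open>[0, t]\<close> is written over the fixed interval
  \<open>[0, 1]\<close>: one formula covers both signs of \<open>t\<close>, and continuity in
  \<open>t\<close> becomes continuity of an integral in a parameter.\<close>

lemma integral_rescaled:
  fixes g :: "real \<Rightarrow> 'a::banach"
  assumes "continuous_on UNIV g"
  shows "((\<lambda>t. t *\<^sub>R integral {0..1} (\<lambda>\<sigma>. g (t * \<sigma>))) has_vector_derivative g t) (at t)"
proof -
  define R where "R = \<bar>t\<bar> + 1"
  define G where "G = (\<lambda>s. integral {-R..s} g)"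
  have G: "(G has_vector_derivative g s) (at s)" if "\<bar>s\<bar> < R" for s
  proof -
    have "(G has_vector_derivative g s) (at s within {-R..R})"
      unfolding G_def using that
      by (intro integral_has_vector_derivative continuous_on_subset[OF assms]) auto
    moreover have "s \<in> interior {-R..R}" using that by auto
    ultimately show ?thesis by (simp only: at_within_interior)
  qed
  have *: "s *\<^sub>R integral {0..1} (\<lambda>\<sigma>. g (s * \<sigma>)) = G s - G 0" if "\<bar>s\<bar> < R" for s
  proof -
    have "((\<lambda>\<sigma>. s *\<^sub>R g (s * \<sigma>)) has_integral G (s * 1) - G (s * 0)) {0..1}"
    proof (rule fundamental_theorem_of_calculus)
      fix \<sigma> :: real assume \<sigma>: "\<sigma> \<in> {0..1}"
      then have "\<bar>s * \<sigma>\<bar> \<le> \<bar>s\<bar>" by (simp add: abs_mult mult_left_le)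
      then have "\<bar>s * \<sigma>\<bar> < R" using that by linarith
      note GD = has_vector_derivative_at_within[OF G[OF this]]
      have "((\<lambda>\<sigma>. s * \<sigma>) has_vector_derivative s) (at \<sigma> within {0..1})"
        by (auto intro!: derivative_eq_intros)
      from vector_diff_chain_within[OF this GD]
      show "((\<lambda>\<sigma>. G (s * \<sigma>)) has_vector_derivative s *\<^sub>R g (s * \<sigma>)) (at \<sigma> within {0..1})"
        by (simp add: o_def)
    qed simp
    from integral_unique[OF this] show ?thesis by simp
  qed
  have "((\<lambda>s. G s - G 0) has_vector_derivative g t) (at t)"
    using G[of t] by (auto simp: R_def intro!: derivative_eq_intros)
  then show ?thesis
    by (rule has_vector_derivative_transform_within_open[of _ _ _ "{-R<..<R}"]) (auto simp: * R_def)
qed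

lemma continuous_on_rescaled_integral:
  fixes h :: "'x::topological_space \<times> real \<Rightarrow> 'a::banach"
  assumes "continuous_on (U \<times> {0..1}) h"
  shows "continuous_on U (\<lambda>x. integral {0..1} (\<lambda>\<sigma>. h (x, \<sigma>)))"
  using integral_continuous_on_param[of U 0 1 "\<lambda>x \<sigma>. h (x, \<sigma>)"] assms by (simp add: case_prod_unfold)

lemma norm_integral_unit_le:
  fixes g :: "real \<Rightarrow> 'a::euclidean_space"
  assumes "continuous_on {0..1} g" "\<And>\<sigma>. \<sigma> \<in> {0..1} \<Longrightarrow> norm (g \<sigma>) \<le> B"
  shows "norm (integral {0..1} g) \<le> B"
  using integral_bound[of 0 1 g B] assms by simp

lemma ode_param_exists:
  fixes F :: "real \<times> 'p::metric_space \<times> 'a::euclidean_space \<Rightarrow> 'a"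
  assumes contF: "continuous_on UNIV F"
    and lip: "\<And>s p y z. norm (F (s, p, y) - F (s, p, z)) \<le> L * norm (y - z)"
    and bdd: "\<And>s p. norm (F (s, p, 0)) \<le> B"
    and \<epsilon>: "\<epsilon> > 0" "\<epsilon> * L \<le> 1 / 2"
  obtains w where "continuous_on UNIV w" "\<And>p. w (0, p) = 0"
    "\<And>t p. \<bar>t\<bar> < \<epsilon> \<Longrightarrow> ((\<lambda>t. w (t, p)) has_vector_derivative F (t, p, w (t, p))) (at t)"
proof -
  \<comment> \<open>Time is clamped to \<open>[-\<epsilon>, \<epsilon>]\<close>, which lets the
    integral operator act on functions defined for all times; inside the interval nothing
    changes.\<close>
  define c where "c = (\<lambda>t. max (-\<epsilon>) (min \<epsilon> t))"
  have c: "\<bar>c t\<bar> \<le> \<epsilon>" for t using \<epsilon> by (auto simp: c_def)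
  have contc: "continuous_on UNIV c" unfolding c_def by (intro continuous_intros)
  \<comment> \<open>Applied to a unit vector and \<open>0\<close>, the Lipschitz condition forces a
    nonnegative constant.\<close>
  have L0: "L \<ge> 0"
    using order_trans[OF norm_ge_zero lip[of undefined undefined "SOME b. b \<in> Basis" 0]]
    by (simp add: SOME_Basis)
  define g where "g = (\<lambda>w t p \<sigma>. F (c t * \<sigma>, p, w (c t * \<sigma>, p)))"
  define Q where "Q = (\<lambda>w (t, p). c t *\<^sub>R integral {0..1} (g w t p))"
  have contg: "continuous_on UNIV (\<lambda>((t, p), \<sigma>). g w t p \<sigma>)" if "continuous_on UNIV w" for w
    unfolding g_def case_prod_unfold
    by (intro continuous_on_compose2[OF contF] continuous_on_compose2[OF that]
        continuous_on_compose2[OF contc] continuous_intros) auto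
  have contg1: "continuous_on {0..1} (g w t p)" if "continuous_on UNIV w" for w t p
  proof -
    have "continuous_on {0..1} (\<lambda>\<sigma>::real. ((t, p), \<sigma>))" by (intro continuous_intros)
    from continuous_on_compose2[OF contg[OF that] this] show ?thesis by simp
  qed
  have contQ: "continuous_on UNIV (Q w)" if "continuous_on UNIV w" for w
  proof -
    have "continuous_on UNIV (\<lambda>x. integral {0..1} (\<lambda>\<sigma>. (\<lambda>((t, p), \<sigma>). g w t p \<sigma>) (x, \<sigma>)))"
      by (rule continuous_on_rescaled_integral) (rule continuous_on_subset[OF contg[OF that]], simp)
    then show ?thesis
      unfolding Q_def case_prod_unfold
      by (intro continuous_intros continuous_on_compose2[OF contc]) auto
  qed
  have Fb: "norm (F (s, p, y)) \<le> B + L * norm y" for s p y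
    using norm_triangle_sub[of "F (s, p, y)" "F (s, p, 0)"] lip[of s p y 0] bdd[of s p] by simp
  have bQ: "norm (Q w x) \<le> \<epsilon> * (B + L * W)" if "continuous_on UNIV w" "\<And>x. norm (w x) \<le> W" for w W x
  proof (cases x)
    case (Pair t p)
    have "norm (integral {0..1} (g w t p)) \<le> B + L * W"
    proof (rule norm_integral_unit_le[OF contg1[OF that(1)]])
      show "norm (g w t p \<sigma>) \<le> B + L * W" for \<sigma>
        unfolding g_def using Fb[of _ _ "w (c t * \<sigma>, p)"] that(2)[of "(c t * \<sigma>, p)"] L0
        by (smt (verit, best) mult_left_mono)
    qed
    then show ?thesis
      using mult_mono[OF c[of t] _ _ norm_ge_zero] \<epsilon>(1) by (fastforce simp: Q_def Pair)
  qed
  \<comment> \<open>Contraction: one integration over a time of at most \<epsilon> costs the factor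
    \<open>\<epsilon> * L\<close>.\<close>
  have lQ: "norm (Q v x - Q w x) \<le> 1 / 2 * D"
    if "continuous_on UNIV v" "continuous_on UNIV w" "\<And>x. norm (v x - w x) \<le> D" for v w D x
  proof (cases x)
    case (Pair t p)
    have "integral {0..1} (g v t p) - integral {0..1} (g w t p) = integral {0..1} (\<lambda>\<sigma>. g v t p \<sigma> - g w t p \<sigma>)"
      by (rule integral_diff[symmetric]) (intro integrable_continuous_interval contg1 that)+
    moreover have "norm (integral {0..1} (\<lambda>\<sigma>. g v t p \<sigma> - g w t p \<sigma>)) \<le> L * D"
    proof (rule norm_integral_unit_le)
      show "norm (g v t p \<sigma> - g w t p \<sigma>) \<le> L * D" for \<sigma>
        unfolding g_def using lip order_trans mult_left_mono[OF that(3) L0] by blast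
    qed (intro continuous_intros contg1 that)
    ultimately have "norm (Q v x - Q w x) \<le> \<epsilon> * (L * D)"
      using mult_mono[OF c[of t] _ _ norm_ge_zero] \<epsilon>(1)
      by (fastforce simp: Q_def Pair scaleR_diff_right[symmetric])
    moreover have "D \<ge> 0" using order_trans[OF norm_ge_zero that(3)] by blast
    ultimately show ?thesis
      using mult_right_mono[OF \<epsilon>(2), of D] by (simp add: mult.assoc)
  qed
  define P where "P = (\<lambda>w. Bcontfun (Q (apply_bcontfun w)))"
  have PQ: "apply_bcontfun (P w) = Q (apply_bcontfun w)" for w :: "(real \<times> 'p) \<Rightarrow>\<^sub>C 'a"
  proof -
    obtain W where "\<And>x. norm (apply_bcontfun w x) \<le> W"
      using bounded_apply_bcontfun[of w] by (auto simp: bounded_iff)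
    then have "Q (apply_bcontfun w) \<in> bcontfun"
      by (intro bcontfun_normI[OF contQ bQ]) auto
    then show ?thesis by (simp add: P_def Bcontfun_inverse)
  qed
  have "\<exists>!w. P w = w"
  proof (rule banach_fix_type[of "1 / 2"])
    show "\<forall>v w. dist (P v) (P w) \<le> 1 / 2 * dist v w"
    proof (intro allI dist_bound)
      fix v w :: "(real \<times> 'p) \<Rightarrow>\<^sub>C 'a" and x
      show "dist (apply_bcontfun (P v) x) (apply_bcontfun (P w) x) \<le> 1 / 2 * dist v w"
        unfolding PQ dist_norm[of "Q _ _"]
        by (rule lQ) (auto simp: dist_norm[symmetric] dist_bounded)
    qed
  qed auto
  then obtain w where w: "apply_bcontfun w = Q (apply_bcontfun w)" using PQ by metis
  show thesis
  proof
    show "continuous_on UNIV (apply_bcontfun w)" by simp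
    show "apply_bcontfun w (0, p) = 0" for p
      by (subst w) (simp add: Q_def c_def \<epsilon>(1) less_imp_le)
    fix t :: real and p assume t: "\<bar>t\<bar> < \<epsilon>"
    let ?g = "\<lambda>s. F (s, p, apply_bcontfun w (s, p))"
    have "continuous_on UNIV ?g"
      by (intro continuous_on_compose2[OF contF] continuous_on_compose2[OF continuous_on_apply_bcontfun, of UNIV]
          continuous_intros) auto
    from integral_rescaled[OF this, of t]
    show "((\<lambda>t. apply_bcontfun w (t, p)) has_vector_derivative ?g t) (at t)"
    proof (rule has_vector_derivative_transform_within_open[of _ _ _ "{-\<epsilon><..<\<epsilon>}"])
      fix s assume "s \<in> {-\<epsilon><..<\<epsilon>}"
      then have "c s = s" by (simp add: c_def)
      then show "s *\<^sub>R integral {0..1} (\<lambda>\<sigma>. ?g (s * \<sigma>)) = apply_bcontfun w (s, p)"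
        by (subst (2) w) (simp add: Q_def g_def)
    qed (use t in auto)
  qed
qed

text \<open>At a point where \<open>norm D\<close> is maximal on the closed ball around
  \<open>t0\<close> with radius \<open>\<bar>t - t0\<bar>\<close>, the mean value inequality bounds
  the maximum by half of itself. Shortness of the interval takes the place of an exponential
  estimate.\<close>

lemma ode_short_unique:
  fixes D :: "real \<Rightarrow> 'a::real_normed_vector"
  assumes D: "\<And>t. \<bar>t - t0\<bar> < \<epsilon> \<Longrightarrow> (D has_vector_derivative D' t) (at t)"
    and bd: "\<And>t. \<bar>t - t0\<bar> < \<epsilon> \<Longrightarrow> norm (D' t) \<le> L * norm (D t)"
    and \<epsilon>: "\<epsilon> * L \<le> 1 / 2" "L \<ge> 0" and "D t0 = 0" and t: "\<bar>t - t0\<bar> < \<epsilon>"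
  shows "D t = 0"
proof -
  define I where "I = cball t0 \<bar>t - t0\<bar>"
  have I: "\<bar>s - t0\<bar> < \<epsilon>" if "s \<in> I" for s
    using that t by (simp add: I_def dist_real_def)
  have "continuous_on I D"
    using D I by (auto intro!: continuous_at_imp_continuous_on has_vector_derivative_continuous)
  then have "continuous_on I (\<lambda>s. norm (D s))" by (intro continuous_intros)
  from continuous_attains_sup[OF _ _ this] obtain m where m: "m \<in> I" "\<And>s. s \<in> I \<Longrightarrow> norm (D s) \<le> norm (D m)"
    unfolding I_def by (auto simp: compact_cball)
  have "norm (D m - D t0) \<le> (L * norm (D m)) * norm (m - t0)"
  proof (rule differentiable_bound[of I D "\<lambda>s h. h *\<^sub>R D' s"])
    show "(D has_derivative (\<lambda>h. h *\<^sub>R D' s)) (at s within I)" if "s \<in> I" for s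
      using D[OF I[OF that]] has_derivative_at_withinI unfolding has_vector_derivative_def by blast
    show "onorm (\<lambda>h. h *\<^sub>R D' s) \<le> L * norm (D m)" if "s \<in> I" for s
    proof (rule onorm_le)
      fix h :: real
      have "norm (D' s) \<le> L * norm (D m)"
        using bd[OF I[OF that]] mult_left_mono[OF m(2)[OF that] \<epsilon>(2)] by linarith
      then show "norm (h *\<^sub>R D' s) \<le> L * norm (D m) * norm h"
        by (simp add: mult.commute mult_left_mono)
    qed
  qed (use m in \<open>auto simp: I_def\<close>)
  also have "\<dots> \<le> (L * norm (D m)) * \<epsilon>"
    using I[OF m(1)] \<epsilon>(2) by (intro mult_left_mono) auto
  also have "\<dots> \<le> 1 / 2 * norm (D m)"
    using mult_right_mono[OF \<epsilon>(1), of "norm (D m)"] by (simp add: ac_simps)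
  finally have "norm (D m) \<le> 0" using \<open>D t0 = 0\<close> by simp
  moreover have "t \<in> I" by (simp add: I_def dist_real_def)
  ultimately show ?thesis using m(2)[of t] by simp
qed


section \<open>Differentiability of solutions with respect to parameters\<close>

lemma norm_derivative_le_of_lipschitz:
  assumes D: "(F has_derivative F') (at z)" and "open S" "z \<in> S"
    and lip: "\<And>h. z + h *\<^sub>R u \<in> S \<Longrightarrow> norm (F (z + h *\<^sub>R u) - F z) \<le> L * \<bar>h\<bar>"
  shows "norm (F' u) \<le> L"
proof (rule tendsto_upperbound)
  show "((\<lambda>h. norm ((F (z + h *\<^sub>R u) - F z) /\<^sub>R h)) \<longlongrightarrow> norm (F' u)) (at 0)"
    using has_derivative_imp_directional[OF D, of u]
    by (intro tendsto_norm) (simp add: has_vector_derivative_at_0_iff)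
  have "((\<lambda>h. z + h *\<^sub>R u) \<longlongrightarrow> z) (at (0::real))" by (auto intro!: tendsto_eq_intros)
  then have "\<forall>\<^sub>F h in at 0. z + h *\<^sub>R u \<in> S"
    using \<open>open S\<close> \<open>z \<in> S\<close> topological_tendstoD by blast
  moreover have "\<forall>\<^sub>F h in at (0::real). h \<noteq> 0" by (simp add: eventually_at_filter)
  ultimately show "\<forall>\<^sub>F h in at 0. norm ((F (z + h *\<^sub>R u) - F z) /\<^sub>R h) \<le> L"
  proof eventually_elim
    case (elim h)
    have "norm ((F (z + h *\<^sub>R u) - F z) /\<^sub>R h) = norm (F (z + h *\<^sub>R u) - F z) / \<bar>h\<bar>"
      by (simp add: divide_inverse mult.commute)
    then show ?case using lip[OF elim(1)] elim(2) by (simp add: pos_divide_le_eq)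
  qed
qed simp

text \<open>Joint continuity in the point and the direction: by linearity the direction enters only
  through its coordinates.\<close>

lemma continuous_on_frechet_apply:
  fixes F :: "'b::euclidean_space \<Rightarrow> 'c::real_normed_vector"
  assumes F: "Ck_on (Suc 0) \<Omega> F" and "continuous_on S z" "continuous_on S v"
    and sub: "\<And>x. x \<in> S \<Longrightarrow> z x \<in> \<Omega>"
  shows "continuous_on S (\<lambda>x. frechet_derivative F (at (z x)) (v x))"
proof -
  have "linear (frechet_derivative F (at (z x)))" if "x \<in> S" for x
    using F sub[OF that] linear_frechet_derivative by auto
  note [simp] = linear_componentwise_sum[OF this, of _ "v _", symmetric]
  have "continuous_on S (\<lambda>x. \<Sum>b\<in>Basis. (v x \<bullet> b) *\<^sub>R frechet_derivative F (at (z x)) b)"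
  proof (intro continuous_on_sum continuous_intros assms)
    fix b :: 'b
    have "continuous_on \<Omega> (\<lambda>x. frechet_derivative F (at x) b)" using F by simp
    then show "continuous_on S (\<lambda>x. frechet_derivative F (at (z x)) b)"
      by (rule continuous_on_compose2) (use assms in auto)
  qed
  then show ?thesis by (simp cong: continuous_on_cong)
qed

lemma Ck_on_frechet_apply:
  fixes F :: "'b::euclidean_space \<Rightarrow> 'c::real_normed_vector"
  assumes F: "Ck_on (Suc k) \<Omega> F" "open \<Omega>" and S: "open S" "Ck_on k S z" "Ck_on k S v"
    and sub: "\<And>x. x \<in> S \<Longrightarrow> z x \<in> \<Omega>"
  shows "Ck_on k S (\<lambda>x. frechet_derivative F (at (z x)) (v x))"
proof -
  have "linear (frechet_derivative F (at (z x)))" if "x \<in> S" for x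
    using F sub[OF that] linear_frechet_derivative by auto
  note [simp] = linear_componentwise_sum[OF this, of _ "v _", symmetric]
  have "Ck_on k S (\<lambda>x. \<Sum>b\<in>Basis. (v x \<bullet> b) *\<^sub>R frechet_derivative F (at (z x)) b)"
  proof (intro Ck_on_sum Ck_on_scaleR Ck_on_inner Ck_on_const S)
    fix b :: 'b
    have "Ck_on k \<Omega> (\<lambda>x. frechet_derivative F (at x) b)" using F by simp
    then show "Ck_on k S (\<lambda>x. frechet_derivative F (at (z x)) b)"
      by (rule Ck_on_compose[OF S(1) F(2) S(2)]) (use sub in auto)
  qed
  then show ?thesis by (rule Ck_on_cong[OF S(1)]) simp
qed

text \<open>
  The difference quotients in direction \<open>v\<close> solve a linear equation whose coefficients are averages
  of the derivative of \<open>F\<close> over segments. These depend continuously on the step \<open>h\<close>, up to and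
  including \<open>h = 0\<close>, and so does the solution.
\<close>

lemma ode_param_directional_local:
  fixes F :: "real \<times> 'p::euclidean_space \<times> 'a::euclidean_space \<Rightarrow> 'a" and y :: "real \<times> 'p \<Rightarrow> 'a"
  assumes \<Omega>: "open \<Omega>" "convex \<Omega>" and "open P" and F: "Ck_on (Suc 0) \<Omega> F"
    and lip: "\<And>s p w z. (s, p, w) \<in> \<Omega> \<Longrightarrow> (s, p, z) \<in> \<Omega> \<Longrightarrow>
      norm (F (s, p, w) - F (s, p, z)) \<le> L * norm (w - z)"
    and \<epsilon>: "\<epsilon> > 0" "\<epsilon> * L \<le> 1 / 2" "L \<ge> 0"
    and conty: "continuous_on ({-\<epsilon><..<\<epsilon>} \<times> P) y" and y0: "\<And>p. p \<in> P \<Longrightarrow> y (0, p) = 0"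
    and iny: "\<And>t p. \<bar>t\<bar> < \<epsilon> \<Longrightarrow> p \<in> P \<Longrightarrow> (t, p, y (t, p)) \<in> \<Omega>"
    and ode: "\<And>t p. \<bar>t\<bar> < \<epsilon> \<Longrightarrow> p \<in> P \<Longrightarrow>
      ((\<lambda>t. y (t, p)) has_vector_derivative F (t, p, y (t, p))) (at t)"
    and t1: "\<bar>t1\<bar> < \<epsilon>" and p1: "p1 \<in> P"
  obtains \<rho> \<epsilon>' Q where "\<rho> > 0" "\<bar>t1\<bar> < \<epsilon>'" "\<epsilon>' < \<epsilon>" "ball p1 \<rho> \<subseteq> P"
    "continuous_on UNIV (Q :: real \<times> 'p \<Rightarrow> 'a)" "\<And>p. Q (0, p) = 0"
    "\<And>t p. \<bar>t\<bar> < \<epsilon>' \<Longrightarrow> p \<in> ball p1 \<rho> \<Longrightarrow>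
      ((\<lambda>h. y (t, p + h *\<^sub>R v)) has_vector_derivative Q (t, p)) (at 0)"
    "\<And>t p. \<bar>t\<bar> < \<epsilon>' \<Longrightarrow> p \<in> ball p1 \<rho> \<Longrightarrow> ((\<lambda>t. Q (t, p)) has_vector_derivative
      frechet_derivative F (at (t, p, y (t, p))) (0, v, Q (t, p))) (at t)"
proof -
  let ?DF = "\<lambda>z. frechet_derivative F (at z)"
  obtain r where r: "r > 0" "ball p1 r \<subseteq> P" using \<open>open P\<close> p1 open_contains_ball by metis
  \<comment> \<open>Small enough that \<open>p + h v\<close> stays in \<open>P\<close> for all
    \<open>p\<close> within \<rho> of \<open>p1\<close> and all \<open>h\<close> of size up to
    \<rho>.\<close>
  define \<rho> where "\<rho> = r / (2 * (1 + norm v))"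
  have nv: "1 + norm v > 0" using norm_ge_zero[of v] by linarith
  have \<rho>: "\<rho> > 0" "\<rho> * (1 + norm v) < r" using r nv mult_pos_pos[OF r(1) nv]
    by (simp_all add: \<rho>_def divide_simps)
  have inP: "p + h *\<^sub>R v \<in> P" if "p \<in> cball p1 \<rho>" "\<bar>h\<bar> \<le> \<rho>" for p h
  proof -
    have "norm ((p - p1) + h *\<^sub>R v) \<le> \<rho> + \<rho> * norm v"
      using that by (intro order_trans[OF norm_triangle_ineq] add_mono)
        (auto simp: dist_norm norm_minus_commute mult_right_mono)
    then have "p + h *\<^sub>R v \<in> ball p1 r"
      using \<rho>(2) by (simp add: dist_norm norm_minus_commute algebra_simps)
    then show ?thesis using r by blast
  qed
  \<comment> \<open>Strictly between \<open>\<bar>t1\<bar>\<close> and \<epsilon>: the closed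
    interval is compact, which bounds the coefficients, and has \<open>t1\<close> in its
    interior.\<close>
  define \<epsilon>' where "\<epsilon>' = (\<bar>t1\<bar> + \<epsilon>) / 2"
  have \<epsilon>': "\<bar>t1\<bar> < \<epsilon>'" "\<epsilon>' < \<epsilon>" "\<epsilon>' > 0" using t1 by (auto simp: \<epsilon>'_def)
  define K where "K = {-\<epsilon>'..\<epsilon>'} \<times> cball p1 \<rho> \<times> {-\<rho>..\<rho>}"
  have K: "compact K" "convex K" "closed K" "K \<noteq> {}"
    using \<rho> \<epsilon>' unfolding K_def
    by (auto intro!: compact_Times convex_Times closed_Times)
  \<comment> \<open>Projection onto the compact convex set \<open>K\<close> extends the coefficients
    continuously to all times, points and steps, as \<open>ode_param_exists\<close>
    requires.\<close>
  define \<pi> where "\<pi> = closest_point K"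
  have \<pi>: "\<pi> k \<in> K" "continuous_on S \<pi>" "k \<in> K \<Longrightarrow> \<pi> k = k" for k S
    unfolding \<pi>_def
    by (fact closest_point_in_set[OF K(3,4)], fact continuous_on_closest_point[OF K(2,3,4)],
        fact closest_point_self)
  \<comment> \<open>The segment between the solutions for \<open>p\<close> and for
    \<open>p + h v\<close>, parametrized by \<sigma>; it stays in \<Omega> by convexity. At
    \<open>h = 0\<close> it shrinks to a point, and the averaged equation becomes the equation of
    first variation.\<close>
  define \<zeta> where "\<zeta> = (\<lambda>(s, p, h) \<sigma>. (s, p + (\<sigma> * h) *\<^sub>R v, y (s, p) + \<sigma> *\<^sub>R (y (s, p + h *\<^sub>R v) - y (s, p))))"
  have Kin: "\<bar>s\<bar> < \<epsilon>" "p \<in> P" "p + h *\<^sub>R v \<in> P" if "(s, p, h) \<in> K" for s p h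
    using that \<epsilon>' \<rho>(1) inP[of p 0] inP[of p h] by (auto simp: K_def)
  have KinS: "- \<epsilon> < fst k \<and> fst k < \<epsilon> \<and> fst (snd k) \<in> P \<and> fst (snd k) + snd (snd k) *\<^sub>R v \<in> P"
    if "k \<in> K" for k
    using Kin[of "fst k" "fst (snd k)" "snd (snd k)"] that by (auto simp: abs_less_iff)
  have \<zeta>\<Omega>: "\<zeta> k \<sigma> \<in> \<Omega>" if "k \<in> K" "\<sigma> \<in> {0..1}" for k \<sigma>
  proof (cases k)
    case (fields s p h)
    have "(1 - \<sigma>) *\<^sub>R (s, p, y (s, p)) + \<sigma> *\<^sub>R (s, p + h *\<^sub>R v, y (s, p + h *\<^sub>R v)) \<in> \<Omega>"
      using that Kin[of s p h] fields by (intro convexD[OF \<Omega>(2)] iny) auto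
    then show ?thesis by (simp add: \<zeta>_def fields algebra_simps)
  qed
  have cont\<zeta>: "continuous_on (K \<times> {0..1}) (\<lambda>(k, \<sigma>). \<zeta> k \<sigma>)"
    unfolding \<zeta>_def case_prod_unfold
    by (intro continuous_intros continuous_on_compose2[OF conty]) (use KinS in auto)
  define J where "J = (\<lambda>k w. integral {0..1} (\<lambda>\<sigma>. ?DF (\<zeta> k \<sigma>) (0, v, w)))"
  have contJ: "continuous_on (K \<times> UNIV) (\<lambda>(k, w). J k w)"
  proof -
    have "continuous_on ((K \<times> UNIV) \<times> {0..1}) (\<lambda>x. ?DF (\<zeta> (fst (fst x)) (snd x)) (0, v, snd (fst x)))"
      by (intro continuous_on_frechet_apply[OF F] continuous_intros
          continuous_on_compose2[OF cont\<zeta>, of _ "\<lambda>x. (fst (fst x), snd x)", simplified]) (auto intro: \<zeta>\<Omega>)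
    from continuous_on_rescaled_integral[OF this] show ?thesis by (simp add: J_def case_prod_unfold)
  qed
  have cont\<sigma>: "continuous_on {0..1} (\<lambda>\<sigma>. ?DF (\<zeta> k \<sigma>) (0, v, w))" if "k \<in> K" for k w
    using that by (intro continuous_on_frechet_apply[OF F] continuous_intros
          continuous_on_compose2[OF cont\<zeta>, of _ "\<lambda>\<sigma>. (k, \<sigma>)", simplified]) (auto intro: \<zeta>\<Omega>)
  have linDF: "linear (?DF z)" if "z \<in> \<Omega>" for z using F that linear_frechet_derivative by auto
  \<comment> \<open>A Lipschitz constant bounds the derivative, so the averaged equation has the
    same constant \<open>L\<close>, and its solutions exist for times up to
    \<open>\<epsilon>'\<close>.\<close>
  have DFL: "norm (?DF z (0, 0, w)) \<le> L * norm w" if "z \<in> \<Omega>" for z w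
  proof (rule norm_derivative_le_of_lipschitz[OF Ck_on_SucD_derivative[OF F that] \<Omega>(1) that])
    fix h assume h: "z + h *\<^sub>R (0, 0, w) \<in> \<Omega>"
    obtain s p u where z: "z = (s, p, u)" by (cases z)
    have "norm (F (s, p, u + h *\<^sub>R w) - F (s, p, u)) \<le> L * norm (u + h *\<^sub>R w - u)"
      using that h by (intro lip) (simp_all add: z)
    then show "norm (F (z + h *\<^sub>R (0, 0, w)) - F z) \<le> L * norm w * \<bar>h\<bar>" by (simp add: z ac_simps)
  qed
  have Jlip: "norm (J k w - J k z) \<le> L * norm (w - z)" if "k \<in> K" for k w z
  proof -
    have "J k w - J k z = integral {0..1} (\<lambda>\<sigma>. ?DF (\<zeta> k \<sigma>) (0, v, w) - ?DF (\<zeta> k \<sigma>) (0, v, z))"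
      unfolding J_def by (rule integral_diff[symmetric]) (intro integrable_continuous_interval cont\<sigma> that)+
    also have "norm \<dots> \<le> L * norm (w - z)"
    proof (rule norm_integral_unit_le)
      fix \<sigma> :: real assume "\<sigma> \<in> {0..1}"
      from DFL[OF \<zeta>\<Omega>[OF that this], of "w - z"] linear_diff[OF linDF[OF \<zeta>\<Omega>[OF that this]], symmetric]
      show "norm (?DF (\<zeta> k \<sigma>) (0, v, w) - ?DF (\<zeta> k \<sigma>) (0, v, z)) \<le> L * norm (w - z)" by simp
    qed (intro continuous_intros cont\<sigma> that)
    finally show ?thesis .
  qed
  have "continuous_on K (\<lambda>k. J k 0)"
  proof -
    have "continuous_on K (\<lambda>k. (k, 0 :: 'a))" by (intro continuous_intros)
    from continuous_on_compose2[OF contJ this] show ?thesis by auto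
  qed
  then have "bounded ((\<lambda>k. J k 0) ` K)" using K(1) compact_continuous_image compact_imp_bounded by blast
  then obtain B where B: "\<And>k. k \<in> K \<Longrightarrow> norm (J k 0) \<le> B" by (auto simp: bounded_iff)
  define M where "M = (\<lambda>(s, ph, w). J (\<pi> (s, ph)) w)"
  have "continuous_on UNIV M"
    unfolding M_def case_prod_unfold
    by (intro continuous_on_compose2[OF contJ, of _ "\<lambda>x. (\<pi> (fst x, fst (snd x)), snd (snd x))", simplified]
        continuous_intros continuous_on_compose2[OF \<pi>(2)[of UNIV]]) (auto simp: \<pi>)
  moreover have "norm (M (s, ph, w) - M (s, ph, z)) \<le> L * norm (w - z)" for s ph w z
    unfolding M_def using Jlip[OF \<pi>(1)] by simp
  moreover have "norm (M (s, ph, 0)) \<le> B" for s ph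
    unfolding M_def using B[OF \<pi>(1)] by simp
  moreover have \<epsilon>'L: "\<epsilon>' * L \<le> 1 / 2" using \<epsilon> \<epsilon>' mult_right_mono[of \<epsilon>' \<epsilon> L] by linarith
  ultimately obtain Q where Q: "continuous_on UNIV Q" "\<And>ph. Q (0, ph) = 0"
    "\<And>t ph. \<bar>t\<bar> < \<epsilon>' \<Longrightarrow> ((\<lambda>t. Q (t, ph)) has_vector_derivative M (t, ph, Q (t, ph))) (at t)"
    using ode_param_exists[of M L B \<epsilon>'] \<epsilon>'(3) by metis
  have Meq: "M (t, (p, h), w) = J (t, p, h) w" if "\<bar>t\<bar> < \<epsilon>'" "p \<in> ball p1 \<rho>" "\<bar>h\<bar> \<le> \<rho>" for t p h w
  proof -
    have "(t, p, h) \<in> K" using that by (auto simp: K_def)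
    then show ?thesis using \<pi>(3) by (simp add: M_def)
  qed
  \<comment> \<open>For fixed \<open>p\<close> and \<open>h\<close>, both sides solve the averaged
    equation with initial value zero, so they agree by uniqueness.\<close>
  have quot: "(y (t, p + h *\<^sub>R v) - y (t, p)) /\<^sub>R h = Q (t, (p, h))"
    if t: "\<bar>t\<bar> < \<epsilon>'" and p: "p \<in> ball p1 \<rho>" and h: "h \<noteq> 0" "\<bar>h\<bar> \<le> \<rho>" for t p h
  proof -
    define q where "q = (\<lambda>t. (y (t, p + h *\<^sub>R v) - y (t, p)) /\<^sub>R h)"
    have P: "p \<in> P" "p + h *\<^sub>R v \<in> P" using inP[of p 0] inP[of p h] p h \<rho>(1) by auto
    have "q t - Q (t, (p, h)) = 0"
    proof (rule ode_short_unique[where \<epsilon> = \<epsilon>' and L = L and ?t0.0 = 0 and t = t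
          and D = "\<lambda>t. q t - Q (t, (p, h))" and D' = "\<lambda>t. J (t, p, h) (q t) - J (t, p, h) (Q (t, (p, h)))"])
      fix t assume "\<bar>t - 0\<bar> < \<epsilon>'"
      then have t': "\<bar>t\<bar> < \<epsilon>'" and t: "\<bar>t\<bar> < \<epsilon>" using \<epsilon>' by auto
      have k: "(t, p, h) \<in> K" using t' p h by (auto simp: K_def)
      have ftc: "((\<lambda>\<sigma>. ?DF (\<zeta> (t, p, h) \<sigma>) (0, h *\<^sub>R v, y (t, p + h *\<^sub>R v) - y (t, p))) has_integral
          F (\<zeta> (t, p, h) 1) - F (\<zeta> (t, p, h) 0)) {0..1}"
      proof (rule fundamental_theorem_of_calculus)
        fix \<sigma> :: real assume \<sigma>: "\<sigma> \<in> {0..1}"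
        have "(\<zeta> (t, p, h) has_vector_derivative (0, h *\<^sub>R v, y (t, p + h *\<^sub>R v) - y (t, p))) (at \<sigma> within {0..1})"
          unfolding \<zeta>_def has_vector_derivative_def
          by (auto intro!: derivative_eq_intros simp: algebra_simps)
        from vector_derivative_diff_chain_within[OF this
            has_derivative_at_withinI[OF Ck_on_SucD_derivative[OF F \<zeta>\<Omega>[OF k \<sigma>]]]]
        show "((\<lambda>\<sigma>. F (\<zeta> (t, p, h) \<sigma>)) has_vector_derivative
          ?DF (\<zeta> (t, p, h) \<sigma>) (0, h *\<^sub>R v, y (t, p + h *\<^sub>R v) - y (t, p))) (at \<sigma> within {0..1})"
          by (simp add: o_def)
      qed simp
      have "(\<lambda>\<sigma>. ?DF (\<zeta> (t, p, h) \<sigma>) (0, v, q t)) integrable_on {0..1}"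
        by (intro integrable_continuous_interval cont\<sigma> k)
      then have int: "((\<lambda>\<sigma>. h *\<^sub>R ?DF (\<zeta> (t, p, h) \<sigma>) (0, v, q t)) has_integral h *\<^sub>R J (t, p, h) (q t)) {0..1}"
        unfolding J_def by (intro has_integral_cmul integrable_integral)
      have eq: "h *\<^sub>R ?DF (\<zeta> (t, p, h) \<sigma>) (0, v, q t) =
          ?DF (\<zeta> (t, p, h) \<sigma>) (0, h *\<^sub>R v, y (t, p + h *\<^sub>R v) - y (t, p))" if "\<sigma> \<in> {0..1}" for \<sigma>
        using linear_scale[OF linDF[OF \<zeta>\<Omega>[OF k that]], of h "(0, v, q t)"] h by (simp add: q_def)
      have "((\<lambda>\<sigma>. ?DF (\<zeta> (t, p, h) \<sigma>) (0, h *\<^sub>R v, y (t, p + h *\<^sub>R v) - y (t, p))) has_integral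
          h *\<^sub>R J (t, p, h) (q t)) {0..1}"
        by (rule has_integral_eq[OF eq int])
      with ftc have "h *\<^sub>R J (t, p, h) (q t) = F (\<zeta> (t, p, h) 1) - F (\<zeta> (t, p, h) 0)"
        by (rule has_integral_unique[rotated])
      then have "(h *\<^sub>R J (t, p, h) (q t)) /\<^sub>R h = (F (\<zeta> (t, p, h) 1) - F (\<zeta> (t, p, h) 0)) /\<^sub>R h" by simp
      then have JF: "J (t, p, h) (q t) = (F (t, p + h *\<^sub>R v, y (t, p + h *\<^sub>R v)) - F (t, p, y (t, p))) /\<^sub>R h"
        using h by (simp add: \<zeta>_def)
      show "((\<lambda>t. q t - Q (t, (p, h))) has_vector_derivative J (t, p, h) (q t) - J (t, p, h) (Q (t, (p, h)))) (at t)"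
      proof (rule has_vector_derivative_diff)
        show "(q has_vector_derivative J (t, p, h) (q t)) (at t)"
          unfolding JF unfolding q_def
          by (intro has_vector_derivative_diff
              bounded_linear.has_vector_derivative[OF bounded_linear_scaleR_right] ode t P)
        show "((\<lambda>t. Q (t, (p, h))) has_vector_derivative J (t, p, h) (Q (t, (p, h)))) (at t)"
          using Q(3)[OF t', of "(p, h)"] Meq[OF t' p h(2)] by simp
      qed
      show "norm (J (t, p, h) (q t) - J (t, p, h) (Q (t, (p, h)))) \<le> L * norm (q t - Q (t, (p, h)))"
        by (rule Jlip[OF k])
    qed (use y0 P Q \<epsilon>'L \<epsilon> t in \<open>auto simp: q_def\<close>)
    then show ?thesis by (simp add: q_def)
  qed
  show thesis
  proof (rule that[of \<rho> \<epsilon>' "\<lambda>(t, p). Q (t, (p, 0))"])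
    show "continuous_on UNIV (\<lambda>(t, p). Q (t, (p, 0)))"
      unfolding case_prod_unfold by (intro continuous_on_compose2[OF Q(1)] continuous_intros) auto
    show "ball p1 \<rho> \<subseteq> P" using inP[of _ 0] \<rho>(1) by auto
    fix t p assume t: "\<bar>t\<bar> < \<epsilon>'" and p: "p \<in> ball p1 \<rho>"
    have "((\<lambda>h. Q (t, (p, h))) \<longlongrightarrow> Q (t, (p, 0))) (at 0)"
    proof -
      have "continuous_on UNIV (\<lambda>h. Q (t, (p, h)))"
        by (intro continuous_on_compose2[OF Q(1)] continuous_intros) auto
      then show ?thesis by (simp add: continuous_on_eq_continuous_at isCont_def)
    qed
    moreover have "\<forall>\<^sub>F h in at 0. Q (t, (p, h)) = (y (t, p + h *\<^sub>R v) - y (t, p)) /\<^sub>R h"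
      unfolding eventually_at using \<rho>(1) quot[OF t p] by (intro exI[of _ \<rho>]) (auto simp: dist_norm)
    ultimately have "((\<lambda>h. (y (t, p + h *\<^sub>R v) - y (t, p)) /\<^sub>R h) \<longlongrightarrow> Q (t, (p, 0))) (at 0)"
      by (rule Lim_transform_eventually)
    then show "((\<lambda>h. y (t, p + h *\<^sub>R v)) has_vector_derivative (case (t, p) of (t, p) \<Rightarrow> Q (t, (p, 0)))) (at 0)"
      by (simp add: has_vector_derivative_at_0_iff)
    have "J (t, p, 0) w = ?DF (t, p, y (t, p)) (0, v, w)" for w
      unfolding J_def \<zeta>_def by simp
    then show "((\<lambda>t. case (t, p) of (t, p) \<Rightarrow> Q (t, (p, 0))) has_vector_derivative
      ?DF (t, p, y (t, p)) (0, v, case (t, p) of (t, p) \<Rightarrow> Q (t, (p, 0)))) (at t)"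
      using Q(3)[OF t, of "(p, 0)"] Meq[OF t p, of 0] \<rho>(1) by simp
  qed (use \<rho> \<epsilon>' Q in auto)
qed

text \<open>The local pieces fit together because \<psi> is defined as the actual directional
  derivative, to which every local solution \<open>Q\<close> is equal.\<close>

lemma ode_param_directional:
  fixes F :: "real \<times> 'p::euclidean_space \<times> 'a::euclidean_space \<Rightarrow> 'a" and y :: "real \<times> 'p \<Rightarrow> 'a"
  assumes \<Omega>: "open \<Omega>" "convex \<Omega>" and "open P" and F: "Ck_on (Suc 0) \<Omega> F"
    and lip: "\<And>s p w z. (s, p, w) \<in> \<Omega> \<Longrightarrow> (s, p, z) \<in> \<Omega> \<Longrightarrow>
      norm (F (s, p, w) - F (s, p, z)) \<le> L * norm (w - z)"
    and \<epsilon>: "\<epsilon> > 0" "\<epsilon> * L \<le> 1 / 2" "L \<ge> 0"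
    and conty: "continuous_on ({-\<epsilon><..<\<epsilon>} \<times> P) y" and y0: "\<And>p. p \<in> P \<Longrightarrow> y (0, p) = 0"
    and iny: "\<And>t p. \<bar>t\<bar> < \<epsilon> \<Longrightarrow> p \<in> P \<Longrightarrow> (t, p, y (t, p)) \<in> \<Omega>"
    and ode: "\<And>t p. \<bar>t\<bar> < \<epsilon> \<Longrightarrow> p \<in> P \<Longrightarrow>
      ((\<lambda>t. y (t, p)) has_vector_derivative F (t, p, y (t, p))) (at t)"
  obtains \<psi> where "continuous_on ({-\<epsilon><..<\<epsilon>} \<times> P) (\<psi> :: real \<times> 'p \<Rightarrow> 'a)" "\<And>p. p \<in> P \<Longrightarrow> \<psi> (0, p) = 0"
    "\<And>t p. \<bar>t\<bar> < \<epsilon> \<Longrightarrow> p \<in> P \<Longrightarrow>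
      ((\<lambda>h. y (t, p + h *\<^sub>R v)) has_vector_derivative \<psi> (t, p)) (at 0)"
    "\<And>t p. \<bar>t\<bar> < \<epsilon> \<Longrightarrow> p \<in> P \<Longrightarrow> ((\<lambda>t. \<psi> (t, p)) has_vector_derivative
      frechet_derivative F (at (t, p, y (t, p))) (0, v, \<psi> (t, p))) (at t)"
proof -
  define \<psi> where "\<psi> = (\<lambda>(t, p). vector_derivative (\<lambda>h. y (t, p + h *\<^sub>R v)) (at 0))"
  have loc: "\<exists>\<rho> \<epsilon>' Q. \<rho> > 0 \<and> \<bar>t1\<bar> < \<epsilon>' \<and> \<epsilon>' < \<epsilon> \<and> continuous_on UNIV Q \<and> (\<forall>p. Q (0, p) = 0) \<and>
     (\<forall>t p. \<bar>t\<bar> < \<epsilon>' \<longrightarrow> p \<in> ball p1 \<rho> \<longrightarrow>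
       ((\<lambda>h. y (t, p + h *\<^sub>R v)) has_vector_derivative \<psi> (t, p)) (at 0) \<and> \<psi> (t, p) = Q (t, p) \<and>
       ((\<lambda>t. \<psi> (t, p)) has_vector_derivative
          frechet_derivative F (at (t, p, y (t, p))) (0, v, \<psi> (t, p))) (at t))"
    if t1: "\<bar>t1\<bar> < \<epsilon>" and p1: "p1 \<in> P" for t1 p1
  proof -
    obtain \<rho> \<epsilon>' Q where Q: "\<rho> > 0" "\<bar>t1\<bar> < \<epsilon>'" "\<epsilon>' < \<epsilon>" "continuous_on UNIV (Q :: real \<times> 'p \<Rightarrow> 'a)" "\<And>p. Q (0, p) = 0"
      "\<And>t p. \<bar>t\<bar> < \<epsilon>' \<Longrightarrow> p \<in> ball p1 \<rho> \<Longrightarrow>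
        ((\<lambda>h. y (t, p + h *\<^sub>R v)) has_vector_derivative Q (t, p)) (at 0)"
      "\<And>t p. \<bar>t\<bar> < \<epsilon>' \<Longrightarrow> p \<in> ball p1 \<rho> \<Longrightarrow> ((\<lambda>t. Q (t, p)) has_vector_derivative
        frechet_derivative F (at (t, p, y (t, p))) (0, v, Q (t, p))) (at t)"
    proof -
      show ?thesis
        by (rule ode_param_directional_local[OF assms t1 p1, of v]) (assumption | rule that)+
    qed
    have eq: "\<psi> (t, p) = Q (t, p)" if "\<bar>t\<bar> < \<epsilon>'" "p \<in> ball p1 \<rho>" for t p
      using vector_derivative_at[OF Q(6)[OF that]] by (simp add: \<psi>_def)
    have "((\<lambda>t. \<psi> (t, p)) has_vector_derivative
          frechet_derivative F (at (t, p, y (t, p))) (0, v, \<psi> (t, p))) (at t)"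
      if "\<bar>t\<bar> < \<epsilon>'" "p \<in> ball p1 \<rho>" for t p
      unfolding eq[OF that]
      by (rule has_vector_derivative_transform_within_open[OF Q(7)[OF that], of "{-\<epsilon>'<..<\<epsilon>'}"])
        (use that eq in auto)
    then show ?thesis using Q eq by (intro exI[of _ \<rho>] exI[of _ \<epsilon>'] exI[of _ Q]) auto
  qed
  show thesis
  proof
    have "isCont \<psi> x" if "x \<in> {-\<epsilon><..<\<epsilon>} \<times> P" for x
    proof -
      obtain t1 p1 where x: "x = (t1, p1)" "\<bar>t1\<bar> < \<epsilon>" "p1 \<in> P" using \<open>x \<in> _\<close> by (cases x) auto
      from loc[OF x(2,3)] obtain \<rho> \<epsilon>' Q where Q: "\<rho> > 0" "\<bar>t1\<bar> < \<epsilon>'" "continuous_on UNIV Q"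
        "\<And>t p. \<bar>t\<bar> < \<epsilon>' \<Longrightarrow> p \<in> ball p1 \<rho> \<Longrightarrow> \<psi> (t, p) = Q (t, p)" by blast
      have "x \<in> {-\<epsilon>'<..<\<epsilon>'} \<times> ball p1 \<rho>" using x Q by auto
      moreover have "continuous_on ({-\<epsilon>'<..<\<epsilon>'} \<times> ball p1 \<rho>) \<psi>"
      proof (subst continuous_on_cong[OF refl])
        show "continuous_on ({-\<epsilon>'<..<\<epsilon>'} \<times> ball p1 \<rho>) Q" using Q(3) continuous_on_subset by blast
      qed (use Q(4) in auto)
      moreover have "open ({-\<epsilon>'<..<\<epsilon>'} \<times> ball p1 \<rho>)" by (intro open_Times) auto
      ultimately show ?thesis using continuous_on_eq_continuous_at by blast
    qed
    then show "continuous_on ({-\<epsilon><..<\<epsilon>} \<times> P) \<psi>" by (simp add: continuous_at_imp_continuous_on)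
    show "\<psi> (0, p) = 0" if "p \<in> P" for p
    proof -
      from loc[OF _ that, of 0] \<epsilon>(1) obtain \<rho> \<epsilon>' Q where "\<rho> > 0" "\<bar>0 :: real\<bar> < \<epsilon>'" "\<And>p. Q (0, p) = (0 :: 'a)"
        "\<And>s q. \<bar>s\<bar> < \<epsilon>' \<Longrightarrow> q \<in> ball p \<rho> \<Longrightarrow> \<psi> (s, q) = Q (s, q)" by force
      then show ?thesis by simp
    qed
    show "((\<lambda>h. y (t, p + h *\<^sub>R v)) has_vector_derivative \<psi> (t, p)) (at 0)"
      "((\<lambda>t. \<psi> (t, p)) has_vector_derivative
         frechet_derivative F (at (t, p, y (t, p))) (0, v, \<psi> (t, p))) (at t)"
      if "\<bar>t\<bar> < \<epsilon>" "p \<in> P" for t p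
    proof -
      from loc[OF that] obtain \<rho> \<epsilon>' where "\<rho> > 0" "\<bar>t\<bar> < \<epsilon>'" and
        *: "\<And>s q. \<bar>s\<bar> < \<epsilon>' \<Longrightarrow> q \<in> ball p \<rho> \<Longrightarrow>
         ((\<lambda>h. y (s, q + h *\<^sub>R v)) has_vector_derivative \<psi> (s, q)) (at 0) \<and>
         ((\<lambda>t. \<psi> (t, q)) has_vector_derivative
            frechet_derivative F (at (s, q, y (s, q))) (0, v, \<psi> (s, q))) (at s)" by blast
      then show "((\<lambda>h. y (t, p + h *\<^sub>R v)) has_vector_derivative \<psi> (t, p)) (at 0)"
        "((\<lambda>t. \<psi> (t, p)) has_vector_derivative
           frechet_derivative F (at (t, p, y (t, p))) (0, v, \<psi> (t, p))) (at t)"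
        using *[of t p] by simp_all
    qed
  qed
qed

text \<open>Induction over \<open>m\<close>: with \<open>y\<close> of class \<open>m\<close>, the
  equation of first variation has a right side of class \<open>m\<close>, so its solution \<psi> is
  of class \<open>m\<close> by the same statement. This equation is affine in the unknown with the
  same constant \<open>L\<close>, so the time \<epsilon> does not shrink along the induction. The
  time derivative of \<open>y\<close> is the right side of its own equation.\<close>

lemma ode_param_Ck:
  fixes F :: "real \<times> 'p::euclidean_space \<times> 'a::euclidean_space \<Rightarrow> 'a" and y :: "real \<times> 'p \<Rightarrow> 'a"
  assumes "open \<Omega>" "convex \<Omega>" and P: "open P" "convex P" and "Ck_on m \<Omega> F"
    and "\<And>s p w z. (s, p, w) \<in> \<Omega> \<Longrightarrow> (s, p, z) \<in> \<Omega> \<Longrightarrow>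
      norm (F (s, p, w) - F (s, p, z)) \<le> L * norm (w - z)"
    and \<epsilon>: "\<epsilon> > 0" "\<epsilon> * L \<le> 1 / 2" "L \<ge> 0"
    and "continuous_on ({-\<epsilon><..<\<epsilon>} \<times> P) y" and "\<And>p. p \<in> P \<Longrightarrow> y (0, p) = 0"
    and "\<And>t p. \<bar>t\<bar> < \<epsilon> \<Longrightarrow> p \<in> P \<Longrightarrow> (t, p, y (t, p)) \<in> \<Omega>"
    and "\<And>t p. \<bar>t\<bar> < \<epsilon> \<Longrightarrow> p \<in> P \<Longrightarrow>
      ((\<lambda>t. y (t, p)) has_vector_derivative F (t, p, y (t, p))) (at t)"
  shows "Ck_on m ({-\<epsilon><..<\<epsilon>} \<times> P) y"
  using assms(1,2,5,6,10-)
proof (induction m arbitrary: \<Omega> F y)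
  case 0
  then show ?case by simp
next
  case (Suc m)
  let ?DF = "\<lambda>z. frechet_derivative F (at z)" and ?S = "{-\<epsilon><..<\<epsilon>} \<times> P"
  note prems = Suc.prems
  have opS: "open ?S" using P by (simp add: open_Times)
  have opS': "open ({-\<epsilon><..<\<epsilon>} \<times> P \<times> (UNIV :: 'a set))" using P by (intro open_Times) auto
  have ym: "Ck_on m ?S y"
    by (rule Suc.IH[of \<Omega> F]) (use prems Ck_on_Suc_imp[OF prems(3)] in auto)
  have F1: "Ck_on (Suc 0) \<Omega> F" using prems(3) by (rule Ck_on_mono) simp
  have linDF: "linear (?DF z)" if "z \<in> \<Omega>" for z using F1 that linear_frechet_derivative by auto
  have "\<exists>\<psi>. \<forall>v. Ck_on m ?S (\<psi> v) \<and> (\<forall>t p. \<bar>t\<bar> < \<epsilon> \<longrightarrow> p \<in> P \<longrightarrow>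
      ((\<lambda>h. y (t, p + h *\<^sub>R v)) has_vector_derivative \<psi> v (t, p)) (at 0))"
  proof (rule choice, rule allI)
    fix v :: 'p
    obtain \<psi> where \<psi>: "continuous_on ?S \<psi>" "\<And>p. p \<in> P \<Longrightarrow> \<psi> (0, p) = 0"
      "\<And>t p. \<bar>t\<bar> < \<epsilon> \<Longrightarrow> p \<in> P \<Longrightarrow> ((\<lambda>h. y (t, p + h *\<^sub>R v)) has_vector_derivative \<psi> (t, p)) (at 0)"
      "\<And>t p. \<bar>t\<bar> < \<epsilon> \<Longrightarrow> p \<in> P \<Longrightarrow>
        ((\<lambda>t. \<psi> (t, p)) has_vector_derivative ?DF (t, p, y (t, p)) (0, v, \<psi> (t, p))) (at t)"
    proof -
      show ?thesis
        by (rule ode_param_directional[OF prems(1,2) P(1) F1 prems(4) \<epsilon> prems(5-8), of v]) (assumption | rule that)+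
    qed
    \<comment> \<open>Defined for all values of the unknown, so its domain is
      \<open>{-\<epsilon><..<\<epsilon>} \<times> P \<times> UNIV\<close>, which is convex because
      \<open>P\<close> is.\<close>
    define F' where "F' = (\<lambda>(s, p, w). ?DF (s, p, y (s, p)) (0, v, w))"
    have yc: "Ck_on m ({-\<epsilon><..<\<epsilon>} \<times> P \<times> UNIV) (\<lambda>x :: real \<times> 'p \<times> 'a. y (fst x, fst (snd x)))"
      by (rule Ck_on_compose[OF opS' opS _ ym])
        (auto intro!: Ck_on_linear bounded_linear_Pair bounded_linear_fst bounded_linear_fst_comp bounded_linear_snd)
    have "Ck_on m ?S \<psi>"
    proof (rule Suc.IH[of "{-\<epsilon><..<\<epsilon>} \<times> P \<times> UNIV" F' \<psi>])
      show "Ck_on m ({-\<epsilon><..<\<epsilon>} \<times> P \<times> UNIV) F'"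
        unfolding F'_def case_prod_unfold
        by (intro Ck_on_frechet_apply[OF prems(3,1) opS'] Ck_on_Pair opS' Ck_on_const yc
            Ck_on_linear[of fst] Ck_on_linear[of "\<lambda>x. fst (snd x)"] Ck_on_linear[of "\<lambda>x. snd (snd x)"]
            bounded_linear_fst bounded_linear_snd_comp bounded_linear_fst_comp bounded_linear_snd)
          (auto intro!: prems(7))
      show "norm (F' (s, p, w) - F' (s, p, z)) \<le> L * norm (w - z)"
        if "(s, p, w) \<in> {-\<epsilon><..<\<epsilon>} \<times> P \<times> UNIV" for s p w z
      proof -
        have in\<Omega>: "(s, p, y (s, p)) \<in> \<Omega>" using that by (intro prems) auto
        have "norm (?DF (s, p, y (s, p)) (0, 0, w - z)) \<le> L * norm (w - z)"
        proof (rule norm_derivative_le_of_lipschitz[OF Ck_on_SucD_derivative[OF F1 in\<Omega>] prems(1) in\<Omega>])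
          fix h assume h: "(s, p, y (s, p)) + h *\<^sub>R (0, 0, w - z) \<in> \<Omega>"
          then have "norm (F (s, p, y (s, p) + h *\<^sub>R (w - z)) - F (s, p, y (s, p))) \<le>
              L * norm (y (s, p) + h *\<^sub>R (w - z) - y (s, p))"
            using in\<Omega> by (intro prems(4)) simp_all
          then show "norm (F ((s, p, y (s, p)) + h *\<^sub>R (0, 0, w - z)) - F (s, p, y (s, p))) \<le> L * norm (w - z) * \<bar>h\<bar>"
            by (simp add: ac_simps)
        qed
        then show ?thesis
          using linear_diff[OF linDF[OF in\<Omega>], of "(0, v, w)" "(0, v, z)"] by (simp add: F'_def)
      qed
    qed (use \<psi> P opS' in \<open>auto simp: F'_def intro!: convex_Times\<close>)
    then show "\<exists>\<psi>. Ck_on m ?S \<psi> \<and> (\<forall>t p. \<bar>t\<bar> < \<epsilon> \<longrightarrow> p \<in> P \<longrightarrow>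
      ((\<lambda>h. y (t, p + h *\<^sub>R v)) has_vector_derivative \<psi> (t, p)) (at 0))" using \<psi>(3) by blast
  qed
  then obtain \<psi> where \<psi>: "\<And>v. Ck_on m ?S (\<psi> v)" "\<And>v t p. \<bar>t\<bar> < \<epsilon> \<Longrightarrow> p \<in> P \<Longrightarrow>
      ((\<lambda>h. y (t, p + h *\<^sub>R v)) has_vector_derivative \<psi> v (t, p)) (at 0)" by blast
  \<comment> \<open>A basis vector of \<open>real \<times> 'p\<close> is either the time direction
    \<open>(1, 0)\<close> or has no time component.\<close>
  define f' :: "real \<times> 'p \<Rightarrow> real \<times> 'p \<Rightarrow> 'a" where "f' b z = (if b = (1, 0) then F (fst z, snd z, y z) else \<psi> (snd b) z)" for b z
  show ?case
  proof (rule Ck_on_SucI_partials[OF opS, where f' = f'])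
    fix b :: "real \<times> 'p" assume b: "b \<in> Basis"
    show "Ck_on m ?S (f' b)"
    proof (cases "b = (1, 0)")
      case True
      have "Ck_on m ?S (\<lambda>z. F (fst z, snd z, y z))"
        by (intro Ck_on_compose[OF opS prems(1) _ Ck_on_Suc_imp[OF prems(3)]] Ck_on_Pair opS ym
            Ck_on_linear[of fst] Ck_on_linear[of snd] bounded_linear_fst bounded_linear_snd) (auto intro!: prems(7))
      then show ?thesis using True by (simp add: f'_def[abs_def])
    next
      case False
      then show ?thesis using \<psi>(1) by (simp add: f'_def[abs_def])
    qed
    fix z assume "z \<in> ?S"
    then obtain t p where z: "z = (t, p)" "\<bar>t\<bar> < \<epsilon>" "p \<in> P" by (cases z) auto
    show "((\<lambda>h. y (z + h *\<^sub>R b)) has_vector_derivative f' b z) (at 0)"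
    proof (cases "b = (1, 0)")
      case True
      have "((\<lambda>h. t + h) has_vector_derivative 1) (at 0)" by (auto intro!: derivative_eq_intros)
      from vector_diff_chain_at[OF this, of "\<lambda>t. y (t, p)"] prems(8)[OF z(2,3)]
      show ?thesis by (simp add: o_def True z f'_def)
    next
      case False
      then have "fst b = 0" using b by (auto simp: Basis_prod_def)
      then show ?thesis using \<psi>(2)[OF z(2,3), of "snd b"] False
        by (cases b) (simp add: z f'_def)
    qed
  qed
qed


subsection \<open>Local flows\<close>

text \<open>The partial derivatives are bounded on the compact ball, and the ball is convex.\<close>

lemma C1_lipschitz_cball:
  fixes f :: "'a::euclidean_space \<Rightarrow> 'b::real_normed_vector"
  assumes f: "Ck_on (Suc 0) S f" and sub: "cball x0 R \<subseteq> S"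
  obtains L where "L \<ge> 0" "\<And>x y. x \<in> cball x0 R \<Longrightarrow> y \<in> cball x0 R \<Longrightarrow> norm (f x - f y) \<le> L * norm (x - y)"
proof -
  have "\<exists>C. \<forall>x\<in>cball x0 R. norm (frechet_derivative f (at x) b) \<le> C" for b
  proof -
    have "continuous_on (cball x0 R) (\<lambda>x. frechet_derivative f (at x) b)"
      using f continuous_on_subset[OF _ sub] by auto
    then have "bounded ((\<lambda>x. frechet_derivative f (at x) b) ` cball x0 R)"
      by (intro compact_imp_bounded compact_continuous_image) auto
    then show ?thesis by (auto simp: bounded_iff)
  qed
  then obtain C where C: "\<And>b x. x \<in> cball x0 R \<Longrightarrow> norm (frechet_derivative f (at x) b) \<le> C b" by metis
  define L where "L = \<bar>\<Sum>b\<in>Basis. C b\<bar>"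
  show thesis
  proof
    fix x y assume xy: "x \<in> cball x0 R" "y \<in> cball x0 R"
    show "norm (f x - f y) \<le> L * norm (x - y)"
    proof (rule differentiable_bound[OF convex_cball _ _ xy, where f' = "\<lambda>x. frechet_derivative f (at x)"])
      fix z assume z: "z \<in> cball x0 R"
      have D: "(f has_derivative frechet_derivative f (at z)) (at z)"
        using Ck_on_SucD_derivative[OF f] z sub by blast
      then show "(f has_derivative frechet_derivative f (at z)) (at z within cball x0 R)"
        by (rule has_derivative_at_withinI)
      show "onorm (frechet_derivative f (at z)) \<le> L"
      proof (rule onorm_le)
        fix v
        have "frechet_derivative f (at z) v = (\<Sum>b\<in>Basis. (v \<bullet> b) *\<^sub>R frechet_derivative f (at z) b)"
          by (rule linear_componentwise_sum) (use D has_derivative_linear in blast)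
        also have "norm \<dots> \<le> (\<Sum>b\<in>Basis. norm v * C b)"
          by (intro order_trans[OF norm_sum] sum_mono) (simp add: Basis_le_norm C[OF z] mult_mono)
        also have "\<dots> \<le> L * norm v"
          unfolding L_def sum_distrib_left[symmetric] by (subst mult.commute) (intro mult_right_mono, auto)
        finally show "norm (frechet_derivative f (at z) v) \<le> L * norm v" .
      qed
    qed
  qed (simp add: L_def)
qed

text \<open>The unknown is the displacement \<open>w = \<phi> - x\<close>, with the initial point as
  parameter, so that its initial value is zero for all \<open>x\<close>. The last conclusion is the
  equation of first variation; it exchanges a time and a space derivative and is kept because the
  class of the flow alone does not give it.\<close>

lemma local_flow:
  fixes f :: "'a::euclidean_space \<Rightarrow> 'a"
  assumes "open S" "x0 \<in> S" and f: "Ck_on (Suc m) S f"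
  obtains \<epsilon> \<phi> where "\<epsilon> > 0" "Ck_on (Suc m) ({-\<epsilon><..<\<epsilon>} \<times> ball x0 \<epsilon>) \<phi>"
    "\<And>x. x \<in> ball x0 \<epsilon> \<Longrightarrow> \<phi> (0, x) = x"
    "\<And>t x. \<bar>t\<bar> < \<epsilon> \<Longrightarrow> x \<in> ball x0 \<epsilon> \<Longrightarrow> \<phi> (t, x) \<in> S"
    "\<And>t x. \<bar>t\<bar> < \<epsilon> \<Longrightarrow> x \<in> ball x0 \<epsilon> \<Longrightarrow> ((\<lambda>t. \<phi> (t, x)) has_vector_derivative f (\<phi> (t, x))) (at t)"
    "\<And>t x v. \<bar>t\<bar> < \<epsilon> \<Longrightarrow> x \<in> ball x0 \<epsilon> \<Longrightarrow>
      ((\<lambda>t. frechet_derivative \<phi> (at (t, x)) (0, v)) has_vector_derivative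
         frechet_derivative f (at (\<phi> (t, x))) (frechet_derivative \<phi> (at (t, x)) (0, v))) (at t)"
proof -
  obtain R where R: "R > 0" "cball x0 R \<subseteq> S" using assms(1,2) open_contains_cball by metis
  have f1: "Ck_on (Suc 0) S f" using f by (rule Ck_on_mono) simp
  obtain L where L: "L \<ge> 0"
    "\<And>x y. x \<in> cball x0 R \<Longrightarrow> y \<in> cball x0 R \<Longrightarrow> norm (f x - f y) \<le> L * norm (x - y)"
    using C1_lipschitz_cball[OF f1 R(2)] by metis
  have contf: "continuous_on (cball x0 R) f"
    using Ck_on_imp_continuous_on[OF f] R(2) continuous_on_subset by blast
  then have "bounded (f ` cball x0 R)" by (intro compact_imp_bounded compact_continuous_image) auto
  then obtain B' where B': "\<And>x. x \<in> cball x0 R \<Longrightarrow> norm (f x) \<le> B'"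
    unfolding bounded_iff by blast
  define B where "B = \<bar>B'\<bar>"
  have B: "B \<ge> 0" "\<And>x. x \<in> cball x0 R \<Longrightarrow> norm (f x) \<le> B" using B' by (force simp: B_def)+
  \<comment> \<open>\<open>R / 2\<close> bounds the distance of the initial point from
    \<open>x0\<close>, \<open>1 / (2 * (L + 1))\<close> makes the integral operator contract, and
    \<open>R / (2 * (B + 1))\<close> keeps the displacement below \<open>R / 2\<close>.\<close>
  define \<epsilon> where "\<epsilon> = min (R / 2) (min (1 / (2 * (L + 1))) (R / (2 * (B + 1))))"
  have \<epsilon>: "\<epsilon> > 0" "\<epsilon> \<le> R / 2" "\<epsilon> \<le> 1 / (2 * (L + 1))" "\<epsilon> \<le> R / (2 * (B + 1))"
  proof -
    have "0 < R / 2" "0 < 1 / (2 * (L + 1))" "0 < R / (2 * (B + 1))"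
      using R(1) L(1) B(1) by simp_all
    then show "\<epsilon> > 0" unfolding \<epsilon>_def by linarith
    show "\<epsilon> \<le> R / 2" "\<epsilon> \<le> 1 / (2 * (L + 1))" "\<epsilon> \<le> R / (2 * (B + 1))"
      unfolding \<epsilon>_def by linarith+
  qed
  have "\<epsilon> * L \<le> 1 / (2 * (L + 1)) * L" by (rule mult_right_mono[OF \<epsilon>(3) L(1)])
  also have "\<dots> \<le> 1 / 2" using L(1) by (simp add: field_simps)
  finally have \<epsilon>L: "\<epsilon> * L \<le> 1 / 2" .
  have "\<epsilon> * B \<le> R / (2 * (B + 1)) * B" by (rule mult_right_mono[OF \<epsilon>(4) B(1)])
  also have "\<dots> < R / 2" using B(1) R(1) by (simp add: field_simps)
  finally have \<epsilon>B: "\<epsilon> * B < R / 2" .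
  define \<pi> where "\<pi> = closest_point (cball x0 R)"
  have C: "convex (cball x0 R)" "closed (cball x0 R)" "cball x0 R \<noteq> {}" using R(1) by auto
  have \<pi>: "\<pi> x \<in> cball x0 R" "continuous_on UNIV \<pi>" "norm (\<pi> x - \<pi> y) \<le> norm (x - y)" for x y
    unfolding \<pi>_def
    using closest_point_in_set[OF C(2,3)] continuous_on_closest_point[OF C] closest_point_lipschitz[OF C]
    by (auto simp: dist_norm)
  \<comment> \<open>Cut off by projecting onto the ball, hence bounded and globally Lipschitz.
    Solutions starting in the small ball stay inside the large one for times below \<epsilon>, so
    they solve the original equation.\<close>
  define F1 where "F1 = (\<lambda>(s::real, x, w). f (\<pi> (x + w)))"
  obtain w where w: "continuous_on UNIV w" "\<And>p. w (0, p) = 0"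
    "\<And>t p. \<bar>t\<bar> < \<epsilon> \<Longrightarrow> ((\<lambda>t. w (t, p)) has_vector_derivative F1 (t, p, w (t, p))) (at t)"
  proof (rule ode_param_exists[of F1 L B \<epsilon>])
    show "continuous_on UNIV F1"
      unfolding F1_def case_prod_unfold
      by (intro continuous_on_compose2[OF contf] continuous_on_compose2[OF \<pi>(2)] continuous_intros)
        (use \<pi>(1) in auto)
    show "norm (F1 (s, p, y) - F1 (s, p, z)) \<le> L * norm (y - z)" for s p y z
      using order_trans[OF L(2)[OF \<pi>(1) \<pi>(1)] mult_left_mono[OF \<pi>(3) L(1)], of "p + y" "p + z"]
      by (simp add: F1_def)
    show "norm (F1 (s, p, 0)) \<le> B" for s p using B(2)[OF \<pi>(1)] by (simp add: F1_def)
  qed (use \<epsilon> \<epsilon>L in auto)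
  have wB: "norm (w (t, x)) \<le> \<epsilon> * B" if "\<bar>t\<bar> < \<epsilon>" for t x
  proof -
    have "norm (w (t, x) - w (0, x)) \<le> B * norm (t - 0)"
    proof (rule differentiable_bound[of "{-\<epsilon><..<\<epsilon>}" "\<lambda>t. w (t, x)" "\<lambda>t h. h *\<^sub>R F1 (t, x, w (t, x))"])
      fix s assume "s \<in> {-\<epsilon><..<\<epsilon>}"
      then have "\<bar>s\<bar> < \<epsilon>" by auto
      from w(3)[OF this, of x]
      show "((\<lambda>t. w (t, x)) has_derivative (\<lambda>h. h *\<^sub>R F1 (s, x, w (s, x)))) (at s within {-\<epsilon><..<\<epsilon>})"
        unfolding has_vector_derivative_def by (rule has_derivative_at_withinI)
      show "onorm (\<lambda>h. h *\<^sub>R F1 (s, x, w (s, x))) \<le> B"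
      proof (rule onorm_le)
        fix h :: real
        show "norm (h *\<^sub>R F1 (s, x, w (s, x))) \<le> B * norm h"
          using mult_left_mono[OF B(2)[OF \<pi>(1)], of "\<bar>h\<bar>"] by (simp add: F1_def mult.commute)
      qed
    qed (use that \<epsilon> in auto)
    also have "\<dots> \<le> \<epsilon> * B" using that B(1) by (simp add: mult.commute mult_left_mono)
    finally show ?thesis by (simp add: w)
  qed
  define P where "P = ball x0 \<epsilon>"
  \<comment> \<open>The cut-off need not be differentiable, so the smoothness argument uses the
    original field where \<open>x + w\<close> lies in the open ball; this set is convex as a
    preimage under a linear map.\<close>
  define \<Omega> where "\<Omega> = {z :: real \<times> 'a \<times> 'a. fst (snd z) + snd (snd z) \<in> ball x0 R}"
  define F where "F = (\<lambda>z :: real \<times> 'a \<times> 'a. f (fst (snd z) + snd (snd z)))"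
  have lin: "bounded_linear (\<lambda>z :: real \<times> 'a \<times> 'a. fst (snd z) + snd (snd z))"
    by (intro bounded_linear_add bounded_linear_fst_comp bounded_linear_snd_comp bounded_linear_snd)
  have vim: "\<Omega> = (\<lambda>z. fst (snd z) + snd (snd z)) -` ball x0 R" by (auto simp: \<Omega>_def)
  have op\<Omega>: "open \<Omega>" unfolding vim
    by (intro open_vimage continuous_intros) auto
  have conv\<Omega>: "convex \<Omega>" unfolding vim
    by (intro convex_linear_vimage convex_ball) (use lin bounded_linear.linear in blast)
  have sub: "ball x0 R \<subseteq> S" using R(2) ball_subset_cball by blast
  have CkF: "Ck_on (Suc m) \<Omega> F"
    unfolding F_def by (rule Ck_on_compose[OF op\<Omega> open_ball Ck_on_linear[OF lin] Ck_on_subset[OF f sub]])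
      (simp add: \<Omega>_def)
  have Flip: "norm (F (s, p, w) - F (s, p, z)) \<le> L * norm (w - z)"
    if "(s, p, w) \<in> \<Omega>" "(s, p, z) \<in> \<Omega>" for s p w z
    using L(2)[of "p + w" "p + z"] that by (auto simp: F_def \<Omega>_def)
  have in\<Omega>: "(t, x, w (t, x)) \<in> \<Omega>" if "\<bar>t\<bar> < \<epsilon>" "x \<in> P" for t x
  proof -
    have "dist x0 (x + w (t, x)) \<le> dist x0 x + norm (w (t, x))"
      using norm_triangle_ineq[of "x - x0" "w (t, x)"]
      by (simp add: dist_norm norm_minus_commute algebra_simps)
    also have "\<dots> < R" using wB[OF that(1), of x] \<epsilon>B \<epsilon>(2) that(2) by (simp add: P_def)
    finally show ?thesis by (simp add: \<Omega>_def)
  qed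
  have ode: "((\<lambda>t. w (t, x)) has_vector_derivative F (t, x, w (t, x))) (at t)" if "\<bar>t\<bar> < \<epsilon>" "x \<in> P" for t x
  proof -
    have "x + w (t, x) \<in> cball x0 R" using in\<Omega>[OF that] by (auto simp: \<Omega>_def)
    then have "F1 (t, x, w (t, x)) = F (t, x, w (t, x))"
      by (simp add: F1_def F_def \<pi>_def closest_point_self)
    then show ?thesis using w(3)[OF that(1), of x] by simp
  qed
  have P: "open P" "convex P" by (simp_all add: P_def)
  have contw: "continuous_on ({-\<epsilon><..<\<epsilon>} \<times> P) w" using w(1) continuous_on_subset by blast
  have opP: "open ({-\<epsilon><..<\<epsilon>} \<times> P)" using P by (simp add: open_Times)
  have Ckw: "Ck_on (Suc m) ({-\<epsilon><..<\<epsilon>} \<times> P) w"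
    by (rule ode_param_Ck[OF op\<Omega> conv\<Omega> P CkF Flip \<epsilon>(1) \<epsilon>L L(1) contw w(2) in\<Omega> ode])
  define \<phi> where "\<phi> = (\<lambda>z. snd z + w z)"
  have Ck\<phi>: "Ck_on (Suc m) ({-\<epsilon><..<\<epsilon>} \<times> P) \<phi>"
    unfolding \<phi>_def by (intro Ck_on_add opP Ckw Ck_on_linear bounded_linear_snd)
  show thesis
  proof (rule that[of \<epsilon> \<phi>])
    show "\<phi> (t, x) \<in> S" if "\<bar>t\<bar> < \<epsilon>" "x \<in> ball x0 \<epsilon>" for t x
      using in\<Omega>[of t x] that sub by (auto simp: P_def \<Omega>_def \<phi>_def)
    show "((\<lambda>t. \<phi> (t, x)) has_vector_derivative f (\<phi> (t, x))) (at t)" if "\<bar>t\<bar> < \<epsilon>" "x \<in> ball x0 \<epsilon>" for t x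
      using has_vector_derivative_add[OF has_vector_derivative_const ode[of t x], of x] that
      by (simp add: P_def \<phi>_def F_def)
    fix t x v assume t: "\<bar>t\<bar> < \<epsilon>" and x: "x \<in> ball x0 \<epsilon>"
    have FS: "Ck_on (Suc 0) \<Omega> F" using CkF by (rule Ck_on_mono) simp
    obtain \<psi> where "continuous_on ({-\<epsilon><..<\<epsilon>} \<times> P) \<psi>" "\<And>p. p \<in> P \<Longrightarrow> \<psi> (0, p) = 0"
      and \<psi>: "\<And>t p. \<bar>t\<bar> < \<epsilon> \<Longrightarrow> p \<in> P \<Longrightarrow>
        ((\<lambda>h. w (t, p + h *\<^sub>R v)) has_vector_derivative \<psi> (t, p)) (at 0)"
      "\<And>t p. \<bar>t\<bar> < \<epsilon> \<Longrightarrow> p \<in> P \<Longrightarrow> ((\<lambda>t. \<psi> (t, p)) has_vector_derivative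
        frechet_derivative F (at (t, p, w (t, p))) (0, v, \<psi> (t, p))) (at t)"
    proof -
      show ?thesis
        by (rule ode_param_directional[OF op\<Omega> conv\<Omega> P(1) FS Flip \<epsilon>(1) \<epsilon>L L(1) contw w(2) in\<Omega> ode, of v]) (assumption | rule that)+
    qed
    \<comment> \<open>The differential of the flow is the identity plus the variation of the
      displacement.\<close>
    have D\<phi>: "frechet_derivative \<phi> (at (s, x)) (0, v) = v + \<psi> (s, x)" if "\<bar>s\<bar> < \<epsilon>" for s
    proof -
      have "(s, x) \<in> {-\<epsilon><..<\<epsilon>} \<times> P" using that x by (auto simp: P_def)
      from has_derivative_imp_directional[OF Ck_on_SucD_derivative[OF Ck\<phi> this], of "(0, v)"]
      have 1: "((\<lambda>h. \<phi> (s, x + h *\<^sub>R v)) has_vector_derivative frechet_derivative \<phi> (at (s, x)) (0, v)) (at 0)"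
        by simp
      have "((\<lambda>h. x + h *\<^sub>R v) has_vector_derivative v) (at 0)"
        by (auto intro!: derivative_eq_intros simp: has_vector_derivative_def)
      from has_vector_derivative_add[OF this \<psi>(1)[OF \<open>\<bar>s\<bar> < \<epsilon>\<close>]]
      have 2: "((\<lambda>h. \<phi> (s, x + h *\<^sub>R v)) has_vector_derivative v + \<psi> (s, x)) (at 0)"
        using x by (simp add: \<phi>_def P_def)
      show ?thesis using vector_derivative_unique_at[OF 1 2] .
    qed
    have "x + w (t, x) \<in> S" using in\<Omega>[of t x] t x sub by (auto simp: P_def \<Omega>_def)
    from diff_chain_at[OF bounded_linear_imp_has_derivative[OF lin], of f _ "(t, x, w (t, x))"]
      Ck_on_SucD_derivative[OF f this]
    have "(F has_derivative (\<lambda>z. frechet_derivative f (at (x + w (t, x))) (fst (snd z) + snd (snd z)))) (at (t, x, w (t, x)))"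
      by (simp add: o_def F_def)
    from frechet_derivative_at[OF this, symmetric]
    have DF: "frechet_derivative F (at (t, x, w (t, x))) (0, v, \<psi> (t, x)) =
        frechet_derivative f (at (\<phi> (t, x))) (frechet_derivative \<phi> (at (t, x)) (0, v))"
      by (simp add: D\<phi>[OF t]) (simp add: \<phi>_def)
    have "((\<lambda>s. v + \<psi> (s, x)) has_vector_derivative frechet_derivative F (at (t, x, w (t, x))) (0, v, \<psi> (t, x))) (at t)"
      using has_vector_derivative_add[OF has_vector_derivative_const \<psi>(2)[OF t, of x], of v] x by (simp add: P_def)
    then have "((\<lambda>s. frechet_derivative \<phi> (at (s, x)) (0, v)) has_vector_derivative
        frechet_derivative F (at (t, x, w (t, x))) (0, v, \<psi> (t, x))) (at t)"
      by (rule has_vector_derivative_transform_within_open[of _ _ _ "{-\<epsilon><..<\<epsilon>}"]) (use t D\<phi> in auto)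
    then show "((\<lambda>t. frechet_derivative \<phi> (at (t, x)) (0, v)) has_vector_derivative
        frechet_derivative f (at (\<phi> (t, x))) (frechet_derivative \<phi> (at (t, x)) (0, v))) (at t)"
      unfolding DF .
  qed (use \<epsilon> Ck\<phi> w in \<open>auto simp: P_def \<phi>_def\<close>)
qed

section \<open>Manifolds and maps in charts\<close>

subsection \<open>Charts\<close>

lemma chart_inv_left: "inj_on (snd c) (fst c) \<Longrightarrow> p \<in> fst c \<Longrightarrow> chart_inv c (snd c p) = p"
  by (simp add: chart_inv_def)

lemma chart_inv_right:
  assumes "x \<in> snd c ` fst c"
  shows "chart_inv c x \<in> fst c" "snd c (chart_inv c x) = x"
  using assms by (auto simp: chart_inv_def inv_into_into f_inv_into_f)

lemma is_chart_inj: "is_chart X c \<Longrightarrow> inj_on (snd c) (fst c)"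
  unfolding is_chart_def
  by (metis homeomorphic_imp_injective_map openin_subset topspace_subtopology_subset)

lemma is_chart_subset: "is_chart X c \<Longrightarrow> fst c \<subseteq> topspace X"
  unfolding is_chart_def by (simp add: openin_subset)

lemma is_chart_open_image:
  assumes "is_chart X c" "openin X S"
  shows "open (snd c ` (fst c \<inter> S))"
proof -
  have "open_map (subtopology X (fst c)) (top_of_set (snd c ` fst c)) (snd c)"
    using assms(1) homeomorphic_imp_open_map unfolding is_chart_def by blast
  moreover have "openin (subtopology X (fst c)) (fst c \<inter> S)"
    using assms(2) by (metis inf_commute openin_subtopology_Int)
  ultimately have "openin (top_of_set (snd c ` fst c)) (snd c ` (fst c \<inter> S))"
    by (simp add: open_map_def)
  then show ?thesis using assms(1) unfolding is_chart_def by (metis openin_open_eq)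
qed

lemma is_chart_open_preimage:
  assumes "is_chart X c" "open N"
  shows "openin X {p \<in> fst c. snd c p \<in> N}"
proof -
  have "continuous_map (subtopology X (fst c)) (top_of_set (snd c ` fst c)) (snd c)"
    using assms(1) homeomorphic_imp_continuous_map unfolding is_chart_def by blast
  moreover have "openin (top_of_set (snd c ` fst c)) (snd c ` fst c \<inter> N)"
    using assms(2) by (rule openin_open_Int)
  ultimately have "openin (subtopology X (fst c)) {p \<in> topspace (subtopology X (fst c)). snd c p \<in> snd c ` fst c \<inter> N}"
    by (rule openin_continuous_map_preimage)
  moreover have "{p \<in> topspace (subtopology X (fst c)). snd c p \<in> snd c ` fst c \<inter> N} = {p \<in> fst c. snd c p \<in> N}"
    using is_chart_subset[OF assms(1)] by auto
  ultimately show ?thesis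
    using assms(1) unfolding is_chart_def by (metis openin_trans_full)
qed

lemma is_chartI:
  assumes o: "openin X (fst c)" and inj: "inj_on (snd c) (fst c)"
    and im: "\<And>S. openin X S \<Longrightarrow> open (snd c ` (fst c \<inter> S))"
    and pre: "\<And>N. open N \<Longrightarrow> openin X {p \<in> fst c. snd c p \<in> N}"
  shows "is_chart X c"
proof -
  have ts: "topspace (subtopology X (fst c)) = fst c" using openin_subset[OF o] by auto
  have "open_map (subtopology X (fst c)) (top_of_set (snd c ` fst c)) (snd c)"
    unfolding open_map_def
  proof (intro allI impI)
    fix U assume "openin (subtopology X (fst c)) U"
    then obtain S where S: "openin X S" "U = S \<inter> fst c" by (auto simp: openin_subtopology)
    then show "openin (top_of_set (snd c ` fst c)) (snd c ` U)"
      using im[OF S(1)] by (intro open_subset) (auto simp: Int_commute)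
  qed
  moreover have "continuous_map (subtopology X (fst c)) (top_of_set (snd c ` fst c)) (snd c)"
    unfolding continuous_map_def
  proof (intro conjI allI impI)
    fix U assume "openin (top_of_set (snd c ` fst c)) U"
    then obtain N where N: "open N" "U = snd c ` fst c \<inter> N" by (auto simp: openin_open)
    have "{x \<in> topspace (subtopology X (fst c)). snd c x \<in> U} = {p \<in> fst c. snd c p \<in> N}"
      unfolding ts N(2) by auto
    then show "openin (subtopology X (fst c)) {x \<in> topspace (subtopology X (fst c)). snd c x \<in> U}"
      unfolding openin_subtopology using pre[OF N(1)] by (intro exI[of _ "{p \<in> fst c. snd c p \<in> N}"]) auto
  qed (use ts in auto)
  ultimately have "homeomorphic_map (subtopology X (fst c)) (top_of_set (snd c ` fst c)) (snd c)"
    by (intro bijective_open_imp_homeomorphic_map) (simp_all add: inj ts del: topspace_subtopology)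
  moreover have "open (snd c ` fst c)" using im[OF o] by simp
  ultimately show ?thesis using o by (simp add: is_chart_def)
qed

text \<open>The part of an atlas that differentiation in charts uses, without a topology on the
  manifold: openness is asked only of the images of charts and of their overlaps. In this form it
  passes easily to products.\<close>

definition chart_system :: "nat \<Rightarrow> ('x, 'e::euclidean_space) chart set \<Rightarrow> bool" where
  "chart_system k A \<longleftrightarrow> (\<forall>c\<in>A. inj_on (snd c) (fst c) \<and> open (snd c ` fst c)) \<and>
     (\<forall>c\<in>A. \<forall>c'\<in>A. open (snd c ` (fst c \<inter> fst c')) \<and>
        Ck_on k (snd c ` (fst c \<inter> fst c')) (\<lambda>x. snd c' (chart_inv c x)))"

lemma chart_systemD:
  assumes "chart_system k A" "c \<in> A"
  shows "inj_on (snd c) (fst c)" "open (snd c ` fst c)"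
    and "p \<in> fst c \<Longrightarrow> chart_inv c (snd c p) = p"
    and "c' \<in> A \<Longrightarrow> open (snd c ` (fst c \<inter> fst c'))"
    and "c' \<in> A \<Longrightarrow> Ck_on k (snd c ` (fst c \<inter> fst c')) (\<lambda>x. snd c' (chart_inv c x))"
proof -
  show inj: "inj_on (snd c) (fst c)" and "open (snd c ` fst c)"
    using assms by (auto simp: chart_system_def)
  show "p \<in> fst c \<Longrightarrow> chart_inv c (snd c p) = p" by (rule chart_inv_left[OF inj])
  show "c' \<in> A \<Longrightarrow> open (snd c ` (fst c \<inter> fst c'))"
    and "c' \<in> A \<Longrightarrow> Ck_on k (snd c ` (fst c \<inter> fst c')) (\<lambda>x. snd c' (chart_inv c x))"
    using assms by (auto simp: chart_system_def)
qed

lemma Ck_atlas_chart_system: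
  assumes "Ck_atlas k X A" shows "chart_system k A"
  unfolding chart_system_def
proof (intro conjI ballI)
  fix c c' assume c: "c \<in> A" "c' \<in> A"
  then have "is_chart X c" "openin X (fst c')"
    using assms by (auto simp: Ck_atlas_def is_chart_def)
  then show "inj_on (snd c) (fst c)" "open (snd c ` fst c)" "open (snd c ` (fst c \<inter> fst c'))"
    by (simp_all add: is_chart_inj is_chart_open_image) (simp add: is_chart_def)
  show "Ck_on k (snd c ` (fst c \<inter> fst c')) (\<lambda>x. snd c' (chart_inv c x))"
    using assms c by (auto simp: Ck_atlas_def o_def)
qed

lemma Ck_atlas_mono: "Ck_atlas l X A \<Longrightarrow> k \<le> l \<Longrightarrow> Ck_atlas k X A"
  unfolding Ck_atlas_def by (meson Ck_on_mono)

text \<open>The charts of \<open>Q \<times> \<real>\<close>; those of spacetime are obtained by adding the time coordinate.\<close>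

definition line_chart :: "('q, 'e) chart \<Rightarrow> ('q \<times> real, 'e \<times> real) chart" where
  "line_chart c = (fst c \<times> UNIV, \<lambda>(q, y). (snd c q, y))"

lemma spacetime_chart_eq: "spacetime_chart c = event_chart (line_chart c)"
  by (auto simp: spacetime_chart_def event_chart_def line_chart_def fun_eq_iff)

lemma spacetime_atlas_eq: "spacetime_atlas A = event_atlas (line_chart ` A)"
  by (simp add: spacetime_atlas_def event_atlas_def image_image spacetime_chart_eq)

lemma event_chart_simps [simp]:
  "fst (event_chart c) = UNIV \<times> fst c" "snd (event_chart c) (t, q) = (t, snd c q)"
  by (simp_all add: event_chart_def)

lemma line_chart_simps [simp]:
  "fst (line_chart c) = fst c \<times> UNIV" "snd (line_chart c) (q, y) = (snd c q, y)"
  by (simp_all add: line_chart_def)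

lemma event_chart_image: "snd (event_chart c) ` (I \<times> S) = I \<times> snd c ` S"
  by (auto simp: event_chart_def image_iff)

lemma line_chart_image: "snd (line_chart c) ` (S \<times> I) = snd c ` S \<times> I"
  by (auto simp: line_chart_def image_iff)

lemma inj_on_event_chart: "inj_on (snd c) (fst c) \<Longrightarrow> inj_on (snd (event_chart c)) (fst (event_chart c))"
  by (auto simp: inj_on_def)

lemma inj_on_line_chart: "inj_on (snd c) (fst c) \<Longrightarrow> inj_on (snd (line_chart c)) (fst (line_chart c))"
  by (auto simp: inj_on_def)

lemma chart_inv_event_chart:
  assumes "inj_on (snd c) (fst c)" "x \<in> snd c ` fst c"
  shows "chart_inv (event_chart c) (t, x) = (t, chart_inv c x)"
  using chart_inv_left[OF inj_on_event_chart[OF assms(1)], of "(t, chart_inv c x)"]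
    chart_inv_right[OF assms(2)] by simp

lemma chart_inv_line_chart:
  assumes "inj_on (snd c) (fst c)" "x \<in> snd c ` fst c"
  shows "chart_inv (line_chart c) (x, y) = (chart_inv c x, y)"
  using chart_inv_left[OF inj_on_line_chart[OF assms(1)], of "(chart_inv c x, y)"]
    chart_inv_right[OF assms(2)] by simp

lemma is_chart_event_chart:
  assumes c: "is_chart X c"
  shows "is_chart (prod_topology euclidean X) (event_chart c)"
proof (rule is_chartI)
  show "openin (prod_topology euclidean X) (fst (event_chart c))"
    using c by (simp add: is_chart_def openin_prod_Times_iff)
  show "inj_on (snd (event_chart c)) (fst (event_chart c))"
    using inj_on_event_chart is_chart_inj[OF c] by blast
  fix S assume S: "openin (prod_topology (euclidean :: real topology) X) S"
  show "open (snd (event_chart c) ` (fst (event_chart c) \<inter> S))"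
  proof (subst open_subopen, intro ballI)
    fix z assume "z \<in> snd (event_chart c) ` (fst (event_chart c) \<inter> S)"
    then obtain t q where z: "z = (t, snd c q)" "q \<in> fst c" "(t, q) \<in> S" by auto
    from S[unfolded openin_prod_topology_alt, rule_format, OF z(3)]
    obtain U V where UV: "open U" "openin X V" "t \<in> U" "q \<in> V" "U \<times> V \<subseteq> S"
      by (auto simp only: open_openin)
    show "\<exists>T. open T \<and> z \<in> T \<and> T \<subseteq> snd (event_chart c) ` (fst (event_chart c) \<inter> S)"
    proof (intro exI conjI)
      show "open (U \<times> snd c ` (fst c \<inter> V))" using UV is_chart_open_image[OF c] by (intro open_Times)
      show "U \<times> snd c ` (fst c \<inter> V) \<subseteq> snd (event_chart c) ` (fst (event_chart c) \<inter> S)"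
        unfolding event_chart_image[symmetric] using UV by auto
    qed (use UV z in auto)
  qed
next
  fix N :: "(real \<times> 'b) set" assume N: "open N"
  show "openin (prod_topology euclidean X) {p \<in> fst (event_chart c). snd (event_chart c) p \<in> N}"
    unfolding openin_prod_topology_alt
  proof (intro allI impI)
    fix t q assume "(t, q) \<in> {p \<in> fst (event_chart c). snd (event_chart c) p \<in> N}"
    then have q: "q \<in> fst c" "(t, snd c q) \<in> N" by auto
    obtain U V where "open U" "open V" "(t, snd c q) \<in> U \<times> V" and sub: "U \<times> V \<subseteq> N"
      by (rule open_prod_elim[OF N q(2)])
    then have UV: "open U" "open V" "t \<in> U" "snd c q \<in> V" "U \<times> V \<subseteq> N" by auto
    show "\<exists>U V. openin euclidean U \<and> openin X V \<and> t \<in> U \<and> q \<in> V \<and>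
        U \<times> V \<subseteq> {p \<in> fst (event_chart c). snd (event_chart c) p \<in> N}"
    proof (intro exI conjI)
      show "openin X {p \<in> fst c. snd c p \<in> V}" by (rule is_chart_open_preimage[OF c UV(2)])
      show "U \<times> {p \<in> fst c. snd c p \<in> V} \<subseteq> {p \<in> fst (event_chart c). snd (event_chart c) p \<in> N}"
        using UV(5) by auto
    qed (use UV q in auto)
  qed
qed

lemma is_chart_line_chart:
  assumes c: "is_chart X c"
  shows "is_chart (prod_topology X euclidean) (line_chart c)"
proof (rule is_chartI)
  show "openin (prod_topology X euclidean) (fst (line_chart c))"
    using c by (simp add: is_chart_def openin_prod_Times_iff)
  show "inj_on (snd (line_chart c)) (fst (line_chart c))"
    using inj_on_line_chart is_chart_inj[OF c] by blast
  fix S assume S: "openin (prod_topology X (euclidean :: real topology)) S"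
  show "open (snd (line_chart c) ` (fst (line_chart c) \<inter> S))"
  proof (subst open_subopen, intro ballI)
    fix z assume "z \<in> snd (line_chart c) ` (fst (line_chart c) \<inter> S)"
    then obtain t q where z: "z = (snd c q, t)" "q \<in> fst c" "(q, t) \<in> S" by auto
    from S[unfolded openin_prod_topology_alt, rule_format, OF z(3)]
    obtain V U where UV: "open U" "openin X V" "t \<in> U" "q \<in> V" "V \<times> U \<subseteq> S"
      by (auto simp only: open_openin)
    show "\<exists>T. open T \<and> z \<in> T \<and> T \<subseteq> snd (line_chart c) ` (fst (line_chart c) \<inter> S)"
    proof (intro exI conjI)
      show "open (snd c ` (fst c \<inter> V) \<times> U)" using UV is_chart_open_image[OF c] by (intro open_Times)
      show "snd c ` (fst c \<inter> V) \<times> U \<subseteq> snd (line_chart c) ` (fst (line_chart c) \<inter> S)"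
        unfolding line_chart_image[symmetric] using UV by auto
    qed (use UV z in auto)
  qed
next
  fix N :: "('b \<times> real) set" assume N: "open N"
  show "openin (prod_topology X euclidean) {p \<in> fst (line_chart c). snd (line_chart c) p \<in> N}"
    unfolding openin_prod_topology_alt
  proof (intro allI impI)
    fix q t assume "(q, t) \<in> {p \<in> fst (line_chart c). snd (line_chart c) p \<in> N}"
    then have q: "q \<in> fst c" "(snd c q, t) \<in> N" by auto
    obtain V U where "open V" "open U" "(snd c q, t) \<in> V \<times> U" and sub: "V \<times> U \<subseteq> N"
      by (rule open_prod_elim[OF N q(2)])
    then have UV: "open U" "open V" "t \<in> U" "snd c q \<in> V" "V \<times> U \<subseteq> N" by auto
    show "\<exists>V U. openin X V \<and> openin euclidean U \<and> q \<in> V \<and> t \<in> U \<and>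
        V \<times> U \<subseteq> {p \<in> fst (line_chart c). snd (line_chart c) p \<in> N}"
    proof (intro exI conjI)
      show "openin X {p \<in> fst c. snd c p \<in> V}" by (rule is_chart_open_preimage[OF c UV(2)])
      show "{p \<in> fst c. snd c p \<in> V} \<times> U \<subseteq> {p \<in> fst (line_chart c). snd (line_chart c) p \<in> N}"
        using UV(5) by auto
    qed (use UV q in auto)
  qed
qed

lemma chart_system_event_atlas:
  assumes A: "chart_system k A"
  shows "chart_system k (event_atlas A)"
  unfolding chart_system_def event_atlas_def
proof (intro conjI ballI)
  fix d assume "d \<in> event_chart ` A"
  then obtain c where c: "c \<in> A" and d: "d = event_chart c" by blast
  note cc = chart_systemD[OF A c]
  show "inj_on (snd d) (fst d)" unfolding d using inj_on_event_chart cc by blast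
  show "open (snd d ` fst d)" unfolding d
    using cc(2) by (simp add: event_chart_image open_Times)
  fix d' assume "d' \<in> event_chart ` A"
  then obtain c' where c': "c' \<in> A" and d': "d' = event_chart c'" by blast
  have im: "snd (event_chart c) ` (fst (event_chart c) \<inter> fst (event_chart c')) =
      UNIV \<times> snd c ` (fst c \<inter> fst c')"
    by (simp add: Times_Int_Times event_chart_image)
  show o: "open (snd d ` (fst d \<inter> fst d'))"
    unfolding d d' im using cc(4)[OF c'] by (intro open_Times) auto
  have "Ck_on k ((UNIV :: real set) \<times> snd c ` (fst c \<inter> fst c')) (\<lambda>z. (fst z, snd c' (chart_inv c (snd z))))"
    using o unfolding d d' im
    by (intro Ck_on_Pair Ck_on_linear[of fst] bounded_linear_fst
        Ck_on_compose[OF _ cc(4)[OF c'] Ck_on_linear[OF bounded_linear_snd] cc(5)[OF c']]) auto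
  note ck = this
  show "Ck_on k (snd d ` (fst d \<inter> fst d')) (\<lambda>x. snd d' (chart_inv d x))"
    unfolding d d' im by (rule Ck_on_cong[OF o[unfolded d d' im] ck]) (auto simp: chart_inv_event_chart[OF cc(1)])
qed

lemma chart_system_line_atlas:
  assumes A: "chart_system k A"
  shows "chart_system k (line_chart ` A)"
  unfolding chart_system_def
proof (intro conjI ballI)
  fix d assume "d \<in> line_chart ` A"
  then obtain c where c: "c \<in> A" and d: "d = line_chart c" by blast
  note cc = chart_systemD[OF A c]
  show "inj_on (snd d) (fst d)" unfolding d using inj_on_line_chart cc by blast
  show "open (snd d ` fst d)" unfolding d
    using cc(2) by (simp add: line_chart_image open_Times)
  fix d' assume "d' \<in> line_chart ` A"
  then obtain c' where c': "c' \<in> A" and d': "d' = line_chart c'" by blast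
  have im: "snd (line_chart c) ` (fst (line_chart c) \<inter> fst (line_chart c')) =
      snd c ` (fst c \<inter> fst c') \<times> UNIV"
    by (simp add: Times_Int_Times line_chart_image)
  show o: "open (snd d ` (fst d \<inter> fst d'))"
    unfolding d d' im using cc(4)[OF c'] by (intro open_Times) auto
  have "Ck_on k (snd c ` (fst c \<inter> fst c') \<times> (UNIV :: real set)) (\<lambda>z. (snd c' (chart_inv c (fst z)), snd z))"
    using o unfolding d d' im
    by (intro Ck_on_Pair Ck_on_linear[of snd] bounded_linear_snd
        Ck_on_compose[OF _ cc(4)[OF c'] Ck_on_linear[OF bounded_linear_fst] cc(5)[OF c']]) auto
  note ck = this
  show "Ck_on k (snd d ` (fst d \<inter> fst d')) (\<lambda>x. snd d' (chart_inv d x))"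
    unfolding d d' im by (rule Ck_on_cong[OF o[unfolded d d' im] ck]) (auto simp: chart_inv_line_chart[OF cc(1)])
qed

lemma chart_system_spacetime_atlas: "chart_system k A \<Longrightarrow> chart_system k (spacetime_atlas A)"
  unfolding spacetime_atlas_eq by (intro chart_system_event_atlas chart_system_line_atlas)

lemma is_chart_spacetime_chart: "is_chart X c \<Longrightarrow> is_chart (spacetime_top X) (spacetime_chart c)"
  unfolding spacetime_chart_eq spacetime_top_def by (intro is_chart_event_chart is_chart_line_chart)

lemma chart_inv_std: "chart_inv (UNIV, \<lambda>x. x) x = x"
  using chart_inv_right(2)[of x "(UNIV, \<lambda>x. x)"] by simp

lemma chart_system_std_atlas: "chart_system k std_atlas"
  by (simp add: chart_system_def std_atlas_def chart_inv_std Ck_on_id)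

subsection \<open>Differentiability of maps at a point\<close>

text \<open>Asks for one suitable pair of charts, so it is easy to establish and to compose;
  \<open>Ck_map\<close>, which quantifies over all pairs, is recovered by changing charts. The
  neighbourhood of the point is given by the open set \<open>N\<close> of coordinates.\<close>

definition Ck_at ::
  "nat \<Rightarrow> ('x, 'e::euclidean_space) chart set \<Rightarrow> ('y, 'f::euclidean_space) chart set \<Rightarrow>
   ('x \<Rightarrow> 'y) \<Rightarrow> 'x \<Rightarrow> bool" where
  "Ck_at k A B f p \<longleftrightarrow> (\<exists>c\<in>A. \<exists>d\<in>B. \<exists>N. p \<in> fst c \<and> open N \<and> snd c p \<in> N \<and> N \<subseteq> snd c ` fst c \<and>
     (\<forall>x\<in>N. f (chart_inv c x) \<in> fst d) \<and> Ck_on k N (\<lambda>x. snd d (f (chart_inv c x))))"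

lemma Ck_at_mono: "Ck_at l A B f p \<Longrightarrow> k \<le> l \<Longrightarrow> Ck_at k A B f p"
  unfolding Ck_at_def using Ck_on_mono by blast

text \<open>In new charts the map is the old coordinate expression between two transition maps. The
  domain is cut down twice: to where the value lies in the new target chart, and to where the old
  and new source charts overlap.\<close>

lemma Ck_at_in_charts:
  assumes A: "chart_system k A" and B: "chart_system k B" and f: "Ck_at k A B f p"
    and cd: "c \<in> A" "d \<in> B" "p \<in> fst c" "f p \<in> fst d"
  obtains N where "open N" "snd c p \<in> N" "N \<subseteq> snd c ` fst c" "\<And>x. x \<in> N \<Longrightarrow> f (chart_inv c x) \<in> fst d"
    "Ck_on k N (\<lambda>x. snd d (f (chart_inv c x)))"
proof -
  obtain c0 d0 N0 where 0: "c0 \<in> A" "d0 \<in> B" "p \<in> fst c0" "open N0" "snd c0 p \<in> N0" "N0 \<subseteq> snd c0 ` fst c0"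
    "\<And>x. x \<in> N0 \<Longrightarrow> f (chart_inv c0 x) \<in> fst d0" "Ck_on k N0 (\<lambda>x. snd d0 (f (chart_inv c0 x)))"
    using f unfolding Ck_at_def by blast
  note c = chart_systemD[OF A cd(1)] and c0 = chart_systemD[OF A 0(1)] and d0 = chart_systemD[OF B 0(2)]
  define N1 where "N1 = {x \<in> N0. snd d0 (f (chart_inv c0 x)) \<in> snd d0 ` (fst d0 \<inter> fst d)}"
  have oN1: "open N1"
    unfolding N1_def by (rule Ck_on_open_preimage[OF 0(4,8) d0(4)[OF cd(2)]])
  let ?C = "snd c ` (fst c \<inter> fst c0)"
  define N where "N = {x \<in> ?C. snd c0 (chart_inv c x) \<in> N1}"
  have oN: "open N"
    unfolding N_def by (rule Ck_on_open_preimage[OF c(4,5)[OF 0(1)] oN1])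
  have inC: "chart_inv c x \<in> fst c" "chart_inv c x \<in> fst c0" "chart_inv c0 (snd c0 (chart_inv c x)) = chart_inv c x"
    if "x \<in> ?C" for x
    using that c(3) c0(3) by auto
  \<comment> \<open>The condition is stated on coordinates; injectivity of \<open>d0\<close> brings
    it back to the manifold.\<close>
  have inN: "f (chart_inv c x) \<in> fst d0 \<inter> fst d" if "x \<in> N" for x
  proof -
    have x: "x \<in> ?C" "snd c0 (chart_inv c x) \<in> N1" using that by (auto simp: N_def)
    then have 1: "f (chart_inv c x) \<in> fst d0" "snd d0 (f (chart_inv c x)) \<in> snd d0 ` (fst d0 \<inter> fst d)"
      using 0(7)[of "snd c0 (chart_inv c x)"] inC[OF x(1)] by (auto simp: N1_def)
    then obtain q where q: "q \<in> fst d0 \<inter> fst d" "snd d0 (f (chart_inv c x)) = snd d0 q" by auto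
    then have "f (chart_inv c x) = q" using inj_onD[OF d0(1) q(2) 1(1)] by blast
    then show ?thesis using q(1) by simp
  qed
  have "f p \<in> fst d0" using 0(7)[OF 0(5)] c0(3)[OF 0(3)] by simp
  then have "snd c0 p \<in> N1" using 0(5) cd(4) c0(3)[OF 0(3)] by (simp add: N1_def)
  then have "snd c p \<in> N" using 0(3) cd(3) c(3) by (auto simp: N_def)
  moreover have "N \<subseteq> snd c ` fst c" by (auto simp: N_def)
  moreover have "Ck_on k N (\<lambda>x. snd d (f (chart_inv c x)))"
  proof -
    have "Ck_on k N (\<lambda>x. snd c0 (chart_inv c x))"
      by (rule Ck_on_subset[OF c(5)[OF 0(1)]]) (auto simp: N_def)
    from Ck_on_compose[OF oN oN1 this Ck_on_subset[OF 0(8)]]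
    have "Ck_on k N (\<lambda>x. snd d0 (f (chart_inv c0 (snd c0 (chart_inv c x)))))" by (auto simp: N_def N1_def)
    from Ck_on_compose[OF oN d0(4)[OF cd(2)] this d0(5)[OF cd(2)]]
    have "Ck_on k N (\<lambda>x. snd d (chart_inv d0 (snd d0 (f (chart_inv c0 (snd c0 (chart_inv c x)))))))"
      by (auto simp: N_def N1_def)
    then show ?thesis
    proof (rule Ck_on_cong[OF oN])
      fix x assume x: "x \<in> N"
      then have "x \<in> ?C" by (simp add: N_def)
      then show "snd d (chart_inv d0 (snd d0 (f (chart_inv c0 (snd c0 (chart_inv c x)))))) =
          snd d (f (chart_inv c x))"
        using inC(3) d0(3) inN[OF x] by simp
    qed
  qed
  ultimately show thesis using that oN inN by blast
qed

lemma Ck_at_compose: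
  assumes A: "chart_system k A" and B: "chart_system k B" and C: "chart_system k C"
    and f: "Ck_at k A B f p" and g: "Ck_at k B C g (f p)"
  shows "Ck_at k A C (\<lambda>x. g (f x)) p"
proof -
  obtain c d Nf where f': "c \<in> A" "d \<in> B" "p \<in> fst c" "open Nf" "snd c p \<in> Nf" "Nf \<subseteq> snd c ` fst c"
    "\<And>x. x \<in> Nf \<Longrightarrow> f (chart_inv c x) \<in> fst d" "Ck_on k Nf (\<lambda>x. snd d (f (chart_inv c x)))"
    using f unfolding Ck_at_def by blast
  have fp: "f p \<in> fst d" using f'(5,7) chart_systemD(3)[OF A f'(1,3)] by force
  obtain e where e: "e \<in> C" "g (f p) \<in> fst e"
  proof -
    obtain c' e N where "c' \<in> B" "e \<in> C" "f p \<in> fst c'" "snd c' (f p) \<in> N" "\<forall>x\<in>N. g (chart_inv c' x) \<in> fst e"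
      using g unfolding Ck_at_def by blast
    then show thesis using that[of e] chart_systemD(3)[OF B, of c' "f p"] by force
  qed
  obtain Ng where Ng: "open Ng" "snd d (f p) \<in> Ng" and "Ng \<subseteq> snd d ` fst d" and
    Ng': "\<And>x. x \<in> Ng \<Longrightarrow> g (chart_inv d x) \<in> fst e"
    and CkNg: "Ck_on k Ng (\<lambda>x. snd e (g (chart_inv d x)))"
  proof -
    show ?thesis by (rule Ck_at_in_charts[OF B C g f'(2) e(1) fp e(2)]) (rule that)
  qed
  define N where "N = {x \<in> Nf. snd d (f (chart_inv c x)) \<in> Ng}"
  have oN: "open N" unfolding N_def by (rule Ck_on_open_preimage[OF f'(4,8) Ng(1)])
  have eq: "chart_inv d (snd d (f (chart_inv c x))) = f (chart_inv c x)" if "x \<in> N" for x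
    using that f'(7) chart_systemD(3)[OF B f'(2)] by (simp add: N_def)
  have "Ck_on k N (\<lambda>x. snd e (g (chart_inv d (snd d (f (chart_inv c x))))))"
    by (rule Ck_on_compose[OF oN Ng(1) Ck_on_subset[OF f'(8)] CkNg]) (auto simp: N_def)
  then have "Ck_on k N (\<lambda>x. snd e (g (f (chart_inv c x))))"
    by (rule Ck_on_cong[OF oN]) (simp add: eq)
  moreover have "g (f (chart_inv c x)) \<in> fst e" if "x \<in> N" for x
    using Ng'[of "snd d (f (chart_inv c x))"] eq[OF that] that by (simp add: N_def)
  moreover have "snd c p \<in> N"
    using f'(5) Ng(2) chart_systemD(3)[OF A f'(1,3)] by (simp add: N_def)
  ultimately show ?thesis
    unfolding Ck_at_def using f'(1,3,6) e(1) oN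
    by (intro bexI[of _ c] bexI[of _ e] exI[of _ N]) (auto simp: N_def)
qed

lemma Ck_at_cong:
  assumes A: "\<And>c. c \<in> A \<Longrightarrow> is_chart X c" and S: "openin X S" "p \<in> S" "\<And>q. q \<in> S \<Longrightarrow> f q = g q"
    and f: "Ck_at k A B f p"
  shows "Ck_at k A B g p"
proof -
  obtain c d N where f': "c \<in> A" "d \<in> B" "p \<in> fst c" "open N" "snd c p \<in> N" "N \<subseteq> snd c ` fst c"
    "\<And>x. x \<in> N \<Longrightarrow> f (chart_inv c x) \<in> fst d" "Ck_on k N (\<lambda>x. snd d (f (chart_inv c x)))"
    using f unfolding Ck_at_def by blast
  define M where "M = N \<inter> snd c ` (fst c \<inter> S)"
  have oM: "open M" unfolding M_def using f'(4) is_chart_open_image[OF A[OF f'(1)] S(1)] by blast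
  have eq: "f (chart_inv c x) = g (chart_inv c x)" if "x \<in> M" for x
    using that S(3) chart_inv_left[OF is_chart_inj[OF A[OF f'(1)]]] by (auto simp: M_def)
  have "Ck_on k M (\<lambda>x. snd d (f (chart_inv c x)))" by (rule Ck_on_subset[OF f'(8)]) (auto simp: M_def)
  then have "Ck_on k M (\<lambda>x. snd d (g (chart_inv c x)))" by (rule Ck_on_cong[OF oM]) (simp add: eq)
  moreover have "\<forall>x\<in>M. g (chart_inv c x) \<in> fst d" using f'(7) eq by (metis IntD1 M_def)
  moreover have "snd c p \<in> M" using f' S by (auto simp: M_def)
  ultimately show ?thesis unfolding Ck_at_def using f' oM
    by (intro bexI[of _ c] bexI[of _ d] exI[of _ M]) (auto simp: M_def)
qed

lemma Ck_at_id:
  assumes "chart_system k A" "c \<in> A" "p \<in> fst c"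
  shows "Ck_at k A A (\<lambda>x. x) p"
  unfolding Ck_at_def
proof (intro bexI[of _ c] exI[of _ "snd c ` fst c"] conjI)
  show "Ck_on k (snd c ` fst c) (\<lambda>x. snd c (chart_inv c x))"
    by (rule Ck_on_cong[OF chart_systemD(2)[OF assms(1,2)] Ck_on_id]) (simp add: chart_inv_right)
qed (use assms chart_systemD[OF assms(1,2)] chart_inv_right in \<open>auto\<close>)

lemma Ck_at_const:
  assumes "chart_system k A" "c \<in> A" "p \<in> fst c" "d \<in> B" "q \<in> fst d"
  shows "Ck_at k A B (\<lambda>x. q) p"
  unfolding Ck_at_def
  by (intro bexI[of _ c] bexI[of _ d] exI[of _ "snd c ` fst c"] conjI)
    (use assms chart_systemD[OF assms(1,2)] in \<open>auto intro: Ck_on_const\<close>)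

lemma Ck_at_std_const:
  "chart_system k A \<Longrightarrow> c \<in> A \<Longrightarrow> p \<in> fst c \<Longrightarrow> Ck_at k A std_atlas (\<lambda>x. q) p"
  by (rule Ck_at_const[of k A c p "(UNIV, \<lambda>x. x)"]) (auto simp: std_atlas_def)

lemma Ck_at_std_iff:
  "Ck_at k A std_atlas f p \<longleftrightarrow> (\<exists>c\<in>A. \<exists>N. p \<in> fst c \<and> open N \<and> snd c p \<in> N \<and> N \<subseteq> snd c ` fst c \<and>
     Ck_on k N (\<lambda>x. f (chart_inv c x)))"
  by (simp add: Ck_at_def std_atlas_def)

lemma Ck_at_std_in_chart:
  assumes A: "chart_system k A" and f: "Ck_at k A std_atlas f p" and cd: "c \<in> A" "p \<in> fst c"
  obtains N where "open N" "snd c p \<in> N" "N \<subseteq> snd c ` fst c" "Ck_on k N (\<lambda>x. f (chart_inv c x))"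
  using Ck_at_in_charts[OF A chart_system_std_atlas f cd(1) _ cd(2), of "(UNIV, \<lambda>x. x)"]
  by (auto simp: std_atlas_def)

lemma Ck_at_std_op:
  fixes A :: "('x, 'e::euclidean_space) chart set" and f g :: "'x \<Rightarrow> 'f::euclidean_space"
  assumes A: "chart_system k A" and f: "Ck_at k A std_atlas f p" and g: "Ck_at k A std_atlas g p"
    and op: "\<And>N (f :: 'e \<Rightarrow> 'f) g. open N \<Longrightarrow> Ck_on k N f \<Longrightarrow> Ck_on k N g \<Longrightarrow> Ck_on k N (\<lambda>x. h (f x) (g x))"
  shows "Ck_at k A std_atlas (\<lambda>x. h (f x) (g x)) p"
proof -
  obtain c N where f': "c \<in> A" "p \<in> fst c" "open N" "snd c p \<in> N" "N \<subseteq> snd c ` fst c"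
    "Ck_on k N (\<lambda>x. f (chart_inv c x))"
    using f unfolding Ck_at_std_iff by blast
  obtain M where g': "open M" "snd c p \<in> M" "M \<subseteq> snd c ` fst c" "Ck_on k M (\<lambda>x. g (chart_inv c x))"
    by (rule Ck_at_std_in_chart[OF A g f'(1,2)])
  have "Ck_on k (N \<inter> M) (\<lambda>x. h (f (chart_inv c x)) (g (chart_inv c x)))"
    by (rule op[of "N \<inter> M" "\<lambda>x. f (chart_inv c x)" "\<lambda>x. g (chart_inv c x)"])
      (use f' g' in \<open>auto intro: Ck_on_subset[OF f'(6)] Ck_on_subset[OF g'(4)]\<close>)
  then show ?thesis unfolding Ck_at_std_iff using f' g'
    by (intro bexI[of _ c] exI[of _ "N \<inter> M"]) auto
qed

lemmas Ck_at_add = Ck_at_std_op[of _ _ _ _ _ "(+)", OF _ _ _ Ck_on_add]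
lemmas Ck_at_diff = Ck_at_std_op[of _ _ _ _ _ "(-)", OF _ _ _ Ck_on_diff]

section \<open>Maps into products and their components\<close>

lemma Ck_at_event_pair:
  assumes C: "chart_system k C" and B: "chart_system k B"
    and \<tau>: "Ck_at k C std_atlas \<tau> p" and f: "Ck_at k C B f p"
  shows "Ck_at k C (event_atlas B) (\<lambda>x. (\<tau> x, f x)) p"
proof -
  obtain c d N where f': "c \<in> C" "d \<in> B" "p \<in> fst c" "open N" "snd c p \<in> N" "N \<subseteq> snd c ` fst c"
    "\<And>x. x \<in> N \<Longrightarrow> f (chart_inv c x) \<in> fst d" "Ck_on k N (\<lambda>x. snd d (f (chart_inv c x)))"
    using f unfolding Ck_at_def by blast
  obtain M where M: "open M" "snd c p \<in> M" "M \<subseteq> snd c ` fst c" "Ck_on k M (\<lambda>x. \<tau> (chart_inv c x))"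
    by (rule Ck_at_std_in_chart[OF C \<tau> f'(1,3)])
  have "Ck_on k (N \<inter> M) (\<lambda>x. (\<tau> (chart_inv c x), snd d (f (chart_inv c x))))"
    using f' M by (intro Ck_on_Pair Ck_on_subset[OF f'(8)] Ck_on_subset[OF M(4)]) auto
  then show ?thesis unfolding Ck_at_def event_atlas_def using f' M
    by (intro bexI[of _ c] bexI[of _ "event_chart d"] exI[of _ "N \<inter> M"]) auto
qed

lemma Ck_at_line_pair:
  assumes C: "chart_system k C" and B: "chart_system k B"
    and \<tau>: "Ck_at k C std_atlas \<tau> p" and f: "Ck_at k C B f p"
  shows "Ck_at k C (line_chart ` B) (\<lambda>x. (f x, \<tau> x)) p"
proof -
  obtain c d N where f': "c \<in> C" "d \<in> B" "p \<in> fst c" "open N" "snd c p \<in> N" "N \<subseteq> snd c ` fst c"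
    "\<And>x. x \<in> N \<Longrightarrow> f (chart_inv c x) \<in> fst d" "Ck_on k N (\<lambda>x. snd d (f (chart_inv c x)))"
    using f unfolding Ck_at_def by blast
  obtain M where M: "open M" "snd c p \<in> M" "M \<subseteq> snd c ` fst c" "Ck_on k M (\<lambda>x. \<tau> (chart_inv c x))"
    by (rule Ck_at_std_in_chart[OF C \<tau> f'(1,3)])
  have "Ck_on k (N \<inter> M) (\<lambda>x. (snd d (f (chart_inv c x)), \<tau> (chart_inv c x)))"
    using f' M by (intro Ck_on_Pair Ck_on_subset[OF f'(8)] Ck_on_subset[OF M(4)]) auto
  then show ?thesis unfolding Ck_at_def using f' M
    by (intro bexI[of _ c] bexI[of _ "line_chart d"] exI[of _ "N \<inter> M"]) auto
qed

lemma Ck_at_event_fst: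
  assumes A: "chart_system k A" and c: "c \<in> A" "snd p \<in> fst c"
  shows "Ck_at k (event_atlas A) std_atlas fst p"
  unfolding Ck_at_std_iff
proof (intro bexI[of _ "event_chart c"] exI[of _ "UNIV \<times> snd c ` fst c"] conjI)
  have o: "open (UNIV \<times> snd c ` fst c)" using chart_systemD(2)[OF A c(1)] by (simp add: open_Times)
  then show "Ck_on k (UNIV \<times> snd c ` fst c) (\<lambda>x. fst (chart_inv (event_chart c) x))"
    by (rule Ck_on_cong[OF _ Ck_on_linear[OF bounded_linear_fst]])
      (auto simp: chart_inv_event_chart[OF chart_systemD(1)[OF A c(1)]])
  show "open (UNIV \<times> snd c ` fst c)" by (rule o)
qed (use c in \<open>cases p, auto simp: event_atlas_def event_chart_image\<close>)+

lemma Ck_at_event_snd: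
  assumes A: "chart_system k A" and c: "c \<in> A" "snd p \<in> fst c"
  shows "Ck_at k (event_atlas A) A snd p"
  unfolding Ck_at_def
proof (intro bexI[of _ "event_chart c"] bexI[of _ c] exI[of _ "UNIV \<times> snd c ` fst c"] conjI)
  note inj = chart_systemD(1)[OF A c(1)]
  have o: "open (UNIV \<times> snd c ` fst c)" using chart_systemD(2)[OF A c(1)] by (simp add: open_Times)
  then show "Ck_on k (UNIV \<times> snd c ` fst c) (\<lambda>x. snd c (snd (chart_inv (event_chart c) x)))"
    by (rule Ck_on_cong[OF _ Ck_on_linear[OF bounded_linear_snd]])
      (auto simp: chart_inv_event_chart[OF inj] chart_inv_left[OF inj])
  show "open (UNIV \<times> snd c ` fst c)" by (rule o)
  show "\<forall>x\<in>UNIV \<times> snd c ` fst c. snd (chart_inv (event_chart c) x) \<in> fst c"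
    by (auto simp: chart_inv_event_chart[OF inj] chart_inv_left[OF inj])
qed (use c in \<open>cases p, auto simp: event_atlas_def event_chart_image\<close>)+

lemma Ck_at_line_fst:
  assumes A: "chart_system k A" and c: "c \<in> A" "fst p \<in> fst c"
  shows "Ck_at k (line_chart ` A) A fst p"
  unfolding Ck_at_def
proof (intro bexI[of _ "line_chart c"] bexI[of _ c] exI[of _ "snd c ` fst c \<times> UNIV"] conjI)
  note inj = chart_systemD(1)[OF A c(1)]
  have o: "open (snd c ` fst c \<times> UNIV)" using chart_systemD(2)[OF A c(1)] by (simp add: open_Times)
  then show "Ck_on k (snd c ` fst c \<times> UNIV) (\<lambda>x. snd c (fst (chart_inv (line_chart c) x)))"
    by (rule Ck_on_cong[OF _ Ck_on_linear[OF bounded_linear_fst]])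
      (auto simp: chart_inv_line_chart[OF inj] chart_inv_left[OF inj])
  show "open (snd c ` fst c \<times> UNIV)" by (rule o)
  show "\<forall>x\<in>snd c ` fst c \<times> UNIV. fst (chart_inv (line_chart c) x) \<in> fst c"
    by (auto simp: chart_inv_line_chart[OF inj] chart_inv_left[OF inj])
qed (use c in \<open>cases p, auto simp: line_chart_image\<close>)+

lemma Ck_at_line_snd:
  assumes A: "chart_system k A" and c: "c \<in> A" "fst p \<in> fst c"
  shows "Ck_at k (line_chart ` A) std_atlas snd p"
  unfolding Ck_at_std_iff
proof (intro bexI[of _ "line_chart c"] exI[of _ "snd c ` fst c \<times> UNIV"] conjI)
  have o: "open (snd c ` fst c \<times> UNIV)" using chart_systemD(2)[OF A c(1)] by (simp add: open_Times)
  then show "Ck_on k (snd c ` fst c \<times> UNIV) (\<lambda>x. snd (chart_inv (line_chart c) x))"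
    by (rule Ck_on_cong[OF _ Ck_on_linear[OF bounded_linear_snd]])
      (auto simp: chart_inv_line_chart[OF chart_systemD(1)[OF A c(1)]])
  show "open (snd c ` fst c \<times> UNIV)" by (rule o)
qed (use c in \<open>cases p, auto simp: line_chart_image\<close>)+

text \<open>Continuity comes along with differentiability: the coordinate expressions are
  continuous, and charts are homeomorphisms onto open sets.\<close>

lemma Ck_map_of_Ck_at:
  assumes A: "chart_system k A" "\<And>c. c \<in> A \<Longrightarrow> is_chart X c"
    and B: "chart_system k B" "\<And>d. d \<in> B \<Longrightarrow> is_chart Y d"
    and S: "openin X S" and f: "\<And>p. p \<in> S \<Longrightarrow> Ck_at k A B f p"
  shows "Ck_map k X A S Y B f"
  unfolding Ck_map_def
proof (intro conjI ballI)
  have ts: "topspace (subtopology X S) = S" using openin_subset[OF S] by auto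
  have loc: "\<exists>W. openin X W \<and> p \<in> W \<and> f ` W \<subseteq> O' \<inter> topspace Y"
    if p: "p \<in> S" and O: "openin Y O'" "f p \<in> O'" for p O'
  proof -
    obtain c d N where f': "c \<in> A" "d \<in> B" "p \<in> fst c" "open N" "snd c p \<in> N" "N \<subseteq> snd c ` fst c"
      "\<And>x. x \<in> N \<Longrightarrow> f (chart_inv c x) \<in> fst d" "Ck_on k N (\<lambda>x. snd d (f (chart_inv c x)))"
      using f[OF p] unfolding Ck_at_def by blast
    note inv = chart_systemD(3)[OF A(1) f'(1)]
    define N' where "N' = {x \<in> N. snd d (f (chart_inv c x)) \<in> snd d ` (fst d \<inter> O')}"
    have oN': "open N'"
      unfolding N'_def by (rule Ck_on_open_preimage[OF f'(4,8) is_chart_open_image[OF B(2)[OF f'(2)] O(1)]])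
    show ?thesis
    proof (intro exI conjI)
      show "openin X {p \<in> fst c. snd c p \<in> N'}" by (rule is_chart_open_preimage[OF A(2)[OF f'(1)] oN'])
      have "f p \<in> fst d" using f'(7)[OF f'(5)] inv[OF f'(3)] by simp
      then show "p \<in> {p \<in> fst c. snd c p \<in> N'}" using f'(3,5) O(2) inv[OF f'(3)] by (simp add: N'_def)
      show "f ` {p \<in> fst c. snd c p \<in> N'} \<subseteq> O' \<inter> topspace Y"
      proof safe
        fix q assume q: "q \<in> fst c" "snd c q \<in> N'"
        have fd: "f q \<in> fst d" using f'(7)[of "snd c q"] q inv[OF q(1)] by (simp add: N'_def)
        then show "f q \<in> topspace Y" using is_chart_subset[OF B(2)[OF f'(2)]] by blast
        have "snd d (f q) \<in> snd d ` (fst d \<inter> O')" using q inv[OF q(1)] by (simp add: N'_def)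
        then obtain q' where "q' \<in> fst d \<inter> O'" "snd d (f q) = snd d q'" by blast
        then show "f q \<in> O'" using fd inj_onD[OF chart_systemD(1)[OF B(1) f'(2)]] by (metis Int_iff)
      qed
    qed
  qed
  show "continuous_map (subtopology X S) Y f"
    unfolding continuous_map_def ts
  proof (intro conjI allI impI)
    show "f \<in> S \<rightarrow> topspace Y"
    proof
      fix p assume p: "p \<in> S"
      obtain c d N where f': "c \<in> A" "d \<in> B" "p \<in> fst c" "snd c p \<in> N"
        "\<And>x. x \<in> N \<Longrightarrow> f (chart_inv c x) \<in> fst d"
        using f[OF p] unfolding Ck_at_def by blast
      then show "f p \<in> topspace Y"
        using is_chart_subset[OF B(2)[OF f'(2)]] chart_systemD(3)[OF A(1) f'(1,3)] by force
    qed
    fix U assume U: "openin Y U"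
    have "openin X {x \<in> S. f x \<in> U}"
    proof (subst openin_subopen, intro ballI)
      fix p assume "p \<in> {x \<in> S. f x \<in> U}"
      then obtain W where "openin X W" "p \<in> W" "f ` W \<subseteq> U \<inter> topspace Y" "p \<in> S" using loc[of p U] U by blast
      then show "\<exists>T. openin X T \<and> p \<in> T \<and> T \<subseteq> {x \<in> S. f x \<in> U}"
        using S by (intro exI[of _ "W \<inter> S"]) auto
    qed
    then show "openin (subtopology X S) {x \<in> S. f x \<in> U}"
      using S by (simp add: openin_open_subtopology)
  qed
  fix c d assume cd: "c \<in> A" "d \<in> B"
  show "Ck_on k (snd c ` {p \<in> fst c \<inter> S. f p \<in> fst d}) (snd d \<circ> f \<circ> chart_inv c)"
  proof (rule Ck_on_local)
    fix x assume "x \<in> snd c ` {p \<in> fst c \<inter> S. f p \<in> fst d}"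
    then obtain p where p: "x = snd c p" "p \<in> fst c" "p \<in> S" "f p \<in> fst d" by blast
    then show "\<exists>U. open U \<and> x \<in> U \<and> Ck_on k U (snd d \<circ> f \<circ> chart_inv c)"
      by (rule_tac Ck_at_in_charts[OF A(1) B(1) f[OF p(3)] cd p(2,4)]) (auto simp: o_def)
  qed
qed

lemma Ck_at_of_Ck_map:
  assumes A: "\<And>c. c \<in> A \<Longrightarrow> is_chart X c" and B: "\<And>d. d \<in> B \<Longrightarrow> is_chart Y d"
    and S: "openin X S" and f: "Ck_map k X A S Y B f"
    and cd: "c \<in> A" "d \<in> B" "p \<in> S" "p \<in> fst c" "f p \<in> fst d"
  shows "Ck_at k A B f p"
  unfolding Ck_at_def
proof (intro bexI[OF _ cd(1)] bexI[OF _ cd(2)] exI conjI)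
  let ?N = "snd c ` {p \<in> fst c \<inter> S. f p \<in> fst d}"
  have "openin Y (fst d)" using B[OF cd(2)] by (simp add: is_chart_def)
  then have "openin (subtopology X S) {x \<in> topspace (subtopology X S). f x \<in> fst d}"
    using f openin_continuous_map_preimage unfolding Ck_map_def by blast
  then have "openin X {x \<in> S. f x \<in> fst d}"
    using S openin_subset[OF S] openin_trans_full by (auto simp: Int_absorb1)
  from is_chart_open_image[OF A[OF cd(1)] this]
  have "open (snd c ` (fst c \<inter> {x \<in> S. f x \<in> fst d}))" .
  moreover have "fst c \<inter> {x \<in> S. f x \<in> fst d} = {p \<in> fst c \<inter> S. f p \<in> fst d}" by auto
  ultimately show "open ?N" by simp
  show "Ck_on k ?N (\<lambda>x. snd d (f (chart_inv c x)))"
    using f cd(1,2) by (simp add: Ck_map_def o_def)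
qed (use cd chart_inv_left[OF is_chart_inj[OF A[OF cd(1)]]] in auto)

subsection \<open>Differentials in charts\<close>

lemma coord_deriv_works:
  assumes A: "chart_system (Suc k) A" and B: "chart_system (Suc k) B" and f: "Ck_at (Suc k) A B f p"
    and cd: "c \<in> A" "d \<in> B" "p \<in> fst c" "f p \<in> fst d"
  shows "((\<lambda>x. snd d (f (chart_inv c x))) has_derivative coord_deriv c d f p) (at (snd c p))"
proof -
  obtain N where "open N" "snd c p \<in> N" "N \<subseteq> snd c ` fst c" "\<And>x. x \<in> N \<Longrightarrow> f (chart_inv c x) \<in> fst d"
    "Ck_on (Suc k) N (\<lambda>x. snd d (f (chart_inv c x)))"
  proof -
    show ?thesis by (rule Ck_at_in_charts[OF A B f cd]) (rule that)
  qed
  from Ck_on_SucD_derivative[OF this(5,2)] show ?thesis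
    by (simp add: coord_deriv_def o_def)
qed

lemma coord_deriv_linear:
  assumes "chart_system (Suc k) A" "chart_system (Suc k) B" "Ck_at (Suc k) A B f p"
    "c \<in> A" "d \<in> B" "p \<in> fst c" "f p \<in> fst d"
  shows "linear (coord_deriv c d f p)"
  using has_derivative_linear[OF coord_deriv_works[OF assms]] .

lemma coord_deriv_compose:
  assumes A: "chart_system (Suc k) A" and B: "chart_system (Suc k) B" and C: "chart_system (Suc k) C"
    and f: "Ck_at (Suc k) A B f p" and g: "Ck_at (Suc k) B C g (f p)"
    and cde: "c \<in> A" "d \<in> B" "e \<in> C" "p \<in> fst c" "f p \<in> fst d" "g (f p) \<in> fst e"
  shows "coord_deriv c e (\<lambda>x. g (f x)) p v = coord_deriv d e g (f p) (coord_deriv c d f p v)"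
proof -
  obtain N where N: "open N" "snd c p \<in> N" "N \<subseteq> snd c ` fst c" "\<And>x. x \<in> N \<Longrightarrow> f (chart_inv c x) \<in> fst d"
    "Ck_on (Suc k) N (\<lambda>x. snd d (f (chart_inv c x)))"
  proof -
    show ?thesis by (rule Ck_at_in_charts[OF A B f cde(1,2,4,5)]) (rule that)
  qed
  have inv: "chart_inv c (snd c p) = p" using chart_systemD(3)[OF A cde(1,4)] .
  have "((\<lambda>x. snd e (g (chart_inv d x))) has_derivative coord_deriv d e g (f p)) (at (snd d (f (chart_inv c (snd c p)))))"
    unfolding inv by (rule coord_deriv_works[OF B C g cde(2,3,5,6)])
  from diff_chain_at[OF coord_deriv_works[OF A B f cde(1,2,4,5)] this]
  have "((\<lambda>x. snd e (g (chart_inv d (snd d (f (chart_inv c x)))))) has_derivative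
      (\<lambda>v. coord_deriv d e g (f p) (coord_deriv c d f p v))) (at (snd c p))"
    by (simp add: o_def)
  then have "((\<lambda>x. snd e (g (f (chart_inv c x)))) has_derivative
      (\<lambda>v. coord_deriv d e g (f p) (coord_deriv c d f p v))) (at (snd c p))"
    by (rule has_derivative_transform_within_open[OF _ N(1,2)])
      (use N(4) chart_systemD(3)[OF B cde(2)] in auto)
  from fun_cong[OF frechet_derivative_at[OF this], of v] show ?thesis
    by (simp add: coord_deriv_def o_def)
qed

text \<open>The two Frechet derivatives are choices from the same property, since maps that agree
  near a point have the same derivatives there.\<close>

lemma coord_deriv_cong:
  assumes c: "is_chart X c" and S: "openin X S" "p \<in> S" "p \<in> fst c" "\<And>q. q \<in> S \<Longrightarrow> f q = g q"
  shows "coord_deriv c d f p = coord_deriv c d g p"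
proof -
  let ?N = "snd c ` (fst c \<inter> S)"
  have o: "open ?N" and p: "snd c p \<in> ?N" using is_chart_open_image[OF c S(1)] S by auto
  have eq: "(snd d \<circ> f \<circ> chart_inv c) x = (snd d \<circ> g \<circ> chart_inv c) x" if "x \<in> ?N" for x
    using that chart_inv_left[OF is_chart_inj[OF c]] S(4) by auto
  have "((snd d \<circ> f \<circ> chart_inv c) has_derivative D) (at (snd c p)) \<longleftrightarrow>
      ((snd d \<circ> g \<circ> chart_inv c) has_derivative D) (at (snd c p))" for D
    using has_derivative_transform_within_open[OF _ o p, of _ D UNIV] eq by (metis (no_types, lifting))
  then show ?thesis by (simp add: coord_deriv_def frechet_derivative_def)
qed

lemma coord_deriv_id:
  assumes "chart_system k A" "c \<in> A" "p \<in> fst c"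
  shows "coord_deriv c c (\<lambda>x. x) p v = v"
proof -
  have "((\<lambda>x. snd c (chart_inv c x)) has_derivative (\<lambda>v. v)) (at (snd c p))"
    by (rule has_derivative_transform_within_open[OF has_derivative_ident chart_systemD(2)[OF assms(1,2)]])
      (use assms chart_inv_right[of _ c] in auto)
  from frechet_derivative_at[OF this, symmetric] show ?thesis
    by (simp add: coord_deriv_def o_def)
qed

section \<open>Rosen coordinates from a solution and its characteristics\<close>

subsection \<open>Linear algebra of inner products\<close>

definition inner_form :: "('e::euclidean_space \<Rightarrow> 'e \<Rightarrow> real) \<Rightarrow> bool" where
  "inner_form G \<longleftrightarrow> bilinear G \<and> (\<forall>v w. G v w = G w v) \<and> (\<forall>v. v \<noteq> 0 \<longrightarrow> G v v > 0)"

lemma inner_form_unique: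
  assumes "inner_form G" "\<And>v. G w v = G z v"
  shows "w = z"
proof -
  have "G (w - z) (w - z) = 0"
    using assms bilinear_lsub[of G w z] unfolding inner_form_def by (metis eq_iff_diff_eq_0)
  then show ?thesis using assms(1) unfolding inner_form_def
    by (metis eq_iff_diff_eq_0 less_irrefl)
qed

text \<open>Covectors are represented by vectors through the Euclidean inner product of the model
  space, so that raising an index becomes an injective linear equation in \<open>'e\<close>, to
  which \<open>Ck_on_solve\<close> applies.\<close>

definition lower_index :: "('e::euclidean_space \<Rightarrow> 'e \<Rightarrow> real) \<Rightarrow> 'e \<Rightarrow> 'e" where
  "lower_index G w = (\<Sum>b\<in>Basis. G w b *\<^sub>R b)"

lemma lower_index_inner:
  assumes "inner_form G" shows "lower_index G w \<bullet> v = G w v"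
proof -
  have "linear (G w)" using assms by (simp add: inner_form_def bilinear_def)
  from linear_componentwise_sum[OF this, of v]
  show ?thesis by (simp add: lower_index_def inner_sum_left inner_commute[of v] mult.commute)
qed

lemma linear_lower_index:
  assumes "inner_form G" shows "linear (lower_index G)"
proof -
  have "bilinear G" using assms by (simp add: inner_form_def)
  then show ?thesis unfolding lower_index_def
    by (intro linearI) (simp_all add: bilinear_ladd bilinear_lmul scaleR_add_left sum.distrib scaleR_sum_right)
qed

lemma inj_lower_index: "inner_form G \<Longrightarrow> inj (lower_index G)"
  by (rule injI) (metis inner_form_unique lower_index_inner)

lemma sharp_eqI:
  assumes "inner_form G" "\<And>v. G w v = \<alpha> v"
  shows "sharp G \<alpha> = w"
  unfolding sharp_def
  by (rule the_equality) (use assms inner_form_unique[OF assms(1)] in auto)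

text \<open>An injective endomorphism of a finite-dimensional space is onto, so the dual vector
  exists.\<close>

lemma sharp_works:
  assumes "inner_form G" "linear \<alpha>"
  shows "G (sharp G \<alpha>) v = \<alpha> v"
proof -
  have "surj (lower_index G)"
    using linear_inj_imp_surj[OF linear_lower_index inj_lower_index] assms(1) by blast
  then obtain w where w: "lower_index G w = (\<Sum>b\<in>Basis. \<alpha> b *\<^sub>R b)" by (metis surjD)
  have "G w v = \<alpha> v" for v
    using lower_index_inner[OF assms(1), of w v] linear_componentwise_sum[OF assms(2), of v]
    by (simp add: w inner_sum_left inner_commute[of v] mult.commute)
  then show ?thesis using sharp_eqI[OF assms(1), of w \<alpha>] by simp
qed

lemma riemannian_metric_onD:
  assumes "riemannian_metric_on k A D a" "c \<in> A" "(t, q) \<in> D" "q \<in> fst c"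
  shows "inner_form (a c (t, q))"
    and "c' \<in> A \<Longrightarrow> q \<in> fst c' \<Longrightarrow> a c (t, q) v w =
      a c' (t, q) (coord_deriv c c' (\<lambda>x. x) q v) (coord_deriv c c' (\<lambda>x. x) q w)"
  using assms unfolding riemannian_metric_on_def inner_form_def by blast+

lemma one_form_onD:
  assumes "one_form_on k A D b" "c \<in> A" "(t, q) \<in> D" "q \<in> fst c"
  shows "linear (b c (t, q))"
    and "c' \<in> A \<Longrightarrow> q \<in> fst c' \<Longrightarrow> b c (t, q) v = b c' (t, q) (coord_deriv c c' (\<lambda>x. x) q v)"
  using assms unfolding one_form_on_def by blast+

subsection \<open>Differentials on events and on spacetime\<close>

abbreviation std_chart :: "('e, 'e) chart" where "std_chart \<equiv> (UNIV, \<lambda>x. x)"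

lemma std_chart_mem [simp]: "std_chart \<in> std_atlas"
  by (simp add: std_atlas_def)

lemma event_chart_mem [simp]: "c \<in> A \<Longrightarrow> event_chart c \<in> event_atlas A"
  by (simp add: event_atlas_def)

lemma spacetime_chart_mem [simp]: "c \<in> A \<Longrightarrow> spacetime_chart c \<in> spacetime_atlas A"
  by (simp add: spacetime_atlas_def)

lemma spacetime_chart_simps [simp]:
  "fst (spacetime_chart c) = UNIV \<times> fst c \<times> UNIV" "snd (spacetime_chart c) (t, q, y) = (t, snd c q, y)"
  by (simp_all add: spacetime_chart_def)

lemma chart_inv_spacetime_chart:
  assumes "inj_on (snd c) (fst c)" "x \<in> snd c ` fst c"
  shows "chart_inv (spacetime_chart c) (t, x, y) = (t, chart_inv c x, y)"
proof -
  have "(x, y) \<in> snd (line_chart c) ` fst (line_chart c)"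
    using assms(2) line_chart_image[of c "fst c" UNIV] by auto
  from chart_inv_event_chart[OF inj_on_line_chart[OF assms(1)] this] chart_inv_line_chart[OF assms]
  show ?thesis by (simp add: spacetime_chart_eq)
qed

lemma coord_deriv_event_pair:
  assumes C: "chart_system (Suc k) C" and B: "chart_system (Suc k) B"
    and \<tau>: "Ck_at (Suc k) C std_atlas \<tau> p" and f: "Ck_at (Suc k) C B f p"
    and cd: "c \<in> C" "d \<in> B" "p \<in> fst c" "f p \<in> fst d"
  shows "coord_deriv c (event_chart d) (\<lambda>x. (\<tau> x, f x)) p v =
    (coord_deriv c std_chart \<tau> p v, coord_deriv c d f p v)"
proof -
  have "((\<lambda>x. (\<tau> (chart_inv c x), snd d (f (chart_inv c x)))) has_derivative
      (\<lambda>v. (coord_deriv c std_chart \<tau> p v, coord_deriv c d f p v))) (at (snd c p))"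
    using coord_deriv_works[OF C chart_system_std_atlas \<tau> cd(1) std_chart_mem cd(3)]
      coord_deriv_works[OF C B f cd] by (intro has_derivative_Pair) auto
  from fun_cong[OF frechet_derivative_at[OF this], of v] show ?thesis
    by (simp add: coord_deriv_def o_def)
qed

lemma coord_deriv_event_fst:
  assumes A: "chart_system k A" and c: "c \<in> A" "q \<in> fst c"
  shows "coord_deriv (event_chart c) std_chart fst (t, q) (\<tau>, v) = \<tau>"
proof -
  note cc = chart_systemD[OF A c(1)]
  have "((\<lambda>x. fst (chart_inv (event_chart c) x)) has_derivative fst) (at (t, snd c q))"
    by (rule has_derivative_transform_within_open[OF
          bounded_linear_imp_has_derivative[OF bounded_linear_fst], of "UNIV \<times> snd c ` fst c"])
      (use cc c in \<open>auto simp: open_Times chart_inv_event_chart\<close>)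
  from fun_cong[OF frechet_derivative_at[OF this], of "(\<tau>, v)"] show ?thesis
    by (simp add: coord_deriv_def o_def)
qed

lemma coord_deriv_event_snd:
  assumes A: "chart_system k A" and c: "c \<in> A" "q \<in> fst c"
  shows "coord_deriv (event_chart c) c snd (t, q) (\<tau>, v) = v"
proof -
  note cc = chart_systemD[OF A c(1)]
  have "((\<lambda>x. snd c (snd (chart_inv (event_chart c) x))) has_derivative snd) (at (t, snd c q))"
    by (rule has_derivative_transform_within_open[OF
          bounded_linear_imp_has_derivative[OF bounded_linear_snd], of "UNIV \<times> snd c ` fst c"])
      (use cc c in \<open>auto simp: open_Times chart_inv_event_chart\<close>)
  from fun_cong[OF frechet_derivative_at[OF this], of "(\<tau>, v)"] show ?thesis
    by (simp add: coord_deriv_def o_def)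
qed

lemma coord_deriv_event_id:
  assumes A: "chart_system (Suc k) A" and c: "c \<in> A" "c' \<in> A" "q \<in> fst c" "q \<in> fst c'"
  shows "coord_deriv (event_chart c) (event_chart c') (\<lambda>x. x) (t, q) (\<tau>, v) =
    (\<tau>, coord_deriv c c' (\<lambda>x. x) q v)"
proof -
  note E = chart_system_event_atlas[OF A]
  have f: "Ck_at (Suc k) (event_atlas A) std_atlas fst (t, q)"
    by (rule Ck_at_event_fst[OF A c(1)]) (simp add: c)
  have s: "Ck_at (Suc k) (event_atlas A) A snd (t, q)"
    by (rule Ck_at_event_snd[OF A c(1)]) (simp add: c)
  have "coord_deriv (event_chart c) c' (\<lambda>x. (\<lambda>x. x) (snd x)) (t, q) (\<tau>, v) =
      coord_deriv c c' (\<lambda>x. x) (snd (t, q)) (coord_deriv (event_chart c) c snd (t, q) (\<tau>, v))"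
    by (rule coord_deriv_compose[OF E A A s Ck_at_id[OF A c(1)]]) (use c in auto)
  moreover have "coord_deriv (event_chart c) (event_chart c') (\<lambda>x. (fst x, snd x)) (t, q) (\<tau>, v) =
      (coord_deriv (event_chart c) std_chart fst (t, q) (\<tau>, v), coord_deriv (event_chart c) c' snd (t, q) (\<tau>, v))"
    by (rule coord_deriv_event_pair[OF E A f s]) (use c in auto)
  ultimately show ?thesis
    using coord_deriv_event_fst[OF A c(1,3)] coord_deriv_event_snd[OF A c(1,3)] by simp
qed

lemma Ck_at_spacetime_event:
  assumes A: "chart_system k A" and c: "c \<in> A" "fst (snd p) \<in> fst c"
  shows "Ck_at k (spacetime_atlas A) (event_atlas A) (\<lambda>p. (fst p, fst (snd p))) p"
proof -
  have L: "chart_system k (line_chart ` A)" by (rule chart_system_line_atlas[OF A])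
  have E: "chart_system k (event_atlas (line_chart ` A))" by (rule chart_system_event_atlas[OF L])
  have lc: "line_chart c \<in> line_chart ` A" "snd p \<in> fst (line_chart c)"
    using c by (auto simp: mem_Times_iff)
  have "Ck_at k (event_atlas (line_chart ` A)) A (\<lambda>p. fst (snd p)) p"
    by (rule Ck_at_compose[OF E L A Ck_at_event_snd[OF L lc] Ck_at_line_fst[OF A c]])
  from Ck_at_event_pair[OF E A Ck_at_event_fst[OF L lc] this]
  show ?thesis by (simp add: spacetime_atlas_eq)
qed

lemma Ck_at_spacetime_y:
  assumes A: "chart_system k A" and c: "c \<in> A" "fst (snd p) \<in> fst c"
  shows "Ck_at k (spacetime_atlas A) std_atlas (\<lambda>p. snd (snd p)) p"
proof -
  have L: "chart_system k (line_chart ` A)" by (rule chart_system_line_atlas[OF A])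
  have E: "chart_system k (event_atlas (line_chart ` A))" by (rule chart_system_event_atlas[OF L])
  have lc: "line_chart c \<in> line_chart ` A" "snd p \<in> fst (line_chart c)"
    using c by (auto simp: mem_Times_iff)
  show ?thesis
    unfolding spacetime_atlas_eq
    by (rule Ck_at_compose[OF E L chart_system_std_atlas Ck_at_event_snd[OF L lc] Ck_at_line_snd[OF A c]])
qed

lemma Ck_at_spacetime_triple:
  assumes C: "chart_system k C" and B: "chart_system k B"
    and "Ck_at k C std_atlas \<tau> p" "Ck_at k C B f p" "Ck_at k C std_atlas \<eta> p"
  shows "Ck_at k C (spacetime_atlas B) (\<lambda>x. (\<tau> x, f x, \<eta> x)) p"
  unfolding spacetime_atlas_eq
  by (intro Ck_at_event_pair Ck_at_line_pair chart_system_line_atlas assms)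

text \<open>The coordinate changes that occur keep \<open>t\<close> and translate \<open>y\<close>
  by a function of the event, so their differential is assembled from those of \<phi> and
  \<open>u\<close> on events.\<close>

lemma coord_deriv_spacetime:
  fixes A :: "('q, 'e::euclidean_space) chart set" and A' :: "('w, 'f::euclidean_space) chart set"
  assumes A: "chart_system (Suc k) A" and A': "chart_system (Suc k) A'"
    and \<phi>: "Ck_at (Suc k) (event_atlas A) A' \<phi> (t, q)" and u: "Ck_at (Suc k) (event_atlas A) std_atlas u (t, q)"
    and c: "c \<in> A" "c' \<in> A'" "q \<in> fst c" "\<phi> (t, q) \<in> fst c'"
  shows "coord_deriv (spacetime_chart c) (spacetime_chart c') (\<lambda>(t, q, y). (t, \<phi> (t, q), y - u (t, q))) (t, q, y) (\<tau>, v, \<eta>) =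
    (\<tau>, coord_deriv (event_chart c) c' \<phi> (t, q) (\<tau>, v), \<eta> - coord_deriv (event_chart c) std_chart u (t, q) (\<tau>, v))"
proof -
  note E = chart_system_event_atlas[OF A] and cc = chart_systemD[OF A c(1)]
  let ?p = "(t, snd c q, y)" and ?\<pi> = "\<lambda>z :: real \<times> 'e \<times> real. (fst z, fst (snd z))"
  have \<pi>: "(?\<pi> has_derivative ?\<pi>) (at ?p)"
    by (intro bounded_linear_imp_has_derivative bounded_linear_Pair bounded_linear_fst bounded_linear_fst_comp
        bounded_linear_snd)
  have 1: "((\<lambda>x. snd c' (\<phi> (chart_inv (event_chart c) x))) has_derivative
      coord_deriv (event_chart c) c' \<phi> (t, q)) (at (?\<pi> ?p))"
    using coord_deriv_works[OF E A' \<phi>, of "event_chart c" c'] c by simp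
  have 2: "((\<lambda>x. u (chart_inv (event_chart c) x)) has_derivative
      coord_deriv (event_chart c) std_chart u (t, q)) (at (?\<pi> ?p))"
    using coord_deriv_works[OF E chart_system_std_atlas u, of "event_chart c" std_chart] c by simp
  have fs: "bounded_linear (\<lambda>z :: real \<times> 'e \<times> real. snd (snd z))"
    by (rule bounded_linear_snd_comp[OF bounded_linear_snd])
  have "((\<lambda>z. (fst z, snd c' (\<phi> (chart_inv (event_chart c) (?\<pi> z))), snd (snd z) - u (chart_inv (event_chart c) (?\<pi> z))))
     has_derivative (\<lambda>\<xi>. (fst \<xi>, coord_deriv (event_chart c) c' \<phi> (t, q) (?\<pi> \<xi>),
        snd (snd \<xi>) - coord_deriv (event_chart c) std_chart u (t, q) (?\<pi> \<xi>)))) (at ?p)"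
    using diff_chain_at[OF \<pi> 1] diff_chain_at[OF \<pi> 2]
    by (intro has_derivative_Pair has_derivative_diff bounded_linear_imp_has_derivative[OF bounded_linear_fst]
        bounded_linear_imp_has_derivative[OF fs]) (simp_all add: o_def)
  moreover have "open (UNIV \<times> snd c ` fst c \<times> UNIV)" using cc(2) by (simp add: open_Times)
  ultimately have "((\<lambda>z. snd (spacetime_chart c') ((\<lambda>(t, q, y). (t, \<phi> (t, q), y - u (t, q))) (chart_inv (spacetime_chart c) z)))
     has_derivative (\<lambda>\<xi>. (fst \<xi>, coord_deriv (event_chart c) c' \<phi> (t, q) (?\<pi> \<xi>),
        snd (snd \<xi>) - coord_deriv (event_chart c) std_chart u (t, q) (?\<pi> \<xi>)))) (at ?p)"
    by (rule has_derivative_transform_within_open)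
      (use c cc in \<open>auto simp: chart_inv_event_chart chart_inv_spacetime_chart\<close>)
  from fun_cong[OF frechet_derivative_at[OF this], of "(\<tau>, v, \<eta>)"] show ?thesis
    by (simp add: coord_deriv_def o_def)
qed

text \<open>The Hamilton-Jacobi equation differentiates along constant \<open>q\<close> and along
  constant \<open>t\<close>; the differential on events contains both derivatives, and it is what
  the chain rule acts on.\<close>

lemma
  assumes A: "chart_system (Suc k) A" and u: "Ck_at (Suc k) (event_atlas A) std_atlas u (t, q)"
    and c: "c \<in> A" "q \<in> fst c"
  shows time_deriv_coord: "time_deriv u (t, q) = coord_deriv (event_chart c) std_chart u (t, q) (1, 0)"
    and space_deriv_coord: "space_deriv c u (t, q) v = coord_deriv (event_chart c) std_chart u (t, q) (0, v)"
proof -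
  note E = chart_system_event_atlas[OF A] and cc = chart_systemD[OF A c(1)]
  let ?D = "coord_deriv (event_chart c) std_chart u (t, q)"
  have D: "((\<lambda>x. u (chart_inv (event_chart c) x)) has_derivative ?D) (at (t, snd c q))"
    using coord_deriv_works[OF E chart_system_std_atlas u, of "event_chart c" std_chart] c by simp
  have "((\<lambda>s. (s, snd c q)) has_derivative (\<lambda>h. (h, 0))) (at t)" by (auto intro!: derivative_eq_intros)
  from diff_chain_at[OF this, of "\<lambda>x. u (chart_inv (event_chart c) x)" ?D] D
  have "((\<lambda>s. u (s, q)) has_derivative (\<lambda>h. ?D (h, 0))) (at t)"
    using c cc by (simp add: o_def chart_inv_event_chart)
  moreover have "(\<lambda>h. ?D (h, 0)) = (*) (?D (1, 0))"
  proof
    show "?D (h, 0) = ?D (1, 0) * h" for h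
      using linear_scale[OF has_derivative_linear[OF D], of h "(1, 0)"] by simp
  qed
  ultimately have "((\<lambda>s. u (s, q)) has_field_derivative ?D (1, 0)) (at t)"
    by (simp only: has_field_derivative_def)
  then show "time_deriv u (t, q) = ?D (1, 0)" by (simp add: time_deriv_def DERIV_imp_deriv)
  have "((\<lambda>x. (t, x)) has_derivative (\<lambda>h. (0, h))) (at (snd c q))" by (auto intro!: derivative_eq_intros)
  from diff_chain_at[OF this, of "\<lambda>x. u (chart_inv (event_chart c) x)" ?D] D
  have "((\<lambda>x. u (chart_inv (event_chart c) (t, x))) has_derivative (\<lambda>h. ?D (0, h))) (at (snd c q))"
    by (simp add: o_def)
  then have "((\<lambda>x. u (t, chart_inv c x)) has_derivative (\<lambda>h. ?D (0, h))) (at (snd c q))"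
    by (rule has_derivative_transform_within_open[OF _ cc(2)])
      (use c cc in \<open>auto simp: chart_inv_event_chart\<close>)
  from fun_cong[OF frechet_derivative_at[OF this], of v] show "space_deriv c u (t, q) v = ?D (0, v)"
    by (simp add: space_deriv_def)
qed

text \<open>A change of chart in \<open>Q\<close> leaves \<open>t\<close> and \<open>y\<close>
  alone, so only the space components of the two vectors change.\<close>

lemma gw_metric_transform:
  assumes a: "riemannian_metric_on k A D a" and b: "one_form_on l A D b"
    and c: "c \<in> A" "c' \<in> A" "(t, q) \<in> D" "q \<in> fst c" "q \<in> fst c'"
  shows "gw_metric a b V c (t, q, y) (\<tau>, v, \<eta>) (\<sigma>, w, \<zeta>) =
    gw_metric a b V c' (t, q, y) (\<tau>, coord_deriv c c' (\<lambda>x. x) q v, \<eta>) (\<sigma>, coord_deriv c c' (\<lambda>x. x) q w, \<zeta>)"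
  using riemannian_metric_onD(2)[OF a c(1,3,4,2,5)] one_form_onD(2)[OF b c(1,3,4,2,5)]
  by (simp add: gw_metric_def)

text \<open>
  The vector \<open>Z\<close> is the velocity of the characteristic through the event, \<open>P\<close> and \<open>p\<^sub>t\<close> are the
  space and time derivatives of \<open>u\<close>, and \<open>w - \<sigma> Z\<close> is the image of \<open>(\<sigma>, w)\<close> under the differentials
  of \<open>\<phi>\<close> and of the inverse flow.
\<close>

lemma rosen_identity:
  fixes G :: "'e::euclidean_space \<Rightarrow> 'e \<Rightarrow> real"
  assumes G: "inner_form G" and Z: "\<And>v. G Z v = P v - \<beta> v" and hj: "p\<^sub>t + (1 / 2) * G Z Z + V\<^sub>0 = 0"
  shows "G v w - \<tau> * (\<zeta> - \<beta> w) - (\<eta> - \<beta> v) * \<sigma> - 2 * V\<^sub>0 * \<tau> * \<sigma> =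
    G (v - \<tau> *\<^sub>R Z) (w - \<sigma> *\<^sub>R Z) - \<tau> * (\<zeta> - (\<sigma> * p\<^sub>t + P w)) - (\<eta> - (\<tau> * p\<^sub>t + P v)) * \<sigma>"
proof -
  have bl: "bilinear G" and s: "G v Z = G Z v" using G by (auto simp: inner_form_def)
  have "G (v - \<tau> *\<^sub>R Z) (w - \<sigma> *\<^sub>R Z) = G v w - \<sigma> * G Z v - \<tau> * G Z w + \<tau> * \<sigma> * G Z Z"
    by (simp add: bilinear_lsub[OF bl] bilinear_rsub[OF bl] bilinear_lmul[OF bl] bilinear_rmul[OF bl] s algebra_simps)
  moreover have "V\<^sub>0 = - p\<^sub>t - (1 / 2) * G Z Z" using hj by simp
  ultimately show ?thesis by (simp only: Z[of v] Z[of w]) (simp add: algebra_simps)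
qed


subsection \<open>The Rosen coordinates of a family of characteristics\<close>

lemma openin_spacetime_preimage:
  assumes "openin (prod_topology euclidean X) U0"
  shows "openin (spacetime_top X) {(t, q, y). (t, q) \<in> U0}"
proof -
  have sub: "U0 \<subseteq> UNIV \<times> topspace X" using openin_subset[OF assms] by simp
  have "continuous_map (spacetime_top X) (prod_topology euclidean X) (\<lambda>p. (fst p, fst (snd p)))"
    unfolding spacetime_top_def
    by (intro continuous_map_pairedI continuous_map_fst
        continuous_map_compose[OF continuous_map_snd continuous_map_fst, unfolded o_def])
  from openin_continuous_map_preimage[OF this assms]
  have "openin (spacetime_top X) {p \<in> topspace (spacetime_top X). (fst p, fst (snd p)) \<in> U0}" .
  moreover have "{p \<in> topspace (spacetime_top X). (fst p, fst (snd p)) \<in> U0} = {(t, q, y). (t, q) \<in> U0}"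
    using sub by (auto simp: spacetime_top_def)
  ultimately show ?thesis by simp
qed

text \<open>The change of \<open>q\<close> alone, between open sets of events. It is used twice:
  with \<phi> built from characteristics, and with \<phi> read off from given Rosen
  coordinates.\<close>

locale event_diffeo =
  fixes k :: nat and X :: "'q topology" and A :: "('q, 'e::euclidean_space) chart set"
    and X' :: "'w topology" and A' :: "('w, 'e) chart set"
    and U0 :: "(real \<times> 'q) set" and W0 :: "(real \<times> 'w) set"
    and \<phi> :: "real \<times> 'q \<Rightarrow> 'w" and \<psi> :: "real \<times> 'w \<Rightarrow> 'q"
  assumes atlas: "Ck_atlas (Suc k) X A" and atlas': "Ck_atlas (Suc k) X' A'"
    and openU0: "openin (prod_topology euclidean X) U0" and openW0: "openin (prod_topology euclidean X') W0"
    and \<phi>\<psi>: "\<And>t q. (t, q) \<in> U0 \<Longrightarrow> (t, \<phi> (t, q)) \<in> W0 \<and> \<psi> (t, \<phi> (t, q)) = q"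
    and \<psi>\<phi>: "\<And>t q'. (t, q') \<in> W0 \<Longrightarrow> (t, \<psi> (t, q')) \<in> U0 \<and> \<phi> (t, \<psi> (t, q')) = q'"
    and Ck\<phi>: "\<And>e. e \<in> U0 \<Longrightarrow> Ck_at (Suc k) (event_atlas A) A' \<phi> e"
    and Ck\<psi>: "\<And>e. e \<in> W0 \<Longrightarrow> Ck_at (Suc k) (event_atlas A') A \<psi> e"
begin

lemmas cs = Ck_atlas_chart_system[OF atlas] and cs' = Ck_atlas_chart_system[OF atlas']
lemmas ecs = chart_system_event_atlas[OF cs] and ecs' = chart_system_event_atlas[OF cs']

lemma charts: "c \<in> A \<Longrightarrow> is_chart X c" "c' \<in> A' \<Longrightarrow> is_chart X' c'"
  using atlas atlas' by (auto simp: Ck_atlas_def)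

lemma U0_sub:
  assumes "(t, q) \<in> U0" shows "\<exists>c\<in>A. q \<in> fst c"
proof -
  have "q \<in> topspace X" using openin_subset[OF openU0] assms by auto
  then show ?thesis using atlas unfolding Ck_atlas_def by blast
qed

lemma W0_sub:
  assumes "(t, q') \<in> W0" shows "\<exists>c'\<in>A'. q' \<in> fst c'"
proof -
  have "q' \<in> topspace X'" using openin_subset[OF openW0] assms by auto
  then show ?thesis using atlas' unfolding Ck_atlas_def by blast
qed

text \<open>Differentiates \<open>\<psi> (t, \<phi> (t, q)) = q\<close> with the time carried along
  as a component; the same \<tau> enters both differentials because time is preserved.\<close>

lemma D\<psi>D\<phi>:
  assumes e: "(t, q) \<in> U0" and c: "c \<in> A" "c' \<in> A'" "q \<in> fst c" "\<phi> (t, q) \<in> fst c'"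
  shows "coord_deriv (event_chart c') c \<psi> (t, \<phi> (t, q)) (\<tau>, coord_deriv (event_chart c) c' \<phi> (t, q) (\<tau>, v)) = v"
proof -
  have f: "Ck_at (Suc k) (event_atlas A) std_atlas fst (t, q)"
    by (rule Ck_at_event_fst[OF cs c(1)]) (simp add: c)
  have pair: "Ck_at (Suc k) (event_atlas A) (event_atlas A') (\<lambda>x. (fst x, \<phi> x)) (t, q)"
    by (rule Ck_at_event_pair[OF ecs cs' f Ck\<phi>[OF e]])
  have "Ck_at (Suc k) (event_atlas A') A \<psi> ((\<lambda>x. (fst x, \<phi> x)) (t, q))"
    using Ck\<psi> \<phi>\<psi>[OF e] by simp
  from coord_deriv_compose[OF ecs ecs' cs pair this, of "event_chart c" "event_chart c'" c "(\<tau>, v)"]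
  have "coord_deriv (event_chart c) c (\<lambda>x. \<psi> (fst x, \<phi> x)) (t, q) (\<tau>, v) =
      coord_deriv (event_chart c') c \<psi> (t, \<phi> (t, q)) (coord_deriv (event_chart c) (event_chart c') (\<lambda>x. (fst x, \<phi> x)) (t, q) (\<tau>, v))"
    using c \<phi>\<psi>[OF e] by simp
  also have "coord_deriv (event_chart c) (event_chart c') (\<lambda>x. (fst x, \<phi> x)) (t, q) (\<tau>, v) =
      (\<tau>, coord_deriv (event_chart c) c' \<phi> (t, q) (\<tau>, v))"
    using coord_deriv_event_pair[OF ecs cs' f Ck\<phi>[OF e], of "event_chart c" c'] c coord_deriv_event_fst[OF cs c(1,3)]
    by simp
  also have "coord_deriv (event_chart c) c (\<lambda>x. \<psi> (fst x, \<phi> x)) (t, q) = coord_deriv (event_chart c) c snd (t, q)"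
    by (rule coord_deriv_cong[OF is_chart_event_chart[OF charts(1)[OF c(1)]] openU0 e])
      (use c \<phi>\<psi> in auto)
  finally show ?thesis using coord_deriv_event_snd[OF cs c(1,3)] by simp
qed

lemma D\<phi>D\<psi>:
  assumes e: "(t, q') \<in> W0" and c: "c \<in> A" "c' \<in> A'" "\<psi> (t, q') \<in> fst c" "q' \<in> fst c'"
  shows "coord_deriv (event_chart c) c' \<phi> (t, \<psi> (t, q')) (\<tau>, coord_deriv (event_chart c') c \<psi> (t, q') (\<tau>, v)) = v"
proof -
  have f: "Ck_at (Suc k) (event_atlas A') std_atlas fst (t, q')"
    by (rule Ck_at_event_fst[OF cs' c(2)]) (simp add: c)
  have pair: "Ck_at (Suc k) (event_atlas A') (event_atlas A) (\<lambda>x. (fst x, \<psi> x)) (t, q')"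
    by (rule Ck_at_event_pair[OF ecs' cs f Ck\<psi>[OF e]])
  have "Ck_at (Suc k) (event_atlas A) A' \<phi> ((\<lambda>x. (fst x, \<psi> x)) (t, q'))"
    using Ck\<phi> \<psi>\<phi>[OF e] by simp
  from coord_deriv_compose[OF ecs' ecs cs' pair this, of "event_chart c'" "event_chart c" c' "(\<tau>, v)"]
  have "coord_deriv (event_chart c') c' (\<lambda>x. \<phi> (fst x, \<psi> x)) (t, q') (\<tau>, v) =
      coord_deriv (event_chart c) c' \<phi> (t, \<psi> (t, q')) (coord_deriv (event_chart c') (event_chart c) (\<lambda>x. (fst x, \<psi> x)) (t, q') (\<tau>, v))"
    using c \<psi>\<phi>[OF e] by simp
  also have "coord_deriv (event_chart c') (event_chart c) (\<lambda>x. (fst x, \<psi> x)) (t, q') (\<tau>, v) =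
      (\<tau>, coord_deriv (event_chart c') c \<psi> (t, q') (\<tau>, v))"
    using coord_deriv_event_pair[OF ecs' cs f Ck\<psi>[OF e], of "event_chart c'" c] c coord_deriv_event_fst[OF cs' c(2,4)]
    by simp
  also have "coord_deriv (event_chart c') c' (\<lambda>x. \<phi> (fst x, \<psi> x)) (t, q') = coord_deriv (event_chart c') c' snd (t, q')"
    by (rule coord_deriv_cong[OF is_chart_event_chart[OF charts(2)[OF c(2)]] openW0 e])
      (use c \<psi>\<phi> in auto)
  finally show ?thesis using coord_deriv_event_snd[OF cs' c(2,4)] by simp
qed

lemma \<psi>_time_derivative:
  assumes e: "(t, q') \<in> W0" and c: "c \<in> A" "c' \<in> A'" "\<psi> (t, q') \<in> fst c" "q' \<in> fst c'"
  shows "((\<lambda>s. snd c (\<psi> (s, q'))) has_vector_derivative coord_deriv (event_chart c') c \<psi> (t, q') (1, 0)) (at t)"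
proof -
  let ?D\<psi> = "coord_deriv (event_chart c') c \<psi> (t, q')"
  have D\<psi>: "((\<lambda>x. snd c (\<psi> (chart_inv (event_chart c') x))) has_derivative ?D\<psi>) (at (t, snd c' q'))"
    using coord_deriv_works[OF ecs' cs Ck\<psi>[OF e], of "event_chart c'" c] c by simp
  have "((\<lambda>s. (s, snd c' q')) has_derivative (\<lambda>h. (h, 0))) (at t)" by (auto intro!: derivative_eq_intros)
  from diff_chain_at[OF this, of "\<lambda>x. snd c (\<psi> (chart_inv (event_chart c') x))" ?D\<psi>] D\<psi>
  have "((\<lambda>s. snd c (\<psi> (s, q'))) has_derivative (\<lambda>h. ?D\<psi> (h, 0))) (at t)"
    using c chart_systemD(1,3)[OF cs' c(2)] by (simp add: o_def chart_inv_event_chart)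
  moreover have "(\<lambda>h. ?D\<psi> (h, 0)) = (\<lambda>h. h *\<^sub>R ?D\<psi> (1, 0))"
  proof
    show "?D\<psi> (h, 0) = h *\<^sub>R ?D\<psi> (1, 0)" for h
      using linear_scale[OF has_derivative_linear[OF D\<psi>], of h "(1, 0)"] by simp
  qed
  ultimately show ?thesis by (simp only: has_vector_derivative_def)
qed

end

text \<open>The Hamilton-Jacobi equation and the equation of characteristics are assumed in one
  chart around each event; the metric identity that follows is tensorial and moves to the other
  charts. The maps and \<open>u\<close> are of class \<open>k + 1\<close>, the new metric is of
  class \<open>k\<close>.\<close>

locale rosen_data = event_diffeo k X A X' A' U0 W0 \<phi> \<psi>
  for k :: nat and X :: "'q topology" and A :: "('q, 'e::euclidean_space) chart set"
    and X' :: "'w topology" and A' :: "('w, 'e) chart set"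
    and U0 :: "(real \<times> 'q) set" and W0 :: "(real \<times> 'w) set"
    and \<phi> :: "real \<times> 'q \<Rightarrow> 'w" and \<psi> :: "real \<times> 'w \<Rightarrow> 'q" +
  fixes a :: "('q, 'e) tmetric" and b :: "('q, 'e) tform" and V :: "real \<times> 'q \<Rightarrow> real"
    and u :: "real \<times> 'q \<Rightarrow> real"
  assumes manifold': "Ck_manifold (Suc k) X' A'"
    and a: "riemannian_metric_on k A U0 a" and b: "one_form_on 0 A U0 b"
    and Cku: "\<And>e. e \<in> U0 \<Longrightarrow> Ck_at (Suc k) (event_atlas A) std_atlas u e"
    and hj: "\<And>t q. (t, q) \<in> U0 \<Longrightarrow> \<exists>c\<in>A. q \<in> fst c \<and>
      time_deriv u (t, q) + hamiltonian a b V c (t, q) (space_deriv c u (t, q)) = 0 \<and>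
      ((\<lambda>s. snd c (\<psi> (s, \<phi> (t, q)))) has_vector_derivative
        sharp (a c (t, q)) (\<lambda>v. space_deriv c u (t, q) v - b c (t, q) v)) (at t)"
begin

text \<open>The pullback of \<open>a\<close> under \<psi> at fixed time. The chart around
  \<open>\<psi> e\<close> is an arbitrary choice, of which the value is independent by
  \<open>new_metric_eq\<close>.\<close>

definition new_metric :: "('w, 'e) tmetric" where
  "new_metric c' e v w = (let c = SOME c. c \<in> A \<and> \<psi> e \<in> fst c; D = coord_deriv (event_chart c') c \<psi> e
     in a c (fst e, \<psi> e) (D (0, v)) (D (0, w)))"

lemma new_metric_eq:
  assumes e: "(t, q') \<in> W0" and c: "c \<in> A" "c' \<in> A'" "\<psi> (t, q') \<in> fst c" "q' \<in> fst c'"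
  shows "new_metric c' (t, q') v w = a c (t, \<psi> (t, q'))
    (coord_deriv (event_chart c') c \<psi> (t, q') (0, v)) (coord_deriv (event_chart c') c \<psi> (t, q') (0, w))"
proof -
  define c0 where "c0 = (SOME c. c \<in> A \<and> \<psi> (t, q') \<in> fst c)"
  have c0: "c0 \<in> A" "\<psi> (t, q') \<in> fst c0"
    using someI[of "\<lambda>c. c \<in> A \<and> \<psi> (t, q') \<in> fst c" c] c by (auto simp: c0_def)
  have D: "coord_deriv (event_chart c') c (\<lambda>x. (\<lambda>x. x) (\<psi> x)) (t, q') z =
      coord_deriv c0 c (\<lambda>x. x) (\<psi> (t, q')) (coord_deriv (event_chart c') c0 \<psi> (t, q') z)" for z
    by (rule coord_deriv_compose[OF ecs' cs cs Ck\<psi>[OF e] Ck_at_id[OF cs c0(1)]]) (use c c0 in auto)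
  have e': "(t, \<psi> (t, q')) \<in> U0" using \<psi>\<phi>[OF e] by simp
  show ?thesis
    using riemannian_metric_onD(2)[OF a c0(1) e' c0(2) c(1,3)] D
    by (simp add: new_metric_def c0_def[symmetric] Let_def)
qed

text \<open>The regularity of \<open>a\<close> is known for fixed vectors only, while here it is
  evaluated on the differential of \<psi>; expansion in a basis separates the two. That differential
  is \<open>C^k\<close> because \<psi> is \<open>C^(k+1)\<close>.\<close>

lemma new_metric_Ck:
  assumes c': "c' \<in> A'"
  shows "Ck_on k (snd (event_chart c') ` (fst (event_chart c') \<inter> W0))
    (\<lambda>z. new_metric c' (chart_inv (event_chart c') z) v w)"
proof (rule Ck_on_local)
  fix z assume "z \<in> snd (event_chart c') ` (fst (event_chart c') \<inter> W0)"
  then obtain t q' where z: "z = (t, snd c' q')" "q' \<in> fst c'" "(t, q') \<in> W0" by auto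
  have e: "(t, \<psi> (t, q')) \<in> U0" using \<psi>\<phi>[OF z(3)] by simp
  then obtain c where c: "c \<in> A" "\<psi> (t, q') \<in> fst c" using U0_sub by blast
  let ?h = "\<lambda>z. snd c (\<psi> (chart_inv (event_chart c') z))"
  obtain N where N: "open N" "snd (event_chart c') (t, q') \<in> N" "N \<subseteq> snd (event_chart c') ` fst (event_chart c')"
    "\<And>x. x \<in> N \<Longrightarrow> \<psi> (chart_inv (event_chart c') x) \<in> fst c" "Ck_on (Suc k) N ?h"
  proof -
    show ?thesis
      by (rule Ck_at_in_charts[OF ecs' cs Ck\<psi>[OF z(3)], of "event_chart c'" c]) (use c' c z that in auto)
  qed
  define M where "M = N \<inter> snd (event_chart c') ` (fst (event_chart c') \<inter> W0)"
  have oM: "open M" unfolding M_def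
    using N(1) is_chart_open_image[OF is_chart_event_chart[OF charts(2)[OF c']] openW0] by blast
  have hM: "Ck_on (Suc k) M ?h" by (rule Ck_on_subset[OF N(5)]) (auto simp: M_def)
  let ?D = "\<lambda>z v. frechet_derivative ?h (at z) (0, v)"
  have eM: "\<exists>t q'. z = (t, snd c' q') \<and> chart_inv (event_chart c') z = (t, q') \<and> (t, q') \<in> W0 \<and> q' \<in> fst c' \<and>
      \<psi> (t, q') \<in> fst c" if zM: "z \<in> M" for z
  proof -
    obtain t q' where *: "z = (t, snd c' q')" "q' \<in> fst c'" "(t, q') \<in> W0" using zM by (auto simp: M_def)
    then have "chart_inv (event_chart c') z = (t, q')"
      using chart_systemD(1,3)[OF cs' c'] by (simp add: chart_inv_event_chart)
    then show ?thesis using * N(4)[of z] zM by (auto simp: M_def)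
  qed
  have oE: "open (snd (event_chart c) ` (fst (event_chart c) \<inter> U0))"
    by (rule is_chart_open_image[OF is_chart_event_chart[OF charts(1)[OF c(1)]] openU0])
  let ?a = "\<lambda>i j z. a c (chart_inv (event_chart c) (fst z, ?h z)) i j"
  have aij: "Ck_on k M (?a i j)" for i j
  proof (rule Ck_on_compose[OF oM oE])
    show "Ck_on k M (\<lambda>z. (fst z, ?h z))"
      by (intro Ck_on_Pair oM Ck_on_Suc_imp[OF hM] Ck_on_linear[OF bounded_linear_fst])
    show "Ck_on k (snd (event_chart c) ` (fst (event_chart c) \<inter> U0)) (\<lambda>z. a c (chart_inv (event_chart c) z) i j)"
      using a c(1) by (simp add: riemannian_metric_on_def)
    fix z assume "z \<in> M"
    from eM[OF this] obtain t q' where *: "z = (t, snd c' q')" "chart_inv (event_chart c') z = (t, q')" "(t, q') \<in> W0" "\<psi> (t, q') \<in> fst c"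
      by blast
    then have "(t, \<psi> (t, q')) \<in> fst (event_chart c) \<inter> U0" using \<psi>\<phi>[OF *(3)] by simp
    moreover have "(fst z, ?h z) = snd (event_chart c) (t, \<psi> (t, q'))" using * by simp
    ultimately show "(fst z, ?h z) \<in> snd (event_chart c) ` (fst (event_chart c) \<inter> U0)" by blast
  qed
  have "Ck_on k M (\<lambda>z. ?D z v)" for v using hM by simp
  then have "Ck_on k M (\<lambda>z. \<Sum>i\<in>Basis. \<Sum>j\<in>Basis. ((?D z v \<bullet> i) * (?D z w \<bullet> j)) * ?a i j z)"
    by (intro Ck_on_sum Ck_on_mult Ck_on_inner aij oM Ck_on_const)
  then have "Ck_on k M (\<lambda>z. new_metric c' (chart_inv (event_chart c') z) v w)"
  proof (rule Ck_on_cong[OF oM])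
    fix z assume "z \<in> M"
    from eM[OF this] obtain t q' where *: "z = (t, snd c' q')" "chart_inv (event_chart c') z = (t, q')" "(t, q') \<in> W0"
      "q' \<in> fst c'" "\<psi> (t, q') \<in> fst c" by blast
    have in0: "(t, \<psi> (t, q')) \<in> U0" using \<psi>\<phi>[OF *(3)] by simp
    have ha: "?a i j z = a c (t, \<psi> (t, q')) i j" for i j
      using * chart_systemD(1,3)[OF cs c(1)] by (simp add: chart_inv_event_chart)
    have D: "?D z v = coord_deriv (event_chart c') c \<psi> (t, q') (0, v)" for v
      by (simp add: coord_deriv_def o_def *(1))
    have bl: "bilinear (a c (t, \<psi> (t, q')))"
      using riemannian_metric_onD(1)[OF a c(1) in0 *(5)] by (simp add: inner_form_def)
    have l: "linear (a c (t, \<psi> (t, q')) x)" "linear (\<lambda>x. a c (t, \<psi> (t, q')) x y)" for x y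
      using bl by (auto simp: bilinear_def)
    have "a c (t, \<psi> (t, q')) (?D z v) (?D z w) =
        (\<Sum>i\<in>Basis. (?D z v \<bullet> i) * a c (t, \<psi> (t, q')) i (?D z w))"
      using linear_componentwise_sum[OF l(2)[of "?D z w"], of "?D z v"] by simp
    also have "\<dots> = (\<Sum>i\<in>Basis. (?D z v \<bullet> i) * (\<Sum>j\<in>Basis. (?D z w \<bullet> j) * a c (t, \<psi> (t, q')) i j))"
    proof (intro sum.cong refl arg_cong2[where f = "(*)"])
      fix i show "a c (t, \<psi> (t, q')) i (?D z w) = (\<Sum>j\<in>Basis. (?D z w \<bullet> j) * a c (t, \<psi> (t, q')) i j)"
        using linear_componentwise_sum[OF l(1), of i "?D z w"] by simp
    qed
    also have "\<dots> = (\<Sum>i\<in>Basis. \<Sum>j\<in>Basis. ((?D z v \<bullet> i) * (?D z w \<bullet> j)) * a c (t, \<psi> (t, q')) i j)"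
      by (simp add: sum_distrib_left mult.assoc)
    finally have "(\<Sum>i\<in>Basis. \<Sum>j\<in>Basis. ((?D z v \<bullet> i) * (?D z w \<bullet> j)) * a c (t, \<psi> (t, q')) i j) =
        a c (t, \<psi> (t, q')) (?D z v) (?D z w)" by (rule sym)
    also have "\<dots> = new_metric c' (chart_inv (event_chart c') z) v w"
      unfolding *(2) D by (rule new_metric_eq[OF *(3) c(1) c' *(5,4), symmetric])
    finally show "(\<Sum>i\<in>Basis. \<Sum>j\<in>Basis. ((?D z v \<bullet> i) * (?D z w \<bullet> j)) * ?a i j z) =
        new_metric c' (chart_inv (event_chart c') z) v w"
      unfolding ha .
  qed
  moreover have "z \<in> M" using N(2) z by (auto simp: M_def image_iff intro!: bexI[of _ "(t, q')"])
  ultimately show "\<exists>U. open U \<and> z \<in> U \<and> Ck_on k U (\<lambda>z. new_metric c' (chart_inv (event_chart c') z) v w)"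
    using oM by blast
qed

text \<open>Positivity rests on \<open>D\<phi>D\<psi>\<close>: the space differential of \<psi> has
  a left inverse, so it kills no nonzero vector. The transformation law is the chain rule for \<psi>
  in two charts of \<open>Q'\<close>.\<close>

lemma new_metric_riemannian: "riemannian_metric_on k A' W0 new_metric"
  unfolding riemannian_metric_on_def
proof (intro conjI ballI allI)
  show "Ck_on k (snd (event_chart c') ` (fst (event_chart c') \<inter> W0)) (\<lambda>z. new_metric c' (chart_inv (event_chart c') z) v w)"
    if "c' \<in> A'" for c' v w by (rule new_metric_Ck[OF that])
  show "case e of (t, q') \<Rightarrow> q' \<in> fst c' \<longrightarrow> bilinear (new_metric c' (t, q')) \<and>
      (\<forall>v w. new_metric c' (t, q') v w = new_metric c' (t, q') w v) \<and>
      (\<forall>v. v \<noteq> 0 \<longrightarrow> 0 < new_metric c' (t, q') v v)" if c': "c' \<in> A'" and eW: "e \<in> W0" for c' e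
  proof (cases e, clarsimp)
    fix t q' assume e: "e = (t, q')" and q': "q' \<in> fst c'"
    have eW: "(t, q') \<in> W0" using eW e by simp
    then have eU: "(t, \<psi> (t, q')) \<in> U0" using \<psi>\<phi> by blast
    then obtain c where c: "c \<in> A" "\<psi> (t, q') \<in> fst c" using U0_sub by blast
    let ?D = "coord_deriv (event_chart c') c \<psi> (t, q')"
    have lin: "linear ?D"
      by (rule coord_deriv_linear[OF ecs' cs Ck\<psi>[OF eW]]) (use c c' q' in auto)
    have lin0: "linear (\<lambda>v. ?D (0, v))"
      using linear_compose[OF _ lin, of "\<lambda>v. (0, v)"] by (simp add: o_def linear_iff)
    have G: "inner_form (a c (t, \<psi> (t, q')))" by (rule riemannian_metric_onD(1)[OF a c(1) eU c(2)])
    have eq: "new_metric c' (t, q') = (\<lambda>v w. a c (t, \<psi> (t, q')) (?D (0, v)) (?D (0, w)))"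
      using new_metric_eq[OF eW c(1) c' c(2) q'] by (intro ext)
    have "bilinear (new_metric c' (t, q'))"
      unfolding eq bilinear_def using G unfolding inner_form_def bilinear_def
      by (auto intro!: linear_compose[OF lin0, unfolded o_def])
    moreover have "0 < new_metric c' (t, q') v v" if "v \<noteq> 0" for v
    proof -
      have z: "coord_deriv (event_chart c) c' \<phi> (t, \<psi> (t, q')) (0, ?D (0, v)) = v"
        by (rule D\<phi>D\<psi>[OF eW c(1) c' c(2) q'])
      have "linear (coord_deriv (event_chart c) c' \<phi> (t, \<psi> (t, q')))"
        by (rule coord_deriv_linear[OF ecs cs' Ck\<phi>[OF eU]]) (use c c' q' \<psi>\<phi>[OF eW] in auto)
      from linear_0[OF this] have "?D (0, v) \<noteq> 0" using z that by (auto simp: zero_prod_def)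
      then show ?thesis using G by (simp add: eq inner_form_def)
    qed
    moreover have "new_metric c' (t, q') v w = new_metric c' (t, q') w v" for v w
      using G by (simp add: eq inner_form_def)
    ultimately show "bilinear (new_metric c' (t, q')) \<and>
      (\<forall>v w. new_metric c' (t, q') v w = new_metric c' (t, q') w v) \<and>
      (\<forall>v. v \<noteq> 0 \<longrightarrow> 0 < new_metric c' (t, q') v v)" by blast
  qed
  show "case e of (t, q') \<Rightarrow> q' \<in> fst c' \<inter> fst c'' \<longrightarrow> (\<forall>v w. new_metric c' (t, q') v w =
      new_metric c'' (t, q') (coord_deriv c' c'' (\<lambda>x. x) q' v) (coord_deriv c' c'' (\<lambda>x. x) q' w))"
    if c': "c' \<in> A'" and c'': "c'' \<in> A'" and eW: "e \<in> W0" for c' c'' e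
  proof (cases e, clarsimp)
    fix t q' v w assume e: "e = (t, q')" and q': "q' \<in> fst c'" "q' \<in> fst c''"
    have eW: "(t, q') \<in> W0" using eW e by simp
    then have eU: "(t, \<psi> (t, q')) \<in> U0" using \<psi>\<phi> by blast
    then obtain c where c: "c \<in> A" "\<psi> (t, q') \<in> fst c" using U0_sub by blast
    have id: "Ck_at (Suc k) (event_atlas A') (event_atlas A') (\<lambda>x. x) (t, q')"
      by (rule Ck_at_id[OF ecs', of "event_chart c'"]) (use c' q' in auto)
    have "coord_deriv (event_chart c') c (\<lambda>x. \<psi> ((\<lambda>x. x) x)) (t, q') (0, v) =
      coord_deriv (event_chart c'') c \<psi> (t, q') (coord_deriv (event_chart c') (event_chart c'') (\<lambda>x. x) (t, q') (0, v))" for v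
      by (rule coord_deriv_compose[OF ecs' ecs' cs id Ck\<psi>[OF eW]]) (use c c' c'' q' in auto)
    then have "coord_deriv (event_chart c') c \<psi> (t, q') (0, v) =
      coord_deriv (event_chart c'') c \<psi> (t, q') (0, coord_deriv c' c'' (\<lambda>x. x) q' v)" for v
      using coord_deriv_event_id[OF cs' c' c'' q'] by simp
    then show "new_metric c' (t, q') v w =
      new_metric c'' (t, q') (coord_deriv c' c'' (\<lambda>x. x) q' v) (coord_deriv c' c'' (\<lambda>x. x) q' w)"
      using new_metric_eq[OF eW c(1) c' c(2) q'(1)] new_metric_eq[OF eW c(1) c'' c(2) q'(2)] by simp
  qed
qed

section \<open>The new coordinates on spacetime\<close>

definition \<Phi> :: "real \<times> 'q \<times> real \<Rightarrow> real \<times> 'w \<times> real" where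
  "\<Phi> = (\<lambda>(t, q, y). (t, \<phi> (t, q), y - u (t, q)))"

abbreviation "U \<equiv> {(t, q, y :: real). (t, q) \<in> U0}"
abbreviation "W \<equiv> {(t, q', y' :: real). (t, q') \<in> W0}"

text \<open>In the chart \<open>c0\<close> in which the equations are assumed this is
  \<open>rosen_identity\<close> with \<open>Z\<close> the velocity. Then both sides pass to
  \<open>c\<close>: the differentials of \<phi> and \<open>u\<close> by the chain rule, the metric
  by its tensor law.\<close>

lemma metric_identity:
  assumes e: "(t, q) \<in> U0" and c: "c \<in> A" "c' \<in> A'" "q \<in> fst c" "\<phi> (t, q) \<in> fst c'"
    and L_def: "L = coord_deriv (spacetime_chart c) (spacetime_chart c') \<Phi> (t, q, y)"
  shows "L (0, 0, 1) = (0, 0, 1)"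
    and "gw_metric a b V c (t, q, y) \<xi> \<zeta> = rosen_metric new_metric c' (\<Phi> (t, q, y)) (L \<xi>) (L \<zeta>)"
proof -
  let ?D\<phi> = "\<lambda>c. coord_deriv (event_chart c) c' \<phi> (t, q)" and ?Du = "\<lambda>c. coord_deriv (event_chart c) std_chart u (t, q)"
  have L: "L (\<tau>, v, \<eta>) = (\<tau>, ?D\<phi> c (\<tau>, v), \<eta> - ?Du c (\<tau>, v))" for \<tau> v \<eta>
    unfolding L_def \<Phi>_def by (rule coord_deriv_spacetime[OF cs cs' Ck\<phi>[OF e] Cku[OF e] c])
  have "linear (?D\<phi> c)" by (rule coord_deriv_linear[OF ecs cs' Ck\<phi>[OF e]]) (use c in auto)
  moreover have lDu: "linear (?Du c)" if "c \<in> A" "q \<in> fst c" for c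
    by (rule coord_deriv_linear[OF ecs chart_system_std_atlas Cku[OF e]]) (use that in auto)
  ultimately show "L (0, 0, 1) = (0, 0, 1)"
    using lDu[OF c(1,3)] by (simp add: L linear_0 flip: zero_prod_def)
  have id: "rosen_metric new_metric c' (\<Phi> (t, q, y)) (\<tau>, ?D\<phi> c0 (\<tau>, v), \<eta> - ?Du c0 (\<tau>, v)) (\<sigma>, ?D\<phi> c0 (\<sigma>, w), \<zeta> - ?Du c0 (\<sigma>, w)) =
      gw_metric a b V c0 (t, q, y) (\<tau>, v, \<eta>) (\<sigma>, w, \<zeta>)"
    if c0: "c0 \<in> A" "q \<in> fst c0"
      and h: "time_deriv u (t, q) + hamiltonian a b V c0 (t, q) (space_deriv c0 u (t, q)) = 0"
      and ch: "((\<lambda>s. snd c0 (\<psi> (s, \<phi> (t, q)))) has_vector_derivative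
        sharp (a c0 (t, q)) (\<lambda>v. space_deriv c0 u (t, q) v - b c0 (t, q) v)) (at t)"
    for c0 \<tau> v \<eta> \<sigma> w \<zeta>
  proof -
    have eW: "(t, \<phi> (t, q)) \<in> W0" and \<psi>eq: "\<psi> (t, \<phi> (t, q)) = q" using \<phi>\<psi>[OF e] by auto
    have \<psi>in: "\<psi> (t, \<phi> (t, q)) \<in> fst c0" using \<psi>eq c0 by simp
    let ?D\<psi> = "coord_deriv (event_chart c') c0 \<psi> (t, \<phi> (t, q))"
    let ?\<alpha> = "\<lambda>v. space_deriv c0 u (t, q) v - b c0 (t, q) v"
    define Z where "Z = sharp (a c0 (t, q)) ?\<alpha>"
    have G: "inner_form (a c0 (t, q))" by (rule riemannian_metric_onD(1)[OF a c0(1) e c0(2)])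
    have D\<psi>: "((\<lambda>x. snd c0 (\<psi> (chart_inv (event_chart c') x))) has_derivative ?D\<psi>) (at (t, snd c' (\<phi> (t, q))))"
      using coord_deriv_works[OF ecs' cs Ck\<psi>[OF eW], of "event_chart c'" c0] c c0 \<psi>in by simp
    have l\<psi>: "linear ?D\<psi>" using has_derivative_linear[OF D\<psi>] .
    have sp: "space_deriv c0 u (t, q) v = ?Du c0 (0, v)" for v
      by (rule space_deriv_coord[OF cs Cku[OF e] c0])
    have tm: "time_deriv u (t, q) = ?Du c0 (1, 0)"
      by (rule time_deriv_coord[OF cs Cku[OF e] c0])
    have "linear (\<lambda>v. (0::real, v::'e))" by (simp add: linear_iff)
    then have "linear (\<lambda>v. ?Du c0 (0, v))" using linear_compose[OF _ lDu[OF c0]] by (simp add: o_def)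
    then have l\<alpha>: "linear ?\<alpha>"
      using one_form_onD(1)[OF b c0(1) e c0(2)] by (simp add: sp linear_compose_sub)
    have GZ: "a c0 (t, q) Z v = space_deriv c0 u (t, q) v - b c0 (t, q) v" for v
      unfolding Z_def by (rule sharp_works[OF G l\<alpha>])
    have "?D\<psi> (1, 0) = Z"
      using vector_derivative_unique_at[OF \<psi>_time_derivative[OF eW c0(1) c(2) \<psi>in c(4)] ch] by (simp add: Z_def)
    \<comment> \<open>\<open>D\<psi>\<close> undoes \<open>D\<phi>\<close> when the time component
      \<tau> is passed on; dropping that component subtracts \<tau> times
      \<open>D\<psi> (1, 0)\<close>, the velocity of the curve of constant
      \<open>q'\<close>.\<close>
    then have pull: "?D\<psi> (0, ?D\<phi> c0 (\<tau>, v)) = v - \<tau> *\<^sub>R Z" for \<tau> v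
      using D\<psi>D\<phi>[OF e c0(1) c(2) c0(2) c(4), of \<tau> v] linear_scale[OF l\<psi>, of \<tau> "(1, 0)"]
        linear_diff[OF l\<psi>, of "(\<tau>, ?D\<phi> c0 (\<tau>, v))" "(\<tau>, 0)"] by simp
    have split: "?Du c0 (\<tau>, v) = \<tau> * time_deriv u (t, q) + space_deriv c0 u (t, q) v" for \<tau> v
      using linear_scale[OF lDu[OF c0], of \<tau> "(1, 0)"] linear_add[OF lDu[OF c0], of "(\<tau>, 0)" "(0, v)"]
      by (simp add: sp tm)
    have "hamiltonian a b V c0 (t, q) (space_deriv c0 u (t, q)) = (1 / 2) * a c0 (t, q) Z Z + V (t, q)"
      by (simp add: hamiltonian_def inverse_metric_def Z_def[symmetric] GZ)
    then have h': "time_deriv u (t, q) + (1 / 2) * a c0 (t, q) Z Z + V (t, q) = 0" using h by simp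
    have "rosen_metric new_metric c' (\<Phi> (t, q, y)) (\<tau>, ?D\<phi> c0 (\<tau>, v), \<eta> - ?Du c0 (\<tau>, v)) (\<sigma>, ?D\<phi> c0 (\<sigma>, w), \<zeta> - ?Du c0 (\<sigma>, w)) =
      a c0 (t, q) (v - \<tau> *\<^sub>R Z) (w - \<sigma> *\<^sub>R Z) - \<tau> * (\<zeta> - ?Du c0 (\<sigma>, w)) - (\<eta> - ?Du c0 (\<tau>, v)) * \<sigma>"
      using new_metric_eq[OF eW c0(1) c(2) \<psi>in c(4)] pull by (simp add: rosen_metric_def \<Phi>_def \<psi>eq)
    also have "\<dots> = gw_metric a b V c0 (t, q, y) (\<tau>, v, \<eta>) (\<sigma>, w, \<zeta>)"
      using rosen_identity[OF G GZ h', of v w \<tau> \<zeta> \<eta> \<sigma>] by (simp add: split gw_metric_def)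
    finally show ?thesis .
  qed
  obtain c0 where c0: "c0 \<in> A" "q \<in> fst c0"
      and h: "time_deriv u (t, q) + hamiltonian a b V c0 (t, q) (space_deriv c0 u (t, q)) = 0"
      and ch: "((\<lambda>s. snd c0 (\<psi> (s, \<phi> (t, q)))) has_vector_derivative
        sharp (a c0 (t, q)) (\<lambda>v. space_deriv c0 u (t, q) v - b c0 (t, q) v)) (at t)"
    using hj[OF e] by blast
  let ?T = "coord_deriv c c0 (\<lambda>x. x) q"
  have ide: "Ck_at (Suc k) (event_atlas A) (event_atlas A) (\<lambda>x. x) (t, q)"
    by (rule Ck_at_id[OF ecs, of "event_chart c"]) (use c in auto)
  have "?D\<phi> c (\<tau>, v) = ?D\<phi> c0 (\<tau>, ?T v)" for \<tau> v
  proof -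
    have "coord_deriv (event_chart c) c' (\<lambda>x. \<phi> ((\<lambda>x. x) x)) (t, q) (\<tau>, v) =
      ?D\<phi> c0 (coord_deriv (event_chart c) (event_chart c0) (\<lambda>x. x) (t, q) (\<tau>, v))"
      by (rule coord_deriv_compose[OF ecs ecs cs' ide Ck\<phi>[OF e]]) (use c c0 in auto)
    then show ?thesis using coord_deriv_event_id[OF cs c(1) c0(1) c(3) c0(2)] by simp
  qed
  moreover have "?Du c (\<tau>, v) = ?Du c0 (\<tau>, ?T v)" for \<tau> v
  proof -
    have "coord_deriv (event_chart c) std_chart (\<lambda>x. u ((\<lambda>x. x) x)) (t, q) (\<tau>, v) =
      ?Du c0 (coord_deriv (event_chart c) (event_chart c0) (\<lambda>x. x) (t, q) (\<tau>, v))"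
      by (rule coord_deriv_compose[OF ecs ecs chart_system_std_atlas ide Cku[OF e]]) (use c c0 in auto)
    then show ?thesis using coord_deriv_event_id[OF cs c(1) c0(1) c(3) c0(2)] by simp
  qed
  moreover obtain \<tau> v \<eta> \<sigma> w z where "\<xi> = (\<tau>, v, \<eta>)" "\<zeta> = (\<sigma>, w, z)" by (metis surj_pair)
  ultimately show "gw_metric a b V c (t, q, y) \<xi> \<zeta> = rosen_metric new_metric c' (\<Phi> (t, q, y)) (L \<xi>) (L \<zeta>)"
    using gw_metric_transform[OF a b c(1) c0(1) e c(3) c0(2), of V y \<tau> v \<eta> \<sigma> w z] id[OF c0 h ch, of \<tau> "?T v" \<eta> \<sigma> "?T w" z]
    by (simp add: L)
qed

lemma Ck_at_\<Phi>:
  assumes "(t, q) \<in> U0"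
  shows "Ck_at (Suc k) (spacetime_atlas A) (spacetime_atlas A') \<Phi> (t, q, y)"
proof -
  obtain c where c: "c \<in> A" "fst (snd (t, q, y)) \<in> fst c" using U0_sub[OF assms] by auto
  note S = chart_system_spacetime_atlas[OF cs] and \<pi> = Ck_at_spacetime_event[OF cs c]
  have fst: "Ck_at (Suc k) (spacetime_atlas A) std_atlas (\<lambda>p. fst (fst p, fst (snd p))) (t, q, y)"
    by (rule Ck_at_compose[OF S ecs chart_system_std_atlas \<pi> Ck_at_event_fst[OF cs c(1)]]) (use c in simp)
  have "Ck_at (Suc k) (spacetime_atlas A) A' (\<lambda>p. \<phi> (fst p, fst (snd p))) (t, q, y)"
    by (rule Ck_at_compose[OF S ecs cs' \<pi>]) (use Ck\<phi>[OF assms] in simp)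
  moreover have "Ck_at (Suc k) (spacetime_atlas A) std_atlas (\<lambda>p. u (fst p, fst (snd p))) (t, q, y)"
    by (rule Ck_at_compose[OF S ecs chart_system_std_atlas \<pi>]) (use Cku[OF assms] in simp)
  then have "Ck_at (Suc k) (spacetime_atlas A) std_atlas (\<lambda>p. snd (snd p) - u (fst p, fst (snd p))) (t, q, y)"
    by (rule Ck_at_diff[OF S Ck_at_spacetime_y[OF cs c]])
  ultimately have "Ck_at (Suc k) (spacetime_atlas A) (spacetime_atlas A')
      (\<lambda>p. (fst p, \<phi> (fst p, fst (snd p)), snd (snd p) - u (fst p, fst (snd p)))) (t, q, y)"
    using fst by (intro Ck_at_spacetime_triple[OF S cs']) auto
  then show ?thesis by (simp add: \<Phi>_def case_prod_unfold)
qed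

definition \<Psi> :: "real \<times> 'w \<times> real \<Rightarrow> real \<times> 'q \<times> real" where
  "\<Psi> = (\<lambda>(t, q', y'). (t, \<psi> (t, q'), y' + u (t, \<psi> (t, q'))))"

lemma Ck_at_\<Psi>:
  assumes "(t, q') \<in> W0"
  shows "Ck_at (Suc k) (spacetime_atlas A') (spacetime_atlas A) \<Psi> (t, q', y')"
proof -
  obtain c where c: "c \<in> A'" "fst (snd (t, q', y')) \<in> fst c" using W0_sub[OF assms] by auto
  note S = chart_system_spacetime_atlas[OF cs'] and \<pi> = Ck_at_spacetime_event[OF cs' c]
  have fst: "Ck_at (Suc k) (spacetime_atlas A') std_atlas (\<lambda>p. fst (fst p, fst (snd p))) (t, q', y')"
    by (rule Ck_at_compose[OF S ecs' chart_system_std_atlas \<pi> Ck_at_event_fst[OF cs' c(1)]]) (use c in simp)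
  have \<psi>: "Ck_at (Suc k) (spacetime_atlas A') A (\<lambda>p. \<psi> (fst p, fst (snd p))) (t, q', y')"
    by (rule Ck_at_compose[OF S ecs' cs \<pi>]) (use Ck\<psi>[OF assms] in simp)
  have \<pi>': "Ck_at (Suc k) (spacetime_atlas A') (event_atlas A) (\<lambda>p. (fst p, \<psi> (fst p, fst (snd p)))) (t, q', y')"
    using fst by (intro Ck_at_event_pair[OF S cs _ \<psi>]) simp
  have "Ck_at (Suc k) (spacetime_atlas A') std_atlas (\<lambda>p. u (fst p, \<psi> (fst p, fst (snd p)))) (t, q', y')"
    by (rule Ck_at_compose[OF S ecs chart_system_std_atlas \<pi>']) (use Cku \<psi>\<phi>[OF assms] in simp)
  then have "Ck_at (Suc k) (spacetime_atlas A') std_atlas (\<lambda>p. snd (snd p) + u (fst p, \<psi> (fst p, fst (snd p)))) (t, q', y')"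
    by (rule Ck_at_add[OF S Ck_at_spacetime_y[OF cs' c]])
  then have "Ck_at (Suc k) (spacetime_atlas A') (spacetime_atlas A)
      (\<lambda>p. (fst p, \<psi> (fst p, fst (snd p)), snd (snd p) + u (fst p, \<psi> (fst p, fst (snd p))))) (t, q', y')"
    using fst \<psi> by (intro Ck_at_spacetime_triple[OF S cs]) auto
  then show ?thesis by (simp add: \<Psi>_def case_prod_unfold)
qed

theorem rosen_coordinates_of_data:
  "rosen_coordinates (Suc k) X A a b V U X' A' W \<Phi> new_metric"
proof -
  note sc = chart_system_spacetime_atlas[OF cs] and sc' = chart_system_spacetime_atlas[OF cs']
  have ch: "is_chart (spacetime_top X) c" if "c \<in> spacetime_atlas A" for c
    using that is_chart_spacetime_chart[OF charts(1)] by (auto simp only: spacetime_atlas_def)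
  have ch': "is_chart (spacetime_top X') c" if "c \<in> spacetime_atlas A'" for c
    using that is_chart_spacetime_chart[OF charts(2)] by (auto simp only: spacetime_atlas_def)
  note oU = openin_spacetime_preimage[OF openU0] and oW = openin_spacetime_preimage[OF openW0]
  have 1: "\<Phi> p \<in> W \<and> \<Psi> (\<Phi> p) = p" if "p \<in> U" for p
    using that \<phi>\<psi> by (auto simp: \<Phi>_def \<Psi>_def)
  have 2: "\<Psi> p \<in> U \<and> \<Phi> (\<Psi> p) = p" if "p \<in> W" for p
    using that \<psi>\<phi> by (auto simp: \<Phi>_def \<Psi>_def)
  have bij: "bij_betw \<Phi> U W"
  proof (rule bij_betwI)
    show "\<Phi> \<in> U \<rightarrow> W" by (rule Pi_I) (rule conjunct1[OF 1])
    show "\<Psi> \<in> W \<rightarrow> U" by (rule Pi_I) (rule conjunct1[OF 2])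
    show "\<Psi> (\<Phi> p) = p" if "p \<in> U" for p using 1[OF that] by (rule conjunct2)
    show "\<Phi> (\<Psi> p) = p" if "p \<in> W" for p using 2[OF that] by (rule conjunct2)
  qed
  \<comment> \<open>\<open>Ck_diffeo\<close> speaks of \<open>inv_into\<close>, so the explicit
    inverse has to be identified with it on \<open>W\<close>.\<close>
  have inv: "\<Psi> p = inv_into U \<Phi> p" if "p \<in> W" for p
  proof -
    have "inv_into U \<Phi> (\<Phi> (\<Psi> p)) = \<Psi> p"
      by (rule inv_into_f_f[OF bij_betw_imp_inj_on[OF bij]]) (use 2[OF that] in \<open>rule conjunct1\<close>)
    then show ?thesis using 2[OF that] by simp
  qed
  have "Ck_map (Suc k) (spacetime_top X) (spacetime_atlas A) U (spacetime_top X') (spacetime_atlas A') \<Phi>"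
    by (rule Ck_map_of_Ck_at[OF sc ch sc' ch' oU]) (auto intro: Ck_at_\<Phi>)
  moreover have "Ck_map (Suc k) (spacetime_top X') (spacetime_atlas A') W (spacetime_top X) (spacetime_atlas A) (inv_into U \<Phi>)"
  proof (rule Ck_map_of_Ck_at[OF sc' ch' sc ch oW])
    fix p assume p: "p \<in> W"
    then have "Ck_at (Suc k) (spacetime_atlas A') (spacetime_atlas A) \<Psi> p" by (auto intro: Ck_at_\<Psi>)
    then show "Ck_at (Suc k) (spacetime_atlas A') (spacetime_atlas A) (inv_into U \<Phi>) p"
      by (rule Ck_at_cong[OF ch' oW p inv, rotated 2])
  qed
  ultimately have diffeo: "Ck_diffeo (Suc k) (spacetime_top X) (spacetime_atlas A) U
      (spacetime_top X') (spacetime_atlas A') W \<Phi>"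
    using oU oW bij by (simp add: Ck_diffeo_def)
  have D: "{(t, q'). \<exists>y'. (t, q', y') \<in> W} = W0" by auto
  show ?thesis
    unfolding rosen_coordinates_def D Let_def
  proof (intro conjI ballI impI allI)
    show "riemannian_metric_on (Suc k - 1) A' W0 new_metric" using new_metric_riemannian by simp
    show "fst (\<Phi> p) = fst p" for p by (simp add: \<Phi>_def case_prod_unfold)
    fix c c' p assume c: "c \<in> A" "c' \<in> A'" "p \<in> U"
      and p: "p \<in> fst (spacetime_chart c) \<and> \<Phi> p \<in> fst (spacetime_chart c')"
    obtain t q y where pe: "p = (t, q, y)" by (metis surj_pair)
    have *: "(t, q) \<in> U0" "q \<in> fst c" "\<phi> (t, q) \<in> fst c'"
      using c p by (auto simp: pe \<Phi>_def)
    show "coord_deriv (spacetime_chart c) (spacetime_chart c') \<Phi> p (0, 0, 1) = (0, 0, 1)"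
      unfolding pe by (rule metric_identity(1)[OF *(1) c(1,2) *(2,3) refl])
    show "gw_metric a b V c p \<xi> \<zeta> = rosen_metric new_metric c' (\<Phi> p)
        (coord_deriv (spacetime_chart c) (spacetime_chart c') \<Phi> p \<xi>)
        (coord_deriv (spacetime_chart c) (spacetime_chart c') \<Phi> p \<zeta>)" for \<xi> \<zeta>
      unfolding pe by (rule metric_identity(2)[OF *(1) c(1,2) *(2,3) refl])
  qed (use diffeo manifold' in auto)
qed

end

section \<open>A solution from Rosen coordinates\<close>

lemma Ck_at_spacetime_q:
  assumes A: "chart_system k A" and c: "c \<in> A" "fst (snd p) \<in> fst c"
  shows "Ck_at k (spacetime_atlas A) A (\<lambda>p. fst (snd p)) p"
  using Ck_at_compose[OF chart_system_spacetime_atlas[OF A] chart_system_event_atlas[OF A] A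
      Ck_at_spacetime_event[OF A c] Ck_at_event_snd[OF A c(1)]] c(2) by simp

lemma Ck_at_zero_section:
  assumes A: "chart_system k A" and c: "c \<in> A" "snd e \<in> fst c"
  shows "Ck_at k (event_atlas A) (spacetime_atlas A) (\<lambda>e. (fst e, snd e, 0)) e"
proof -
  note E = chart_system_event_atlas[OF A]
  have "e \<in> fst (event_chart c)" using c(2) by (simp add: mem_Times_iff)
  from Ck_at_std_const[OF E event_chart_mem[OF c(1)] this]
  show ?thesis
    by (intro Ck_at_spacetime_triple[OF E A] Ck_at_event_fst[OF A c] Ck_at_event_snd[OF A c])
qed

lemma coordinate_curve_open:
  fixes c :: "('q, 'e::euclidean_space) chart" and N :: "(real \<times> 'e) set"
  assumes c: "is_chart X c" and \<gamma>: "continuous_map (top_of_set K) X \<gamma>" and "open K" "open N"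
  shows "open {t \<in> K. \<gamma> t \<in> fst c \<and> (t, snd c (\<gamma> t)) \<in> N}"
proof -
  have "continuous_map (top_of_set K) (prod_topology euclidean X) (\<lambda>t. (t, \<gamma> t))"
    using \<gamma> by (intro continuous_map_pairedI) auto
  from openin_continuous_map_preimage[OF this is_chart_open_preimage[OF is_chart_event_chart[OF c] \<open>open N\<close>]]
  have "openin (top_of_set K) {t \<in> K. \<gamma> t \<in> fst c \<and> (t, snd c (\<gamma> t)) \<in> N}" by simp
  then show ?thesis using \<open>open K\<close> openin_open_eq by blast
qed

lemma vanishing_derivative_constant:
  fixes f :: "real \<Rightarrow> 'a::real_normed_vector"
  assumes "is_interval S" "\<And>t. t \<in> S \<Longrightarrow> (f has_vector_derivative 0) (at t)" "s \<in> S" "t \<in> S"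
  shows "f s = f t"
proof -
  have "\<exists>c. \<forall>x\<in>S. f x = c"
    by (rule has_derivative_zero_constant)
      (use assms(1,2) has_vector_derivative_at_within in \<open>auto simp: has_vector_derivative_def is_interval_convex_1 intro: has_derivative_at_withinI\<close>)
  then show ?thesis using assms(3,4) by metis
qed

locale rosen_given =
  fixes X :: "'q topology" and A :: "('q, 'e::euclidean_space) chart set"
    and X' :: "'w topology" and A' :: "('w, 'e) chart set" and r :: nat and T I :: "real set"
    and a :: "('q, 'e) tmetric" and b :: "('q, 'e) tform" and V :: "real \<times> 'q \<Rightarrow> real"
    and \<Phi> :: "real \<times> 'q \<times> real \<Rightarrow> real \<times> 'w \<times> real" and a' :: "('w, 'e) tmetric"
  assumes atlas0: "Ck_atlas (Suc 0) X A" and openI: "open I" "is_interval I" "I \<subseteq> T"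
    and a: "riemannian_metric_on r A (T \<times> topspace X) a" and b: "one_form_on r A (T \<times> topspace X) b"
    and rosen: "rosen_coordinates 1 X A a b V (I \<times> topspace X \<times> UNIV) X' A' (I \<times> topspace X' \<times> UNIV) \<Phi> a'"
begin

abbreviation "U \<equiv> I \<times> topspace X \<times> (UNIV :: real set)"
abbreviation "W \<equiv> I \<times> topspace X' \<times> (UNIV :: real set)"

lemma atlas0': "Ck_atlas (Suc 0) X' A'"
  using rosen by (simp add: rosen_coordinates_def Ck_manifold_def)

lemmas C = Ck_atlas_chart_system[OF atlas0] and C' = Ck_atlas_chart_system[OF atlas0']
lemmas EC = chart_system_event_atlas[OF C] and EC' = chart_system_event_atlas[OF C']
lemmas SC = chart_system_spacetime_atlas[OF C] and SC' = chart_system_spacetime_atlas[OF C']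

lemma is_charts: "c \<in> A \<Longrightarrow> is_chart X c" "c' \<in> A' \<Longrightarrow> is_chart X' c'"
  using atlas0 atlas0' by (auto simp: Ck_atlas_def)

lemma is_charts_spacetime:
  "c \<in> spacetime_atlas A \<Longrightarrow> is_chart (spacetime_top X) c"
  "c' \<in> spacetime_atlas A' \<Longrightarrow> is_chart (spacetime_top X') c'"
  using is_chart_spacetime_chart[OF is_charts(1)] is_chart_spacetime_chart[OF is_charts(2)]
  by (auto simp only: spacetime_atlas_def)

lemma covered: "q \<in> topspace X \<Longrightarrow> \<exists>c\<in>A. q \<in> fst c" "q' \<in> topspace X' \<Longrightarrow> \<exists>c'\<in>A'. q' \<in> fst c'"
  using atlas0 atlas0' by (auto simp only: Ck_atlas_def)

lemma diffeo: "Ck_diffeo (Suc 0) (spacetime_top X) (spacetime_atlas A) U (spacetime_top X') (spacetime_atlas A') W \<Phi>"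
  using rosen by (simp add: rosen_coordinates_def)

definition \<Psi> where "\<Psi> = inv_into U \<Phi>"

lemma openUW: "openin (spacetime_top X) U" "openin (spacetime_top X') W"
  using diffeo by (auto simp only: Ck_diffeo_def)

lemma \<Phi>\<Psi>:
  "p \<in> U \<Longrightarrow> \<Phi> p \<in> W" "p \<in> U \<Longrightarrow> \<Psi> (\<Phi> p) = p" "p' \<in> W \<Longrightarrow> \<Psi> p' \<in> U" "p' \<in> W \<Longrightarrow> \<Phi> (\<Psi> p') = p'"
proof -
  have bij: "bij_betw \<Phi> U W" using diffeo by (simp only: Ck_diffeo_def)
  show "p \<in> U \<Longrightarrow> \<Phi> p \<in> W" by (rule bij_betwE[OF bij, rule_format])
  show "p \<in> U \<Longrightarrow> \<Psi> (\<Phi> p) = p" unfolding \<Psi>_def by (rule bij_betw_inv_into_left[OF bij])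
  show "p' \<in> W \<Longrightarrow> \<Psi> p' \<in> U" unfolding \<Psi>_def by (rule bij_betwE[OF bij_betw_inv_into[OF bij], rule_format])
  show "p' \<in> W \<Longrightarrow> \<Phi> (\<Psi> p') = p'" unfolding \<Psi>_def by (rule bij_betw_inv_into_right[OF bij])
qed

lemma fst_\<Phi>: "p \<in> U \<Longrightarrow> fst (\<Phi> p) = fst p"
  using rosen unfolding rosen_coordinates_def by blast

lemma Ck\<Phi>:
  assumes p: "p \<in> U" shows "Ck_at (Suc 0) (spacetime_atlas A) (spacetime_atlas A') \<Phi> p"
proof -
  obtain t q y where pe: "p = (t, q, y)" by (metis surj_pair)
  obtain t' q' y' where pe': "\<Phi> p = (t', q', y')" by (metis surj_pair)
  have "q \<in> topspace X" using p by (simp add: pe)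
  moreover have "q' \<in> topspace X'" using \<Phi>\<Psi>(1)[OF p] by (simp add: pe')
  ultimately obtain c c' where c: "c \<in> A" "q \<in> fst c" "c' \<in> A'" "q' \<in> fst c'" using covered by blast
  have "Ck_map (Suc 0) (spacetime_top X) (spacetime_atlas A) U (spacetime_top X') (spacetime_atlas A') \<Phi>"
    using diffeo by (simp only: Ck_diffeo_def)
  from Ck_at_of_Ck_map[OF is_charts_spacetime openUW(1) this spacetime_chart_mem[OF c(1)] spacetime_chart_mem[OF c(3)] p]
  show ?thesis using c by (simp add: pe pe'[unfolded pe])
qed

lemma Ck\<Psi>:
  assumes p: "p \<in> W" shows "Ck_at (Suc 0) (spacetime_atlas A') (spacetime_atlas A) \<Psi> p"
proof -
  obtain t q y where pe: "p = (t, q, y)" by (metis surj_pair)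
  obtain t' q' y' where pe': "\<Psi> p = (t', q', y')" by (metis surj_pair)
  have "q \<in> topspace X'" using p by (simp add: pe)
  moreover have "q' \<in> topspace X" using \<Phi>\<Psi>(3)[OF p] by (simp add: pe')
  ultimately obtain c c' where c: "c \<in> A'" "q \<in> fst c" "c' \<in> A" "q' \<in> fst c'" using covered by blast
  have "Ck_map (Suc 0) (spacetime_top X') (spacetime_atlas A') W (spacetime_top X) (spacetime_atlas A) \<Psi>"
    using diffeo by (simp only: Ck_diffeo_def \<Psi>_def)
  from Ck_at_of_Ck_map[OF is_charts_spacetime(2,1) openUW(2) this spacetime_chart_mem[OF c(1)] spacetime_chart_mem[OF c(3)] p]
  show ?thesis using c by (simp add: pe pe'[unfolded pe])
qed

lemma rosen_identities:
  assumes "c \<in> A" "c' \<in> A'" "p \<in> U" "p \<in> fst (spacetime_chart c)" "\<Phi> p \<in> fst (spacetime_chart c')"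
  shows "coord_deriv (spacetime_chart c) (spacetime_chart c') \<Phi> p (0, 0, 1) = (0, 0, 1)"
    and "gw_metric a b V c p \<xi> \<zeta> = rosen_metric a' c' (\<Phi> p)
      (coord_deriv (spacetime_chart c) (spacetime_chart c') \<Phi> p \<xi>)
      (coord_deriv (spacetime_chart c) (spacetime_chart c') \<Phi> p \<zeta>)"
  using rosen assms unfolding rosen_coordinates_def Let_def by blast+

text \<open>The condition \<open>\<partial>\<^sub>y\<^sub>' = n\<close> says that in charts the
  velocity of \<Phi> along a line in \<open>y\<close> is \<open>(0, 0, 1)\<close>. A chart of
  \<open>Q'\<close> need not contain the image of the whole line, so the formula is carried along
  the connected line from one piece to the next.\<close>

lemma \<Phi>_along_line:
  assumes tq: "t \<in> I" "q \<in> topspace X"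
  shows "snd (\<Phi> (t, q, y)) = (fst (snd (\<Phi> (t, q, 0))), y + snd (snd (\<Phi> (t, q, 0))))"
proof (rule connected_induction_simple[of UNIV 0 y])
  obtain c where c: "c \<in> A" "q \<in> fst c" using covered(1)[OF tq(2)] by blast
  fix y1 :: real
  have p1: "(t, q, y1) \<in> U" using tq by auto
  obtain c' where c': "c' \<in> A'" "\<Phi> (t, q, y1) \<in> fst (spacetime_chart c')"
  proof -
    have "fst (snd (\<Phi> (t, q, y1))) \<in> topspace X'" using \<Phi>\<Psi>(1)[OF p1] by (auto simp: mem_Times_iff)
    then obtain c' where "c' \<in> A'" "fst (snd (\<Phi> (t, q, y1))) \<in> fst c'" using covered(2) by blast
    then show thesis by (intro that[of c']) (auto simp: mem_Times_iff)
  qed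
  let ?sc = "spacetime_chart c" and ?sc' = "spacetime_chart c'"
  obtain N where N: "open N" "snd ?sc (t, q, y1) \<in> N" "\<And>x. x \<in> N \<Longrightarrow> \<Phi> (chart_inv ?sc x) \<in> fst ?sc'"
    by (rule Ck_at_in_charts[OF SC SC' Ck\<Phi>[OF p1] spacetime_chart_mem[OF c(1)] spacetime_chart_mem[OF c'(1)] _ c'(2)])
      (use c in auto)
  have inv: "chart_inv ?sc (t, snd c q, y) = (t, q, y)" for y
    using chart_inv_spacetime_chart[OF is_chart_inj[OF is_charts(1)[OF c(1)]], of "snd c q"] c(2)
      chart_systemD(3)[OF C c] by simp
  have "open ((\<lambda>y. (t, snd c q, y)) -` N)"
    by (intro open_vimage N continuous_intros)
  moreover have "y1 \<in> (\<lambda>y. (t, snd c q, y)) -` N" using N(2) by simp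
  ultimately obtain d where d: "d > 0" "ball y1 d \<subseteq> (\<lambda>y. (t, snd c q, y)) -` N"
    using open_contains_ball by metis
  let ?h = "\<lambda>y. snd ?sc' (\<Phi> (t, q, y))"
  have Dh: "(?h has_vector_derivative (0, 0, 1)) (at y)" if "y \<in> ball y1 d" for y
  proof -
    have p: "(t, q, y) \<in> U" "(t, q, y) \<in> fst ?sc" using tq c by auto
    have \<Phi>p: "\<Phi> (t, q, y) \<in> fst ?sc'" using N(3)[of "(t, snd c q, y)"] d(2) that inv by auto
    let ?L = "coord_deriv ?sc ?sc' \<Phi> (t, q, y)"
    have D: "((\<lambda>x. snd ?sc' (\<Phi> (chart_inv ?sc x))) has_derivative ?L) (at (t, snd c q, y))"
      using coord_deriv_works[OF SC SC' Ck\<Phi>[OF p(1)] spacetime_chart_mem[OF c(1)] spacetime_chart_mem[OF c'(1)] p(2) \<Phi>p]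
      by simp
    have "((\<lambda>y. (t, snd c q, y)) has_derivative (\<lambda>h. (0, 0, h))) (at y)" by (auto intro!: derivative_eq_intros)
    from diff_chain_at[OF this, of "\<lambda>x. snd ?sc' (\<Phi> (chart_inv ?sc x))" ?L] D
    have "(?h has_derivative (\<lambda>h. ?L (0, 0, h))) (at y)" by (simp add: o_def inv)
    moreover have "?L (0, 0, h) = h *\<^sub>R (0, 0, 1)" for h
      using linear_scale[OF has_derivative_linear[OF D], of h "(0, 0, 1)"]
        rosen_identities(1)[OF c(1) c'(1) p \<Phi>p] by simp
    ultimately show ?thesis by (simp add: has_vector_derivative_def)
  qed
  show "\<exists>T. openin (top_of_set UNIV) T \<and> y1 \<in> T \<and> (\<forall>y\<in>T. \<forall>z\<in>T.
      snd (\<Phi> (t, q, y)) = (fst (snd (\<Phi> (t, q, 0))), y + snd (snd (\<Phi> (t, q, 0)))) \<longrightarrow>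
      snd (\<Phi> (t, q, z)) = (fst (snd (\<Phi> (t, q, 0))), z + snd (snd (\<Phi> (t, q, 0)))))"
  proof (intro exI[of _ "ball y1 d"] conjI ballI impI)
    fix y z assume yz: "y \<in> ball y1 d" "z \<in> ball y1 d"
      and P: "snd (\<Phi> (t, q, y)) = (fst (snd (\<Phi> (t, q, 0))), y + snd (snd (\<Phi> (t, q, 0))))"
    have "(\<lambda>y. ?h y - y *\<^sub>R (0, 0, 1)) y = (\<lambda>y. ?h y - y *\<^sub>R (0, 0, 1)) z"
    proof (rule vanishing_derivative_constant[OF _ _ yz])
      fix s assume s: "s \<in> ball y1 d"
      have "((\<lambda>y. y *\<^sub>R ((0, 0, 1) :: real \<times> 'e \<times> real)) has_vector_derivative (0, 0, 1)) (at s)"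
        by (auto intro!: derivative_eq_intros simp: has_vector_derivative_def)
      from has_vector_derivative_diff[OF Dh[OF s] this]
      show "((\<lambda>y. ?h y - y *\<^sub>R (0, 0, 1)) has_vector_derivative 0) (at s)" by simp
    qed (simp add: is_interval_convex_1)
    moreover have mem: "fst (snd (\<Phi> (t, q, y))) \<in> fst c'" if "y \<in> ball y1 d" for y
      using N(3)[of "(t, snd c q, y)"] d(2) that inv by (auto simp: mem_Times_iff)
    ultimately have "snd c' (fst (snd (\<Phi> (t, q, y)))) = snd c' (fst (snd (\<Phi> (t, q, z))))"
      "snd (snd (\<Phi> (t, q, z))) = snd (snd (\<Phi> (t, q, y))) + z - y"
      by (auto simp: spacetime_chart_def case_prod_unfold)
    moreover from this(1) have "fst (snd (\<Phi> (t, q, y))) = fst (snd (\<Phi> (t, q, z)))"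
      by (rule inj_onD[OF chart_systemD(1)[OF C' c'(1)] _ mem[OF yz(1)] mem[OF yz(2)]])
    ultimately show "snd (\<Phi> (t, q, z)) = (fst (snd (\<Phi> (t, q, 0))), z + snd (snd (\<Phi> (t, q, 0))))"
      using P by (simp add: prod_eq_iff)
  qed (use d in auto)
qed auto

text \<open>Read off on the section \<open>y = 0\<close>, which loses nothing by
  \<open>\<Phi>_along_line\<close>.\<close>

definition \<phi> :: "real \<times> 'q \<Rightarrow> 'w" where "\<phi> e = fst (snd (\<Phi> (fst e, snd e, 0)))"
text \<open>Negative because \<open>y' = y - u\<close>; written as a difference from
  \<open>0\<close> so that \<open>Ck_at_diff\<close> applies literally.\<close>

definition u :: "real \<times> 'q \<Rightarrow> real" where "u e = 0 - snd (snd (\<Phi> (fst e, snd e, 0)))"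
definition \<psi> :: "real \<times> 'w \<Rightarrow> 'q" where "\<psi> e = fst (snd (\<Psi> (fst e, snd e, 0)))"

lemma \<Phi>_eq:
  assumes "t \<in> I" "q \<in> topspace X"
  shows "\<Phi> (t, q, y) = (t, \<phi> (t, q), y - u (t, q))"
  using \<Phi>_along_line[OF assms, of y] fst_\<Phi>[of "(t, q, y)"] assms
  by (simp add: \<phi>_def u_def prod_eq_iff)

lemma openI0: "openin (prod_topology euclidean X) (I \<times> topspace X)" "openin (prod_topology euclidean X') (I \<times> topspace X')"
  using openI by (auto simp: openin_prod_Times_iff)

lemma Ck_zero:
  assumes "e \<in> I \<times> topspace X"
  shows "Ck_at (Suc 0) (event_atlas A) (spacetime_atlas A') (\<lambda>e. \<Phi> (fst e, snd e, 0)) e"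
proof -
  obtain c where c: "c \<in> A" "snd e \<in> fst c" using covered(1)[of "snd e"] assms by auto
  show ?thesis
    by (rule Ck_at_compose[OF EC SC SC' Ck_at_zero_section[OF C c] Ck\<Phi>]) (use assms in auto)
qed

sublocale event_diffeo 0 X A X' A' "I \<times> topspace X" "I \<times> topspace X'" \<phi> \<psi>
proof unfold_locales
  show "Ck_atlas (Suc 0) X A" "Ck_atlas (Suc 0) X' A'" by (fact atlas0 atlas0')+
  show "openin (prod_topology euclidean X) (I \<times> topspace X)" "openin (prod_topology euclidean X') (I \<times> topspace X')"
    by (fact openI0)+
  show "(t, \<phi> (t, q)) \<in> I \<times> topspace X' \<and> \<psi> (t, \<phi> (t, q)) = q" if "(t, q) \<in> I \<times> topspace X" for t q
  proof -
    \<comment> \<open>The point over \<open>(t, q)\<close> at height \<open>u (t, q)\<close> is the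
      one with \<open>y' = 0\<close>, which is where \<psi> evaluates the inverse.\<close>
    have p: "(t, q, u (t, q)) \<in> U" using that by auto
    have "\<Phi> (t, q, u (t, q)) = (t, \<phi> (t, q), 0)" using \<Phi>_eq that by auto
    then show ?thesis using \<Phi>\<Psi>(1,2)[OF p] by (auto simp: \<psi>_def)
  qed
  show "(t, \<psi> (t, q')) \<in> I \<times> topspace X \<and> \<phi> (t, \<psi> (t, q')) = q'" if "(t, q') \<in> I \<times> topspace X'" for t q'
  proof -
    have p: "(t, q', 0) \<in> W" using that by auto
    obtain t1 q1 y1 where e: "\<Psi> (t, q', 0) = (t1, q1, y1)" by (metis surj_pair)
    have m: "t1 \<in> I" "q1 \<in> topspace X" using \<Phi>\<Psi>(3)[OF p] by (auto simp: e)
    then have "(t1, \<phi> (t1, q1), y1 - u (t1, q1)) = (t, q', 0)" using \<Phi>\<Psi>(4)[OF p] \<Phi>_eq[OF m, of y1] by (simp only: e)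
    then have t1: "t1 = t" and "\<phi> (t1, q1) = q'" by blast+
    then show ?thesis using m by (auto simp: \<psi>_def e)
  qed
  show "Ck_at (Suc 0) (event_atlas A) A' \<phi> e" if "e \<in> I \<times> topspace X" for e
  proof -
    have "fst (snd (\<Phi> (fst e, snd e, 0))) \<in> topspace X'" using \<Phi>\<Psi>(1)[of "(fst e, snd e, 0)"] that by (auto simp: mem_Times_iff)
    then obtain c' where c': "c' \<in> A'" "fst (snd (\<Phi> (fst e, snd e, 0))) \<in> fst c'" using covered(2) by blast
    show ?thesis unfolding \<phi>_def
      by (rule Ck_at_compose[OF EC SC' C' Ck_zero[OF that] Ck_at_spacetime_q[OF C' c']])
  qed
  show "Ck_at (Suc 0) (event_atlas A') A \<psi> e" if e: "e \<in> I \<times> topspace X'" for e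
  proof -
    have p: "(fst e, snd e, 0) \<in> W" using e by auto
    obtain d where d: "d \<in> A'" "snd e \<in> fst d" using covered(2)[of "snd e"] e by auto
    have "fst (snd (\<Psi> (fst e, snd e, 0))) \<in> topspace X" using \<Phi>\<Psi>(3)[OF p] by (auto simp: mem_Times_iff)
    then obtain c where c: "c \<in> A" "fst (snd (\<Psi> (fst e, snd e, 0))) \<in> fst c" using covered(1) by blast
    have "Ck_at (Suc 0) (event_atlas A') (spacetime_atlas A) (\<lambda>e. \<Psi> (fst e, snd e, 0)) e"
      by (rule Ck_at_compose[OF EC' SC' SC Ck_at_zero_section[OF C' d] Ck\<Psi>[OF p]])
    from Ck_at_compose[OF EC' SC C this Ck_at_spacetime_q[OF C c]] show ?thesis
      unfolding \<psi>_def[abs_def] .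
  qed
qed

lemma Cku:
  assumes e: "e \<in> I \<times> topspace X" shows "Ck_at (Suc 0) (event_atlas A) std_atlas u e"
proof -
  obtain c where c: "c \<in> A" "e \<in> fst (event_chart c)"
    using covered(1)[of "snd e"] e by (auto simp: mem_Times_iff)
  have "fst (snd (\<Phi> (fst e, snd e, 0))) \<in> topspace X'" using \<Phi>\<Psi>(1)[of "(fst e, snd e, 0)"] e by (auto simp: mem_Times_iff)
  then obtain c' where c': "c' \<in> A'" "fst (snd (\<Phi> (fst e, snd e, 0))) \<in> fst c'" using covered(2) by blast
  have "Ck_at (Suc 0) (event_atlas A) std_atlas (\<lambda>e. snd (snd (\<Phi> (fst e, snd e, 0)))) e"
    by (rule Ck_at_compose[OF EC SC' chart_system_std_atlas Ck_zero[OF e] Ck_at_spacetime_y[OF C' c']])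
  from Ck_at_diff[OF EC Ck_at_std_const[OF EC event_chart_mem[OF c(1)] c(2), where q = 0] this]
  show ?thesis unfolding u_def[abs_def] .
qed

text \<open>Comparison of coefficients in the two forms of the metric: \<open>dq dq\<close>
  identifies \<open>a\<close> with the pullback of \<open>a'\<close>, \<open>dt dq\<close>
  determines the velocity, and \<open>dt\<^sup>2\<close> then is the Hamilton-Jacobi equation. The
  kernel contains only one \<open>(1, z)\<close> because the space differential of \<phi> is
  injective.\<close>

lemma
  assumes tq: "t \<in> I" "q \<in> topspace X" and c: "c \<in> A" "q \<in> fst c" and c': "c' \<in> A'" "\<phi> (t, q) \<in> fst c'"
  defines "Z \<equiv> sharp (a c (t, q)) (\<lambda>v. space_deriv c u (t, q) v - b c (t, q) v)"
  shows hj_equation: "time_deriv u (t, q) + hamiltonian a b V c (t, q) (space_deriv c u (t, q)) = 0"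
    and flow_kernel: "coord_deriv (event_chart c) c' \<phi> (t, q) (1, z) = 0 \<longleftrightarrow> z = Z"
proof -
  have e: "(t, q) \<in> I \<times> topspace X" using tq by auto
  have eT: "(t, q) \<in> T \<times> topspace X" using tq openI by auto
  let ?sc = "spacetime_chart c" and ?sc' = "spacetime_chart c'"
  let ?D = "coord_deriv (event_chart c) c' \<phi> (t, q)" and ?Du = "coord_deriv (event_chart c) std_chart u (t, q)"
  have lD: "linear ?D" by (rule coord_deriv_linear[OF EC C' Ck\<phi>[OF e]]) (use c c' in auto)
  have lDu: "linear ?Du" by (rule coord_deriv_linear[OF EC chart_system_std_atlas Cku[OF e]]) (use c in auto)
  have p: "(t, q, 0) \<in> U" "(t, q, 0) \<in> fst ?sc" using tq c by auto
  have \<Phi>p: "\<Phi> (t, q, 0) \<in> fst ?sc'" using \<Phi>_eq[OF tq] c' by simp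
  have "coord_deriv ?sc ?sc' \<Phi> (t, q, 0) = coord_deriv ?sc ?sc' (\<lambda>(t, q, y). (t, \<phi> (t, q), y - u (t, q))) (t, q, 0)"
    by (rule coord_deriv_cong[OF is_charts_spacetime(1)[OF spacetime_chart_mem[OF c(1)]] openUW(1) p])
      (auto simp: \<Phi>_eq)
  then have L: "coord_deriv ?sc ?sc' \<Phi> (t, q, 0) (\<tau>, v, \<eta>) = (\<tau>, ?D (\<tau>, v), \<eta> - ?Du (\<tau>, v))" for \<tau> v \<eta>
    using coord_deriv_spacetime[OF C C' Ck\<phi>[OF e] Cku[OF e] c(1) c'(1) c(2) c'(2)] by simp
  let ?G = "a c (t, q)" and ?G' = "a' c' (t, \<phi> (t, q))"
  have id: "?G v w - \<tau> * (\<zeta> - b c (t, q) w) - (\<eta> - b c (t, q) v) * \<sigma> - 2 * V (t, q) * \<tau> * \<sigma> =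
      ?G' (?D (\<tau>, v)) (?D (\<sigma>, w)) - \<tau> * (\<zeta> - ?Du (\<sigma>, w)) - (\<eta> - ?Du (\<tau>, v)) * \<sigma>" for v w \<tau> \<zeta> \<eta> \<sigma>
    using rosen_identities(2)[OF c(1) c'(1) p \<Phi>p, of "(\<tau>, v, \<eta>)" "(\<sigma>, w, \<zeta>)"]
    unfolding L by (simp add: gw_metric_def rosen_metric_def \<Phi>_eq[OF tq])
  have G: "inner_form ?G" by (rule riemannian_metric_onD(1)[OF a c(1) eT c(2)])
  then have blG: "bilinear ?G" by (simp add: inner_form_def)
  have "riemannian_metric_on 0 A' {(t, q'). \<exists>y'. (t, q', y') \<in> W} a'"
    using rosen by (simp add: rosen_coordinates_def)
  moreover have "(t, \<phi> (t, q)) \<in> {(t, q'). \<exists>y'. (t, q', y') \<in> W}" using \<phi>\<psi>[OF e] by auto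
  ultimately have "inner_form ?G'" by (rule riemannian_metric_onD(1)[OF _ c'(1) _ c'(2)])
  then have blG': "bilinear ?G'" by (simp add: inner_form_def)
  have lb: "linear (b c (t, q))" by (rule one_form_onD(1)[OF b c(1) eT c(2)])
  have zero: "?D (0, 0) = 0" "?Du (0, 0) = 0" "?G v 0 = 0" "?G 0 v = 0" "b c (t, q) 0 = 0" "?G' 0 x = 0" "?G' x 0 = 0" for v x
    using linear_0[OF lD] linear_0[OF lDu] linear_0[OF lb] bilinear_lzero[OF blG] bilinear_rzero[OF blG]
      bilinear_lzero[OF blG'] bilinear_rzero[OF blG'] by (auto simp: zero_prod_def)
  \<comment> \<open>In these instances the time and \<open>y\<close> components are \<open>0\<close>
    or \<open>1\<close>, which isolates one coefficient of the metric at a time.\<close>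
  have 1: "?G v w = ?G' (?D (0, v)) (?D (0, w))" for v w using id[of v w 0 0 0 0] by simp
  have 2: "b c (t, q) w = ?G' (?D (1, 0)) (?D (0, w)) + ?Du (0, w)" for w
    using id[of 0 w 1 0 0 0] by (simp add: zero)
  have 3: "- 2 * V (t, q) = ?G' (?D (1, 0)) (?D (1, 0)) + 2 * ?Du (1, 0)"
    using id[of 0 0 1 0 0 1] by (simp add: zero)
  have "linear (\<lambda>v. (0::real, v::'e))" by (simp add: linear_iff)
  then have lD0: "linear (\<lambda>v. ?D (0, v))" using linear_compose[OF _ lD] by (simp add: o_def)
  have inj0: "v = 0" if "?D (0, v) = 0" for v
    using 1[of v v] G that by (auto simp: zero inner_form_def)
  then have "inj (\<lambda>v. ?D (0, v))" using linear_injective_0[OF lD0] by blast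
  then have "surj (\<lambda>v. ?D (0, v))" using linear_inj_imp_surj[OF lD0] by blast
  \<comment> \<open>\<open>z0\<close> makes \<open>(1, z0)\<close> a kernel vector of the
    differential of \<phi>; the coefficient of \<open>dt dq\<close> identifies it with the velocity
    of the characteristic.\<close>
  then obtain z0 where z0: "?D (0, z0) = - ?D (1, 0)" by (metis surjD)
  have sp: "space_deriv c u (t, q) v = ?Du (0, v)" for v by (rule space_deriv_coord[OF C Cku[OF e] c])
  have tm: "time_deriv u (t, q) = ?Du (1, 0)" by (rule time_deriv_coord[OF C Cku[OF e] c])
  have Gz0: "?G z0 v = space_deriv c u (t, q) v - b c (t, q) v" for v
    using 2[of v] by (simp add: 1 z0 sp bilinear_lneg[OF blG'])
  have Z: "Z = z0" unfolding Z_def by (rule sharp_eqI[OF G Gz0])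
  have "?G Z Z = ?G' (?D (1, 0)) (?D (1, 0))"
    by (simp add: 1 Z z0 bilinear_lneg[OF blG'] bilinear_rneg[OF blG'])
  moreover have "hamiltonian a b V c (t, q) (space_deriv c u (t, q)) = (1 / 2) * ?G Z Z + V (t, q)"
    by (simp add: hamiltonian_def inverse_metric_def Z_def[symmetric]) (simp add: Z Gz0)
  ultimately show "time_deriv u (t, q) + hamiltonian a b V c (t, q) (space_deriv c u (t, q)) = 0"
    using 3 by (simp add: tm)
  have "?D (1, z) = ?D (0, z - z0)"
    using linear_add[OF lD, of "(1, 0)" "(0, z)"] linear_diff[OF lD0, of z z0] z0 by simp
  then show "?D (1, z) = 0 \<longleftrightarrow> z = Z" using inj0[of "z - z0"] zero by (auto simp: Z)
qed

lemma hj_solution_u: "hj_solution 1 X A a b V I u"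
  unfolding hj_solution_def
proof (intro conjI ballI)
  show "Ck_fun 1 (event_atlas A) (I \<times> topspace X) u"
    unfolding Ck_fun_def
  proof (intro ballI Ck_on_local)
    fix ec x assume ec: "ec \<in> event_atlas A" and x: "x \<in> snd ec ` (fst ec \<inter> I \<times> topspace X)"
    then obtain e where e: "x = snd ec e" "e \<in> fst ec" "e \<in> I \<times> topspace X" by auto
    from Ck_at_std_in_chart[OF EC Cku[OF e(3)] ec e(2)]
    show "\<exists>U. open U \<and> x \<in> U \<and> Ck_on 1 U (u \<circ> chart_inv ec)"
      by (metis (no_types, lifting) One_nat_def comp_apply e(1) ext)
  qed
  fix c t q assume c: "c \<in> A" "t \<in> I" "q \<in> fst c"
  have q: "q \<in> topspace X" using is_chart_subset[OF is_charts(1)[OF c(1)]] c by blast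
  then have "\<phi> (t, q) \<in> topspace X'" using \<phi>\<psi>[of t q] c by simp
  then obtain c' where "c' \<in> A'" "\<phi> (t, q) \<in> fst c'" using covered(2) by blast
  then show "time_deriv u (t, q) + hamiltonian a b V c (t, q) (space_deriv c u (t, q)) = 0"
    using hj_equation[OF c(2) q c(1,3)] by blast
qed simp

text \<open>Charts of \<open>Q\<close> and \<open>Q'\<close> see only short pieces of the curve, so
  constancy is shown locally and spread over \<open>K\<close> by connectedness.\<close>

lemma \<phi>_along_characteristic:
  assumes \<gamma>: "base_characteristic X A a b I u K \<gamma>" and st: "s \<in> K" "t \<in> K"
  shows "\<phi> (s, \<gamma> s) = \<phi> (t, \<gamma> t)"
proof -
  have K: "open K" "is_interval K" "K \<subseteq> I" "continuous_map (top_of_set K) X \<gamma>"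
    using \<gamma> by (auto simp: base_characteristic_def)
  have top: "\<gamma> t \<in> topspace X" if "t \<in> K" for t using K(4) that by (auto simp: continuous_map_def)
  have "(\<lambda>t. \<phi> (t, \<gamma> t)) constant_on K"
  proof (rule locally_constant_imp_constant)
    show "connected K" using K(2) is_interval_connected by blast
    fix t1 assume t1: "t1 \<in> K"
    have e1: "(t1, \<gamma> t1) \<in> I \<times> topspace X" using K t1 top by auto
    obtain c where c: "c \<in> A" "\<gamma> t1 \<in> fst c" using covered(1)[OF top[OF t1]] by blast
    have "\<phi> (t1, \<gamma> t1) \<in> topspace X'" using \<phi>\<psi>[OF e1] by simp
    then obtain c' where c': "c' \<in> A'" "\<phi> (t1, \<gamma> t1) \<in> fst c'" using covered(2) by blast
    obtain N where N: "open N" "snd (event_chart c) (t1, \<gamma> t1) \<in> N"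
      "\<And>x. x \<in> N \<Longrightarrow> \<phi> (chart_inv (event_chart c) x) \<in> fst c'"
      by (rule Ck_at_in_charts[OF EC C' Ck\<phi>[OF e1] event_chart_mem[OF c(1)] c'(1) _ c'(2)]) (use c in auto)
    note inv = chart_inv_event_chart[OF chart_systemD(1)[OF C c(1)]]
    define S where "S = {t \<in> K. \<gamma> t \<in> fst c \<and> (t, snd c (\<gamma> t)) \<in> N}"
    have "open S" unfolding S_def by (rule coordinate_curve_open[OF is_charts(1)[OF c(1)] K(4,1) N(1)])
    moreover have "t1 \<in> S" using t1 c N by (simp add: S_def)
    ultimately obtain d where d: "d > 0" "ball t1 d \<subseteq> S" using open_contains_ball by metis
    have \<phi>c': "\<phi> (t, \<gamma> t) \<in> fst c'" if "t \<in> ball t1 d" for t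
    proof -
      have "t \<in> S" using d that by blast
      then show ?thesis using N(3)[of "(t, snd c (\<gamma> t))"] chart_systemD(3)[OF C c(1), of "\<gamma> t"]
        by (simp add: S_def inv)
    qed
    have "snd c' (\<phi> (t, \<gamma> t)) = snd c' (\<phi> (t1, \<gamma> t1))" if "t \<in> ball t1 d" for t
    proof (rule vanishing_derivative_constant[where f = "\<lambda>t. snd c' (\<phi> (t, \<gamma> t))", OF _ _ that])
      fix t assume t: "t \<in> ball t1 d"
      then have tS: "t \<in> S" using d by blast
      then have tK: "t \<in> K" "\<gamma> t \<in> fst c" by (auto simp: S_def)
      have tI: "t \<in> I" using tK K by auto
      let ?D = "coord_deriv (event_chart c) c' \<phi> (t, \<gamma> t)"
      let ?Z = "sharp (a c (t, \<gamma> t)) (\<lambda>v. space_deriv c u (t, \<gamma> t) v - b c (t, \<gamma> t) v)"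
      have "(t, \<gamma> t) \<in> I \<times> topspace X" using tI top[OF tK(1)] by auto
      from coord_deriv_works[OF EC C' Ck\<phi>[OF this] event_chart_mem[OF c(1)] c'(1) _ \<phi>c'[OF t]]
      have D: "((\<lambda>x. snd c' (\<phi> (chart_inv (event_chart c) x))) has_derivative ?D) (at (t, snd c (\<gamma> t)))"
        using tK by simp
      have "((\<lambda>s. snd c (\<gamma> s)) has_vector_derivative ?Z) (at t)"
        using \<gamma> c(1) tK unfolding base_characteristic_def by blast
      then have "((\<lambda>s. (s, snd c (\<gamma> s))) has_vector_derivative (1, ?Z)) (at t)"
        unfolding has_vector_derivative_def by (auto intro!: derivative_eq_intros)
      from vector_derivative_diff_chain_within[OF this, of _ ?D] D
      have "((\<lambda>s. snd c' (\<phi> (chart_inv (event_chart c) (s, snd c (\<gamma> s))))) has_vector_derivative ?D (1, ?Z)) (at t)"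
        by (auto simp: o_def intro: has_derivative_at_withinI)
      then have "((\<lambda>s. snd c' (\<phi> (s, \<gamma> s))) has_vector_derivative ?D (1, ?Z)) (at t)"
        by (rule has_vector_derivative_transform_within_open[OF _ \<open>open S\<close> tS])
          (use chart_systemD(3)[OF C c(1)] in \<open>auto simp: inv S_def\<close>)
      moreover have "?D (1, ?Z) = 0"
        using flow_kernel[OF tI top[OF tK(1)] c(1) tK(2) c'(1) \<phi>c'[OF t]] by blast
      ultimately show "((\<lambda>s. snd c' (\<phi> (s, \<gamma> s))) has_vector_derivative 0) (at t)" by simp
    qed (use d in \<open>auto simp: is_interval_convex_1\<close>)
    then have "\<phi> (t, \<gamma> t) = \<phi> (t1, \<gamma> t1)" if "t \<in> ball t1 d" for t
      using inj_onD[OF chart_systemD(1)[OF C' c'(1)]] \<phi>c'[OF that] c'(2) that by blast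
    moreover have "ball t1 d \<subseteq> K" using d by (auto simp: S_def)
    then have "openin (top_of_set K) (ball t1 d)" by (rule open_subset) simp
    moreover have "t1 \<in> ball t1 d" using d(1) by simp
    ultimately show "\<exists>T. openin (top_of_set K) T \<and> t1 \<in> T \<and> (\<forall>x\<in>T. \<phi> (x, \<gamma> x) = \<phi> (t1, \<gamma> t1))"
      by blast
  qed
  then show ?thesis using st by (auto simp: constant_on_def)
qed

text \<open>Feeding the constant value \<open>q'\<close> into \<psi> gives a curve on all of
  \<open>I\<close>. Its velocity lies in the kernel of the differential of \<phi>, hence is the
  characteristic one, and \<open>\<phi>_along_characteristic\<close> makes it agree with \<gamma> on
  \<open>K\<close>.\<close>

lemma characteristics_extend: "characteristics_extend_to X A a b I u I"
  unfolding characteristics_extend_to_def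
proof (intro allI impI)
  fix K \<gamma> assume \<gamma>: "base_characteristic X A a b I u K \<gamma>"
  then have K: "open K" "K \<noteq> {}" "K \<subseteq> I" "continuous_map (top_of_set K) X \<gamma>"
    by (auto simp: base_characteristic_def)
  obtain s where s: "s \<in> K" using K by blast
  have top: "\<gamma> t \<in> topspace X" if "t \<in> K" for t using K(4) that by (auto simp: continuous_map_def)
  define q' where "q' = \<phi> (s, \<gamma> s)"
  have q': "q' \<in> topspace X'" using \<phi>\<psi>[of s "\<gamma> s"] s K(3) top by (auto simp: q'_def)
  define \<gamma>' where "\<gamma>' t = \<psi> (t, q')" for t
  have \<gamma>'eq: "\<gamma>' t = \<gamma> t" if "t \<in> K" for t
    using \<phi>\<psi>[of t "\<gamma> t"] \<phi>_along_characteristic[OF \<gamma> s that] that K(3) top by (auto simp: \<gamma>'_def q'_def)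
  have \<gamma>': "\<gamma>' t \<in> topspace X" "\<phi> (t, \<gamma>' t) = q'" if "t \<in> I" for t
    using \<psi>\<phi>[of t q'] that q' by (auto simp: \<gamma>'_def)
  have "base_characteristic X A a b I u I \<gamma>'"
    unfolding base_characteristic_def
  proof (intro conjI ballI impI)
    show "I \<noteq> {}" using K by blast
    have "Ck_map (Suc 0) (prod_topology euclidean X') (event_atlas A') (I \<times> topspace X') X A \<psi>"
      by (rule Ck_map_of_Ck_at[OF EC' _ C is_charts(1) openI0(2) Ck\<psi>])
        (use is_chart_event_chart[OF is_charts(2)] in \<open>auto simp only: event_atlas_def\<close>)
    then have c\<psi>: "continuous_map (subtopology (prod_topology euclidean X') (I \<times> topspace X')) X \<psi>"
      by (simp only: Ck_map_def)
    have "continuous_map (top_of_set I) (subtopology (prod_topology euclidean X') (I \<times> topspace X')) (\<lambda>t. (t, q'))"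
      using q' by (intro continuous_map_into_subtopology continuous_map_pairedI) auto
    from continuous_map_compose[OF this c\<psi>] show "continuous_map (top_of_set I) X \<gamma>'"
      by (simp add: \<gamma>'_def[abs_def] o_def)
    fix c t assume c: "c \<in> A" "t \<in> I" "\<gamma>' t \<in> fst c"
    obtain c' where c': "c' \<in> A'" "q' \<in> fst c'" using covered(2)[OF q'] by blast
    let ?x = "coord_deriv (event_chart c') c \<psi> (t, q') (1, 0)"
    have eW: "(t, q') \<in> I \<times> topspace X'" using c q' by auto
    have "coord_deriv (event_chart c) c' \<phi> (t, \<gamma>' t) (1, ?x) = 0"
      using D\<phi>D\<psi>[OF eW c(1) c'(1) _ c'(2), of 1 0] c(3) by (simp add: \<gamma>'_def)
    then have "?x = sharp (a c (t, \<gamma>' t)) (\<lambda>v. space_deriv c u (t, \<gamma>' t) v - b c (t, \<gamma>' t) v)"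
      using flow_kernel[OF c(2) \<gamma>'(1)[OF c(2)] c(1,3) c'(1)] c' \<gamma>'(2)[OF c(2)] by simp
    moreover have "((\<lambda>s. snd c (\<gamma>' s)) has_vector_derivative ?x) (at t)"
      using \<psi>_time_derivative[OF eW c(1) c'(1) _ c'(2)] c(3) by (simp add: \<gamma>'_def)
    ultimately show "((\<lambda>s. snd c (\<gamma>' s)) has_vector_derivative
        sharp (a c (t, \<gamma>' t)) (\<lambda>v. space_deriv c u (t, \<gamma>' t) v - b c (t, \<gamma>' t) v)) (at t)" by simp
  qed (use openI in auto)
  then show "\<exists>K' \<gamma>'. base_characteristic X A a b I u K' \<gamma>' \<and> K \<subseteq> K' \<and> I \<subseteq> K' \<and> (\<forall>t\<in>K. \<gamma>' t = \<gamma> t)"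
    using K(3) \<gamma>'eq by blast
qed

end

section \<open>Rosen coordinates from a solution\<close>

lemma riemannian_metric_on_mono:
  assumes "riemannian_metric_on l A D a" "k \<le> l" "D' \<subseteq> D"
  shows "riemannian_metric_on k A D' a"
  unfolding riemannian_metric_on_def
proof (intro conjI ballI allI)
  fix c v w assume "c \<in> A"
  then have "Ck_on l (snd (event_chart c) ` (fst (event_chart c) \<inter> D)) (\<lambda>z. a c (chart_inv (event_chart c) z) v w)"
    using assms(1) by (simp add: riemannian_metric_on_def)
  then show "Ck_on k (snd (event_chart c) ` (fst (event_chart c) \<inter> D')) (\<lambda>z. a c (chart_inv (event_chart c) z) v w)"
    by (rule Ck_on_mono[OF Ck_on_subset assms(2)]) (use assms(3) in blast)
next
  fix c e assume "c \<in> A" "e \<in> D'"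
  then have "c \<in> A" "e \<in> D" using assms(3) by auto
  note parts = conjunct2[OF assms(1)[unfolded riemannian_metric_on_def]]
  from bspec[OF bspec[OF conjunct1[OF parts] \<open>c \<in> A\<close>] \<open>e \<in> D\<close>] show "case e of (t, q) \<Rightarrow> q \<in> fst c \<longrightarrow> bilinear (a c (t, q)) \<and> (\<forall>v w. a c (t, q) v w = a c (t, q) w v) \<and>
      (\<forall>v. v \<noteq> 0 \<longrightarrow> 0 < a c (t, q) v v)" .
  fix c' assume "c' \<in> A"
  from bspec[OF bspec[OF bspec[OF conjunct2[OF parts] \<open>c \<in> A\<close>] \<open>c' \<in> A\<close>] \<open>e \<in> D\<close>] show "case e of (t, q) \<Rightarrow> q \<in> fst c \<inter> fst c' \<longrightarrow> (\<forall>v w. a c (t, q) v w =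
      a c' (t, q) (coord_deriv c c' (\<lambda>x. x) q v) (coord_deriv c c' (\<lambda>x. x) q w))" .
qed

lemma one_form_on_mono:
  assumes "one_form_on l A D b" "k \<le> l" "D' \<subseteq> D"
  shows "one_form_on k A D' b"
  unfolding one_form_on_def
proof (intro conjI ballI allI)
  fix c v assume "c \<in> A"
  then have "Ck_on l (snd (event_chart c) ` (fst (event_chart c) \<inter> D)) (\<lambda>z. b c (chart_inv (event_chart c) z) v)"
    using assms(1) by (simp add: one_form_on_def)
  then show "Ck_on k (snd (event_chart c) ` (fst (event_chart c) \<inter> D')) (\<lambda>z. b c (chart_inv (event_chart c) z) v)"
    by (rule Ck_on_mono[OF Ck_on_subset assms(2)]) (use assms(3) in blast)
next
  fix c e assume "c \<in> A" "e \<in> D'"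
  then have "c \<in> A" "e \<in> D" using assms(3) by auto
  note parts = conjunct2[OF assms(1)[unfolded one_form_on_def]]
  from bspec[OF bspec[OF conjunct1[OF parts] \<open>c \<in> A\<close>] \<open>e \<in> D\<close>] show "case e of (t, q) \<Rightarrow> q \<in> fst c \<longrightarrow> linear (b c (t, q))" .
  fix c' assume "c' \<in> A"
  from bspec[OF bspec[OF bspec[OF conjunct2[OF parts] \<open>c \<in> A\<close>] \<open>c' \<in> A\<close>] \<open>e \<in> D\<close>] show "case e of (t, q) \<Rightarrow> q \<in> fst c \<inter> fst c' \<longrightarrow> (\<forall>v. b c (t, q) v =
      b c' (t, q) (coord_deriv c c' (\<lambda>x. x) q v))" .
qed

subsection \<open>The velocity field of the characteristics\<close>

definition velocity ::
  "('q, 'e::euclidean_space) tmetric \<Rightarrow> ('q, 'e) tform \<Rightarrow> (real \<times> 'q \<Rightarrow> real) \<Rightarrow> ('q, 'e) chart \<Rightarrow> real \<times> 'q \<Rightarrow> 'e" where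
  "velocity a b u c e = sharp (a c e) (\<lambda>v. space_deriv c u e v - b c e v)"

lemma coord_deriv_id_inverse:
  assumes A: "chart_system (Suc k) A" and c: "c \<in> A" "c' \<in> A" "q \<in> fst c" "q \<in> fst c'"
  shows "coord_deriv c c' (\<lambda>x. x) q (coord_deriv c' c (\<lambda>x. x) q v) = v"
  using coord_deriv_compose[OF A A A Ck_at_id[OF A c(2,4)] Ck_at_id[OF A c(1,3)] c(2,1,2) c(4,3,4), of v]
    coord_deriv_id[OF A c(2,4)] by simp

text \<open>Uniqueness of the dual vector turns the transformation laws of \<open>a\<close>,
  \<open>b\<close> and the differential of \<open>u\<close> into that of a vector; for this the test
  vector \<open>v\<close> is written as the image of a vector \<open>w\<close> of the other
  chart.\<close>

lemma
  assumes A: "chart_system (Suc k) A" and u: "Ck_at (Suc k) (event_atlas A) std_atlas u (t, q)"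
    and a: "riemannian_metric_on l A D a" and b: "one_form_on m A D b" and e: "(t, q) \<in> D"
    and c: "c \<in> A" "q \<in> fst c"
  shows velocity_works: "a c (t, q) (velocity a b u c (t, q)) v = space_deriv c u (t, q) v - b c (t, q) v"
    and velocity_transform: "c' \<in> A \<Longrightarrow> q \<in> fst c' \<Longrightarrow>
      velocity a b u c' (t, q) = coord_deriv c c' (\<lambda>x. x) q (velocity a b u c (t, q))"
proof -
  note E = chart_system_event_atlas[OF A]
  have sp: "space_deriv c u (t, q) v = coord_deriv (event_chart c) std_chart u (t, q) (0, v)"
    if "c \<in> A" "q \<in> fst c" for c v by (rule space_deriv_coord[OF A u that])
  have "linear (coord_deriv (event_chart c) std_chart u (t, q))"
    by (rule coord_deriv_linear[OF E chart_system_std_atlas u]) (use c in auto)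
  moreover have "linear (\<lambda>v. (0::real, v))" by (simp add: linear_iff)
  ultimately have "linear (space_deriv c u (t, q))"
    using linear_compose[of "\<lambda>v. (0, v)"] by (simp add: sp[OF c, abs_def] o_def)
  then have l: "linear (\<lambda>v. space_deriv c u (t, q) v - b c (t, q) v)"
    using one_form_onD(1)[OF b c(1) e c(2)] by (rule linear_compose_sub)
  have G: "inner_form (a c (t, q))" by (rule riemannian_metric_onD(1)[OF a c(1) e c(2)])
  show works: "a c (t, q) (velocity a b u c (t, q)) v = space_deriv c u (t, q) v - b c (t, q) v" for v
    unfolding velocity_def by (rule sharp_works[OF G l])
  assume c': "c' \<in> A" "q \<in> fst c'"
  have ide: "Ck_at (Suc k) (event_atlas A) (event_atlas A) (\<lambda>x. x) (t, q)"
    by (rule Ck_at_id[OF E, of "event_chart c"]) (use c in auto)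
  have "coord_deriv (event_chart c) std_chart (\<lambda>x. u ((\<lambda>x. x) x)) (t, q) (0, v) =
      coord_deriv (event_chart c') std_chart u (t, q) (coord_deriv (event_chart c) (event_chart c') (\<lambda>x. x) (t, q) (0, v))" for v
    by (rule coord_deriv_compose[OF E E chart_system_std_atlas ide u]) (use c c' in auto)
  then have spT: "space_deriv c u (t, q) v = space_deriv c' u (t, q) (coord_deriv c c' (\<lambda>x. x) q v)" for v
    using coord_deriv_event_id[OF A c(1) c'(1) c(2) c'(2)] by (simp add: sp[OF c] sp[OF c'])
  show "velocity a b u c' (t, q) = coord_deriv c c' (\<lambda>x. x) q (velocity a b u c (t, q))"
    unfolding velocity_def[of a b u c']
  proof (rule sharp_eqI)
    show "inner_form (a c' (t, q))" by (rule riemannian_metric_onD(1)[OF a c'(1) e c'(2)])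
    fix v
    define w where "w = coord_deriv c' c (\<lambda>x. x) q v"
    have v: "v = coord_deriv c c' (\<lambda>x. x) q w"
      unfolding w_def by (rule coord_deriv_id_inverse[OF A c(1) c'(1) c(2) c'(2), symmetric])
    show "a c' (t, q) (coord_deriv c c' (\<lambda>x. x) q (velocity a b u c (t, q))) v = space_deriv c' u (t, q) v - b c' (t, q) v"
      using works[of w] riemannian_metric_onD(2)[OF a c(1) e c(2) c', of "velocity a b u c (t, q)" w]
        one_form_onD(2)[OF b c(1) e c(2) c', of w] spT[of w] by (simp add: v)
  qed
qed

lemma base_characteristic_subset:
  assumes "base_characteristic X A a b I u K \<gamma>" "open K'" "is_interval K'" "K' \<noteq> {}" "K' \<subseteq> K"
  shows "base_characteristic X A a b I u K' \<gamma>"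
  using assms continuous_map_from_subtopology_mono unfolding base_characteristic_def by blast

text \<open>The solution is of class \<open>j + 2\<close>, so its velocity and flow are of class
  \<open>j + 1\<close>. The bound \<open>jr\<close> is \<open>k \<le> r + 1\<close> for
  \<open>k = j + 2\<close>: the coefficients, of class \<open>r\<close>, are then smooth enough for
  the velocity, and the charts, of class \<open>r + 1\<close>, for the solution.\<close>

locale hj_given =
  fixes X :: "'q topology" and A :: "('q, 'e::euclidean_space) chart set" and r j :: nat and T I J :: "real set"
    and a :: "('q, 'e) tmetric" and b :: "('q, 'e) tform" and V u :: "real \<times> 'q \<Rightarrow> real"
  assumes manifold: "Ck_manifold (Suc r) X A" and jr: "Suc j \<le> r"
    and openI: "open I" "is_interval I" "I \<subseteq> T" and openJ: "open J" "is_interval J" "J \<subseteq> I"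
    and a: "riemannian_metric_on r A (T \<times> topspace X) a" and b: "one_form_on r A (T \<times> topspace X) b"
    and hj: "hj_solution (Suc (Suc j)) X A a b V I u"
    and extend: "characteristics_extend_to X A a b I u J"
begin

lemma atlas: "Ck_atlas (Suc j) X A"
  using manifold jr by (auto simp: Ck_manifold_def intro: Ck_atlas_mono)

lemma atlas2: "Ck_atlas (Suc (Suc j)) X A"
  using manifold jr by (auto simp: Ck_manifold_def intro: Ck_atlas_mono)

lemmas C = Ck_atlas_chart_system[OF atlas] and C2 = Ck_atlas_chart_system[OF atlas2]
lemmas EC = chart_system_event_atlas[OF C]
lemmas EEC = chart_system_event_atlas[OF EC]

lemma is_charts: "c \<in> A \<Longrightarrow> is_chart X c"
  using atlas by (auto simp: Ck_atlas_def)

lemma covered: "q \<in> topspace X \<Longrightarrow> \<exists>c\<in>A. q \<in> fst c"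
  using atlas by (auto simp only: Ck_atlas_def)

lemma chart_top: "c \<in> A \<Longrightarrow> q \<in> fst c \<Longrightarrow> q \<in> topspace X"
  using is_chart_subset[OF is_charts] by blast

lemma chart_domain:
  assumes "c \<in> A"
  shows "snd (event_chart c) ` (fst (event_chart c) \<inter> I \<times> topspace X) = I \<times> snd c ` fst c"
    and "open (I \<times> snd c ` fst c)"
proof -
  have "fst (event_chart c) \<inter> I \<times> topspace X = I \<times> fst c"
    using chart_top[OF assms] by auto
  then show "snd (event_chart c) ` (fst (event_chart c) \<inter> I \<times> topspace X) = I \<times> snd c ` fst c"
    by (simp only: event_chart_image)
  show "open (I \<times> snd c ` fst c)" using openI chart_systemD(2)[OF C assms] by (simp add: open_Times)
qed

lemma Cku_chart:
  assumes c: "c \<in> A"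
  shows "Ck_on (Suc (Suc j)) (I \<times> snd c ` fst c) (\<lambda>z. u (chart_inv (event_chart c) z))"
proof -
  have "Ck_fun (Suc (Suc j)) (event_atlas A) (I \<times> topspace X) u" using hj by (simp only: hj_solution_def)
  from bspec[OF this[unfolded Ck_fun_def] event_chart_mem[OF c]]
  show ?thesis unfolding chart_domain(1)[OF c] o_def .
qed

lemma Cku2:
  assumes e: "e \<in> I \<times> topspace X" shows "Ck_at (Suc (Suc j)) (event_atlas A) std_atlas u e"
proof -
  obtain c where c: "c \<in> A" "snd e \<in> fst c" using covered[of "snd e"] e by auto
  show ?thesis
    unfolding Ck_at_std_iff
  proof (intro bexI[OF _ event_chart_mem[OF c(1)]] exI[of _ "I \<times> snd c ` fst c"] conjI)
    show "Ck_on (Suc (Suc j)) (I \<times> snd c ` fst c) (\<lambda>z. u (chart_inv (event_chart c) z))" by (rule Cku_chart[OF c(1)])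
    show "open (I \<times> snd c ` fst c)" by (rule chart_domain(2)[OF c(1)])
  qed (use c e in \<open>cases e, auto simp: event_chart_image\<close>)+
qed

lemmas Cku = Ck_at_mono[OF Cku2 le_SucI[OF order_refl]]

abbreviation vel where "vel \<equiv> velocity a b u"

lemma vel_transform:
  assumes "c \<in> A" "c' \<in> A" "t \<in> I" "q \<in> fst c" "q \<in> fst c'"
  shows "vel c' (t, q) = coord_deriv c c' (\<lambda>x. x) q (vel c (t, q))"
  by (rule velocity_transform[OF C Cku a b]) (use assms chart_top openI in auto)

text \<open>With its index lowered, the velocity solves a linear system with coefficients from
  \<open>a\<close> and right side \<open>du - b\<close>, all of class \<open>j + 1\<close>.\<close>

lemma vel_Ck:
  assumes c: "c \<in> A"
  shows "Ck_on (Suc j) (I \<times> snd c ` fst c) (\<lambda>z. vel c (chart_inv (event_chart c) z))"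
proof -
  let ?S = "I \<times> snd c ` fst c" and ?i = "chart_inv (event_chart c)"
  have o: "open ?S" by (rule chart_domain(2)[OF c])
  have iz: "\<exists>t q. z = (t, snd c q) \<and> ?i z = (t, q) \<and> t \<in> I \<and> q \<in> fst c" if "z \<in> ?S" for z
    using that chart_systemD(1,3)[OF C c] by (auto simp: chart_inv_event_chart)
  have sub: "?S \<subseteq> snd (event_chart c) ` (fst (event_chart c) \<inter> T \<times> topspace X)"
    unfolding chart_domain(1)[OF c, symmetric] using openI(3) by blast
  have Cka: "Ck_on (Suc j) ?S (\<lambda>z. a c (?i z) v w)" for v w
  proof -
    have "Ck_on r (snd (event_chart c) ` (fst (event_chart c) \<inter> T \<times> topspace X)) (\<lambda>z. a c (?i z) v w)"
      using a c by (simp add: riemannian_metric_on_def)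
    from Ck_on_mono[OF Ck_on_subset[OF this sub] jr] show ?thesis .
  qed
  have Ckb: "Ck_on (Suc j) ?S (\<lambda>z. b c (?i z) v)" for v
  proof -
    have "Ck_on r (snd (event_chart c) ` (fst (event_chart c) \<inter> T \<times> topspace X)) (\<lambda>z. b c (?i z) v)"
      using b c by (simp add: one_form_on_def)
    from Ck_on_mono[OF Ck_on_subset[OF this sub] jr] show ?thesis .
  qed
  have "Ck_on (Suc (Suc j)) ?S (\<lambda>z. u (?i z))" by (rule Cku_chart[OF c])
  then have Cku': "Ck_on (Suc j) ?S (\<lambda>z. frechet_derivative (\<lambda>z. u (?i z)) (at z) v)" for v
    by (simp only: Ck_on.simps(2)[of "Suc j"])
  have sp: "space_deriv c u (?i z) v = frechet_derivative (\<lambda>z. u (?i z)) (at z) (0, v)" if z: "z \<in> ?S" for z v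
  proof -
    obtain t q where *: "z = (t, snd c q)" "?i z = (t, q)" "t \<in> I" "q \<in> fst c" using iz[OF z] by blast
    have "(t, q) \<in> I \<times> topspace X" using * chart_top[OF c] by auto
    from space_deriv_coord[OF C Cku[OF this] c *(4), of v] show ?thesis
      unfolding *(2) by (simp add: coord_deriv_def o_def *(1))
  qed
  have G: "inner_form (a c (?i z))" if "z \<in> ?S" for z
    using iz[OF that] riemannian_metric_onD(1)[OF a c] chart_top[OF c] openI by force
  show ?thesis
  proof (rule Ck_on_solve[OF o, of "\<lambda>z. lower_index (a c (?i z))"])
    show "linear (lower_index (a c (?i z)))" "inj (lower_index (a c (?i z)))" if "z \<in> ?S" for z
      using linear_lower_index inj_lower_index G[OF that] by auto
    show "Ck_on (Suc j) ?S (\<lambda>z. lower_index (a c (?i z)) v)" for v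
      unfolding lower_index_def by (intro Ck_on_sum Ck_on_scaleR Cka Ck_on_const o)
    have "Ck_on (Suc j) ?S (\<lambda>z. \<Sum>v\<in>Basis. (frechet_derivative (\<lambda>z. u (?i z)) (at z) (0, v) - b c (?i z) v) *\<^sub>R v)"
      by (intro Ck_on_sum Ck_on_scaleR Ck_on_diff Cku' Ckb Ck_on_const o)
    then show "Ck_on (Suc j) ?S (\<lambda>z. lower_index (a c (?i z)) (vel c (?i z)))"
    proof (rule Ck_on_cong[OF o])
      fix z assume z: "z \<in> ?S"
      obtain t q where *: "?i z = (t, q)" "t \<in> I" "q \<in> fst c" using iz[OF z] by blast
      have e: "(t, q) \<in> I \<times> topspace X" "(t, q) \<in> T \<times> topspace X" using * chart_top[OF c] openI by auto
      show "(\<Sum>v\<in>Basis. (frechet_derivative (\<lambda>z. u (?i z)) (at z) (0, v) - b c (?i z) v) *\<^sub>R v) =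
          lower_index (a c (?i z)) (vel c (?i z))"
        unfolding lower_index_def sp[OF z, symmetric]
        by (rule sum.cong[OF refl]) (simp add: * velocity_works[OF C Cku[OF e(1)] a b e(2) c *(3)])
    qed
  qed
qed

lemma base_characteristic_vel:
  "base_characteristic X A a b I u K \<gamma> \<longleftrightarrow> open K \<and> is_interval K \<and> K \<noteq> {} \<and> K \<subseteq> I \<and>
     continuous_map (top_of_set K) X \<gamma> \<and>
     (\<forall>c\<in>A. \<forall>t\<in>K. \<gamma> t \<in> fst c \<longrightarrow> ((\<lambda>s. snd c (\<gamma> s)) has_vector_derivative vel c (t, \<gamma> t)) (at t))"
  by (simp add: base_characteristic_def velocity_def)

subsection \<open>Existence and uniqueness of characteristics\<close>

text \<open>A characteristic has to satisfy its equation in every chart; the transformation law of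
  the velocity reduces this to the one chart in which the curve is constructed.\<close>

lemma base_characteristic_of_chart:
  assumes c: "c \<in> A" and K: "open K" "is_interval K" "K \<noteq> {}" "K \<subseteq> I"
    and x: "\<And>t. t \<in> K \<Longrightarrow> x t \<in> snd c ` fst c"
    and D: "\<And>t. t \<in> K \<Longrightarrow> (x has_vector_derivative vel c (t, chart_inv c (x t))) (at t)"
  shows "base_characteristic X A a b I u K (\<lambda>t. chart_inv c (x t))"
  unfolding base_characteristic_vel
proof (intro conjI K ballI impI)
  let ?\<gamma> = "\<lambda>t. chart_inv c (x t)"
  note cc = chart_systemD[OF C c]
  have \<gamma>: "?\<gamma> t \<in> fst c" "snd c (?\<gamma> t) = x t" if "t \<in> K" for t using chart_inv_right[OF x[OF that]] .
  have contx: "continuous_on K x"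
    using D has_vector_derivative_continuous by (blast intro: continuous_at_imp_continuous_on)
  show "continuous_map (top_of_set K) X ?\<gamma>"
    unfolding continuous_map_def
  proof (intro conjI allI impI)
    show "?\<gamma> \<in> topspace (top_of_set K) \<rightarrow> topspace X" using \<gamma>(1) chart_top[OF c] by auto
    fix O' assume O': "openin X O'"
    have "open (snd c ` (fst c \<inter> O'))" by (rule is_chart_open_image[OF is_charts[OF c] O'])
    from continuous_openin_preimage_gen[OF contx this]
    have "openin (top_of_set K) (K \<inter> x -` snd c ` (fst c \<inter> O'))" .
    moreover have "K \<inter> x -` snd c ` (fst c \<inter> O') = {t \<in> K. ?\<gamma> t \<in> O'}"
      using \<gamma> cc(3) by (force simp: image_iff)
    ultimately show "openin (top_of_set K) {t \<in> topspace (top_of_set K). ?\<gamma> t \<in> O'}" by simp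
  qed
  fix c' t assume c': "c' \<in> A" and t: "t \<in> K" and m: "?\<gamma> t \<in> fst c'"
  have id: "Ck_at (Suc j) A A (\<lambda>x. x) (?\<gamma> t)" by (rule Ck_at_id[OF C c \<gamma>(1)[OF t]])
  have D': "((\<lambda>y. snd c' (chart_inv c y)) has_derivative coord_deriv c c' (\<lambda>x. x) (?\<gamma> t)) (at (x t))"
    using coord_deriv_works[OF C C id c c' \<gamma>(1)[OF t] m] \<gamma>(2)[OF t] by simp
  have "(x has_vector_derivative vel c (t, ?\<gamma> t)) (at t)" by (rule D[OF t])
  from vector_derivative_diff_chain_within[OF this has_derivative_at_withinI[OF D']]
  show "((\<lambda>s. snd c' (?\<gamma> s)) has_vector_derivative vel c' (t, ?\<gamma> t)) (at t)"
    using vel_transform[OF c c' _ \<gamma>(1)[OF t] m] t K(4) by (auto simp: o_def)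
qed

text \<open>The field depends on time and becomes autonomous by adding the time as a coordinate with
  velocity \<open>1\<close>. The flow parameter \<tau> counts from the initial time
  \<open>t\<close>, and one \<epsilon> serves for all initial events near the given one.\<close>

lemma local_flow_in_chart:
  assumes c: "c \<in> A" "q1 \<in> fst c" and t1: "t1 \<in> I"
  obtains \<epsilon> F where "\<epsilon> > 0" "Ck_on (Suc j) ({-\<epsilon><..<\<epsilon>} \<times> ball (t1, snd c q1) \<epsilon>) F"
    "\<And>\<tau> t x. \<bar>\<tau>\<bar> < \<epsilon> \<Longrightarrow> (t, x) \<in> ball (t1, snd c q1) \<epsilon> \<Longrightarrow>
       t + \<tau> \<in> I \<and> x \<in> snd c ` fst c \<and> F (\<tau>, (t, x)) \<in> snd c ` fst c \<and> F (0, (t, x)) = x \<and>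
       ((\<lambda>\<tau>. F (\<tau>, (t, x))) has_vector_derivative vel c (t + \<tau>, chart_inv c (F (\<tau>, (t, x))))) (at \<tau>)"
proof -
  let ?S = "I \<times> snd c ` fst c" and ?i = "chart_inv (event_chart c)"
  have o: "open ?S" by (rule chart_domain(2)[OF c(1)])
  have m: "(t1, snd c q1) \<in> ?S" using c t1 by auto
  have f: "Ck_on (Suc j) ?S (\<lambda>z. (1, vel c (?i z)))"
    by (intro Ck_on_Pair o Ck_on_const vel_Ck c)
  obtain \<epsilon> \<Phi> where \<Phi>: "\<epsilon> > 0" "Ck_on (Suc j) ({-\<epsilon><..<\<epsilon>} \<times> ball (t1, snd c q1) \<epsilon>) \<Phi>"
    "\<And>x. x \<in> ball (t1, snd c q1) \<epsilon> \<Longrightarrow> \<Phi> (0, x) = x"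
    "\<And>t x. \<bar>t\<bar> < \<epsilon> \<Longrightarrow> x \<in> ball (t1, snd c q1) \<epsilon> \<Longrightarrow> \<Phi> (t, x) \<in> ?S"
    "\<And>t x. \<bar>t\<bar> < \<epsilon> \<Longrightarrow> x \<in> ball (t1, snd c q1) \<epsilon> \<Longrightarrow>
      ((\<lambda>t. \<Phi> (t, x)) has_vector_derivative (1, vel c (?i (\<Phi> (t, x))))) (at t)"
  proof -
    show ?thesis by (rule local_flow[OF o m f]) (rule that)
  qed
  have fst\<Phi>: "fst (\<Phi> (\<tau>, (t, x))) = t + \<tau>" if \<tau>: "\<bar>\<tau>\<bar> < \<epsilon>" and x: "(t, x) \<in> ball (t1, snd c q1) \<epsilon>" for \<tau> t x
  proof -
    have "(\<lambda>\<tau>. fst (\<Phi> (\<tau>, (t, x))) - \<tau>) \<tau> = (\<lambda>\<tau>. fst (\<Phi> (\<tau>, (t, x))) - \<tau>) 0"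
    proof (rule vanishing_derivative_constant[of "{-\<epsilon><..<\<epsilon>}" "\<lambda>\<tau>. fst (\<Phi> (\<tau>, (t, x))) - \<tau>"])
      fix s assume "s \<in> {-\<epsilon><..<\<epsilon>}"
      then have "\<bar>s\<bar> < \<epsilon>" by auto
      from bounded_linear.has_vector_derivative[OF bounded_linear_fst \<Phi>(5)[OF this x]]
      show "((\<lambda>\<tau>. fst (\<Phi> (\<tau>, (t, x))) - \<tau>) has_vector_derivative 0) (at s)"
        by (auto intro!: derivative_eq_intros)
    qed (use \<tau> \<Phi>(1) in \<open>auto simp: is_interval_convex_1\<close>)
    then show ?thesis using \<Phi>(3)[OF x] by simp
  qed
  show thesis
  proof (rule that[OF \<Phi>(1), of "\<lambda>z. snd (\<Phi> z)"])
    show "Ck_on (Suc j) ({-\<epsilon><..<\<epsilon>} \<times> ball (t1, snd c q1) \<epsilon>) (\<lambda>z. snd (\<Phi> z))"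
      by (rule Ck_on_snd[OF _ \<Phi>(2)]) (simp add: open_Times)
    fix \<tau> t x assume \<tau>: "\<bar>\<tau>\<bar> < \<epsilon>" and x: "(t, x) \<in> ball (t1, snd c q1) \<epsilon>"
    have eq: "\<Phi> (\<tau>, (t, x)) = (t + \<tau>, snd (\<Phi> (\<tau>, (t, x))))" using fst\<Phi>[OF \<tau> x] by (simp add: prod_eq_iff)
    have 1: "t + \<tau> \<in> I" "snd (\<Phi> (\<tau>, (t, x))) \<in> snd c ` fst c"
      using \<Phi>(4)[OF \<tau> x] fst\<Phi>[OF \<tau> x] by (auto simp: mem_Times_iff)
    have 2: "x \<in> snd c ` fst c" using \<Phi>(4)[of 0 "(t, x)"] \<Phi>(1) x \<Phi>(3)[OF x] by simp
    have 3: "snd (\<Phi> (0, (t, x))) = x" using \<Phi>(3)[OF x] by simp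
    have "?i (\<Phi> (\<tau>, (t, x))) = (t + \<tau>, chart_inv c (snd (\<Phi> (\<tau>, (t, x)))))"
      by (subst eq) (rule chart_inv_event_chart[OF chart_systemD(1)[OF C c(1)] 1(2)])
    with bounded_linear.has_vector_derivative[OF bounded_linear_snd \<Phi>(5)[OF \<tau> x]]
    have "((\<lambda>\<tau>. snd (\<Phi> (\<tau>, (t, x)))) has_vector_derivative vel c (t + \<tau>, chart_inv c (snd (\<Phi> (\<tau>, (t, x)))))) (at \<tau>)"
      by simp
    then show "t + \<tau> \<in> I \<and> x \<in> snd c ` fst c \<and> snd (\<Phi> (\<tau>, (t, x))) \<in> snd c ` fst c \<and> snd (\<Phi> (0, (t, x))) = x \<and>
       ((\<lambda>\<tau>. snd (\<Phi> (\<tau>, (t, x)))) has_vector_derivative vel c (t + \<tau>, chart_inv c (snd (\<Phi> (\<tau>, (t, x)))))) (at \<tau>)"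
      using 1 2 3 by blast
  qed
qed

lemma local_flow_characteristic:
  assumes c: "c \<in> A" and \<epsilon>: "\<epsilon> > 0" and "x \<in> snd c ` fst c"
    and F: "\<And>\<tau>. \<bar>\<tau>\<bar> < \<epsilon> \<Longrightarrow> t + \<tau> \<in> I \<and> F \<tau> \<in> snd c ` fst c \<and> F 0 = x \<and>
       (F has_vector_derivative vel c (t + \<tau>, chart_inv c (F \<tau>))) (at \<tau>)"
  shows "base_characteristic X A a b I u {t - \<epsilon><..<t + \<epsilon>} (\<lambda>s. chart_inv c (F (s - t)))"
proof (rule base_characteristic_of_chart[OF c])
  fix s assume "s \<in> {t - \<epsilon><..<t + \<epsilon>}"
  then have s: "\<bar>s - t\<bar> < \<epsilon>" by auto
  then show "F (s - t) \<in> snd c ` fst c" using F by blast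
  have "((\<lambda>s. s - t) has_vector_derivative 1) (at s)" by (auto intro!: derivative_eq_intros)
  from vector_diff_chain_at[OF this, of F] F[OF s]
  show "((\<lambda>s. F (s - t)) has_vector_derivative vel c (s, chart_inv c (F (s - t)))) (at s)"
    by (simp add: o_def)
next
  show "{t - \<epsilon><..<t + \<epsilon>} \<subseteq> I"
  proof
    fix s assume "s \<in> {t - \<epsilon><..<t + \<epsilon>}"
    then have "\<bar>s - t\<bar> < \<epsilon>" by auto
    from F[OF this] show "s \<in> I" by simp
  qed
qed (use \<epsilon> in \<open>auto simp: is_interval_convex_1\<close>)

text \<open>The set of times at which the curves agree is open by local uniqueness and closed in
  \<open>K\<close> because \<open>Q\<close> is Hausdorff; induction along the connected interval
  combines the two.\<close>

lemma characteristic_unique: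
  assumes \<gamma>: "base_characteristic X A a b I u K \<gamma>" and \<delta>: "base_characteristic X A a b I u K \<delta>"
    and s: "s \<in> K" "\<gamma> s = \<delta> s" and t: "t \<in> K"
  shows "\<gamma> t = \<delta> t"
proof (rule connected_induction_simple[of K s t])
  have K: "open K" "is_interval K" "K \<subseteq> I" and cont: "continuous_map (top_of_set K) X \<gamma>" "continuous_map (top_of_set K) X \<delta>"
    using \<gamma> \<delta> by (auto simp: base_characteristic_def)
  show "connected K" using K(2) is_interval_connected by blast
  fix t1 assume t1: "t1 \<in> K"
  have top: "\<gamma> t1 \<in> topspace X" "\<delta> t1 \<in> topspace X" using cont t1 by (auto simp: continuous_map_def)
  show "\<exists>S. openin (top_of_set K) S \<and> t1 \<in> S \<and> (\<forall>x\<in>S. \<forall>y\<in>S. \<gamma> x = \<delta> x \<longrightarrow> \<gamma> y = \<delta> y)"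
  proof (cases "\<gamma> t1 = \<delta> t1")
    \<comment> \<open>Disjoint neighbourhoods keep the curves apart at nearby times, where the
      implication is then vacuous.\<close>
    case False
    have "Hausdorff_space X" using manifold by (simp add: Ck_manifold_def)
    then obtain U W where UW: "openin X U" "openin X W" "\<gamma> t1 \<in> U" "\<delta> t1 \<in> W" "disjnt U W"
      using top False unfolding Hausdorff_space_def by blast
    have "openin (top_of_set K) ({t \<in> topspace (top_of_set K). \<gamma> t \<in> U} \<inter> {t \<in> topspace (top_of_set K). \<delta> t \<in> W})"
      using openin_continuous_map_preimage cont UW by (intro openin_Int) blast+
    moreover have "\<gamma> x \<noteq> \<delta> x" if "\<gamma> x \<in> U" "\<delta> x \<in> W" for x using that UW(5) by (auto simp: disjnt_def)
    ultimately show ?thesis using UW(3,4) t1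
      by (intro exI[of _ "{t \<in> topspace (top_of_set K). \<gamma> t \<in> U} \<inter> {t \<in> topspace (top_of_set K). \<delta> t \<in> W}"]) auto
  next
    case True
    obtain c where c: "c \<in> A" "\<gamma> t1 \<in> fst c" using covered[OF top(1)] by blast
    let ?S = "I \<times> snd c ` fst c" and ?f = "\<lambda>z. vel c (chart_inv (event_chart c) z)"
    note cc = chart_systemD[OF C c(1)]
    have o: "open ?S" by (rule chart_domain(2)[OF c(1)])
    have m: "(t1, snd c (\<gamma> t1)) \<in> ?S" using c t1 K by auto
    obtain R where R: "R > 0" "cball (t1, snd c (\<gamma> t1)) R \<subseteq> ?S" using o m open_contains_cball by metis
    have "Ck_on (Suc 0) ?S ?f" using vel_Ck[OF c(1)] by (rule Ck_on_mono) simp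
    then obtain L where L: "L \<ge> 0" "\<And>x y. x \<in> cball (t1, snd c (\<gamma> t1)) R \<Longrightarrow> y \<in> cball (t1, snd c (\<gamma> t1)) R \<Longrightarrow>
        norm (?f x - ?f y) \<le> L * norm (x - y)"
      using C1_lipschitz_cball[OF _ R(2)] by metis
    let ?N = "ball (t1, snd c (\<gamma> t1)) R"
    have oB: "open ({t \<in> K. \<gamma> t \<in> fst c \<and> (t, snd c (\<gamma> t)) \<in> ?N} \<inter> {t \<in> K. \<delta> t \<in> fst c \<and> (t, snd c (\<delta> t)) \<in> ?N})"
      using is_charts[OF c(1)] cont K(1) by (intro open_Int coordinate_curve_open) auto
    have mB: "t1 \<in> {t \<in> K. \<gamma> t \<in> fst c \<and> (t, snd c (\<gamma> t)) \<in> ?N} \<inter> {t \<in> K. \<delta> t \<in> fst c \<and> (t, snd c (\<delta> t)) \<in> ?N}"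
      using t1 c True R by auto
    obtain d0 where d0: "d0 > 0" and d0': "ball t1 d0 \<subseteq>
        {t \<in> K. \<gamma> t \<in> fst c \<and> (t, snd c (\<gamma> t)) \<in> ?N} \<inter> {t \<in> K. \<delta> t \<in> fst c \<and> (t, snd c (\<delta> t)) \<in> ?N}"
      by (rule openE[OF oB mB])
    \<comment> \<open>For \<open>x\<close> within \<open>d\<close> of \<open>t1\<close>, times less
      than \<open>2 * d\<close> away from \<open>x\<close> are within \<open>3 * d \<le> d0\<close>
      of \<open>t1\<close>; and \<open>2 * d * L \<le> 1 / 2\<close> is the shortness required for
      uniqueness.\<close>
    define d where "d = min (d0 / 3) (1 / (4 * (L + 1)))"
    have d: "d > 0" "d \<le> d0 / 3" "d \<le> 1 / (4 * (L + 1))"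
    proof -
      have "0 < d0 / 3" "0 < 1 / (4 * (L + 1))" using d0 L(1) by simp_all
      then show "d > 0" unfolding d_def by linarith
      show "d \<le> d0 / 3" "d \<le> 1 / (4 * (L + 1))" unfolding d_def by linarith+
    qed
    have "2 * d * L \<le> 2 * (1 / (4 * (L + 1))) * L" using d(3) L(1) by (intro mult_right_mono) auto
    also have "\<dots> \<le> 1 / 2" using L(1) by (simp add: field_simps)
    finally have dL: "2 * d * L \<le> 1 / 2" .
    have step: "\<gamma> y = \<delta> y" if xy: "x \<in> ball t1 d" "y \<in> ball t1 d" and eq: "\<gamma> x = \<delta> x" for x y
    proof -
      have near: "t \<in> ball t1 d0" if "\<bar>t - x\<bar> < 2 * d" for t
        using that xy(1) d(2) by (simp add: dist_real_def)
      have "(\<lambda>t. snd c (\<gamma> t) - snd c (\<delta> t)) y = 0"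
      proof (rule ode_short_unique[where ?t0.0 = x and \<epsilon> = "2 * d" and L = L and t = y
            and D = "\<lambda>t. snd c (\<gamma> t) - snd c (\<delta> t)" and D' = "\<lambda>t. vel c (t, \<gamma> t) - vel c (t, \<delta> t)"])
        fix t assume "\<bar>t - x\<bar> < 2 * d"
        from near[OF this] d0' have tt: "t \<in> K" "\<gamma> t \<in> fst c" "(t, snd c (\<gamma> t)) \<in> ?N" "\<delta> t \<in> fst c" "(t, snd c (\<delta> t)) \<in> ?N"
          by auto
        show "((\<lambda>t. snd c (\<gamma> t) - snd c (\<delta> t)) has_vector_derivative vel c (t, \<gamma> t) - vel c (t, \<delta> t)) (at t)"
          using \<gamma> \<delta> c(1) tt unfolding base_characteristic_vel by (intro has_vector_derivative_diff) auto
        have "norm (?f (t, snd c (\<gamma> t)) - ?f (t, snd c (\<delta> t))) \<le> L * norm ((t, snd c (\<gamma> t)) - (t, snd c (\<delta> t)))"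
          using tt by (intro L(2)) auto
        then show "norm (vel c (t, \<gamma> t) - vel c (t, \<delta> t)) \<le> L * norm (snd c (\<gamma> t) - snd c (\<delta> t))"
          using tt cc by (simp add: chart_inv_event_chart norm_Pair)
      qed (use dL L eq xy d in \<open>auto simp: dist_real_def\<close>)
      moreover have "y \<in> ball t1 d0" using near[of y] xy by (simp add: dist_real_def)
      then have "\<gamma> y \<in> fst c" "\<delta> y \<in> fst c" using d0' by auto
      ultimately show ?thesis using inj_onD[OF cc(1)] by simp
    qed
    have "ball t1 d \<subseteq> ball t1 d0" using d d0 by auto
    then have "ball t1 d \<subseteq> K" using d0' by blast
    then have "openin (top_of_set K) (ball t1 d)" by (rule open_subset) simp
    moreover have "t1 \<in> ball t1 d" using d(1) by simp
    ultimately show ?thesis using step by blast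
  qed
qed (use s t in auto)

text \<open>The local flow gives a short characteristic, completeness prolongs it to an interval
  containing \<open>J\<close>, and the result is cut down to \<open>J\<close> so that all
  characteristics have one domain.\<close>

lemma characteristic_exists:
  assumes "t \<in> J" "q \<in> topspace X"
  shows "\<exists>\<gamma>. base_characteristic X A a b I u J \<gamma> \<and> \<gamma> t = q"
proof -
  obtain c where c: "c \<in> A" "q \<in> fst c" using covered[OF assms(2)] by blast
  have tI: "t \<in> I" using assms openJ by blast
  obtain \<epsilon> F where F: "\<epsilon> > 0" "\<And>\<tau> s x. \<bar>\<tau>\<bar> < \<epsilon> \<Longrightarrow> (s, x) \<in> ball (t, snd c q) \<epsilon> \<Longrightarrow>
       s + \<tau> \<in> I \<and> x \<in> snd c ` fst c \<and> F (\<tau>, (s, x)) \<in> snd c ` fst c \<and> F (0, (s, x)) = x \<and>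
       ((\<lambda>\<tau>. F (\<tau>, (s, x))) has_vector_derivative vel c (s + \<tau>, chart_inv c (F (\<tau>, (s, x))))) (at \<tau>)"
  proof -
    show ?thesis by (rule local_flow_in_chart[OF c tI]) (rule that)
  qed
  define \<gamma> where "\<gamma> = (\<lambda>s. chart_inv c (F (s - t, (t, snd c q))))"
  have m: "(t, snd c q) \<in> ball (t, snd c q) \<epsilon>" using F(1) by simp
  have \<gamma>: "base_characteristic X A a b I u {t - \<epsilon><..<t + \<epsilon>} \<gamma>"
    unfolding \<gamma>_def using F(2)[OF _ m]
    by (intro local_flow_characteristic[OF c(1) F(1), where F = "\<lambda>\<tau>. F (\<tau>, (t, snd c q))" and x = "snd c q"]) (use c in auto)
  have \<gamma>t: "\<gamma> t = q" using F(2)[of 0, OF _ m] F(1) chart_systemD(3)[OF C c] by (simp add: \<gamma>_def)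
  obtain K' \<gamma>' where K': "base_characteristic X A a b I u K' \<gamma>'" "{t - \<epsilon><..<t + \<epsilon>} \<subseteq> K'" "J \<subseteq> K'"
    "\<forall>s\<in>{t - \<epsilon><..<t + \<epsilon>}. \<gamma>' s = \<gamma> s"
    using extend \<gamma> unfolding characteristics_extend_to_def by blast
  have "base_characteristic X A a b I u J \<gamma>'"
    by (rule base_characteristic_subset[OF K'(1) openJ(1,2) _ K'(3)]) (use assms in auto)
  moreover have "\<gamma>' t = q" using K'(4) F(1) \<gamma>t by auto
  ultimately show ?thesis by blast
qed

subsection \<open>The global flow\<close>

text \<open>The flow with two times: the position at time \<open>s\<close> of the characteristic
  that is at \<open>q\<close> at time \<open>t\<close>. With both times variable, \<phi> and \<psi>
  are two restrictions of one map.\<close>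

definition G :: "real \<times> real \<times> 'q \<Rightarrow> 'q" where
  "G = (\<lambda>(s, t, q). (SOME \<gamma>. base_characteristic X A a b I u J \<gamma> \<and> \<gamma> t = q) s)"

lemma
  assumes "t \<in> J" "q \<in> topspace X"
  shows G_characteristic: "base_characteristic X A a b I u J (\<lambda>s. G (s, t, q))" and G_start: "G (t, t, q) = q"
  using someI_ex[OF characteristic_exists[OF assms]] by (auto simp: G_def)

lemma G_top: "s \<in> J \<Longrightarrow> t \<in> J \<Longrightarrow> q \<in> topspace X \<Longrightarrow> G (s, t, q) \<in> topspace X"
  using G_characteristic[of t q] by (auto simp: base_characteristic_def continuous_map_def)

lemma G_eqI:
  assumes "base_characteristic X A a b I u K \<gamma>" "K \<subseteq> J" "t \<in> K" "s \<in> K"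
  shows "G (s, t, \<gamma> t) = \<gamma> s"
proof -
  have K: "open K" "is_interval K" "K \<noteq> {}" using assms(1) by (auto simp: base_characteristic_def)
  have q: "\<gamma> t \<in> topspace X" using assms(1,3) by (auto simp: base_characteristic_def continuous_map_def)
  have t: "t \<in> J" using assms by blast
  show ?thesis
    using characteristic_unique[OF base_characteristic_subset[OF G_characteristic[OF t q] K assms(2)] assms(1,3) G_start[OF t q] assms(4)] .
qed

lemma G_compose:
  assumes "s \<in> J" "s' \<in> J" "t \<in> J" "q \<in> topspace X"
  shows "G (s, s', G (s', t, q)) = G (s, t, q)"
  by (rule G_eqI[OF G_characteristic[OF assms(3,4)] order_refl assms(2,1)])

lemma openJX: "openin (prod_topology euclidean X) (J \<times> topspace X)"
  using openJ by (auto simp: openin_prod_Times_iff)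

lemma openJJX: "openin (prod_topology euclidean (prod_topology euclidean X)) (J \<times> J \<times> topspace X)"
  using openJ openJX by (auto simp: openin_prod_Times_iff)

lemma is_charts_EE:
  "cc \<in> event_atlas (event_atlas A) \<Longrightarrow> is_chart (prod_topology euclidean (prod_topology euclidean X)) cc"
  using is_chart_event_chart[OF is_chart_event_chart[OF is_charts]] by (auto simp only: event_atlas_def)

text \<open>For \<open>s\<close> close to \<open>t\<close> the flow is the local flow in one chart.
  That one \<epsilon> serves for all initial events in a neighbourhood is what lets smoothness be
  continued along a whole characteristic.\<close>

lemma G_Ck_near_diagonal:
  assumes "t1 \<in> J" "q1 \<in> topspace X"
  obtains \<epsilon> N where "\<epsilon> > 0" "openin (prod_topology euclidean X) N" "(t1, q1) \<in> N"
    "\<And>s t q. (t, q) \<in> N \<Longrightarrow> s \<in> J \<Longrightarrow> \<bar>s - t\<bar> < \<epsilon> \<Longrightarrow> Ck_at (Suc j) (event_atlas (event_atlas A)) A G (s, t, q)"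
proof -
  obtain c where c: "c \<in> A" "q1 \<in> fst c" using covered[OF assms(2)] by blast
  have tI: "t1 \<in> I" using assms openJ by blast
  note cc = chart_systemD[OF C c(1)]
  let ?B = "\<lambda>\<epsilon>. ball (t1, snd c q1) \<epsilon>"
  obtain \<epsilon> F where \<epsilon>: "\<epsilon> > 0" and CkF: "Ck_on (Suc j) ({-\<epsilon><..<\<epsilon>} \<times> ?B \<epsilon>) F"
    and F: "\<And>\<tau> t x. \<bar>\<tau>\<bar> < \<epsilon> \<Longrightarrow> (t, x) \<in> ?B \<epsilon> \<Longrightarrow>
       t + \<tau> \<in> I \<and> x \<in> snd c ` fst c \<and> F (\<tau>, (t, x)) \<in> snd c ` fst c \<and> F (0, (t, x)) = x \<and>
       ((\<lambda>\<tau>. F (\<tau>, (t, x))) has_vector_derivative vel c (t + \<tau>, chart_inv c (F (\<tau>, (t, x))))) (at \<tau>)"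
  proof -
    show ?thesis by (rule local_flow_in_chart[OF c tI]) (rule that)
  qed
  have Geq: "G (s, t, q) = chart_inv c (F (s - t, (t, snd c q)))"
    if t: "t \<in> J" "q \<in> fst c" "(t, snd c q) \<in> ?B \<epsilon>" and s: "s \<in> J" "\<bar>s - t\<bar> < \<epsilon>" for s t q
  proof -
    let ?\<gamma> = "\<lambda>s. chart_inv c (F (s - t, (t, snd c q)))"
    have "base_characteristic X A a b I u {t - \<epsilon><..<t + \<epsilon>} ?\<gamma>"
      using F[OF _ t(3)] t(2)
      by (intro local_flow_characteristic[OF c(1) \<epsilon>, where F = "\<lambda>\<tau>. F (\<tau>, (t, snd c q))" and x = "snd c q"]) auto
    moreover have "is_interval (J \<inter> {t - \<epsilon><..<t + \<epsilon>})"
      by (intro is_interval_Int openJ) (simp add: is_interval_convex_1)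
    moreover have "open (J \<inter> {t - \<epsilon><..<t + \<epsilon>})" "J \<inter> {t - \<epsilon><..<t + \<epsilon>} \<noteq> {}"
      using openJ t \<epsilon> by auto
    ultimately have "base_characteristic X A a b I u (J \<inter> {t - \<epsilon><..<t + \<epsilon>}) (\<lambda>s. chart_inv c (F (s - t, (t, snd c q))))"
      using base_characteristic_subset[of X A a b I u "{t - \<epsilon><..<t + \<epsilon>}" ?\<gamma> "J \<inter> {t - \<epsilon><..<t + \<epsilon>}"] by simp
    moreover have "t \<in> J \<inter> {t - \<epsilon><..<t + \<epsilon>}" "s \<in> J \<inter> {t - \<epsilon><..<t + \<epsilon>}"
      using s t \<epsilon> by (auto simp: abs_less_iff)
    ultimately have "G (s, t, ?\<gamma> t) = ?\<gamma> s"
      using G_eqI[of "J \<inter> {t - \<epsilon><..<t + \<epsilon>}" ?\<gamma> t s] by blast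
    moreover have "?\<gamma> t = q" using F[of 0, OF _ t(3)] \<epsilon> cc(3)[OF t(2)] by simp
    ultimately show ?thesis by simp
  qed
  define N where "N = {e \<in> fst (event_chart c). snd (event_chart c) e \<in> ?B \<epsilon> \<inter> J \<times> UNIV}"
  define M where "M = {z :: real \<times> real \<times> 'e. fst z \<in> J \<and> fst (snd z) \<in> J \<and> snd z \<in> ?B \<epsilon> \<and> \<bar>fst z - fst (snd z)\<bar> < \<epsilon>}"
  have "M = (fst -` J) \<inter> ((\<lambda>z. fst (snd z)) -` J) \<inter> (snd -` ?B \<epsilon>) \<inter> ((\<lambda>z. fst z - fst (snd z)) -` {-\<epsilon><..<\<epsilon>})"
    by (auto simp: M_def abs_less_iff)
  then have oM: "open M" using openJ by (auto intro!: open_Int open_vimage continuous_intros)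
  show thesis
  proof (rule that[OF \<epsilon>, of N])
    show "openin (prod_topology euclidean X) N"
      unfolding N_def using openJ
      by (intro is_chart_open_preimage[OF is_chart_event_chart[OF is_charts[OF c(1)]]]) (auto intro: open_Times)
    show "(t1, q1) \<in> N" using assms c \<epsilon> by (simp add: N_def)
    fix s t q assume e: "(t, q) \<in> N" and s: "s \<in> J" "\<bar>s - t\<bar> < \<epsilon>"
    then have tq: "q \<in> fst c" "t \<in> J" "(t, snd c q) \<in> ?B \<epsilon>" by (auto simp: N_def)
    let ?cc = "event_chart (event_chart c)"
    have inv: "chart_inv ?cc z = (fst z, fst (snd z), chart_inv c (snd (snd z)))" "snd (snd z) \<in> snd c ` fst c"
      if "z \<in> M" for z
    proof -
      have "(fst (snd z), snd (snd z)) \<in> ?B \<epsilon>" using that by (simp add: M_def)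
      from F[OF _ this, of 0] show x: "snd (snd z) \<in> snd c ` fst c" using \<epsilon> by simp
      then have "snd z \<in> snd (event_chart c) ` fst (event_chart c)"
        by (simp add: event_chart_image mem_Times_iff)
      from chart_inv_event_chart[OF inj_on_event_chart[OF cc(1)] this, of "fst z"]
        chart_inv_event_chart[OF cc(1) x, of "fst (snd z)"]
      show "chart_inv ?cc z = (fst z, fst (snd z), chart_inv c (snd (snd z)))" by simp
    qed
    have GM: "G (chart_inv ?cc z) = chart_inv c (F (fst z - fst (snd z), snd z))"
      "F (fst z - fst (snd z), snd z) \<in> snd c ` fst c" if z: "z \<in> M" for z
    proof -
      note x = inv(2)[OF z]
      have B: "(fst (snd z), snd (snd z)) \<in> ?B \<epsilon>" "\<bar>fst z - fst (snd z)\<bar> < \<epsilon>" using z by (auto simp: M_def)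
      have "G (fst z, fst (snd z), chart_inv c (snd (snd z))) =
          chart_inv c (F (fst z - fst (snd z), (fst (snd z), snd c (chart_inv c (snd (snd z))))))"
        using z B by (intro Geq) (auto simp: M_def chart_inv_right[OF x])
      then show "G (chart_inv ?cc z) = chart_inv c (F (fst z - fst (snd z), snd z))"
        by (simp add: inv(1)[OF z] chart_inv_right[OF x])
      show "F (fst z - fst (snd z), snd z) \<in> snd c ` fst c" using F[OF B(2,1)] by simp
    qed
    have "Ck_on (Suc j) M (\<lambda>z. F (fst z - fst (snd z), snd z))"
    proof (rule Ck_on_compose[OF oM _ _ CkF])
      show "Ck_on (Suc j) M (\<lambda>z. (fst z - fst (snd z), snd z))"
        by (intro Ck_on_linear bounded_linear_Pair bounded_linear_sub bounded_linear_fst bounded_linear_snd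
            bounded_linear_fst_comp)
    qed (auto simp: M_def open_Times abs_less_iff)
    then have "Ck_on (Suc j) M (\<lambda>z. snd c (G (chart_inv ?cc z)))"
      by (rule Ck_on_cong[OF oM]) (simp add: GM chart_inv_right)
    moreover have "M \<subseteq> snd ?cc ` fst ?cc"
      using inv(2) by (auto simp: event_chart_image mem_Times_iff)
    ultimately show "Ck_at (Suc j) (event_atlas (event_atlas A)) A G (s, t, q)"
      unfolding Ck_at_def
    proof (intro bexI[of _ ?cc] bexI[OF _ c(1)] exI[of _ M] conjI)
      show "\<forall>z\<in>M. G (chart_inv ?cc z) \<in> fst c" using GM by (simp add: chart_inv_right)
      show "snd ?cc (s, t, q) \<in> M" using tq s by (simp add: M_def)
    qed (use tq oM c in auto)
  qed
qed

text \<open>Smoothness moves along the characteristic by the composition law: the flow to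
  \<open>y\<close> is the flow to \<open>x\<close> followed by the flow from \<open>x\<close> to
  \<open>y\<close>, the first smooth by induction, the second because \<open>y\<close> is near
  \<open>x\<close>.\<close>

lemma G_Ck:
  assumes "t1 \<in> J" "q1 \<in> topspace X" "s1 \<in> J"
  shows "Ck_at (Suc j) (event_atlas (event_atlas A)) A G (s1, t1, q1)"
proof (rule connected_induction_simple[of J t1 s1])
  let ?EE = "event_atlas (event_atlas A)"
  show "connected J" using openJ is_interval_connected by blast
  show "Ck_at (Suc j) ?EE A G (t1, t1, q1)"
    using G_Ck_near_diagonal[OF assms(1,2)] assms(1) by (metis diff_self abs_zero)
  obtain c where c: "c \<in> A" "q1 \<in> fst c" using covered[OF assms(2)] by blast
  fix s0 assume s0: "s0 \<in> J"
  let ?\<gamma> = "\<lambda>s. G (s, t1, q1)"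
  obtain \<epsilon> N where N: "\<epsilon> > 0" "openin (prod_topology euclidean X) N" "(s0, ?\<gamma> s0) \<in> N"
    "\<And>s t q. (t, q) \<in> N \<Longrightarrow> s \<in> J \<Longrightarrow> \<bar>s - t\<bar> < \<epsilon> \<Longrightarrow> Ck_at (Suc j) ?EE A G (s, t, q)"
  proof -
    show ?thesis by (rule G_Ck_near_diagonal[OF s0 G_top[OF s0 assms(1,2)]]) (rule that)
  qed
  have "continuous_map (top_of_set J) X ?\<gamma>"
    using G_characteristic[OF assms(1,2)] by (simp add: base_characteristic_def)
  then have "continuous_map (top_of_set J) (prod_topology euclidean X) (\<lambda>s. (s, ?\<gamma> s))"
    by (intro continuous_map_pairedI) auto
  from openin_continuous_map_preimage[OF this N(2)]
  have o: "openin (top_of_set J) {s \<in> J. (s, ?\<gamma> s) \<in> N}" by simp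
  \<comment> \<open>Radius \<open>\<epsilon> / 2\<close>, so that any two times in the set differ by
    less than \<epsilon>.\<close>
  let ?S = "{s \<in> J. (s, ?\<gamma> s) \<in> N} \<inter> ball s0 (\<epsilon> / 2)"
  have step: "Ck_at (Suc j) ?EE A G (y, t1, q1)" if x: "x \<in> ?S" and y: "y \<in> ?S" and P: "Ck_at (Suc j) ?EE A G (x, t1, q1)" for x y
  proof -
    have "\<bar>y - x\<bar> \<le> \<bar>y - s0\<bar> + \<bar>x - s0\<bar>" by linarith
    then have yx: "\<bar>y - x\<bar> < \<epsilon>" using x y by (simp add: dist_real_def abs_minus_commute)
    have xJ: "x \<in> J" and yJ: "y \<in> J" using x y by auto
    let ?p = "(y, t1, q1)"
    have ec: "event_chart c \<in> event_atlas A" "snd ?p \<in> fst (event_chart c)" using c by auto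
    have const: "Ck_at (Suc j) ?EE std_atlas (\<lambda>z. x) ?p"
      by (rule Ck_at_std_const[OF EEC event_chart_mem[OF ec(1)]]) (use ec in auto)
    have "Ck_at (Suc j) ?EE ?EE (\<lambda>z. (x, snd z)) ?p"
      by (rule Ck_at_event_pair[OF EEC EC const Ck_at_event_snd[OF EC ec]])
    from Ck_at_compose[OF EEC EEC C this, of G] P
    have Gx: "Ck_at (Suc j) ?EE A (\<lambda>z. G (x, snd z)) ?p" by simp
    have "Ck_at (Suc j) ?EE ?EE (\<lambda>z. (fst z, x, G (x, snd z))) ?p"
      by (rule Ck_at_event_pair[OF EEC EC Ck_at_event_fst[OF EC ec] Ck_at_event_pair[OF EEC C const Gx]])
    moreover have "Ck_at (Suc j) ?EE A G (y, x, ?\<gamma> x)" using N(4) x yJ yx by auto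
    ultimately have "Ck_at (Suc j) ?EE A (\<lambda>z. G (fst z, x, G (x, snd z))) ?p"
      using Ck_at_compose[OF EEC EEC C, of "\<lambda>z. (fst z, x, G (x, snd z))" ?p G] by simp
    then show ?thesis
      by (rule Ck_at_cong[OF is_charts_EE openJJX, rotated 3])
        (use yJ assms xJ in \<open>auto simp: G_compose\<close>)
  qed
  show "\<exists>S. openin (top_of_set J) S \<and> s0 \<in> S \<and>
      (\<forall>x\<in>S. \<forall>y\<in>S. Ck_at (Suc j) ?EE A G (x, t1, q1) \<longrightarrow> Ck_at (Suc j) ?EE A G (y, t1, q1))"
  proof (intro exI[of _ ?S] conjI)
    show "openin (top_of_set J) ?S" using o by (intro openin_Int_open) auto
    show "s0 \<in> ?S" using s0 N by auto
    show "\<forall>x\<in>?S. \<forall>y\<in>?S. Ck_at (Suc j) ?EE A G (x, t1, q1) \<longrightarrow> Ck_at (Suc j) ?EE A G (y, t1, q1)"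
      using step by blast
  qed
qed (use assms in auto)

text \<open>Here \<open>Q'\<close> is \<open>Q\<close> with its own atlas, hence the type argument
  \<open>'q\<close>.\<close>

lemma rosen_coordinates_exist: "admits_rosen_over TYPE('q) (Suc j) X A a b V J"
proof -
  \<comment> \<open>\<open>J\<close> may be empty; membership of \<open>t0\<close> is therefore
    claimed only once some time in \<open>J\<close> is given.\<close>
  define t0 where "t0 = (SOME t. t \<in> J)"
  have t0: "t0 \<in> J" if "t \<in> J" for t using that by (auto simp: t0_def intro: someI)
  define \<phi> where "\<phi> = (\<lambda>e. G (t0, e))"
  define \<psi> where "\<psi> = (\<lambda>e. G (fst e, t0, snd e))"
  interpret rosen_data j X A X A "J \<times> topspace X" "J \<times> topspace X" \<phi> \<psi> a b V u
  proof unfold_locales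
    show "Ck_atlas (Suc j) X A" by (rule atlas)
    then show "Ck_manifold (Suc j) X A" using manifold by (simp add: Ck_manifold_def)
    show "openin (prod_topology euclidean X) (J \<times> topspace X)" by (rule openJX)
    have sub: "J \<times> topspace X \<subseteq> T \<times> topspace X" using openJ openI by auto
    show "riemannian_metric_on j A (J \<times> topspace X) a" by (rule riemannian_metric_on_mono[OF a _ sub]) (use jr in auto)
    show "one_form_on 0 A (J \<times> topspace X) b" by (rule one_form_on_mono[OF b _ sub]) auto
    show "(t, \<phi> (t, q)) \<in> J \<times> topspace X \<and> \<psi> (t, \<phi> (t, q)) = q"
      if "(t, q) \<in> J \<times> topspace X" for t q
      using that t0[of t] by (auto simp: \<phi>_def \<psi>_def G_top G_compose G_start)
    show "(t, \<psi> (t, q)) \<in> J \<times> topspace X \<and> \<phi> (t, \<psi> (t, q)) = q"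
      if "(t, q) \<in> J \<times> topspace X" for t q
      using that t0[of t] by (auto simp: \<phi>_def \<psi>_def G_top G_compose G_start)
    show "Ck_at (Suc j) (event_atlas A) std_atlas u e" if "e \<in> J \<times> topspace X" for e
      using that openJ by (intro Cku) auto
    show "Ck_at (Suc j) (event_atlas A) A \<phi> e" and "Ck_at (Suc j) (event_atlas A) A \<psi> e" if e: "e \<in> J \<times> topspace X" for e
    proof -
      obtain t q where te: "e = (t, q)" "t \<in> J" "q \<in> topspace X" using e by auto
      obtain c where "c \<in> A" "q \<in> fst c" using covered[OF te(3)] by blast
      then have c: "c \<in> A" "snd e \<in> fst c" by (simp_all add: te(1))
      have ec: "event_chart c \<in> event_atlas A" "e \<in> fst (event_chart c)" using c by (auto simp: mem_Times_iff)
      note const = Ck_at_std_const[OF EC ec, of t0]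
      have "Ck_at (Suc j) (event_atlas A) (event_atlas (event_atlas A)) (\<lambda>e. (t0, e)) e"
        by (rule Ck_at_event_pair[OF EC EC const Ck_at_id[OF EC ec]])
      from Ck_at_compose[OF EC EEC C this, of G] show "Ck_at (Suc j) (event_atlas A) A \<phi> e"
        using G_Ck[OF te(2,3) t0[OF te(2)]] te(1) by (simp add: \<phi>_def)
      have "Ck_at (Suc j) (event_atlas A) (event_atlas (event_atlas A)) (\<lambda>e. (fst e, t0, snd e)) e"
        by (rule Ck_at_event_pair[OF EC EC Ck_at_event_fst[OF C c] Ck_at_event_pair[OF EC C const Ck_at_event_snd[OF C c]]])
      from Ck_at_compose[OF EC EEC C this, of G] show "Ck_at (Suc j) (event_atlas A) A \<psi> e"
        using G_Ck[OF t0[OF te(2)] te(3,2)] te(1) by (simp add: \<psi>_def)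
    qed
    fix t q assume tq: "(t, q) \<in> J \<times> topspace X"
    have t: "t \<in> J" "t \<in> I" "q \<in> topspace X" using tq openJ by auto
    obtain c where c: "c \<in> A" "q \<in> fst c" using covered[OF t(3)] by blast
    have q': "G (t0, t, q) \<in> topspace X" using G_top t0 t by blast
    have return: "G (t, t0, G (t0, t, q)) = q" using t t0[OF t(1)] by (simp add: G_compose G_start)
    have "((\<lambda>s. snd c (G (s, t0, G (t0, t, q)))) has_vector_derivative vel c (t, q)) (at t)"
      using G_characteristic[OF t0[OF t(1)] q'] t c unfolding base_characteristic_vel
      by (metis (no_types, lifting) return)
    moreover have "time_deriv u (t, q) + hamiltonian a b V c (t, q) (space_deriv c u (t, q)) = 0"
      using hj c t unfolding hj_solution_def by blast
    ultimately show "\<exists>c\<in>A. q \<in> fst c \<and>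
      time_deriv u (t, q) + hamiltonian a b V c (t, q) (space_deriv c u (t, q)) = 0 \<and>
      ((\<lambda>s. snd c (\<psi> (s, \<phi> (t, q)))) has_vector_derivative
        sharp (a c (t, q)) (\<lambda>v. space_deriv c u (t, q) v - b c (t, q) v)) (at t)"
      using c by (auto simp: \<phi>_def \<psi>_def velocity_def)
  qed
  have "{(t, q, y :: real). (t, q) \<in> J \<times> topspace X} = J \<times> topspace X \<times> UNIV" by auto
  then show ?thesis
    using rosen_coordinates_of_data unfolding admits_rosen_over_def by auto
qed

end

section \<open>Local solutions of the Hamilton-Jacobi equation\<close>

text \<open>The situation in one chart. The coefficients, and with them \<open>H\<close>, are of
  class \<open>j + 2\<close>; the Hamiltonian vector field contains a derivative of \<open>H\<close>
  and is of class \<open>j + 1\<close>.\<close>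

locale euclidean_data =
  fixes S\<^sub>0 :: "(real \<times> 'e::euclidean_space) set" and g :: "real \<times> 'e \<Rightarrow> 'e \<Rightarrow> 'e \<Rightarrow> real"
    and \<beta> :: "real \<times> 'e \<Rightarrow> 'e \<Rightarrow> real" and V\<^sub>0 :: "real \<times> 'e \<Rightarrow> real" and j :: nat
  assumes openS: "open S\<^sub>0" and g: "\<And>z. z \<in> S\<^sub>0 \<Longrightarrow> inner_form (g z)" and \<beta>: "\<And>z. z \<in> S\<^sub>0 \<Longrightarrow> linear (\<beta> z)"
    and Ckg: "\<And>v w. Ck_on (Suc (Suc j)) S\<^sub>0 (\<lambda>z. g z v w)" and Ck\<beta>: "\<And>v. Ck_on (Suc (Suc j)) S\<^sub>0 (\<lambda>z. \<beta> z v)"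
    and CkV: "Ck_on (Suc (Suc j)) S\<^sub>0 V\<^sub>0"
begin

text \<open>Covectors are represented by vectors of the Euclidean model space through the inner product.\<close>

definition w :: "(real \<times> 'e) \<times> 'e \<Rightarrow> 'e" where
  "w = (\<lambda>(z, p). sharp (g z) (\<lambda>v. p \<bullet> v - \<beta> z v))"

text \<open>As \<open>w\<close> is dual to \<open>p - \<beta>\<close>, the pairing of the two is the
  squared norm of \<open>p - \<beta>\<close>, so this is the Hamiltonian in coordinates.\<close>

definition H :: "(real \<times> 'e) \<times> 'e \<Rightarrow> real" where
  "H = (\<lambda>(z, p). (1 / 2) * (p \<bullet> w (z, p) - \<beta> z (w (z, p))) + V\<^sub>0 z)"

abbreviation "S\<^sub>1 \<equiv> S\<^sub>0 \<times> (UNIV :: 'e set)"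

lemma openS1: "open S\<^sub>1" using openS by (simp add: open_Times)

lemma w_works:
  assumes "z \<in> S\<^sub>0" shows "g z (w (z, p)) v = p \<bullet> v - \<beta> z v"
proof -
  have "linear (\<lambda>v. p \<bullet> v)" by (simp add: linear_iff inner_add_right)
  then have "linear (\<lambda>v. p \<bullet> v - \<beta> z v)" using \<beta>[OF assms] by (rule linear_compose_sub)
  from sharp_works[OF g[OF assms] this, of v] show ?thesis by (simp add: w_def)
qed

lemma Ck_on_base: "Ck_on k S\<^sub>0 f \<Longrightarrow> Ck_on k S\<^sub>1 (\<lambda>y. f (fst y))" for f :: "real \<times> 'e \<Rightarrow> 'c::real_normed_vector"
  by (rule Ck_on_compose[OF openS1 openS Ck_on_linear[OF bounded_linear_fst]]) auto

lemma Ckw: "Ck_on (Suc (Suc j)) S\<^sub>1 w"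
proof (rule Ck_on_solve[OF openS1, of "\<lambda>y. lower_index (g (fst y))"])
  show "linear (lower_index (g (fst y)))" "inj (lower_index (g (fst y)))" if "y \<in> S\<^sub>1" for y
  proof -
    have "inner_form (g (fst y))" by (rule g) (use that in auto)
    then show "linear (lower_index (g (fst y)))" "inj (lower_index (g (fst y)))"
      by (fact linear_lower_index, fact inj_lower_index)
  qed
  show "Ck_on (Suc (Suc j)) S\<^sub>1 (\<lambda>y. lower_index (g (fst y)) v)" for v
    unfolding lower_index_def by (intro Ck_on_sum Ck_on_scaleR Ck_on_base Ckg Ck_on_const openS1)
  have "Ck_on (Suc (Suc j)) S\<^sub>1 (\<lambda>y. \<Sum>b\<in>Basis. (snd y \<bullet> b - \<beta> (fst y) b) *\<^sub>R b)"
    by (intro Ck_on_sum Ck_on_scaleR Ck_on_diff Ck_on_inner Ck_on_base Ck\<beta> Ck_on_const openS1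
        Ck_on_linear[OF bounded_linear_snd])
  then show "Ck_on (Suc (Suc j)) S\<^sub>1 (\<lambda>y. lower_index (g (fst y)) (w y))"
    by (rule Ck_on_cong[OF openS1]) (auto simp: lower_index_def w_works)
qed

lemma CkH: "Ck_on (Suc (Suc j)) S\<^sub>1 H"
proof -
  have "Ck_on (Suc (Suc j)) S\<^sub>1 (\<lambda>y. (1 / 2) * (\<Sum>b\<in>Basis. (w y \<bullet> b) * (snd y \<bullet> b - \<beta> (fst y) b)) + V\<^sub>0 (fst y))"
    by (intro Ck_on_add Ck_on_sum Ck_on_mult Ck_on_diff Ck_on_inner Ck_on_base Ck\<beta> CkV Ck_on_const openS1 Ckw
        Ck_on_linear[OF bounded_linear_snd])
  then show ?thesis
  proof (rule Ck_on_cong[OF openS1])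
    fix y assume "y \<in> S\<^sub>1"
    then obtain z p where y: "y = (z, p)" "z \<in> S\<^sub>0" by auto
    have "\<beta> z (w y) = (\<Sum>b\<in>Basis. (w y \<bullet> b) * \<beta> z b)"
      using linear_componentwise_sum[OF \<beta>[OF y(2)], of "w y"] by simp
    moreover have "p \<bullet> w y = (\<Sum>b\<in>Basis. (w y \<bullet> b) * (p \<bullet> b))"
      by (subst euclidean_inner) (simp add: mult.commute)
    ultimately show "(1 / 2) * (\<Sum>b\<in>Basis. (w y \<bullet> b) * (snd y \<bullet> b - \<beta> (fst y) b)) + V\<^sub>0 (fst y) = H y"
      by (simp add: H_def y right_diff_distrib sum_subtractf)
  qed
qed

section \<open>Derivatives of the Hamiltonian\<close>

abbreviation "DH y \<equiv> frechet_derivative H (at y)"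

lemma DH: "y \<in> S\<^sub>1 \<Longrightarrow> (H has_derivative DH y) (at y)"
  by (rule Ck_on_SucD_derivative[OF CkH])

text \<open>\<open>w\<close> is affine in \<open>p\<close>, so \<open>H\<close> is a quadratic
  polynomial along the line \<open>p + h \<pi>\<close>, and its linear coefficient is the
  derivative. This is the first half of Hamilton's equations: \<open>w\<close> is the
  velocity.\<close>

lemma DH_momentum:
  assumes z: "z \<in> S\<^sub>0" shows "DH (z, p) ((0, 0), \<pi>) = \<pi> \<bullet> w (z, p)"
proof -
  have G: "inner_form (g z)" by (rule g[OF z])
  then have bl: "bilinear (g z)" by (simp add: inner_form_def)
  define \<omega> where "\<omega> = sharp (g z) (\<lambda>v. \<pi> \<bullet> v)"
  have \<omega>: "g z \<omega> v = \<pi> \<bullet> v" for v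
    unfolding \<omega>_def by (rule sharp_works[OF G]) (simp add: linear_iff inner_add_right)
  have wh: "w (z, p + h *\<^sub>R \<pi>) = w (z, p) + h *\<^sub>R \<omega>" for h
    unfolding w_def[of] prod.case
    by (rule sharp_eqI[OF G]) (simp add: bilinear_ladd[OF bl] bilinear_lmul[OF bl] \<omega> w_works[OF z, unfolded w_def prod.case] inner_add_left)
  have Heq: "H (z, p) = (1 / 2) * g z (w (z, p)) (w (z, p)) + V\<^sub>0 z" for p
    by (simp add: H_def w_works[OF z])
  have "g z (w (z, p)) \<omega> = g z \<omega> (w (z, p))" using G unfolding inner_form_def by blast
  then have s: "g z (w (z, p)) \<omega> = \<pi> \<bullet> w (z, p)" using \<omega> by simp
  have "H (z, p + h *\<^sub>R \<pi>) = H (z, p) + h * (\<pi> \<bullet> w (z, p)) + h * h * ((1 / 2) * g z \<omega> \<omega>)" for h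
    unfolding Heq wh
    by (simp add: bilinear_ladd[OF bl] bilinear_radd[OF bl] bilinear_lmul[OF bl] bilinear_rmul[OF bl] s \<omega> algebra_simps)
  then have "((\<lambda>h. H (z, p + h *\<^sub>R \<pi>)) has_vector_derivative \<pi> \<bullet> w (z, p)) (at 0)"
    by (auto intro!: derivative_eq_intros simp: has_vector_derivative_def)
  moreover have "((\<lambda>h. H (z, p + h *\<^sub>R \<pi>)) has_vector_derivative DH (z, p) ((0, 0), \<pi>)) (at 0)"
  proof -
    have "(z, p) \<in> S\<^sub>1" using z by simp
    from has_derivative_imp_directional[OF DH[OF this], of "((0, 0), \<pi>)"] show ?thesis
      by (simp flip: zero_prod_def)
  qed
  ultimately show ?thesis using vector_derivative_unique_at by blast
qed

text \<open>The space gradient of \<open>H\<close> under the Euclidean identification;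
  \<open>- Hx\<close> is the rate of change of the momentum.\<close>

definition Hx :: "(real \<times> 'e) \<times> 'e \<Rightarrow> 'e" where
  "Hx y = (\<Sum>b\<in>Basis. DH y ((0, b), 0) *\<^sub>R b)"

lemma DH_space:
  assumes "z \<in> S\<^sub>0" shows "DH (z, p) ((0, v), \<pi>) = Hx (z, p) \<bullet> v + \<pi> \<bullet> w (z, p)"
proof -
  have y: "(z, p) \<in> S\<^sub>1" using assms by simp
  have l: "linear (DH (z, p))" using has_derivative_linear[OF DH[OF y]] .
  have "linear (\<lambda>v::'e. ((0::real, v), 0::'e))" by (simp add: linear_iff)
  from linear_compose[OF this l] have "linear (\<lambda>v. DH (z, p) ((0, v), 0))" by (simp add: o_def)
  from linear_componentwise_sum[OF this, of v]
  have "DH (z, p) ((0, v), 0) = Hx (z, p) \<bullet> v"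
    by (simp add: Hx_def inner_sum_left inner_commute[of v] mult.commute)
  moreover have "DH (z, p) ((0, v), \<pi>) = DH (z, p) ((0, v), 0) + DH (z, p) ((0, 0), \<pi>)"
    using linear_add[OF l, of "((0, v), 0)" "((0, 0), \<pi>)"] by simp
  ultimately show ?thesis by (simp add: DH_momentum[OF assms])
qed

lemma CkHx: "Ck_on (Suc j) S\<^sub>1 Hx"
proof -
  have "Ck_on (Suc j) S\<^sub>1 (\<lambda>y. DH y v)" for v
    using CkH unfolding Ck_on.simps(2)[of "Suc j"] by blast
  then show ?thesis unfolding Hx_def by (intro Ck_on_sum Ck_on_scaleR Ck_on_const openS1)
qed

text \<open>The last component of the Hamiltonian system integrates the action \<open>p dq - H dt\<close>.\<close>

definition field :: "((real \<times> 'e) \<times> 'e) \<times> real \<Rightarrow> ((real \<times> 'e) \<times> 'e) \<times> real" where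
  "field s = (((1, w (fst s)), - Hx (fst s)), snd (fst s) \<bullet> w (fst s) - H (fst s))"

lemma Ck_field: "Ck_on (Suc j) (S\<^sub>1 \<times> UNIV) field"
proof -
  have o: "open (S\<^sub>1 \<times> (UNIV :: real set))" using openS1 by (simp add: open_Times)
  have b: "Ck_on (Suc j) (S\<^sub>1 \<times> (UNIV :: real set)) (\<lambda>s. f (fst s))" if "Ck_on (Suc j) S\<^sub>1 f"
    for f :: "(real \<times> 'e) \<times> 'e \<Rightarrow> 'c::real_normed_vector"
    by (rule Ck_on_compose[OF o openS1 Ck_on_linear[OF bounded_linear_fst] that]) auto
  show ?thesis
    unfolding field_def[abs_def]
    by (intro Ck_on_Pair Ck_on_diff Ck_on_minus Ck_on_inner b Ck_on_const o CkHx Ck_on_Suc_imp[OF Ckw]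
        Ck_on_Suc_imp[OF CkH] Ck_on_linear[OF bounded_linear_snd_comp[OF bounded_linear_fst]])
qed

lemma field_derivative:
  assumes y: "y \<in> S\<^sub>1"
  shows "(field has_derivative (\<lambda>\<delta>. (((0, frechet_derivative w (at y) (fst \<delta>)),
      - frechet_derivative Hx (at y) (fst \<delta>)),
      snd (fst \<delta>) \<bullet> w y + snd y \<bullet> frechet_derivative w (at y) (fst \<delta>) - DH y (fst \<delta>)))) (at (y, U))"
proof -
  have f: "(fst has_derivative fst) (at (y, U))" by (intro bounded_linear_imp_has_derivative bounded_linear_fst)
  have sf: "((\<lambda>s. snd (fst s)) has_derivative (\<lambda>s. snd (fst s))) (at (y, U))"
    by (intro bounded_linear_imp_has_derivative bounded_linear_snd_comp bounded_linear_fst)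
  note comp = diff_chain_at[OF f, unfolded o_def fst_conv]
  have "(w has_derivative frechet_derivative w (at y)) (at y)" by (rule Ck_on_SucD_derivative[OF Ckw y])
  from comp[OF this] have dw: "((\<lambda>s. w (fst s)) has_derivative (\<lambda>\<delta>. frechet_derivative w (at y) (fst \<delta>))) (at (y, U))" .
  have "(Hx has_derivative frechet_derivative Hx (at y)) (at y)" by (rule Ck_on_SucD_derivative[OF CkHx y])
  from comp[OF this] have dHx: "((\<lambda>s. Hx (fst s)) has_derivative (\<lambda>\<delta>. frechet_derivative Hx (at y) (fst \<delta>))) (at (y, U))" .
  from comp[OF DH[OF y]] have dH: "((\<lambda>s. H (fst s)) has_derivative (\<lambda>\<delta>. DH y (fst \<delta>))) (at (y, U))" .
  have "((\<lambda>s. snd (fst s) \<bullet> w (fst s)) has_derivative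
      (\<lambda>\<delta>. snd (fst (y, U)) \<bullet> frechet_derivative w (at y) (fst \<delta>) + snd (fst \<delta>) \<bullet> w (fst (y, U)))) (at (y, U))"
    by (rule has_derivative_inner[OF sf dw])
  then have "((\<lambda>s. snd (fst s) \<bullet> w (fst s)) has_derivative
      (\<lambda>\<delta>. snd (fst \<delta>) \<bullet> w y + snd y \<bullet> frechet_derivative w (at y) (fst \<delta>))) (at (y, U))"
    by (simp add: add.commute)
  from has_derivative_Pair[OF has_derivative_Pair[OF has_derivative_Pair[OF has_derivative_const dw]
        has_derivative_minus[OF dHx]] has_derivative_diff[OF this dH]]
  show ?thesis by (simp add: field_def[abs_def])
qed

end

text \<open>The inverse function theorem gives a homeomorphism with invertible derivatives; its
  inverse then gets the class of \<open>h\<close> from \<open>Ck_on_inverse\<close>.\<close>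

lemma local_diffeomorphism:
  fixes h :: "'a::euclidean_space \<Rightarrow> 'a"
  assumes "open S" "x0 \<in> S" and h: "Ck_on (Suc k) S h" and inj: "inj (frechet_derivative h (at x0))"
  obtains U W h' where "open U" "U \<subseteq> S" "x0 \<in> U" "open W" "h x0 \<in> W"
    "\<And>x. x \<in> U \<Longrightarrow> h x \<in> W \<and> h' (h x) = x \<and> inj (frechet_derivative h (at x))"
    "\<And>y. y \<in> W \<Longrightarrow> h' y \<in> U \<and> h (h' y) = y" "Ck_on (Suc k) W h'"
proof -
  let ?D = "\<lambda>x. frechet_derivative h (at x)"
  have D: "(h has_derivative ?D x) (at x)" if "x \<in> S" for x by (rule Ck_on_SucD_derivative[OF h that])
  have bl: "bounded_linear (?D x)" if "x \<in> S" for x using D[OF that] has_derivative_bounded_linear by blast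
  have lin0: "linear (?D x0)" using bl[OF assms(2)] bounded_linear.linear by blast
  have ap: "blinfun_apply (Blinfun (?D x)) = ?D x" if "x \<in> S" for x
    using bl[OF that] by (rule bounded_linear_Blinfun_apply)
  have linv: "bounded_linear (inv (?D x0))"
    using inj_linear_imp_inv_linear[OF lin0 inj] linear_conv_bounded_linear by blast
  have "continuous_on S (\<lambda>x. Blinfun (?D x))"
  proof (rule continuous_on_blinfun_componentwise)
    fix i :: 'a
    have "continuous_on S (\<lambda>x. ?D x i)" using h Ck_on_imp_continuous_on by fastforce
    then show "continuous_on S (\<lambda>x. blinfun_apply (Blinfun (?D x)) i)"
      using ap by (simp cong: continuous_on_cong)
  qed
  moreover have "Blinfun (inv (?D x0)) o\<^sub>L Blinfun (?D x0) = id_blinfun"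
    by (rule blinfun_eqI) (simp add: ap[OF assms(2)] bounded_linear_Blinfun_apply[OF linv] inv_f_f[OF inj])
  moreover have "\<And>x. x \<in> S \<Longrightarrow> (h has_derivative blinfun_apply (Blinfun (?D x))) (at x)" using D ap by simp
  ultimately obtain U W h' g' where U: "open U" "U \<subseteq> S" "x0 \<in> U" "open W" "h x0 \<in> W" "homeomorphism U W h h'"
    and bij: "\<And>y. y \<in> W \<Longrightarrow> bij (blinfun_apply (Blinfun (?D (h' y))))"
    using inverse_function_theorem[OF assms(1) _ _ assms(2), of h "\<lambda>x. Blinfun (?D x)" "Blinfun (inv (?D x0))"]
    by metis
  have 1: "h x \<in> W" "h' (h x) = x" if "x \<in> U" for x using U(6) that by (auto simp: homeomorphism_def)
  have 2: "h' y \<in> U" "h (h' y) = y" if "y \<in> W" for y using U(6) that by (auto simp: homeomorphism_def)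
  have injU: "inj (?D x)" if "x \<in> U" for x
    using bij[OF 1(1)[OF that]] U(2) that by (auto simp: 1 ap bij_def)
  have "continuous_on W h'" using U(6) by (simp add: homeomorphism_def)
  then have "Ck_on (Suc k) W h'"
    using Ck_on_inverse[OF U(1,4) Ck_on_subset[OF h U(2)] _ 2 injU] by blast
  then show thesis using that[OF U(1-5)] 1 2 injU by blast
qed

context euclidean_data
begin

text \<open>For variations of the initial point, \<open>dU = p dx\<close> holds at the initial time,
  where momentum and action vanish, and Hamilton's equations preserve it; transported by
  \<open>h'\<close> it says that the momentum is the space derivative of \<open>u\<close>. As the
  action grows at the rate \<open>p w - H\<close> along the flow, the time derivative of
  \<open>u\<close> is then \<open>- H\<close>.\<close>

theorem local_solution:
  assumes m: "(t\<^sub>0, x\<^sub>0) \<in> S\<^sub>0"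
  obtains N N' and X Y :: "real \<times> 'e \<Rightarrow> 'e" and u :: "real \<times> 'e \<Rightarrow> real"
  where "open N" "open N'" "(t\<^sub>0, x\<^sub>0) \<in> N'" "N' \<subseteq> S\<^sub>0"
    "Ck_on (Suc j) N X" "Ck_on (Suc j) N' Y" "Ck_on (Suc j) N' u"
    "\<And>t x. (t, x) \<in> N \<Longrightarrow> (t, X (t, x)) \<in> N' \<and> Y (t, X (t, x)) = x"
    "\<And>t x. (t, x) \<in> N' \<Longrightarrow> (t, Y (t, x)) \<in> N \<and> X (t, Y (t, x)) = x"
    "\<And>t x. (t, x) \<in> N' \<Longrightarrow> \<exists>p. (\<forall>v. frechet_derivative u (at (t, x)) (0, v) = p \<bullet> v) \<and>
      frechet_derivative u (at (t, x)) (1, 0) = - H ((t, x), p) \<and>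
      ((\<lambda>s. X (s, Y (t, x))) has_vector_derivative w ((t, x), p)) (at t)"
proof -
  let ?S2 = "S\<^sub>1 \<times> (UNIV :: real set)" and ?s0 = "(((t\<^sub>0, x\<^sub>0), 0 :: 'e), 0 :: real)"
  have o2: "open ?S2" using openS1 by (simp add: open_Times)
  have m2: "?s0 \<in> ?S2" using m by simp
  obtain \<epsilon> \<phi> where \<epsilon>: "\<epsilon> > 0" and Ck\<phi>: "Ck_on (Suc j) ({-\<epsilon><..<\<epsilon>} \<times> ball ?s0 \<epsilon>) \<phi>"
    and \<phi>0: "\<And>s. s \<in> ball ?s0 \<epsilon> \<Longrightarrow> \<phi> (0, s) = s"
    and \<phi>S: "\<And>\<tau> s. \<bar>\<tau>\<bar> < \<epsilon> \<Longrightarrow> s \<in> ball ?s0 \<epsilon> \<Longrightarrow> \<phi> (\<tau>, s) \<in> ?S2"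
    and \<phi>': "\<And>\<tau> s. \<bar>\<tau>\<bar> < \<epsilon> \<Longrightarrow> s \<in> ball ?s0 \<epsilon> \<Longrightarrow>
      ((\<lambda>\<tau>. \<phi> (\<tau>, s)) has_vector_derivative field (\<phi> (\<tau>, s))) (at \<tau>)"
    and D\<phi>': "\<And>\<tau> s v. \<bar>\<tau>\<bar> < \<epsilon> \<Longrightarrow> s \<in> ball ?s0 \<epsilon> \<Longrightarrow>
      ((\<lambda>\<tau>. frechet_derivative \<phi> (at (\<tau>, s)) (0, v)) has_vector_derivative
         frechet_derivative field (at (\<phi> (\<tau>, s))) (frechet_derivative \<phi> (at (\<tau>, s)) (0, v))) (at \<tau>)"
  proof -
    show ?thesis by (rule local_flow[OF o2 m2 Ck_field]) (rule that)
  qed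
  \<comment> \<open>Initial states: time \<open>t\<^sub>0\<close>, position \<open>x\<close>, zero
    momentum and zero action; \<open>\<eta>'\<close> is the differential of this embedding.\<close>
  define \<eta> where "\<eta> = (\<lambda>x :: 'e. (((t\<^sub>0, x), 0 :: 'e), 0 :: real))"
  define \<eta>' where "\<eta>' = (\<lambda>v :: 'e. (((0 :: real, v), 0 :: 'e), 0 :: real))"
  have \<eta>: "\<eta> x \<in> ball ?s0 \<epsilon>" if "x \<in> ball x\<^sub>0 \<epsilon>" for x using that by (simp add: \<eta>_def dist_Pair_Pair)
  let ?B = "{-\<epsilon><..<\<epsilon>} \<times> ball x\<^sub>0 \<epsilon>"
  have oB: "open ?B" by (simp add: open_Times)
  define Z where "Z = (\<lambda>(\<tau>, x). \<phi> (\<tau>, \<eta> x))"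
  have ob: "open ({-\<epsilon><..<\<epsilon>} \<times> ball ?s0 \<epsilon>)" by (simp add: open_Times)
  have CkZ: "Ck_on (Suc j) ?B Z"
    unfolding Z_def case_prod_unfold
  proof (rule Ck_on_compose[OF oB ob _ Ck\<phi>])
    show "Ck_on (Suc j) ?B (\<lambda>z. (fst z, \<eta> (snd z)))"
      unfolding \<eta>_def
      by (intro Ck_on_Pair oB Ck_on_const Ck_on_linear[OF bounded_linear_fst] Ck_on_linear[OF bounded_linear_snd])
    show "(fst z, \<eta> (snd z)) \<in> {-\<epsilon><..<\<epsilon>} \<times> ball ?s0 \<epsilon>" if "z \<in> ?B" for z
      using that \<eta>[of "snd z"] by (auto simp only: mem_Times_iff fst_conv snd_conv)
  qed
  have Z0: "Z (0, x) = \<eta> x" if "x \<in> ball x\<^sub>0 \<epsilon>" for x using \<phi>0[OF \<eta>[OF that]] by (simp add: Z_def)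
  have ZS: "fst (Z (\<tau>, x)) \<in> S\<^sub>1" if "\<bar>\<tau>\<bar> < \<epsilon>" "x \<in> ball x\<^sub>0 \<epsilon>" for \<tau> x
    using \<phi>S[OF that(1) \<eta>[OF that(2)]] by (auto simp: Z_def)
  have Z': "((\<lambda>\<tau>. Z (\<tau>, x)) has_vector_derivative field (Z (\<tau>, x))) (at \<tau>)" if "\<bar>\<tau>\<bar> < \<epsilon>" "x \<in> ball x\<^sub>0 \<epsilon>" for \<tau> x
    using \<phi>'[OF that(1) \<eta>[OF that(2)]] by (simp add: Z_def)
  let ?DZ = "\<lambda>\<tau> x. frechet_derivative Z (at (\<tau>, x))"
  have DZ: "(Z has_derivative ?DZ \<tau> x) (at (\<tau>, x))" if "\<bar>\<tau>\<bar> < \<epsilon>" "x \<in> ball x\<^sub>0 \<epsilon>" for \<tau> x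
    using that by (intro Ck_on_SucD_derivative[OF CkZ]) (auto simp: abs_less_iff)
  have DZ\<phi>: "?DZ \<tau> x (0, v) = frechet_derivative \<phi> (at (\<tau>, \<eta> x)) (0, \<eta>' v)" if "\<bar>\<tau>\<bar> < \<epsilon>" "x \<in> ball x\<^sub>0 \<epsilon>" for \<tau> x v
  proof -
    have "(\<phi> has_derivative frechet_derivative \<phi> (at (\<tau>, \<eta> x))) (at (\<tau>, \<eta> x))"
      using that \<eta>[OF that(2)] by (intro Ck_on_SucD_derivative[OF Ck\<phi>]) (auto simp: abs_less_iff simp del: mem_ball)
    from has_derivative_imp_directional[OF this, of "(0, \<eta>' v)"]
    have "((\<lambda>h. Z ((\<tau>, x) + h *\<^sub>R (0, v))) has_vector_derivative frechet_derivative \<phi> (at (\<tau>, \<eta> x)) (0, \<eta>' v)) (at 0)"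
      by (simp add: Z_def \<eta>_def \<eta>'_def)
    from vector_derivative_unique_at[OF has_derivative_imp_directional[OF DZ[OF that], of "(0, v)"] this] show ?thesis .
  qed
  have DZ': "((\<lambda>\<tau>. ?DZ \<tau> x (0, v)) has_vector_derivative frechet_derivative field (at (Z (\<tau>, x))) (?DZ \<tau> x (0, v))) (at \<tau>)"
    if "\<bar>\<tau>\<bar> < \<epsilon>" "x \<in> ball x\<^sub>0 \<epsilon>" for \<tau> x v
  proof -
    have "((\<lambda>\<tau>. ?DZ \<tau> x (0, v)) has_vector_derivative
         frechet_derivative field (at (\<phi> (\<tau>, \<eta> x))) (frechet_derivative \<phi> (at (\<tau>, \<eta> x)) (0, \<eta>' v))) (at \<tau>)"
      by (rule has_vector_derivative_transform_within_open[OF D\<phi>'[OF that(1) \<eta>[OF that(2)]], of "{-\<epsilon><..<\<epsilon>}"])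
        (use that DZ\<phi> in \<open>auto simp: abs_less_iff\<close>)
    then show ?thesis using DZ\<phi>[OF that] by (simp add: Z_def)
  qed
  have DZ0: "?DZ 0 x (0, v) = \<eta>' v" if x: "x \<in> ball x\<^sub>0 \<epsilon>" for x v
  proof -
    have z: "\<bar>0 :: real\<bar> < \<epsilon>" using \<epsilon> by simp
    have "((\<lambda>h. x + h *\<^sub>R v) \<longlongrightarrow> x) (at 0)" by (auto intro!: tendsto_eq_intros)
    have o: "open ((\<lambda>h. x + h *\<^sub>R v) -` ball x\<^sub>0 \<epsilon>)" by (intro open_vimage continuous_intros) auto
    have "((\<lambda>h. \<eta> (x + h *\<^sub>R v)) has_vector_derivative \<eta>' v) (at 0)"
      unfolding \<eta>_def \<eta>'_def has_vector_derivative_def by (auto intro!: derivative_eq_intros)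
    then have "((\<lambda>h. Z ((0, x) + h *\<^sub>R (0, v))) has_vector_derivative \<eta>' v) (at 0)"
      by (rule has_vector_derivative_transform_within_open[OF _ o]) (use x Z0 in auto)
    from vector_derivative_unique_at[OF has_derivative_imp_directional[OF DZ[OF z x], of "(0, v)"] this] show ?thesis .
  qed
  define tt where "tt = (\<lambda>z. fst (fst (fst (Z z))))"
  define X1 where "X1 = (\<lambda>z. snd (fst (fst (Z z))))"
  define P1 where "P1 = (\<lambda>z. snd (fst (Z z)))"
  define U1 where "U1 = (\<lambda>z. snd (Z z))"
  have Zeq: "Z z = (((tt z, X1 z), P1 z), U1 z)" for z by (simp add: tt_def X1_def P1_def U1_def)
  have tt: "tt (\<tau>, x) = t\<^sub>0 + \<tau>" if \<tau>: "\<bar>\<tau>\<bar> < \<epsilon>" and x: "x \<in> ball x\<^sub>0 \<epsilon>" for \<tau> x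
  proof -
    have "(\<lambda>\<tau>. tt (\<tau>, x) - \<tau>) \<tau> = (\<lambda>\<tau>. tt (\<tau>, x) - \<tau>) 0"
    proof (rule vanishing_derivative_constant[of "{-\<epsilon><..<\<epsilon>}" "\<lambda>\<tau>. tt (\<tau>, x) - \<tau>"])
      fix s assume "s \<in> {-\<epsilon><..<\<epsilon>}"
      then have "\<bar>s\<bar> < \<epsilon>" by auto
      from bounded_linear.has_vector_derivative[OF bounded_linear_fst_comp[OF bounded_linear_fst_comp[OF bounded_linear_fst]] Z'[OF this x]]
      have "((\<lambda>\<tau>. tt (\<tau>, x)) has_vector_derivative 1) (at s)" by (simp add: tt_def field_def)
      then show "((\<lambda>\<tau>. tt (\<tau>, x) - \<tau>) has_vector_derivative 0) (at s)" by (auto intro!: derivative_eq_intros)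
    qed (use \<tau> \<epsilon> in \<open>auto simp: is_interval_convex_1 abs_less_iff\<close>)
    then show ?thesis using Z0[OF x] by (simp add: tt_def \<eta>_def)
  qed
  let ?X' = "\<lambda>\<tau> x v. snd (fst (fst (?DZ \<tau> x (0, v))))"
  \<comment> \<open>In the derivative of \<open>?E\<close> the two terms with the variation of the
    velocity cancel, and \<open>DH_space\<close> splits the variation of \<open>H\<close> into
    exactly the remaining ones. At \<tau> equal to \<open>0\<close> both sides vanish.\<close>
  have action: "snd (?DZ \<tau> x (0, v)) = P1 (\<tau>, x) \<bullet> ?X' \<tau> x v" if \<tau>: "\<bar>\<tau>\<bar> < \<epsilon>" and x: "x \<in> ball x\<^sub>0 \<epsilon>" for \<tau> x v
  proof -
    let ?E = "\<lambda>\<tau>. snd (?DZ \<tau> x (0, v)) - P1 (\<tau>, x) \<bullet> ?X' \<tau> x v"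
    have "?E \<tau> = ?E 0"
    proof (rule vanishing_derivative_constant[of "{-\<epsilon><..<\<epsilon>}" ?E])
      fix s assume "s \<in> {-\<epsilon><..<\<epsilon>}"
      then have s: "\<bar>s\<bar> < \<epsilon>" by auto
      obtain tv Xv Pv Uv where \<Psi>: "?DZ s x (0, v) = (((tv, Xv), Pv), Uv)" by (metis surj_pair)
      let ?y = "((tt (s, x), X1 (s, x)), P1 (s, x))"
      have yS: "?y \<in> S\<^sub>1" using ZS[OF s x] by (simp add: Zeq)
      have zS: "(tt (s, x), X1 (s, x)) \<in> S\<^sub>0" using yS by simp
      \<comment> \<open>The time reached depends on \<tau> only, so it does not vary with the
        initial point.\<close>
      have "tv = 0"
      proof -
        have o: "open ((\<lambda>h. x + h *\<^sub>R v) -` ball x\<^sub>0 \<epsilon>)" by (intro open_vimage continuous_intros) auto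
        have "((\<lambda>h. tt ((s, x) + h *\<^sub>R (0, v))) has_vector_derivative tv) (at 0)"
          using bounded_linear.has_vector_derivative[OF bounded_linear_fst_comp[OF bounded_linear_fst_comp[OF bounded_linear_fst]]
              has_derivative_imp_directional[OF DZ[OF s x], of "(0, v)"]] by (simp add: tt_def \<Psi>)
        moreover have "((\<lambda>h. tt ((s, x) + h *\<^sub>R (0, v))) has_vector_derivative 0) (at 0)"
          by (rule has_vector_derivative_transform_within_open[OF has_vector_derivative_const o])
            (use x s tt in auto)
        ultimately show ?thesis using vector_derivative_unique_at by blast
      qed
      let ?W = "frechet_derivative w (at ?y) ((0, Xv), Pv)"
      have Df: "frechet_derivative field (at (Z (s, x))) (?DZ s x (0, v)) = (((0, ?W), - frechet_derivative Hx (at ?y) ((0, Xv), Pv)),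
          Pv \<bullet> w ?y + P1 (s, x) \<bullet> ?W - DH ?y ((0, Xv), Pv))"
        using fun_cong[OF frechet_derivative_at[OF field_derivative[OF yS, of "U1 (s, x)"]], of "(((0, Xv), Pv), Uv)"]
        by (simp add: Zeq \<Psi> \<open>tv = 0\<close>)
      have dU: "((\<lambda>\<tau>. snd (?DZ \<tau> x (0, v))) has_vector_derivative Pv \<bullet> w ?y + P1 (s, x) \<bullet> ?W - DH ?y ((0, Xv), Pv)) (at s)"
        using bounded_linear.has_vector_derivative[OF bounded_linear_snd DZ'[OF s x, of v]] by (simp add: Df)
      have dX: "((\<lambda>\<tau>. ?X' \<tau> x v) has_vector_derivative ?W) (at s)"
        using bounded_linear.has_vector_derivative[OF bounded_linear_snd_comp[OF bounded_linear_fst_comp[OF bounded_linear_fst]] DZ'[OF s x, of v]]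
        by (simp add: Df)
      have dP: "((\<lambda>\<tau>. P1 (\<tau>, x)) has_vector_derivative - Hx ?y) (at s)"
        using bounded_linear.has_vector_derivative[OF bounded_linear_snd_comp[OF bounded_linear_fst] Z'[OF s x]]
        by (simp add: P1_def[symmetric] field_def Zeq)
      have "((\<lambda>\<tau>. P1 (\<tau>, x) \<bullet> ?X' \<tau> x v) has_vector_derivative P1 (s, x) \<bullet> ?W + (- Hx ?y) \<bullet> Xv) (at s)"
        using bounded_bilinear.has_vector_derivative[OF bounded_bilinear_inner dP dX] by (simp add: \<Psi>)
      from has_vector_derivative_diff[OF dU this]
      show "(?E has_vector_derivative 0) (at s)"
        by (simp add: DH_space[OF zS])
    qed (use \<tau> \<epsilon> in \<open>auto simp: is_interval_convex_1 abs_less_iff\<close>)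
    also have "?E 0 = 0" using DZ0[OF x] Z0[OF x] by (simp add: \<eta>'_def \<eta>_def P1_def)
    finally show ?thesis by simp
  qed
  define N0 where "N0 = {z. (fst z - t\<^sub>0, snd z) \<in> ?B}"
  have N0eq: "N0 = (\<lambda>z. (fst z - t\<^sub>0, snd z)) -` ?B" by (auto simp: N0_def)
  have oN0: "open N0" unfolding N0eq by (intro open_vimage oB continuous_intros)
  have inN0: "(t, x) \<in> N0 \<longleftrightarrow> \<bar>t - t\<^sub>0\<bar> < \<epsilon> \<and> x \<in> ball x\<^sub>0 \<epsilon>" for t x by (auto simp: N0_def)
  define X where "X = (\<lambda>z. X1 (fst z - t\<^sub>0, snd z))"
  have CkZ': "Ck_on (Suc j) N0 (\<lambda>z. Z (fst z - t\<^sub>0, snd z))"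
  proof (rule Ck_on_compose[OF oN0 oB _ CkZ])
    show "Ck_on (Suc j) N0 (\<lambda>z. (fst z - t\<^sub>0, snd z))"
      by (intro Ck_on_Pair Ck_on_diff Ck_on_const oN0 Ck_on_linear[OF bounded_linear_fst] Ck_on_linear[OF bounded_linear_snd])
  qed (auto simp: N0_def)
  have CkX: "Ck_on (Suc j) N0 X"
    unfolding X_def X1_def by (intro Ck_on_snd[OF oN0] Ck_on_fst[OF oN0] CkZ')
  \<comment> \<open>The time is kept as a component, so that the inverse respects it. At
    \<open>t\<^sub>0\<close> positions are initial points, which makes the differential there
    triangular and injective.\<close>
  define h where "h = (\<lambda>z. (fst z, X z))"
  have Ckh: "Ck_on (Suc j) N0 h"
    unfolding h_def by (intro Ck_on_Pair oN0 CkX Ck_on_linear[OF bounded_linear_fst])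
  have Zd: "((\<lambda>z. Z (fst z - t\<^sub>0, snd z)) has_derivative ?DZ (t - t\<^sub>0) x) (at (t, x))" if "(t, x) \<in> N0" for t x
  proof -
    have 1: "((\<lambda>z. (fst z - t\<^sub>0, snd z)) has_derivative (\<lambda>\<delta>. \<delta>)) (at (t, x))"
      by (auto intro!: derivative_eq_intros)
    have "\<bar>t - t\<^sub>0\<bar> < \<epsilon>" "x \<in> ball x\<^sub>0 \<epsilon>" using that by (auto simp: inN0)
    from diff_chain_at[OF 1, of Z] DZ[OF this] show ?thesis by (simp add: o_def)
  qed
  have Dh: "frechet_derivative h (at (t, x)) \<delta> = (fst \<delta>, snd (fst (fst (?DZ (t - t\<^sub>0) x \<delta>))))" if "(t, x) \<in> N0" for t x \<delta>
  proof -
    have "(h has_derivative (\<lambda>\<delta>. (fst \<delta>, snd (fst (fst (?DZ (t - t\<^sub>0) x \<delta>)))))) (at (t, x))"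
      unfolding h_def X_def X1_def
      by (intro has_derivative_Pair has_derivative_fst has_derivative_snd has_derivative_ident Zd that)
    from fun_cong[OF frechet_derivative_at[OF this], of \<delta>] show ?thesis by simp
  qed
  have m0: "(t\<^sub>0, x\<^sub>0) \<in> N0" using \<epsilon> by (simp add: inN0)
  have X0: "X (t\<^sub>0, x\<^sub>0) = x\<^sub>0" using Z0[of x\<^sub>0] \<epsilon> by (simp add: X_def X1_def \<eta>_def)
  have inj0: "inj (frechet_derivative h (at (t\<^sub>0, x\<^sub>0)))"
  proof -
    have l: "linear (frechet_derivative h (at (t\<^sub>0, x\<^sub>0)))"
      using has_derivative_linear[OF Ck_on_SucD_derivative[OF Ckh m0]] .
    have "\<delta> = 0" if z: "frechet_derivative h (at (t\<^sub>0, x\<^sub>0)) \<delta> = 0" for \<delta>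
    proof -
      obtain \<tau> v where \<delta>: "\<delta> = (\<tau>, v)" by (cases \<delta>)
      then have "\<tau> = 0" using z Dh[OF m0, of \<delta>] by (simp add: zero_prod_def)
      then have "v = 0" using z Dh[OF m0, of \<delta>] DZ0[of x\<^sub>0 v] \<epsilon> by (simp add: \<delta> \<eta>'_def zero_prod_def)
      then show ?thesis using \<delta> \<open>\<tau> = 0\<close> by (simp add: zero_prod_def)
    qed
    then show ?thesis using linear_injective_0[OF l] by blast
  qed
  obtain N N' h' where N: "open N" "N \<subseteq> N0" "(t\<^sub>0, x\<^sub>0) \<in> N" "open N'" "h (t\<^sub>0, x\<^sub>0) \<in> N'"
    and hN: "\<And>z. z \<in> N \<Longrightarrow> h z \<in> N' \<and> h' (h z) = z \<and> inj (frechet_derivative h (at z))"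
    and hN': "\<And>z. z \<in> N' \<Longrightarrow> h' z \<in> N \<and> h (h' z) = z" and Ckh': "Ck_on (Suc j) N' h'"
  proof -
    show ?thesis by (rule local_diffeomorphism[OF oN0 m0 Ckh inj0]) (rule that)
  qed
  define Y where "Y = (\<lambda>z. snd (h' z))"
  define u where "u = (\<lambda>z. U1 (fst (h' z) - t\<^sub>0, snd (h' z)))"
  have h': "h' (t, x) = (t, Y (t, x))" if "(t, x) \<in> N'" for t x
    using hN'[OF that] by (simp add: h_def Y_def prod_eq_iff)
  have hS: "h (t, x) \<in> S\<^sub>0" if "(t, x) \<in> N0" for t x
  proof -
    have "\<bar>t - t\<^sub>0\<bar> < \<epsilon>" "x \<in> ball x\<^sub>0 \<epsilon>" using that by (auto simp: inN0)
    from ZS[OF this] tt[OF this] show ?thesis by (simp add: Zeq h_def X_def)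
  qed
  have sub: "N' \<subseteq> S\<^sub>0"
  proof safe
    fix t x assume z: "(t, x) \<in> N'"
    have "h' (t, x) \<in> N0" using hN'[OF z] N(2) by blast
    then show "(t, x) \<in> S\<^sub>0" using hS[of "fst (h' (t, x))" "snd (h' (t, x))"] hN'[OF z] by simp
  qed
  have CkU: "Ck_on (Suc j) N (\<lambda>z. U1 (fst z - t\<^sub>0, snd z))"
    unfolding U1_def by (rule Ck_on_subset[OF Ck_on_snd[OF oN0 CkZ'] N(2)])
  have Cku: "Ck_on (Suc j) N' u"
    unfolding u_def using hN' by (intro Ck_on_compose[OF N(4,1) Ckh' CkU]) blast
  show thesis
  proof (rule that[OF N(1,4) _ sub Ck_on_subset[OF CkX N(2)] _ Cku, of Y])
    show "(t\<^sub>0, x\<^sub>0) \<in> N'" using N(5) X0 by (simp add: h_def)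
    show "Ck_on (Suc j) N' Y" unfolding Y_def by (rule Ck_on_snd[OF N(4) Ckh'])
    show "(t, X (t, x)) \<in> N' \<and> Y (t, X (t, x)) = x" if "(t, x) \<in> N" for t x
      using hN[OF that] by (simp add: h_def Y_def)
    show bk: "(t, Y (t, x)) \<in> N \<and> X (t, Y (t, x)) = x" if "(t, x) \<in> N'" for t x
      using hN'[OF that] h'[OF that] by (simp add: h_def)
    fix t x assume z: "(t, x) \<in> N'"
    define x' where "x' = Y (t, x)"
    have zN: "(t, x') \<in> N" and Xx: "X (t, x') = x" using bk[OF z] by (auto simp: x'_def)
    then have zN0: "(t, x') \<in> N0" using N(2) by blast
    then have \<tau>: "\<bar>t - t\<^sub>0\<bar> < \<epsilon>" and x': "x' \<in> ball x\<^sub>0 \<epsilon>" by (auto simp: inN0)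
    have hz: "h (t, x') = (t, x)" by (simp add: h_def Xx)
    define p where "p = P1 (t - t\<^sub>0, x')"
    have Zz: "Z (t - t\<^sub>0, x') = (((t, x), p), U1 (t - t\<^sub>0, x'))"
      using tt[OF \<tau> x'] Xx by (simp add: Zeq p_def X_def)
    have zS: "(t, x) \<in> S\<^sub>0" using sub z by blast
    let ?Du = "frechet_derivative u (at (t, x))" and ?D = "?DZ (t - t\<^sub>0) x'"
    have lDu: "linear ?Du" using has_derivative_linear[OF Ck_on_SucD_derivative[OF Cku z]] .
    have lDh: "linear (frechet_derivative h (at (t, x')))"
      using has_derivative_linear[OF Ck_on_SucD_derivative[OF Ckh zN0]] .
    have chain: "?Du (frechet_derivative h (at (t, x')) \<delta>) = snd (?D \<delta>)" for \<delta>
    proof -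
      have "((u \<circ> h) has_derivative (\<lambda>\<delta>. ?Du (frechet_derivative h (at (t, x')) \<delta>))) (at (t, x'))"
        using diff_chain_at[OF Ck_on_SucD_derivative[OF Ckh zN0], of u ?Du] Ck_on_SucD_derivative[OF Cku z] hz
        by (simp add: o_def)
      then have "((\<lambda>z. U1 (fst z - t\<^sub>0, snd z)) has_derivative (\<lambda>\<delta>. ?Du (frechet_derivative h (at (t, x')) \<delta>))) (at (t, x'))"
        by (rule has_derivative_transform_within_open[OF _ N(1) zN]) (use hN in \<open>auto simp: u_def\<close>)
      moreover have "((\<lambda>z. U1 (fst z - t\<^sub>0, snd z)) has_derivative (\<lambda>\<delta>. snd (?D \<delta>))) (at (t, x'))"
        unfolding U1_def by (rule has_derivative_snd[OF Zd[OF zN0]])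
      ultimately have "(\<lambda>\<delta>. ?Du (frechet_derivative h (at (t, x')) \<delta>)) = (\<lambda>\<delta>. snd (?D \<delta>))"
        by (rule has_derivative_unique)
      then show ?thesis by (rule fun_cong)
    qed
    have space: "?Du (0, v) = p \<bullet> v" for v
    proof -
      \<comment> \<open>Each space direction \<open>(0, v)\<close> at the end point comes from a
        variation of the initial point at fixed time, to which \<open>action\<close>
        applies.\<close>
      have "surj (frechet_derivative h (at (t, x')))"
        using linear_inj_imp_surj[OF lDh] hN[OF zN] by blast
      then obtain \<delta> where \<delta>: "frechet_derivative h (at (t, x')) \<delta> = (0, v)" by (metis surjD)
      then have "fst \<delta> = 0" using Dh[OF zN0, of \<delta>] by simp
      then obtain y where y: "\<delta> = (0, y)" by (cases \<delta>) auto
      have "?Du (0, v) = snd (?D (0, y))" using chain[of \<delta>] \<delta> y by simp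
      also have "\<dots> = p \<bullet> snd (fst (fst (?D (0, y))))" using action[OF \<tau> x'] by (simp add: p_def)
      also have "snd (fst (fst (?D (0, y)))) = v" using \<delta> Dh[OF zN0, of \<delta>] y by simp
      finally show ?thesis .
    qed
    have D1: "?D (1, 0) = field (Z (t - t\<^sub>0, x'))"
    proof -
      have "((\<lambda>\<tau>. (\<tau>, x')) has_derivative (\<lambda>h. (h, 0))) (at (t - t\<^sub>0))" by (auto intro!: derivative_eq_intros)
      from diff_chain_at[OF this, of Z ?D] DZ[OF \<tau> x']
      have "((\<lambda>\<tau>. Z (\<tau>, x')) has_derivative (\<lambda>h. ?D (h, 0))) (at (t - t\<^sub>0))" by (simp add: o_def)
      moreover have "(\<lambda>h. ?D (h, 0)) = (\<lambda>h. h *\<^sub>R ?D (1, 0))"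
      proof
        show "?D (h, 0) = h *\<^sub>R ?D (1, 0)" for h
          using linear_scale[OF has_derivative_linear[OF DZ[OF \<tau> x']], of h "(1, 0)"] by simp
      qed
      ultimately have "((\<lambda>\<tau>. Z (\<tau>, x')) has_vector_derivative ?D (1, 0)) (at (t - t\<^sub>0))"
        by (simp only: has_vector_derivative_def)
      from vector_derivative_unique_at[OF this Z'[OF \<tau> x']] show ?thesis .
    qed
    \<comment> \<open>Along the trajectory, \<open>u\<close> grows at the rate of the
      action.\<close>
    have "?Du (1, w ((t, x), p)) = p \<bullet> w ((t, x), p) - H ((t, x), p)"
      using chain[of "(1, 0)"] Dh[OF zN0, of "(1, 0)"] D1 by (simp add: Zz field_def)
    then have time: "?Du (1, 0) = - H ((t, x), p)"
      using linear_add[OF lDu, of "(1, 0)" "(0, w ((t, x), p))"] space by simp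
    have "((\<lambda>s. s - t\<^sub>0) has_vector_derivative 1) (at t)" by (auto intro!: derivative_eq_intros)
    from vector_diff_chain_at[OF this, of "\<lambda>\<tau>. Z (\<tau>, x')"] Z'[OF \<tau> x']
    have "((\<lambda>s. Z (s - t\<^sub>0, x')) has_vector_derivative field (Z (t - t\<^sub>0, x'))) (at t)" by (simp add: o_def)
    from bounded_linear.has_vector_derivative[OF bounded_linear_snd_comp[OF bounded_linear_fst_comp[OF bounded_linear_fst]] this]
    have "((\<lambda>s. X (s, x')) has_vector_derivative w ((t, x), p)) (at t)"
      by (simp add: X_def X1_def Zz field_def)
    then show "\<exists>p. (\<forall>v. ?Du (0, v) = p \<bullet> v) \<and> ?Du (1, 0) = - H ((t, x), p) \<and>
      ((\<lambda>s. X (s, Y (t, x))) has_vector_derivative w ((t, x), p)) (at t)"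
      unfolding x'_def[symmetric] using space time by blast
  qed
qed

end


subsection \<open>Model spaces as manifolds\<close>

lemma paracompact_space_euclidean:
  "paracompact_space (euclidean :: 'a::{metric_space, second_countable_topology} topology)"
  unfolding paracompact_space_def
proof (intro allI impI)
  fix \<U> :: "'a set set" assume \<U>: "(\<forall>U\<in>\<U>. openin euclidean U) \<and> \<Union>\<U> = topspace euclidean"
  obtain \<V> where \<V>: "UNIV \<subseteq> \<Union>\<V>" "\<And>U. U \<in> \<V> \<Longrightarrow> open U \<and> (\<exists>T. T \<in> \<U> \<and> U \<subseteq> T)"
    "\<And>x. x \<in> UNIV \<Longrightarrow> \<exists>V. open V \<and> x \<in> V \<and> finite {U. U \<in> \<V> \<and> (U \<inter> V \<noteq> {})}"
  proof -
    show ?thesis by (rule paracompact[of UNIV \<U>]) (use \<U> in \<open>auto intro: that\<close>)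
  qed
  have "locally_finite_in euclidean \<V>"
    unfolding locally_finite_in_def using \<V>(3) by simp
  moreover have "\<Union>\<V> = topspace euclidean" using \<V>(1) by auto
  ultimately show "\<exists>\<V>. (\<forall>V\<in>\<V>. openin euclidean V \<and> (\<exists>U\<in>\<U>. V \<subseteq> U)) \<and> \<Union>\<V> = topspace euclidean \<and>
      locally_finite_in euclidean \<V>"
    using \<V>(2) by (intro exI[of _ \<V>]) (simp, blast)
qed

lemma Ck_manifold_euclidean: "Ck_manifold k (euclidean :: 'e::euclidean_space topology) std_atlas"
  unfolding Ck_manifold_def
proof (intro conjI)
  show "Hausdorff_space (euclidean :: 'e topology)" by simp
  show "paracompact_space (euclidean :: 'e topology)" by (rule paracompact_space_euclidean)
  have "is_chart euclidean (std_chart :: ('e, 'e) chart)" by (rule is_chartI) auto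
  then show "Ck_atlas k (euclidean :: 'e topology) std_atlas"
    by (simp add: Ck_atlas_def std_atlas_def o_def chart_inv_std Ck_on_id)
qed

lemma openin_prod_euclidean:
  assumes "open (S :: ('a::topological_space \<times> 'b::topological_space) set)"
  shows "openin (prod_topology euclidean euclidean) S"
  unfolding openin_prod_topology_alt
proof (intro allI impI)
  fix x y assume xy: "(x, y) \<in> S"
  obtain U W where "open U" "open W" "(x, y) \<in> U \<times> W" "U \<times> W \<subseteq> S"
    by (rule open_prod_elim[OF assms xy])
  then show "\<exists>U W. openin euclidean U \<and> openin euclidean W \<and> x \<in> U \<and> y \<in> W \<and> U \<times> W \<subseteq> S" by auto
qed

lemma chart_inv_event_std: "chart_inv (event_chart std_chart) z = z"
  by (cases z) (simp add: chart_inv_event_chart chart_inv_std)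

text \<open>\<open>Q'\<close> is here the model space: the label of an event is the coordinate
  position at time \<open>t\<^sub>0\<close> of the trajectory through it. With
  \<open>j = r - 2\<close> the coordinates are of class \<open>r - 1\<close> and the new metric is
  of class \<open>r - 2\<close>.\<close>

lemma rosen_near_exists:
  assumes manifold: "Ck_manifold (Suc r) X A" and r: "r = Suc (Suc j)" and T: "open T"
    and a: "riemannian_metric_on r A (T \<times> topspace X) a" and b: "one_form_on r A (T \<times> topspace X) b"
    and V: "Ck_fun r (event_atlas A) (T \<times> topspace X) V" and p: "p \<in> T \<times> topspace X \<times> UNIV"
  shows "rosen_near (Suc j) X A T a b V p"
proof -
  have atlas: "Ck_atlas (Suc j) X A" using manifold r by (auto simp: Ck_manifold_def intro: Ck_atlas_mono)
  note C = Ck_atlas_chart_system[OF atlas]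
  note EC = chart_system_event_atlas[OF C]
  obtain t\<^sub>0 q\<^sub>0 y\<^sub>0 where pe: "p = (t\<^sub>0, q\<^sub>0, y\<^sub>0)" "t\<^sub>0 \<in> T" "q\<^sub>0 \<in> topspace X" using p by auto
  obtain c where c: "c \<in> A" "q\<^sub>0 \<in> fst c" using atlas pe(3) unfolding Ck_atlas_def by blast
  have chart: "is_chart X c" using atlas c by (auto simp: Ck_atlas_def)
  note cc = chart_systemD[OF C c(1)]
  have top: "fst c \<subseteq> topspace X" by (rule is_chart_subset[OF chart])
  let ?i = "chart_inv (event_chart c)" and ?S = "T \<times> snd c ` fst c"
  have im: "snd (event_chart c) ` (fst (event_chart c) \<inter> T \<times> topspace X) = ?S"
  proof -
    have "fst (event_chart c) \<inter> T \<times> topspace X = T \<times> fst c" using top by auto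
    then show ?thesis by (simp only: event_chart_image)
  qed
  have i: "?i (t, x) = (t, chart_inv c x)" if "x \<in> snd c ` fst c" for t x
    by (rule chart_inv_event_chart[OF cc(1) that])
  have iT: "?i z \<in> T \<times> topspace X" "snd (?i z) \<in> fst c" if "z \<in> ?S" for z
    using that i cc(3) top by auto
  have E: "euclidean_data ?S (\<lambda>z. a c (?i z)) (\<lambda>z. b c (?i z)) (\<lambda>z. V (?i z)) j"
  proof (rule euclidean_data.intro)
    show "open ?S" using T cc(2) by (simp add: open_Times)
    show "inner_form (a c (?i z))" if "z \<in> ?S" for z
      using riemannian_metric_onD(1)[OF a c(1), of "fst (?i z)" "snd (?i z)"] iT[OF that] by simp
    show "linear (b c (?i z))" if "z \<in> ?S" for z
      using one_form_onD(1)[OF b c(1), of "fst (?i z)" "snd (?i z)"] iT[OF that] by simp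
  next
    fix v w
    have "Ck_on r (snd (event_chart c) ` (fst (event_chart c) \<inter> T \<times> topspace X)) (\<lambda>z. a c (?i z) v w)"
      using a c(1) by (simp only: riemannian_metric_on_def)
    then show "Ck_on (Suc (Suc j)) ?S (\<lambda>z. a c (?i z) v w)" unfolding im r .
  next
    fix v
    have "Ck_on r (snd (event_chart c) ` (fst (event_chart c) \<inter> T \<times> topspace X)) (\<lambda>z. b c (?i z) v)"
      using b c(1) by (simp only: one_form_on_def)
    then show "Ck_on (Suc (Suc j)) ?S (\<lambda>z. b c (?i z) v)" unfolding im r .
  next
    show "Ck_on (Suc (Suc j)) ?S (\<lambda>z. V (?i z))"
      using bspec[OF V[unfolded Ck_fun_def] event_chart_mem[OF c(1)]] unfolding im r o_def .
  qed
  interpret E: euclidean_data ?S "\<lambda>z. a c (?i z)" "\<lambda>z. b c (?i z)" "\<lambda>z. V (?i z)" j by (rule E)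
  have m: "(t\<^sub>0, snd c q\<^sub>0) \<in> ?S" using pe c by auto
  obtain N N' and Y' Y :: "real \<times> 'b \<Rightarrow> 'b" and v :: "real \<times> 'b \<Rightarrow> real" where
    oN: "open N" "open N'" and mN: "(t\<^sub>0, snd c q\<^sub>0) \<in> N'" "N' \<subseteq> ?S"
    and Ck: "Ck_on (Suc j) N Y'" "Ck_on (Suc j) N' Y" "Ck_on (Suc j) N' v"
    and 1: "\<And>t x. (t, x) \<in> N \<Longrightarrow> (t, Y' (t, x)) \<in> N' \<and> Y (t, Y' (t, x)) = x"
    and 2: "\<And>t x. (t, x) \<in> N' \<Longrightarrow> (t, Y (t, x)) \<in> N \<and> Y' (t, Y (t, x)) = x"
    and hj: "\<And>t x. (t, x) \<in> N' \<Longrightarrow> \<exists>p. (\<forall>w. frechet_derivative v (at (t, x)) (0, w) = p \<bullet> w) \<and>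
      frechet_derivative v (at (t, x)) (1, 0) = - E.H ((t, x), p) \<and>
      ((\<lambda>s. Y' (s, Y (t, x))) has_vector_derivative E.w ((t, x), p)) (at t)"
  proof -
    show ?thesis by (rule E.local_solution[OF m]) (rule that)
  qed
  define U0 where "U0 = {e \<in> fst (event_chart c). snd (event_chart c) e \<in> N'}"
  have U0: "(t, q) \<in> U0 \<longleftrightarrow> q \<in> fst c \<and> (t, snd c q) \<in> N'" for t q by (auto simp: U0_def)
  have N'c: "x \<in> snd c ` fst c" "t \<in> T" if "(t, x) \<in> N'" for t x using mN(2) that by auto
  define \<phi> where "\<phi> = (\<lambda>e. Y (snd (event_chart c) e))"
  define \<psi> where "\<psi> = (\<lambda>e. chart_inv c (Y' e))"
  define u where "u = (\<lambda>e. v (snd (event_chart c) e))"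
  have U0T: "U0 \<subseteq> T \<times> topspace X" using N'c top by (auto simp: U0)
  have N'im: "N' \<subseteq> snd (event_chart c) ` fst (event_chart c)" using N'c by (auto simp: event_chart_image)
  have inv: "snd (event_chart c) (?i z) = z" if "z \<in> N'" for z
    using chart_inv_right(2)[of z "event_chart c"] N'im that by blast
  have Ckpull: "Ck_at (Suc j) (event_atlas A) std_atlas (\<lambda>e. f (snd (event_chart c) e)) e"
    if f: "Ck_on (Suc j) N' f" and e: "e \<in> U0" for f :: "real \<times> 'b \<Rightarrow> 'c::euclidean_space" and e
    unfolding Ck_at_std_iff
  proof (intro bexI[OF _ event_chart_mem[OF c(1)]] exI[of _ N'] conjI)
    show "Ck_on (Suc j) N' (\<lambda>x. f (snd (event_chart c) (?i x)))"
      by (rule Ck_on_cong[OF oN(2) f]) (simp add: inv)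
  qed (use e oN N'im in \<open>auto simp: U0_def\<close>)
  interpret R: rosen_data j X A "euclidean :: 'b topology" std_atlas U0 N \<phi> \<psi> a b V u
  proof unfold_locales
    show "Ck_atlas (Suc j) X A" by (rule atlas)
    show "Ck_manifold (Suc j) (euclidean :: 'b topology) std_atlas" by (rule Ck_manifold_euclidean)
    then show "Ck_atlas (Suc j) (euclidean :: 'b topology) std_atlas" by (simp only: Ck_manifold_def)
    show "openin (prod_topology euclidean X) U0"
      unfolding U0_def by (rule is_chart_open_preimage[OF is_chart_event_chart[OF chart] oN(2)])
    show "openin (prod_topology euclidean euclidean) N" by (rule openin_prod_euclidean[OF oN(1)])
    show "(t, \<phi> (t, q)) \<in> N \<and> \<psi> (t, \<phi> (t, q)) = q" if "(t, q) \<in> U0" for t q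
      using that 2[of t "snd c q"] cc(3) by (auto simp: U0 \<phi>_def \<psi>_def)
    show "(t, \<psi> (t, x)) \<in> U0 \<and> \<phi> (t, \<psi> (t, x)) = x" if "(t, x) \<in> N" for t x
      using 1[OF that] N'c[of t "Y' (t, x)"] by (auto simp: U0 \<phi>_def \<psi>_def chart_inv_right)
    show "Ck_at (Suc j) (event_atlas A) std_atlas \<phi> e" if "e \<in> U0" for e
      unfolding \<phi>_def by (rule Ckpull[OF Ck(2) that])
    show "Ck_at (Suc j) (event_atlas A) std_atlas u e" if "e \<in> U0" for e
      unfolding u_def by (rule Ckpull[OF Ck(3) that])
    show "Ck_at (Suc j) (event_atlas std_atlas) A \<psi> e" if e: "e \<in> N" for e
      unfolding Ck_at_def
    proof (intro bexI[OF _ event_chart_mem[OF std_chart_mem]] bexI[OF _ c(1)] exI[of _ N] conjI)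
      have Y'c: "Y' z \<in> snd c ` fst c" if "z \<in> N" for z
        using 1[of "fst z" "snd z"] N'c[of "fst z" "Y' z"] that by simp
      show "\<forall>z\<in>N. \<psi> (chart_inv (event_chart std_chart) z) \<in> fst c"
        using Y'c by (simp add: \<psi>_def chart_inv_event_std chart_inv_right)
      show "Ck_on (Suc j) N (\<lambda>z. snd c (\<psi> (chart_inv (event_chart std_chart) z)))"
        by (rule Ck_on_cong[OF oN(1) Ck(1)]) (simp add: \<psi>_def chart_inv_event_std chart_inv_right[OF Y'c])
      show "N \<subseteq> snd (event_chart std_chart) ` fst (event_chart std_chart)" by (auto simp: image_iff)
    qed (use e oN in \<open>cases e, auto\<close>)+
    show "riemannian_metric_on j A U0 a" by (rule riemannian_metric_on_mono[OF a _ U0T]) (simp add: r)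
    show "one_form_on 0 A U0 b" by (rule one_form_on_mono[OF b _ U0T]) simp
    fix t q assume e: "(t, q) \<in> U0"
    then have q: "q \<in> fst c" and z: "(t, snd c q) \<in> N'" by (auto simp: U0)
    have iz: "?i (t, snd c q) = (t, q)" using q i[of "snd c q" t] cc(3)[OF q] by simp
    obtain p where p: "\<And>w. frechet_derivative v (at (t, snd c q)) (0, w) = p \<bullet> w"
      "frechet_derivative v (at (t, snd c q)) (1, 0) = - E.H ((t, snd c q), p)"
      "((\<lambda>s. Y' (s, Y (t, snd c q))) has_vector_derivative E.w ((t, snd c q), p)) (at t)"
      using hj[OF z] by blast
    have Cku: "Ck_at (Suc j) (event_atlas A) std_atlas u (t, q)" unfolding u_def by (rule Ckpull[OF Ck(3) e])
    have Du: "coord_deriv (event_chart c) std_chart u (t, q) = frechet_derivative v (at (t, snd c q))"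
    proof -
      have "((\<lambda>x. u (?i x)) has_derivative coord_deriv (event_chart c) std_chart u (t, q)) (at (t, snd c q))"
        using coord_deriv_works[OF EC chart_system_std_atlas Cku event_chart_mem[OF c(1)] std_chart_mem] q by simp
      then have "(v has_derivative coord_deriv (event_chart c) std_chart u (t, q)) (at (t, snd c q))"
        by (rule has_derivative_transform_within_open[OF _ oN(2) z]) (simp add: u_def inv)
      then show ?thesis by (rule frechet_derivative_at)
    qed
    have sp: "space_deriv c u (t, q) w = p \<bullet> w" for w
      using space_deriv_coord[OF C Cku c(1) q] p(1) by (simp add: Du)
    have tm: "time_deriv u (t, q) = - E.H ((t, snd c q), p)"
      using time_deriv_coord[OF C Cku c(1) q] p(2) by (simp add: Du)
    have w: "sharp (a c (t, q)) (\<lambda>w. space_deriv c u (t, q) w - b c (t, q) w) = E.w ((t, snd c q), p)"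
      by (simp add: E.w_def sp iz)
    have "hamiltonian a b V c (t, q) (space_deriv c u (t, q)) = E.H ((t, snd c q), p)"
      by (simp add: hamiltonian_def inverse_metric_def w) (simp add: E.H_def sp iz)
    moreover have "((\<lambda>s. snd c (\<psi> (s, \<phi> (t, q)))) has_vector_derivative E.w ((t, snd c q), p)) (at t)"
    proof (rule has_vector_derivative_transform_within_open[OF p(3)])
      show "open ((\<lambda>s. (s, Y (t, snd c q))) -` N)" by (intro open_vimage oN continuous_intros)
      show "t \<in> (\<lambda>s. (s, Y (t, snd c q))) -` N" using 2[OF z] by simp
      fix s assume "s \<in> (\<lambda>s. (s, Y (t, snd c q))) -` N"
      then have "Y' (s, Y (t, snd c q)) \<in> snd c ` fst c" using 1[of s] N'c(1) by blast
      then show "Y' (s, Y (t, snd c q)) = snd c (\<psi> (s, \<phi> (t, q)))" by (simp add: \<psi>_def \<phi>_def chart_inv_right)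
    qed
    ultimately show "\<exists>c\<in>A. q \<in> fst c \<and>
      time_deriv u (t, q) + hamiltonian a b V c (t, q) (space_deriv c u (t, q)) = 0 \<and>
      ((\<lambda>s. snd c (\<psi> (s, \<phi> (t, q)))) has_vector_derivative
        sharp (a c (t, q)) (\<lambda>v. space_deriv c u (t, q) v - b c (t, q) v)) (at t)"
      using c(1) q tm w by (intro bexI[of _ c]) auto
  qed
  have "p \<in> {(t, q, y). (t, q) \<in> U0}" using pe c mN by (simp add: U0)
  moreover have "{(t, q, y). (t, q) \<in> U0} \<subseteq> T \<times> topspace X \<times> (UNIV :: real set)" using U0T by auto
  ultimately show ?thesis
    unfolding rosen_near_def using R.rosen_coordinates_of_data by (intro exI conjI)
qed

section \<open>The equivalence\<close>

text \<open>The characteristics extend to all of \<open>I\<close>, so this gives the global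
  statement for \<open>I = T\<close> and the time-local one with \<open>J = I\<close>.\<close>

lemma solution_of_rosen:
  assumes gw: "gw_spacetime r X A T a b V" and I: "open I" "is_interval I" "I \<subseteq> T"
    and R: "admits_rosen_over TYPE('w) 1 X A a b V I"
  shows "\<exists>u. hj_solution 1 X A a b V I u \<and> characteristics_extend_to X A a b I u I"
proof -
  obtain X' :: "'w topology" and A' \<Phi> a' where
    rosen: "rosen_coordinates 1 X A a b V (I \<times> topspace X \<times> UNIV) X' A' (I \<times> topspace X' \<times> UNIV) \<Phi> a'"
    using R unfolding admits_rosen_over_def by blast
  have "Ck_atlas (Suc 0) X A"
    using gw by (auto simp: gw_spacetime_def Ck_manifold_def intro: Ck_atlas_mono)
  then interpret rosen_given X A X' A' r T I a b V \<Phi> a'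
    using gw I rosen by unfold_locales (auto simp only: gw_spacetime_def)
  show ?thesis using hj_solution_u characteristics_extend by blast
qed

text \<open>Writing \<open>k = j + 2\<close> translates the bounds on \<open>k\<close> into the
  indices of \<open>hj_given\<close>. The coordinates exist over \<open>J\<close>, which may be
  smaller than the domain \<open>I\<close> of the solution.\<close>

lemma rosen_of_solution:
  fixes X :: "'q topology"
  assumes gw: "gw_spacetime r X A T a b V" and I: "open I" "is_interval I" "I \<subseteq> T"
    and J: "open J" "is_interval J" "J \<subseteq> I" and k: "2 \<le> k" "k \<le> r + 1"
    and u: "hj_solution k X A a b V I u" "characteristics_extend_to X A a b I u J"
  shows "admits_rosen_over TYPE('q) (k - 1) X A a b V J"
proof -
  obtain j where j: "k = Suc (Suc j)" using k(1) by (metis add_2_eq_Suc le_Suc_ex)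
  interpret hj_given X A r j T I J a b V u
    using gw I J k u by unfold_locales (auto simp: gw_spacetime_def j)
  show ?thesis using rosen_coordinates_exist by (simp add: j)
qed

theorem theorem3p14:
  fixes r :: nat
    and X :: "'q topology" and A :: "('q, 'e::euclidean_space) chart set"
    and T :: "real set"
    and a :: "('q, 'e) tmetric" and b :: "('q, 'e) tform" and V :: "real \<times> 'q \<Rightarrow> real"
  assumes "r \<ge> 2"
    and "gw_spacetime r X A T a b V"
  shows "(\<forall>p \<in> T \<times> topspace X \<times> UNIV. rosen_near (r - 1) X A T a b V p) \<and>
    (admits_global_rosen TYPE('w) 1 X A T a b V \<longrightarrow> has_global_solution 1 X A T a b V) \<and>
    (\<forall>k. 2 \<le> k \<and> k \<le> r + 1 \<and> has_global_solution k X A T a b V \<longrightarrow>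
       admits_global_rosen TYPE('q) (k - 1) X A T a b V) \<and>
    (\<forall>t0\<in>T. admits_time_local_rosen TYPE('w) 1 X A T a b V t0 \<longrightarrow>
       has_time_local_solution 1 X A T a b V t0) \<and>
    (\<forall>t0\<in>T. \<forall>k. 2 \<le> k \<and> k \<le> r + 1 \<and> has_time_local_solution k X A T a b V t0 \<longrightarrow>
       admits_time_local_rosen TYPE('q) (k - 1) X A T a b V t0)"
proof (intro conjI ballI allI impI)
  have T: "open T" "is_interval T" using assms(2) by (auto simp: gw_spacetime_def)
  show "rosen_near (r - 1) X A T a b V p" if p: "p \<in> T \<times> topspace X \<times> UNIV" for p
  proof -
    obtain j where j: "r = Suc (Suc j)" using assms(1) by (metis add_2_eq_Suc le_Suc_ex)
    have "rosen_near (Suc j) X A T a b V p"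
      using assms(2) by (intro rosen_near_exists[OF _ j T(1) _ _ _ p]) (auto simp: gw_spacetime_def)
    then show ?thesis by (simp add: j)
  qed
  show "has_global_solution 1 X A T a b V" if "admits_global_rosen TYPE('w) 1 X A T a b V"
    using solution_of_rosen[OF assms(2) T order_refl] that
    unfolding has_global_solution_def admits_global_rosen_def by blast
  show "admits_global_rosen TYPE('q) (k - 1) X A T a b V"
    if "2 \<le> k \<and> k \<le> r + 1 \<and> has_global_solution k X A T a b V" for k
    using rosen_of_solution[OF assms(2) T order_refl T order_refl, of k] that
    unfolding has_global_solution_def admits_global_rosen_def by blast
  show "has_time_local_solution 1 X A T a b V t0"
    if adm: "admits_time_local_rosen TYPE('w) 1 X A T a b V t0" for t0
  proof -
    obtain I where I: "open I" "is_interval I" "t0 \<in> I" "I \<subseteq> T" "admits_rosen_over TYPE('w) 1 X A a b V I"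
      using adm unfolding admits_time_local_rosen_def by blast
    then show ?thesis
      using solution_of_rosen[OF assms(2) I(1,2,4,5)] unfolding has_time_local_solution_def by blast
  qed
  show "admits_time_local_rosen TYPE('q) (k - 1) X A T a b V t0"
    if t0: "t0 \<in> T" and k: "2 \<le> k \<and> k \<le> r + 1 \<and> has_time_local_solution k X A T a b V t0" for t0 k
  proof -
    obtain I J u where I: "open I" "is_interval I" "I \<subseteq> T" "hj_solution k X A a b V I u"
      and J: "open J" "is_interval J" "t0 \<in> J" "J \<subseteq> I" "characteristics_extend_to X A a b I u J"
      using k unfolding has_time_local_solution_def by blast
    have "admits_rosen_over TYPE('q) (k - 1) X A a b V J"
      by (rule rosen_of_solution[OF assms(2) I(1-3) J(1,2,4) _ _ I(4) J(5)]) (use k in auto)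
    then show ?thesis using J I unfolding admits_time_local_rosen_def by blast
  qed
qed

end
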